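(* Let $M$ be an integer and let $H(s)$ be a function given by an Euler product (over the primes) which converges absolutely for $\Re s>\frac13$. Let $f_H$ be the arithmetic function defined by $$F_H(s)=\sum_{n=1}^\infty \frac{f_H(n)}{n^s}=\zeta^2(s)\,\zeta(2s-1)\,(\zeta(2s))^M\,H(s)\qquad(\Re s>1),$$ where $\zeta$ is the Riemann zeta-function. Then, as $x\to\infty$, $$\sum_{n\le x} f_H(n)=\operatorname{Res}_{s=1}\left(F_H(s)\frac{x^s}{s}\right)+\Omega\left(\frac{\sqrt{x}\,(\log x)^2}{(\log\log x)^{|M+1|}}\right).$$
   Context: Here $\operatorname{Res}_{s=1}$ denotes the residue at $s=1$ (where $F_H(s)x^s/s$ has a pole of order at most three, so the residue equals $x\,p(\log x)$ for a polynomial $p$ of degree at most $2$). The notation $g(x)=\Omega(h(x))$ with $h>0$ means that $g(x)=o(h(x))$ is false, i.e. $\limsup_{x\to\infty}|g(x)|/h(x)>0$. *)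

theory Defs
  imports "HOL-Complex_Analysis.Complex_Analysis" "HOL-Library.Landau_Symbols"
begin

section \<open>The Riemann zeta function\<close>

text \<open>
  The zeta function is the analytic continuation to the punctured plane of its Dirichlet
  series. Existence and uniqueness away from \<open>1\<close> are \<open>is_zeta_ex\<close> and \<open>is_zeta_unique\<close>;
  the value at the pole is left unspecified.
\<close>

definition is_zeta :: "(complex \<Rightarrow> complex) \<Rightarrow> bool" where
  "is_zeta f \<longleftrightarrow> f holomorphic_on (- {1}) \<and>
     (\<forall>s. Re s > 1 \<longrightarrow> (\<lambda>n. of_nat (Suc n) powr (- s)) sums f s)"

definition zeta :: "complex \<Rightarrow> complex" where
  "zeta = (SOME f. is_zeta f)"

lemma holomorphic_suminf:
  fixes f :: "nat \<Rightarrow> complex \<Rightarrow> complex"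
  assumes S: "open S" and hol: "\<And>n. f n holomorphic_on S"
    and bd: "\<And>z. z \<in> S \<Longrightarrow> \<exists>d>0. cball z d \<subseteq> S \<and>
      (\<exists>M. summable M \<and> (\<forall>n. \<forall>x\<in>cball z d. norm (f n x) \<le> M n))"
  shows "(\<lambda>s. \<Sum>n. f n s) holomorphic_on S"
proof (rule holomorphic_uniform_sequence[OF S])
  show "(\<lambda>s. \<Sum>i<n. f i s) holomorphic_on S" for n
    by (intro holomorphic_intros hol)
  fix z assume "z \<in> S"
  then obtain d M where "d > 0" "cball z d \<subseteq> S" "summable M"
      "\<forall>n. \<forall>x\<in>cball z d. norm (f n x) \<le> M n"
    using bd by meson
  then show "\<exists>d>0. cball z d \<subseteq> S \<and>
     uniform_limit (cball z d) (\<lambda>n s. \<Sum>i<n. f i s) (\<lambda>s. \<Sum>n. f n s) sequentially"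
    by (intro exI[of _ d] conjI Weierstrass_m_test[of "cball z d" f M]) auto
qed

lemma norm_Suc_powr: "norm (of_nat (Suc n) powr (s::complex)) = real (Suc n) powr Re s"
  by (subst norm_powr_real_powr) (auto simp del: of_nat_Suc)

lemma cball_halfplane:
  assumes "Re z > c"
  obtains d a where "d > 0" "a > c" "\<And>s. s \<in> cball z d \<Longrightarrow> Re s \<ge> a"
proof
  show "(Re z - c) / 2 > 0" "(Re z + c) / 2 > c" using assms by auto
  show "Re s \<ge> (Re z + c) / 2" if "s \<in> cball z ((Re z - c) / 2)" for s
  proof -
    have "Re z - Re s \<le> norm (z - s)" using complex_Re_le_cmod[of "z - s"] by simp
    with that show ?thesis by (simp add: dist_norm field_simps)
  qed
qed

lemma summable_Suc_powr: "a < -1 \<Longrightarrow> summable (\<lambda>n. real (Suc n) powr a)"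
  using summable_real_powr_iff[of a] summable_Suc_iff[of "\<lambda>n. real n powr a"] by simp

lemma dirichlet_summable:
  "Re s > 1 \<Longrightarrow> summable (\<lambda>n. of_nat (Suc n) powr (- s) :: complex)"
  by (rule summable_norm_cancel) (simp add: norm_Suc_powr summable_Suc_powr del: of_nat_Suc)

lemma dirichlet_holomorphic:
  "(\<lambda>s. \<Sum>n. of_nat (Suc n) powr (- s) :: complex) holomorphic_on {s. Re s > 1}"
proof (rule holomorphic_suminf)
  show "open {s. Re s > 1}" by (rule open_halfspace_Re_gt)
  show "(\<lambda>s. of_nat (Suc n) powr (- s) :: complex) holomorphic_on {s. Re s > 1}" for n
    by (auto intro!: holomorphic_intros simp del: of_nat_Suc)
  fix z assume "z \<in> {s. Re s > 1}"
  then obtain d a where d: "d > 0" "a > 1" "\<And>s. s \<in> cball z d \<Longrightarrow> Re s \<ge> a"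
    using cball_halfplane[of 1 z] by auto
  show "\<exists>d>0. cball z d \<subseteq> {s. Re s > 1} \<and>
      (\<exists>M. summable M \<and> (\<forall>n. \<forall>x\<in>cball z d. norm (of_nat (Suc n) powr (- x) :: complex) \<le> M n))"
  proof (intro exI[of _ d] exI[of _ "\<lambda>n. real (Suc n) powr (- a)"] conjI allI ballI)
    show "cball z d \<subseteq> {s. Re s > 1}" using d by fastforce
    show "summable (\<lambda>n. real (Suc n) powr (- a))" using d by (intro summable_Suc_powr) auto
    show "norm (of_nat (Suc n) powr (- x) :: complex) \<le> real (Suc n) powr (- a)"
      if "x \<in> cball z d" for n x
      unfolding norm_Suc_powr using d(3)[OF that] by (intro powr_mono) auto
  qed (use d in auto)
qed

text \<open>
  Continuation proceeds by Taylor expansion of \<open>x powr (1 - s)\<close> between consecutive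
  integers: summing the expansion up to order \<open>N\<close> expresses \<open>(s - 1) * zeta s\<close> through
  its own values at \<open>s + 1, \<dots>, s + N - 1\<close> and a series of remainders that converges
  for \<open>Re s > 1 - N\<close>.
\<close>

definition fall :: "nat \<Rightarrow> complex \<Rightarrow> complex" where
  "fall i s = (\<Prod>k<i. 1 - s - of_nat k)"

definition zeta_rem :: "nat \<Rightarrow> nat \<Rightarrow> complex \<Rightarrow> complex" where
  "zeta_rem N n s = of_nat (Suc (Suc n)) powr (1 - s)
     - (\<Sum>i\<le>N. fall i s * of_nat (Suc n) powr (1 - s - of_nat i) / fact i)"

lemma fall_holomorphic [holomorphic_intros]: "fall i holomorphic_on S"
proof -
  have "(\<lambda>s. \<Prod>k<i. 1 - s - of_nat k) holomorphic_on S"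
    by (intro holomorphic_intros)
  thus ?thesis by (simp add: fall_def[abs_def])
qed

lemma zeta_rem_bound:
  assumes "Re s + real N > 0"
  shows "norm (zeta_rem N n s)
    \<le> norm (fall (Suc N) s) * real (Suc n) powr (- Re s - real N) / fact N"
proof -
  define S :: "complex set" where "S = closed_segment (of_nat (Suc n)) (of_nat (Suc (Suc n)))"
  have S: "\<exists>t. x = of_real t \<and> t \<ge> real (Suc n)" if x: "x \<in> S" for x
  proof -
    obtain u where u: "0 \<le> u" "u \<le> 1"
      "x = (1 - u) *\<^sub>R of_nat (Suc n) + u *\<^sub>R of_nat (Suc (Suc n))"
      using x unfolding S_def closed_segment_def by auto
    have "x = of_real (real (Suc n) + u)"
      unfolding u(3) by (simp add: scaleR_conv_of_real algebra_simps)
    thus ?thesis using u(1) by (intro exI[of _ "real (Suc n) + u"]) auto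
  qed
  define g where "g = (\<lambda>i x. fall i s * x powr (1 - s - of_nat i))"
  have "norm (g 0 (of_nat (Suc (Suc n))) - (\<Sum>i\<le>N. g i (of_nat (Suc n)) *
          (of_nat (Suc (Suc n)) - of_nat (Suc n)) ^ i / fact i))
      \<le> (norm (fall (Suc N) s) * real (Suc n) powr (- Re s - real N)) *
         norm ((of_nat (Suc (Suc n)) :: complex) - of_nat (Suc n)) ^ Suc N / fact N"
  proof (rule field_Taylor)
    show "convex S" by (simp add: S_def)
    show "(g i has_field_derivative g (Suc i) x) (at x within S)" if "x \<in> S" for i x
    proof -
      obtain t where t: "x = of_real t" "t \<ge> real (Suc n)" using S \<open>x \<in> S\<close> by blast
      hence "x \<notin> \<real>\<^sub>\<le>\<^sub>0" by auto
      thus ?thesis unfolding g_def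
        by (auto intro!: derivative_eq_intros simp: fall_def algebra_simps)
    qed
    show "norm (g (Suc N) x) \<le> norm (fall (Suc N) s) * real (Suc n) powr (- Re s - real N)"
      if "x \<in> S" for x
    proof -
      obtain t where t: "x = of_real t" "t \<ge> real (Suc n)" using S \<open>x \<in> S\<close> by blast
      have "norm (x powr (1 - s - of_nat (Suc N))) = t powr (- Re s - real N)"
        using t by (subst norm_powr_real_powr) auto
      also have "\<dots> \<le> real (Suc n) powr (- Re s - real N)"
        using t assms by (intro powr_mono2') auto
      finally show ?thesis by (simp add: g_def norm_mult mult_left_mono)
    qed
  qed (auto simp: S_def)
  thus ?thesis by (simp add: zeta_rem_def g_def fall_def)
qed

lemma zeta_rem_holomorphic:
  "(\<lambda>s. \<Sum>n. zeta_rem (Suc m) n s) holomorphic_on {s. Re s > - real m}"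
proof (rule holomorphic_suminf)
  show "open {s. Re s > - real m}" by (rule open_halfspace_Re_gt)
  show "(\<lambda>s. zeta_rem (Suc m) n s) holomorphic_on {s. Re s > - real m}" for n
    unfolding zeta_rem_def by (auto intro!: holomorphic_intros simp del: of_nat_Suc)
  fix z assume "z \<in> {s. Re s > - real m}"
  then obtain d a where d: "d > 0" "a > - real m" "\<And>s. s \<in> cball z d \<Longrightarrow> Re s \<ge> a"
    using cball_halfplane[of "- real m" z] by auto
  have "compact (fall (Suc (Suc m)) ` cball z d)"
    by (intro compact_continuous_image holomorphic_on_imp_continuous_on holomorphic_intros) auto
  then obtain K where K: "\<And>x. x \<in> cball z d \<Longrightarrow> norm (fall (Suc (Suc m)) x) \<le> K"
    by (meson bounded_iff compact_imp_bounded imageI)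
  have K0: "K \<ge> 0" using K[of z] d(1) norm_ge_zero order_trans by (metis centre_in_cball less_imp_le)
  show "\<exists>d>0. cball z d \<subseteq> {s. Re s > - real m} \<and>
      (\<exists>M. summable M \<and> (\<forall>n. \<forall>x\<in>cball z d. norm (zeta_rem (Suc m) n x) \<le> M n))"
  proof (intro exI[of _ d] exI[of _ "\<lambda>n. K * real (Suc n) powr (- a - real (Suc m))"] conjI allI ballI)
    show "cball z d \<subseteq> {s. Re s > - real m}" using d by fastforce
    show "summable (\<lambda>n. K * real (Suc n) powr (- a - real (Suc m)))"
      using d by (intro summable_mult summable_Suc_powr) auto
    fix n x assume x: "x \<in> cball z d"
    have "norm (zeta_rem (Suc m) n x) \<le> norm (fall (Suc (Suc m)) x) *
        real (Suc n) powr (- Re x - real (Suc m)) / fact (Suc m)"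
      using d(2) d(3)[OF x] by (intro zeta_rem_bound) auto
    also have "\<dots> \<le> norm (fall (Suc (Suc m)) x) * real (Suc n) powr (- Re x - real (Suc m)) / 1"
      by (intro divide_left_mono) (auto intro: fact_ge_1 simp del: fact_Suc)
    also have "\<dots> \<le> K * real (Suc n) powr (- a - real (Suc m))"
      unfolding div_by_1 using d(3)[OF x] K[OF x] K0 by (intro mult_mono powr_mono) auto
    finally show "norm (zeta_rem (Suc m) n x) \<le> K * real (Suc n) powr (- a - real (Suc m))" .
  qed (use d in auto)
qed

lemma zeta_recurrence:
  assumes s: "Re s > 1"
  defines "D \<equiv> \<lambda>s. \<Sum>n. of_nat (Suc n) powr (- s) :: complex"
  shows "(s - 1) * D s = (\<Sum>n. zeta_rem (Suc m) n s) + 1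
    - (\<Sum>i\<in>{2..Suc m}. fall (i - 1) s / fact i * ((s + of_nat i - 2) * D (s + of_nat i - 1)))"
proof -
  have D: "(\<lambda>n. of_nat (Suc n) powr (- w)) sums D w" if "Re w > 1" for w
    unfolding D_def using dirichlet_summable[OF that] by (rule summable_sums)
  have "(\<lambda>n. real (Suc n) powr (- (Re s - 1))) \<longlonglongrightarrow> 0"
    using s by real_asymp
  hence "(\<lambda>n. norm (of_nat (Suc n) powr (1 - s) :: complex)) \<longlonglongrightarrow> 0"
    by (simp add: norm_Suc_powr del: of_nat_Suc)
  hence "(\<lambda>n. of_nat (Suc n) powr (1 - s) :: complex) \<longlonglongrightarrow> 0"
    by (rule tendsto_norm_zero_cancel)
  from telescope_sums[OF this]
  have tel: "(\<lambda>n. of_nat (Suc (Suc n)) powr (1 - s) - of_nat (Suc n) powr (1 - s)) sums (- 1 :: complex)"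
    by simp
  have split: "{..Suc m} = insert 0 {1..Suc m}" by auto
  have rem: "zeta_rem (Suc m) n s = (of_nat (Suc (Suc n)) powr (1 - s) - of_nat (Suc n) powr (1 - s))
     - (\<Sum>i\<in>{1..Suc m}. fall i s / fact i * of_nat (Suc n) powr (- (s + of_nat i - 1)))" for n
    unfolding zeta_rem_def split by (simp add: fall_def algebra_simps)
  have "(\<lambda>n. zeta_rem (Suc m) n s) sums
     (- 1 - (\<Sum>i\<in>{1..Suc m}. fall i s / fact i * D (s + of_nat i - 1)))"
    unfolding rem using s by (intro sums_diff tel sums_sum sums_mult D) auto
  hence "(\<Sum>n. zeta_rem (Suc m) n s) =
     - 1 - (\<Sum>i\<in>{1..Suc m}. fall i s / fact i * D (s + of_nat i - 1))"
    by (simp add: sums_iff)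
  also have "{1..Suc m} = insert 1 {2..Suc m}" by auto
  also have "(\<Sum>i\<in>insert 1 {2..Suc m}. fall i s / fact i * D (s + of_nat i - 1)) =
     (1 - s) * D s + (\<Sum>i\<in>{2..Suc m}. fall i s / fact i * D (s + of_nat i - 1))"
    by (subst sum.insert) (auto simp: fall_def)
  also have "(\<Sum>i\<in>{2..Suc m}. fall i s / fact i * D (s + of_nat i - 1)) =
     - (\<Sum>i\<in>{2..Suc m}. fall (i - 1) s / fact i * ((s + of_nat i - 2) * D (s + of_nat i - 1)))"
    unfolding sum_negf[symmetric]
  proof (rule sum.cong)
    fix i assume "i \<in> {2..Suc m}"
    then obtain j where j: "i = Suc j" by (cases i) auto
    have "fall i s = - (fall (i - 1) s * (s + of_nat i - 2))"
      unfolding j by (simp add: fall_def algebra_simps)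
    thus "fall i s / fact i * D (s + of_nat i - 1) =
       - (fall (i - 1) s / fact i * ((s + of_nat i - 2) * D (s + of_nat i - 1)))"
      by simp
  qed simp
  finally show ?thesis by (simp add: algebra_simps)
qed

lemma zeta_continuation_halfplane:
  "\<exists>Z. Z holomorphic_on {s. Re s > 1 - real m} \<and>
     (\<forall>s. Re s > 1 \<longrightarrow> Z s = (s - 1) * (\<Sum>n. of_nat (Suc n) powr (- s)))"
proof (induction m)
  case 0
  show ?case
    by (rule exI[of _ "\<lambda>s. (s - 1) * (\<Sum>n. of_nat (Suc n) powr (- s))"])
       (auto intro!: holomorphic_intros dirichlet_holomorphic simp del: of_nat_Suc)
next
  case (Suc m)
  then obtain Z where Z: "Z holomorphic_on {s. Re s > 1 - real m}"
    "\<And>s. Re s > 1 \<Longrightarrow> Z s = (s - 1) * (\<Sum>n. of_nat (Suc n) powr (- s))" by blast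
  define W where "W = (\<lambda>s. (\<Sum>n. zeta_rem (Suc m) n s) + 1
    - (\<Sum>i\<in>{2..Suc m}. fall (i - 1) s / fact i * Z (s + of_nat i - 1)))"
  show ?case
  proof (intro exI[of _ W] conjI allI impI)
    have "(\<lambda>s. Z (s + of_nat i - 1)) holomorphic_on {s. Re s > - real m}"
      if "i \<in> {2..Suc m}" for i
      by (rule holomorphic_on_compose_gen[OF _ Z(1), of "\<lambda>s. s + of_nat i - 1", unfolded o_def])
         (use that in \<open>auto intro!: holomorphic_intros\<close>)
    hence "W holomorphic_on {s. Re s > - real m}"
      unfolding W_def by (intro holomorphic_intros zeta_rem_holomorphic) auto
    thus "W holomorphic_on {s. Re s > 1 - real (Suc m)}" by simp
  next
    fix s :: complex assume s: "Re s > 1"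
    have "Z (s + of_nat i - 1) = (s + of_nat i - 2) * (\<Sum>n. of_nat (Suc n) powr (- (s + of_nat i - 1)))"
      if "i \<in> {2..Suc m}" for i
      using that s by (subst Z(2)) (auto simp: algebra_simps)
    thus "W s = (s - 1) * (\<Sum>n. of_nat (Suc n) powr (- s))"
      unfolding zeta_recurrence[OF s, of m] W_def by (simp del: of_nat_Suc)
  qed
qed

lemma is_zeta_ex: "\<exists>f. is_zeta f"
proof -
  define D where "D = (\<lambda>s. \<Sum>n. of_nat (Suc n) powr (- s) :: complex)"
  define H where "H = (\<lambda>m::nat. {s. Re s > 1 - real m})"
  have "\<forall>m. \<exists>Z. Z holomorphic_on H m \<and> (\<forall>s. Re s > 1 \<longrightarrow> Z s = (s - 1) * D s)"
    unfolding H_def D_def using zeta_continuation_halfplane by blast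
  then obtain Z where Z: "\<And>m. Z m holomorphic_on H m"
      "\<And>m s. Re s > 1 \<Longrightarrow> Z m s = (s - 1) * D s" by metis
  have openH: "open (H m)" for m unfolding H_def by (rule open_halfspace_Re_gt)
  have agree: "Z m s = Z k s" if "s \<in> H m" "m \<le> k" for m k s
  proof (rule analytic_continuation_open[of "H 0" "H m" "Z m" "Z k"])
    show "open (H 0)" "open (H m)" by (simp_all add: openH)
    show "connected (H m)" unfolding H_def by (intro convex_connected convex_halfspace_Re_gt)
    have "2 \<in> H 0" by (simp add: H_def)
    thus "H 0 \<noteq> {}" by auto
    show "H 0 \<subseteq> H m" by (auto simp: H_def)
    have "H m \<subseteq> H k" using that by (auto simp: H_def)
    with Z(1)[of k] show "Z k holomorphic_on H m" by (rule holomorphic_on_subset)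
    show "Z m z = Z k z" if "z \<in> H 0" for z using that by (simp add: H_def Z(2))
    show "s \<in> H m" by (rule that(1))
  qed (rule Z(1))
  define k where "k = (\<lambda>s. Suc (nat \<lceil>1 - Re s\<rceil>))"
  have k: "s \<in> H (k s)" for s unfolding H_def k_def by simp linarith
  define G where "G = (\<lambda>s. Z (k s) s)"
  have G: "G s = Z m s" if "s \<in> H m" for m s
  proof (cases "m \<le> k s")
    case True
    thus ?thesis unfolding G_def using agree[OF that True] by simp
  next
    case False
    hence "k s \<le> m" by simp
    thus ?thesis unfolding G_def by (rule agree[OF k])
  qed
  have "G holomorphic_on H m" for m
    using Z(1)[of m] by (rule holomorphic_transform) (simp add: G)
  hence "G field_differentiable at s" for s
    using openH k by (rule holomorphic_on_imp_differentiable_at)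
  hence G_hol: "G holomorphic_on A" for A
    by (simp add: holomorphic_on_def field_differentiable_at_within)
  have "is_zeta (\<lambda>s. G s / (s - 1))" unfolding is_zeta_def
  proof (intro conjI allI impI)
    show "(\<lambda>s. G s / (s - 1)) holomorphic_on - {1}"
      by (auto intro!: holomorphic_intros G_hol)
    fix s :: complex assume s: "Re s > 1"
    hence "G s = (s - 1) * D s" using G[of s 0] Z(2) by (simp add: H_def)
    hence "G s / (s - 1) = D s" using s by auto
    thus "(\<lambda>n. of_nat (Suc n) powr (- s)) sums (G s / (s - 1))"
      using dirichlet_summable[OF s] unfolding D_def by (simp add: summable_sums del: of_nat_Suc)
  qed
  thus ?thesis by (rule exI[of is_zeta])
qed

lemma is_zeta_zeta: "is_zeta zeta"
  unfolding zeta_def using is_zeta_ex by (rule someI_ex)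

lemma is_zeta_unique:
  assumes "is_zeta f" "is_zeta g" "s \<noteq> 1"
  shows "f s = g s"
proof (rule analytic_continuation_open[of "{s. Re s > 1}" "- {1}" f g])
  show "open {s::complex. Re s > 1}" by (rule open_halfspace_Re_gt)
  have "2 \<in> {s. Re s > 1}" by simp
  thus "{s. Re s > 1} \<noteq> {}" by blast
  show "connected (- {1::complex})" by (rule connected_punctured_universe) simp
  show "f z = g z" if "z \<in> {s. Re s > 1}" for z
    proof -
    have "(\<lambda>n. of_nat (Suc n) powr (- z)) sums f z" "(\<lambda>n. of_nat (Suc n) powr (- z)) sums g z"
      using assms(1,2) that unfolding is_zeta_def by (simp_all del: of_nat_Suc)
    thus ?thesis by (rule sums_unique2)
  qed
qed (use assms in \<open>auto simp: is_zeta_def\<close>)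

section \<open>Euler products\<close>

text \<open>
  The local factor at \<open>p\<close> is a power series in \<open>p powr (-s)\<close> with constant term \<open>1\<close>; indices
  that are not prime contribute the factor \<open>1\<close>, so the product over the primes becomes a
  product over the naturals. Local factors may vanish at individual points; \<open>has_prod\<close>
  then gives the value \<open>0\<close>.
\<close>

definition euler_factor :: "(nat \<Rightarrow> nat \<Rightarrow> complex) \<Rightarrow> complex \<Rightarrow> nat \<Rightarrow> complex" where
  "euler_factor a s p =
     (if prime p then \<Sum>k. a p k * of_nat p powr (- (of_nat k * s)) else 1)"

definition has_abs_conv_euler_product :: "(complex \<Rightarrow> complex) \<Rightarrow> real \<Rightarrow> bool" where
  "has_abs_conv_euler_product H c \<longleftrightarrow>
     (\<exists>a. (\<forall>p. prime p \<longrightarrow> a p 0 = 1) \<and>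
       (\<forall>s. Re s > c \<longrightarrow>
          (\<forall>p. prime p \<longrightarrow> summable (\<lambda>k. norm (a p k * of_nat p powr (- (of_nat k * s))))) \<and>
          abs_convergent_prod (euler_factor a s) \<and>
          euler_factor a s has_prod H s))"

end

theory Submission
  imports Defs "HOL-Computational_Algebra.Squarefree" "HOL-Real_Asymp.Real_Asymp"
begin

text \<open>
  We write \<open>F s = zeta s ^ 2 * zeta (2 * s - 1) * G s\<close>, where \<open>G = zeta (2 * s) powi M * H s\<close> is a
  Dirichlet series with coefficients \<open>g\<close>, \<open>g 1 = 1\<close>, converging absolutely on \<open>Re s \<ge> 3/4\<close>. Hence \<open>f\<close>
  is the sum of \<open>l * g e\<close> over all factorisations \<open>r1 * r2 * l^2 * e\<close>, and the error term at \<open>u^2\<close> is tested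
  against the derivatives of the waves \<open>w u * e (u / sqrt n)\<close>, with \<open>w\<close> a quadratic bump on \<open>[U, 2 U]\<close> and
  \<open>e x = exp (2 pi i x)\<close>. By partial summation this produces sums over \<open>r1, r2, l, e\<close> of
  \<open>l * g e * w v * e (v / sqrt n)\<close> with \<open>v = l * sqrt (r1 * r2 * e)\<close>. They resonate exactly when
  \<open>r1 * r2 * e = n * k^2\<close>: then every phase is an integer. For \<open>r1 * r2 * e\<close> not of this form the sum over
  \<open>l\<close> is a cancelling geometric sum, and small \<open>l\<close> are handled by van der Corput's method in \<open>r1\<close>.

  The test is applied with \<open>n = j^2 * m\<close> and weight \<open>d m * mu j\<close>, where \<open>m \<le> N\<close> is coprime to \<open>Q = P0!\<close>
  and \<open>j\<close> divides \<open>Q\<close>. The Moebius weights sieve out all \<open>k\<close> having a common factor with \<open>Q\<close>; after this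
  the terms with \<open>1 < e \<le> P0\<close> vanish, those with \<open>e > P0\<close> are small, and \<open>e = 1\<close> contributes at least
  a constant times \<open>U^2 * D\<close> with \<open>D = \<Sum> d(m)^2 / m\<close>, which is at least of order \<open>(log N)^4\<close>. On the other
  hand, the mean square of the test function shows that an error term \<open>\<epsilon> * sqrt x * (log x)^2\<close>
  contributes \<open>O(\<epsilon> * U^2 * (log U)^2 * sqrt D)\<close>, and the residue contributes \<open>O(U powr (5/4))\<close> up to a fixed
  power of \<open>N\<close>. With \<open>U\<close> a large fixed power of \<open>N\<close> this is contradictory for small \<open>\<epsilon>\<close>.
\<close>

section \<open>Exponential sums\<close>

text \<open>The weight \<open>ndiv m\<close> is dictated by the resonance itself: for
  \<open>e = 1\<close> and \<open>k = 1\<close> the equation \<open>r1 * r2 = m\<close> has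
  \<open>ndiv m\<close> solutions, and the sum over \<open>l\<close> gives each of them about
  \<open>U^2 / m\<close>. The main term is therefore a square sum, and the mean square of the test
  function is governed by the same sum \<open>D\<close>; comparing the two leaves a quotient of
  order \<open>sqrt D\<close>, which is the source of the squared logarithm. The obstacle is that
  \<open>g\<close> has no sign, so terms with \<open>e > 1\<close> might cancel those with
  \<open>e = 1\<close>. Absolute convergence makes only the tail over \<open>e > P0\<close> small.
  The terms below have to vanish exactly, and since every \<open>e\<close> from 2 to
  \<open>P0\<close> divides \<open>Q\<close>, it suffices to make \<open>K^2 * m\<close> coprime to
  \<open>Q\<close>. The price is a constant depending on \<open>Q\<close> alone. The bump vanishes
  at both ends of \<open>[U, 2 U]\<close>, so partial summation leaves no boundary terms; it is
  Lipschitz with constant \<open>1 / U\<close>, so as an amplitude it costs only a bounded factor,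
  and being a polynomial it has an explicit derivative.\<close>

definition ee :: "real \<Rightarrow> complex" where
  "ee x = cis (2 * pi * x)"

lemma norm_ee [simp]: "norm (ee x) = 1"
  by (simp add: ee_def)

lemma ee_nonzero [simp]: "ee x \<noteq> 0"
  using norm_ee[of x] by fastforce

lemma ee_add: "ee (x + y) = ee x * ee y"
  by (simp add: ee_def cis_mult distrib_left)

lemma ee_of_int [simp]: "ee (of_int m) = 1"
  unfolding ee_def by (metis cis_multiple_2pi Ints_of_int)

lemma ee_of_nat [simp]: "ee (of_nat m) = 1"
  using ee_of_int[of "int m"] by simp

lemma ee_0 [simp]: "ee 0 = 1"
  by (simp add: ee_def)

lemma ee_diff_int: "ee (x - of_int m) = ee x"
  using ee_add[of "x - of_int m" "of_int m"] by simp

lemma ee_power: "ee (real l * x) = ee x ^ l"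
  by (induction l) (simp_all add: ee_add algebra_simps)

text \<open>Jordan's inequality: sine is concave on [0, pi], hence lies above its chord from 0 to pi
  / 2.\<close>

lemma sin_ge_two_div_pi:
  assumes "0 \<le> y" "y \<le> pi / 2"
  shows "sin y \<ge> 2 / pi * y"
proof -
  have c: "convex_on {0..pi} (\<lambda>x. - sin x)"
  proof (rule f''_ge0_imp_convex)
    show "((\<lambda>x. - sin x) has_real_derivative - cos x) (at x)" for x :: real
      by (auto intro!: derivative_eq_intros)
    show "((\<lambda>x. - cos x) has_real_derivative sin x) (at x)" for x :: real
      by (auto intro!: derivative_eq_intros)
    show "0 \<le> sin x" if "x \<in> {0..pi}" for x
      using that by (auto intro: sin_ge_zero)
  qed auto
  define t where "t = 2 / pi * y"
  have t: "0 \<le> t" "t \<le> 1" using assms by (auto simp: t_def field_simps)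
  have "- sin ((1 - t) *\<^sub>R 0 + t *\<^sub>R (pi/2)) \<le> (1 - t) * (- sin 0) + t * (- sin (pi / 2))"
    by (rule convex_onD[OF c]) (use t in auto)
  thus ?thesis by (simp add: t_def)
qed

lemma norm_ee_minus_1: "norm (ee x - 1) = 2 * \<bar>sin (pi * x)\<bar>"
proof -
  have "norm (exp (\<i> * of_real (2 * pi * x)) - 1) = 2 * \<bar>sin (2 * pi * x / 2)\<bar>"
    by (rule dist_exp_i_1)
  thus ?thesis by (simp add: ee_def cis_conv_exp)
qed

lemma norm_ee_minus_1_ge:
  assumes "\<bar>x\<bar> \<le> 1 / 2"
  shows "norm (ee x - 1) \<ge> 4 * \<bar>x\<bar>"
proof -
  have "2 / pi * (pi * \<bar>x\<bar>) \<le> sin (pi * \<bar>x\<bar>)"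
    by (rule sin_ge_two_div_pi) (use assms in auto)
  hence "2 * \<bar>x\<bar> \<le> sin (pi * \<bar>x\<bar>)" by simp
  also have "sin (pi * \<bar>x\<bar>) \<le> \<bar>sin (pi * x)\<bar>"
    by (cases "x \<ge> 0") auto
  finally show ?thesis unfolding norm_ee_minus_1 by simp
qed

section \<open>Summation by parts and the Kusmin-Landau inequality\<close>

lemma abel_bound:
  fixes q z :: "nat \<Rightarrow> complex"
  assumes P: "\<And>k. A \<le> k \<Longrightarrow> k \<le> B \<Longrightarrow> norm (\<Sum>r\<in>{A..<k}. z r) \<le> P" and "A \<le> B"
  shows "norm (\<Sum>r\<in>{A..<B}. q r * z r) \<le> P * (norm (q B) + (\<Sum>r\<in>{A..<B}. norm (q (Suc r) - q r)))"
proof -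
  define S where "S = (\<lambda>k. \<Sum>r\<in>{A..<k}. z r)"
  \<comment> \<open>Summation by parts. The boundary term sits at \<open>q B\<close>, one past the
    range, and the remaining weights are increments of \<open>q\<close>, so only the end value and
    the total variation of the amplitude enter.\<close>
  have "(\<Sum>r\<in>{A..<B}. q r * z r) = q B * S B - (\<Sum>r\<in>{A..<B}. (q (Suc r) - q r) * S (Suc r))"
    using \<open>A \<le> B\<close>
    by (induction B rule: dec_induct) (auto simp: S_def algebra_simps)
  also have "norm \<dots> \<le> norm (q B * S B) + norm (\<Sum>r\<in>{A..<B}. (q (Suc r) - q r) * S (Suc r))"
    by (rule norm_triangle_ineq4)
  also have "norm (\<Sum>r\<in>{A..<B}. (q (Suc r) - q r) * S (Suc r)) \<le>
      (\<Sum>r\<in>{A..<B}. norm (q (Suc r) - q r) * P)"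
    unfolding S_def norm_mult
    by (intro sum_norm_le) (auto simp: norm_mult simp del: sum.op_ivl_Suc intro!: mult_left_mono P)
  also have "norm (q B * S B) \<le> norm (q B) * P"
    unfolding norm_mult S_def using \<open>A \<le> B\<close> by (intro mult_left_mono P) auto
  finally show ?thesis by (simp add: algebra_simps sum_distrib_left)
qed

text \<open>The real part is the constant -1/2, so along a monotone sequence of arguments only the
  cotangent moves and the total variation telescopes.\<close>

lemma inverse_ee_minus_1:
  assumes "sin (pi * x) \<noteq> 0"
  shows "1 / (ee x - 1) = Complex (- 1 / 2) (- cot (pi * x) / 2)"
proof -
  define a where "a = pi * x"
  have d: "2 * pi * x = 2 * a" by (simp add: a_def)
  have s: "sin a \<noteq> 0" using assms by (simp add: a_def)
  have e: "ee x - 1 = Complex (- 2 * sin a ^ 2) (2 * sin a * cos a)"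
    unfolding ee_def d by (auto simp: complex_eq_iff cos_double_sin sin_double)
  have "(ee x - 1) * Complex (- 1 / 2) (- cot a / 2) = 1"
    unfolding e using s
    by (simp add: complex_eq_iff cot_def field_simps power2_eq_square)
  thus ?thesis unfolding a_def[symmetric]
    by (metis mult_zero_left nonzero_eq_divide_eq mult.commute zero_neq_one)
qed

lemma cot_antimono:
  assumes "0 < x" "x \<le> y" "y < pi"
  shows "cot y \<le> cot x"
proof -
  have s: "sin x > 0" "sin y > 0" using assms by (auto intro: sin_gt_zero)
  have "sin (y - x) \<ge> 0" using assms by (intro sin_ge_zero) auto
  hence "sin y * cos x - cos y * sin x \<ge> 0" by (simp add: sin_diff)
  thus ?thesis using s by (simp add: cot_def field_simps)
qed

text \<open>With \<open>q r = 1 / (ee (\<delta> r) - 1)\<close> each term is \<open>q r\<close>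
  times the difference \<open>ee (\<theta> (Suc r)) - ee (\<theta> r)\<close>. Partial sums of these
  differences telescope to at most 2 in modulus, and because the increments decrease, the variation
  of \<open>q\<close> telescopes through the cotangent.\<close>

lemma kusmin_landau_0:
  fixes \<theta> :: "nat \<Rightarrow> real"
  defines "\<delta> \<equiv> \<lambda>r. \<theta> (Suc r) - \<theta> r"
  assumes "A \<le> B" "\<xi> > 0"
    and rng: "\<And>r. A \<le> r \<Longrightarrow> r < B \<Longrightarrow> \<xi> \<le> \<delta> r \<and> \<delta> r \<le> 1 - \<xi>"
    and anti: "\<And>r. A \<le> r \<Longrightarrow> Suc r < B \<Longrightarrow> \<delta> (Suc r) \<le> \<delta> r"
  shows "norm (\<Sum>r\<in>{A..<B}. ee (\<theta> r)) \<le> 2 / \<xi>"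
proof (cases "A = B")
  case True
  thus ?thesis using \<open>\<xi> > 0\<close> by simp
next
  case False
  with \<open>A \<le> B\<close> obtain B' where B': "B = Suc B'" "A \<le> B'" by (cases B) auto
  define c where "c = (\<lambda>r. cot (pi * \<delta> r) / 2)"
  \<comment> \<open>Freezing the index at the last one, \<open>B'\<close>, gives \<open>q B\<close>
    a value without assuming anything about the increment at \<open>B\<close>.\<close>
  define q where "q = (\<lambda>r. 1 / (ee (\<delta> (min r B')) - 1))"
  have sp: "sin (pi * \<delta> r) > 0" if "A \<le> r" "r < B" for r
    using rng[OF that] \<open>\<xi> > 0\<close> by (intro sin_gt_zero) (auto simp: field_simps)
  have nz: "ee (\<delta> r) - 1 \<noteq> 0" if "A \<le> r" "r < B" for r
    using norm_ee_minus_1[of "\<delta> r"] sp[OF that] by auto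
  have nq: "norm (1 / (ee (\<delta> r) - 1)) \<le> 1 / (4 * \<xi>)" if r: "A \<le> r" "r < B" for r
  proof -
    have "4 * \<xi> \<le> norm (ee (\<delta> r) - 1)"
    proof (cases "\<delta> r \<le> 1 / 2")
      case True
      thus ?thesis using norm_ee_minus_1_ge[of "\<delta> r"] rng[OF r] \<open>\<xi> > 0\<close> by auto
    next
      case False
      \<comment> \<open>Increments above 1/2 are measured from 1, the nearer integer.\<close>
      have "ee (\<delta> r) = ee (\<delta> r - 1)" using ee_diff_int[of "\<delta> r" 1] by simp
      thus ?thesis using False norm_ee_minus_1_ge[of "\<delta> r - 1"] rng[OF r] \<open>\<xi> > 0\<close> by auto
    qed
    thus ?thesis unfolding norm_divide norm_one using \<open>\<xi> > 0\<close>
      by (intro divide_left_mono mult_pos_pos) linarith+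
  qed
  have qc: "q r = Complex (- 1 / 2) (- c (min r B'))" if "A \<le> r" "r \<le> B" for r
  proof -
    have "A \<le> min r B'" "min r B' < B" using that B' by auto
    from sp[OF this] show ?thesis unfolding q_def c_def by (subst inverse_ee_minus_1) auto
  qed
  have dq: "norm (q (Suc r) - q r) = c (min (Suc r) B') - c (min r B')" if r: "A \<le> r" "r < B" for r
  proof -
    have "c r \<le> c (Suc r)" if "r < B'"
    proof -
      have "\<xi> \<le> \<delta> (Suc r)" "\<delta> r \<le> 1 - \<xi>" "\<delta> (Suc r) \<le> \<delta> r"
        using rng[of "Suc r"] rng[of r] anti[of r] that r B' by auto
      hence "cot (pi * \<delta> r) \<le> cot (pi * \<delta> (Suc r))"
        using \<open>\<xi> > 0\<close> by (intro cot_antimono) (auto simp: field_simps)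
      thus ?thesis by (simp add: c_def)
    qed
    hence "c (min r B') \<le> c (min (Suc r) B')"
      using r B' by (cases "r = B'") auto
    moreover have "q (Suc r) - q r = - \<i> * of_real (c (min (Suc r) B') - c (min r B'))"
      using r B' by (auto simp: qc complex_eq_iff)
    ultimately show ?thesis by (simp add: norm_mult norm_minus_cancel del: of_real_diff)
  qed
  have cb: "\<bar>c r\<bar> \<le> 1 / (4 * \<xi>)" if "A \<le> r" "r \<le> B'" for r
  proof -
    have "\<bar>Im (q r)\<bar> \<le> norm (q r)" by (rule abs_Im_le_cmod)
    also have "\<dots> \<le> 1 / (4 * \<xi>)" unfolding q_def using that B' nq[of r] by (auto simp: min_def)
    finally show ?thesis using qc[of r] that B' by (auto simp: min_def)
  qed
  have tel: "(\<Sum>r\<in>{A..<B}. c (min (Suc r) B') - c (min r B')) = c (min B B') - c (min A B')"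
    using \<open>A \<le> B\<close> by (rule sum_Suc_diff')
  have "(\<Sum>r\<in>{A..<B}. ee (\<theta> r)) = (\<Sum>r\<in>{A..<B}. q r * (ee (\<theta> (Suc r)) - ee (\<theta> r)))"
  proof (rule sum.cong)
    fix r assume r: "r \<in> {A..<B}"
    hence "min r B' = r" using B' by auto
    moreover have "ee (\<theta> (Suc r)) = ee (\<theta> r) * ee (\<delta> r)" unfolding \<delta>_def by (simp flip: ee_add)
    ultimately show "ee (\<theta> r) = q r * (ee (\<theta> (Suc r)) - ee (\<theta> r))"
      using nz[of r] r by (simp add: q_def field_simps)
  qed simp
  also have "norm \<dots> \<le> 2 * (norm (q B) + (\<Sum>r\<in>{A..<B}. norm (q (Suc r) - q r)))"
  proof (rule abel_bound)
    fix k assume "A \<le> k" "k \<le> B"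
    hence "(\<Sum>r\<in>{A..<k}. ee (\<theta> (Suc r)) - ee (\<theta> r)) = ee (\<theta> k) - ee (\<theta> A)"
      by (intro sum_Suc_diff')
    thus "norm (\<Sum>r\<in>{A..<k}. ee (\<theta> (Suc r)) - ee (\<theta> r)) \<le> 2"
      using norm_triangle_ineq4[of "ee (\<theta> k)" "ee (\<theta> A)"] by simp
  qed fact
  also have "(\<Sum>r\<in>{A..<B}. norm (q (Suc r) - q r)) = c (min B B') - c (min A B')"
    by (subst tel[symmetric]) (auto intro!: sum.cong simp: dq)
  also have "\<dots> \<le> 1 / (4 * \<xi>) + 1 / (4 * \<xi>)"
    using cb[of B'] cb[of A] B' by (simp add: min_def)
  also have "norm (q B) \<le> 1 / (4 * \<xi>)"
    unfolding q_def using B' nq[of B'] by (auto simp: min_def)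
  also have "2 * (1 / (4 * \<xi>) + (1 / (4 * \<xi>) + 1 / (4 * \<xi>))) \<le> 2 / \<xi>"
    using \<open>\<xi> > 0\<close> by (simp add: field_simps)
  finally show ?thesis by simp
qed

text \<open>Subtracting the integer phase \<open>r * m\<close> leaves every term unchanged and moves
  the increments into \<open>[\<xi>, 1 - \<xi>]\<close>.\<close>

lemma kusmin_landau:
  fixes \<theta> :: "nat \<Rightarrow> real"
  assumes "A \<le> B" "\<xi> > 0"
    and rng: "\<And>r. A \<le> r \<Longrightarrow> r < B \<Longrightarrow>
      of_int m + \<xi> \<le> \<theta> (Suc r) - \<theta> r \<and> \<theta> (Suc r) - \<theta> r \<le> of_int m + 1 - \<xi>"
    and anti: "\<And>r. A \<le> r \<Longrightarrow> Suc r < B \<Longrightarrow> \<theta> (Suc (Suc r)) - \<theta> (Suc r) \<le> \<theta> (Suc r) - \<theta> r"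
  shows "norm (\<Sum>r\<in>{A..<B}. ee (\<theta> r)) \<le> 2 / \<xi>"
proof -
  define \<phi> where "\<phi> = (\<lambda>r. \<theta> r - of_int (int r * m))"
  have "(\<Sum>r\<in>{A..<B}. ee (\<theta> r)) = (\<Sum>r\<in>{A..<B}. ee (\<phi> r))"
    unfolding \<phi>_def by (simp only: ee_diff_int)
  also have "norm \<dots> \<le> 2 / \<xi>"
  proof (rule kusmin_landau_0)
    fix r assume "A \<le> r" "r < B"
    from rng[OF this] show "\<xi> \<le> \<phi> (Suc r) - \<phi> r \<and> \<phi> (Suc r) - \<phi> r \<le> 1 - \<xi>"
      by (simp add: \<phi>_def algebra_simps)
  next
    fix r assume "A \<le> r" "Suc r < B"
    from anti[OF this] show "\<phi> (Suc (Suc r)) - \<phi> (Suc r) \<le> \<phi> (Suc r) - \<phi> r"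
      by (simp add: \<phi>_def algebra_simps)
  qed fact+
  finally show ?thesis .
qed

lemma norm_sum_ee_linear:
  assumes "ee \<theta> \<noteq> 1" "a \<le> b"
  shows "norm (\<Sum>l\<in>{a..<b}. ee (real l * \<theta>)) \<le> 2 / norm (ee \<theta> - 1)"
proof -
  have "(ee \<theta> - 1) * (\<Sum>l\<in>{a..<b}. ee (real l * \<theta>)) =
      (\<Sum>l\<in>{a..<b}. ee (real (Suc l) * \<theta>) - ee (real l * \<theta>))"
    by (simp only: ee_power sum_distrib_left) (simp add: algebra_simps)
  also have "\<dots> = ee (real b * \<theta>) - ee (real a * \<theta>)"
    using \<open>a \<le> b\<close> by (rule sum_Suc_diff')
  also have "norm \<dots> \<le> 2"
    using norm_triangle_ineq4[of "ee (real b * \<theta>)" "ee (real a * \<theta>)"] by simp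
  finally have "norm (ee \<theta> - 1) * norm (\<Sum>l\<in>{a..<b}. ee (real l * \<theta>)) \<le> 2"
    by (simp add: norm_mult)
  thus ?thesis using assms by (simp add: field_simps)
qed


section \<open>The van der Corput estimate and square-root phases\<close>

lemma card_le_of_gaps:
  fixes \<delta> :: "nat \<Rightarrow> real"
  assumes "finite S" "\<rho> > 0" "\<xi> \<ge> 0"
    and gap: "\<And>r r'. r \<in> S \<Longrightarrow> r' \<in> S \<Longrightarrow> r \<le> r' \<Longrightarrow> \<rho> * (real r' - real r) \<le> \<delta> r - \<delta> r'"
    and near: "\<And>r. r \<in> S \<Longrightarrow> \<bar>\<delta> r - a\<bar> \<le> \<xi>"
  shows "real (card S) \<le> 2 * \<xi> / \<rho> + 1"
proof (cases "S = {}")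
  case True
  thus ?thesis using assms by simp
next
  case False
  define u v where "u = Min S" and "v = Max S"
  have uv: "u \<in> S" "v \<in> S" "u \<le> v" "S \<subseteq> {u..v}"
    using False \<open>finite S\<close> by (auto simp: u_def v_def)
  have "card S \<le> card {u..v}" using uv by (intro card_mono) auto
  hence "real (card S) \<le> real v - real u + 1" using uv by (simp add: of_nat_diff)
  moreover have "\<rho> * (real v - real u) \<le> 2 * \<xi>"
    using gap[of u v] near[of u] near[of v] uv by linarith
  hence "real v - real u \<le> 2 * \<xi> / \<rho>" using \<open>\<rho> > 0\<close> by (simp add: field_simps)
  ultimately show ?thesis by linarith
qed

lemma nat_interval:
  fixes S :: "nat set"
  assumes "S \<subseteq> {A..<B}" "\<And>r r' k. r \<in> S \<Longrightarrow> r' \<in> S \<Longrightarrow> r \<le> k \<Longrightarrow> k \<le> r' \<Longrightarrow> k \<in> S" "S \<noteq> {}"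
  obtains a b where "A \<le> a" "a \<le> b" "b \<le> B" "S = {a..<b}"
proof
  have fin: "finite S" using assms(1) finite_subset by blast
  define u v where "u = Min S" and "v = Max S"
  have uv: "u \<in> S" "v \<in> S" "u \<le> v" "S \<subseteq> {u..v}"
    using assms(3) fin by (auto simp: u_def v_def)
  show "A \<le> u" "u \<le> Suc v" "Suc v \<le> B" using uv assms(1) by fastforce+
  have "k \<in> S" if "k \<in> {u..v}" for k
    using assms(2)[OF uv(1,2)] that by simp
  with uv(4) have "S = {u..v}" by blast
  thus "S = {u..<Suc v}" by (simp add: atLeastLessThanSuc_atLeastAtMost)
qed

text \<open>
  Indices whose increment lies within \<open>\<xi>\<close> of an integer are counted trivially; the others form
  boundedly many intervals to which the Kusmin-Landau inequality applies.
\<close>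

lemma van_der_corput:
  fixes \<theta> :: "nat \<Rightarrow> real"
  defines "\<delta> \<equiv> \<lambda>r. \<theta> (Suc r) - \<theta> r"
  assumes "\<rho> > 0" "\<xi> > 0" "\<xi> \<le> 1" "D \<ge> 0"
    and gap: "\<And>r. A \<le> r \<Longrightarrow> Suc r < B \<Longrightarrow> \<delta> r - \<delta> (Suc r) \<ge> \<rho>"
    and rng: "\<And>r. A \<le> r \<Longrightarrow> r < B \<Longrightarrow> 0 \<le> \<delta> r \<and> \<delta> r \<le> D"
  shows "norm (\<Sum>r\<in>{A..<B}. ee (\<theta> r)) \<le> (D + 2) * (2 / \<xi> + 2 * \<xi> / \<rho> + 1)"
proof -
  have gap': "\<rho> * (real r' - real r) \<le> \<delta> r - \<delta> r'" if "A \<le> r" "r \<le> r'" "r' < B" for r r'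
    using that(2,3)
  proof (induction r' rule: dec_induct)
    case (step k)
    hence "\<rho> * (real k - real r) \<le> \<delta> r - \<delta> k" "\<delta> k - \<delta> (Suc k) \<ge> \<rho>"
      using that(1) by (auto intro: gap)
    thus ?case by (simp add: algebra_simps)
  qed simp
  have anti: "\<delta> r' \<le> \<delta> r" if "A \<le> r" "r \<le> r'" "r' < B" for r r'
  proof -
    have "0 \<le> \<rho> * (real r' - real r)" using that \<open>\<rho> > 0\<close> by simp
    thus ?thesis using gap'[OF that] by linarith
  qed
  \<comment> \<open>\<open>fl r = m\<close> means that the increment lies in
    \<open>[m - \<xi>, m + 1 - \<xi>)\<close>. The part below \<open>m + \<xi>\<close> is counted
    trivially; the rest stays \<open>\<xi>\<close> away from both integers, as Kusmin-Landau
    requires.\<close>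
  define fl where "fl = (\<lambda>r. nat \<lfloor>\<delta> r + \<xi>\<rfloor>)"
  define N where "N = nat \<lfloor>D + \<xi>\<rfloor>"
  have fl_le: "fl r \<le> N" if "r \<in> {A..<B}" for r
    unfolding fl_def N_def using rng[of r] that by (intro nat_mono floor_mono) auto
  have fl: "fl r = m \<longleftrightarrow> real m \<le> \<delta> r + \<xi> \<and> \<delta> r + \<xi> < real m + 1" if "r \<in> {A..<B}" for r m
  proof -
    have "\<delta> r + \<xi> \<ge> 0" using rng[of r] that \<open>\<xi> > 0\<close> by force
    thus ?thesis unfolding fl_def by (simp add: nat_eq_iff floor_eq_iff)
  qed
  have grp: "norm (\<Sum>r\<in>{r\<in>{A..<B}. fl r = m}. ee (\<theta> r)) \<le> 2 / \<xi> + 2 * \<xi> / \<rho> + 1" for m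
  proof -
    define S1 where "S1 = {r\<in>{A..<B}. fl r = m \<and> \<delta> r < real m + \<xi>}"
    define S2 where "S2 = {r\<in>{A..<B}. fl r = m \<and> \<not> \<delta> r < real m + \<xi>}"
    have "{r\<in>{A..<B}. fl r = m} = S1 \<union> S2" by (auto simp: S1_def S2_def)
    hence "(\<Sum>r\<in>{r\<in>{A..<B}. fl r = m}. ee (\<theta> r)) = (\<Sum>r\<in>S1. ee (\<theta> r)) + (\<Sum>r\<in>S2. ee (\<theta> r))"
      by (simp, intro sum.union_disjoint) (auto simp: S1_def S2_def)
    also have "norm \<dots> \<le> norm (\<Sum>r\<in>S1. ee (\<theta> r)) + norm (\<Sum>r\<in>S2. ee (\<theta> r))"
      by (rule norm_triangle_ineq)
    also have "norm (\<Sum>r\<in>S1. ee (\<theta> r)) \<le> real (card S1)"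
      using sum_norm_le[of S1 "\<lambda>r. ee (\<theta> r)" "\<lambda>_. 1"] by simp
    also have "real (card S1) \<le> 2 * \<xi> / \<rho> + 1"
    proof (rule card_le_of_gaps[where a = "real m"])
      show "\<bar>\<delta> r - real m\<bar> \<le> \<xi>" if "r \<in> S1" for r
        using that fl[of r m] by (auto simp: S1_def)
      show "\<rho> * (real r' - real r) \<le> \<delta> r - \<delta> r'" if "r \<in> S1" "r' \<in> S1" "r \<le> r'" for r r'
        using that by (intro gap') (auto simp: S1_def)
      show "finite S1" by (simp add: S1_def)
    qed (use \<open>\<rho> > 0\<close> \<open>\<xi> > 0\<close> in auto)
    also have "norm (\<Sum>r\<in>S2. ee (\<theta> r)) \<le> 2 / \<xi>"
    proof (cases "S2 = {}")
      case False
      have "S2 \<subseteq> {A..<B}" by (auto simp: S2_def)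
      moreover have "k \<in> S2" if k: "r \<in> S2" "r' \<in> S2" "r \<le> k" "k \<le> r'" for r r' k
      proof -
        have "r \<in> {A..<B}" "r' \<in> {A..<B}" using k by (auto simp: S2_def)
        hence "k \<in> {A..<B}" using k by auto
        moreover have "\<delta> k \<le> \<delta> r" "\<delta> r' \<le> \<delta> k" using k by (auto simp: S2_def intro!: anti)
        ultimately show ?thesis using k fl[of k m] fl[of r m] fl[of r' m] by (auto simp: S2_def)
      qed
      ultimately obtain a b where ab: "A \<le> a" "a \<le> b" "b \<le> B" "S2 = {a..<b}"
        using nat_interval[of S2 A B] False by metis
      have mem: "r \<in> S2" if "a \<le> r" "r < b" for r using ab that by auto
      show ?thesis unfolding ab(4)
      proof (rule kusmin_landau[where m = "int m"])
        fix r assume "a \<le> r" "r < b"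
        from mem[OF this] show "of_int (int m) + \<xi> \<le> \<theta> (Suc r) - \<theta> r \<and> \<theta> (Suc r) - \<theta> r \<le> of_int (int m) + 1 - \<xi>"
          using fl[of r m] by (auto simp: S2_def \<delta>_def)
      next
        fix r assume "a \<le> r" "Suc r < b"
        thus "\<theta> (Suc (Suc r)) - \<theta> (Suc r) \<le> \<theta> (Suc r) - \<theta> r"
          using anti[of r "Suc r"] ab by (simp add: \<delta>_def)
      qed fact+
    qed (use \<open>\<xi> > 0\<close> in auto)
    finally show ?thesis by simp
  qed
  have "(\<Sum>r\<in>{A..<B}. ee (\<theta> r)) = (\<Sum>m\<in>{..N}. \<Sum>r\<in>{r\<in>{A..<B}. fl r = m}. ee (\<theta> r))"
    by (rule sum.group[symmetric]) (use fl_le in auto)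
  also have "norm \<dots> \<le> (\<Sum>m\<in>{..N}. 2 / \<xi> + 2 * \<xi> / \<rho> + 1)"
    by (intro sum_norm_le grp)
  also have "\<dots> = real (Suc N) * (2 / \<xi> + 2 * \<xi> / \<rho> + 1)" by simp
  also have "\<dots> \<le> (D + 2) * (2 / \<xi> + 2 * \<xi> / \<rho> + 1)"
  proof (rule mult_right_mono)
    have "real N \<le> D + \<xi>" unfolding N_def using assms by (simp add: of_nat_nat)
    thus "real (Suc N) \<le> D + 2" using \<open>\<xi> \<le> 1\<close> by simp
  qed (use assms in auto)
  finally show ?thesis .
qed

text \<open>The differences are rationalised. The last claim is the discrete form of the second
  derivative of \<open>\<beta> * sqrt x\<close> having size
  \<open>\<beta> / (4 * x powr (3 / 2))\<close>; every square root in the denominator is replaced by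
  that of \<open>r + 2\<close>.\<close>

lemma sqrt_increment:
  assumes "\<beta> > 0"
  defines "\<delta> \<equiv> \<lambda>r. \<beta> * sqrt (real (Suc r)) - \<beta> * sqrt (real r)"
  shows "\<delta> r = \<beta> / (sqrt (real (Suc r)) + sqrt (real r))"
    and "\<delta> (Suc r) \<le> \<delta> r"
    and "\<delta> r - \<delta> (Suc r) \<ge> \<beta> / (4 * (real r + 2) * sqrt (real r + 2))"
proof -
  have f: "\<beta> * sqrt (real (Suc r)) - \<beta> * sqrt (real r) = \<beta> / (sqrt (real (Suc r)) + sqrt (real r))" for r
  proof -
    have "(sqrt (real (Suc r)) - sqrt (real r)) * (sqrt (real (Suc r)) + sqrt (real r)) = 1"
      by (simp add: algebra_simps)
    moreover have "sqrt (real (Suc r)) + sqrt (real r) > 0" by (simp add: add_pos_nonneg)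
    ultimately show ?thesis by (simp add: field_simps)
  qed
  show "\<delta> r = \<beta> / (sqrt (real (Suc r)) + sqrt (real r))" unfolding \<delta>_def by (rule f)
  define a b c where "a = sqrt (real r)" and "b = sqrt (real (Suc r))" and "c = sqrt (real r + 2)"
  have abc: "0 \<le> a" "a \<le> b" "b \<le> c" "0 < b" "c * c = real r + 2" "a * a = real r"
    "sqrt (real r + 2) = c"
    unfolding a_def b_def c_def by auto
  have d1: "\<delta> r = \<beta> / (b + a)" "\<delta> (Suc r) = \<beta> / (c + b)"
    unfolding \<delta>_def f by (simp_all add: a_def b_def c_def add_ac)
  have e: "\<delta> r - \<delta> (Suc r) = \<beta> * (c - a) / ((b + a) * (c + b))"
    unfolding d1 using abc by (simp add: field_simps)
  have ca: "(c - a) * (c + a) = 2" using abc by (simp add: algebra_simps)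
  have "(c - a) * (2 * c) \<ge> (c - a) * (c + a)" using abc by (intro mult_left_mono) auto
  hence ca': "c - a \<ge> 1 / c" using ca abc by (simp add: field_simps)
  have "\<beta> / (4 * (real r + 2) * sqrt (real r + 2)) = \<beta> * (1 / c) / ((c + c) * (c + c))"
    unfolding abc(7) unfolding abc(5)[symmetric] using abc(2-4) by (simp add: field_simps)
  also have "\<dots> \<le> \<beta> * (c - a) / ((b + a) * (c + b))"
    using abc ca' \<open>\<beta> > 0\<close> by (intro frac_le mult_left_mono mult_mono) auto
  finally show g: "\<delta> r - \<delta> (Suc r) \<ge> \<beta> / (4 * (real r + 2) * sqrt (real r + 2))" unfolding e .
  have "\<beta> / (4 * (real r + 2) * sqrt (real r + 2)) \<ge> 0" using \<open>\<beta> > 0\<close> by simp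
  with g show "\<delta> (Suc r) \<le> \<delta> r" by linarith
qed

text \<open>The increments of the phase are about \<open>\<beta> / (2 * sqrt r)\<close>. From
  \<open>\<beta>^2\<close> on they lie between 0 and 1/2 and Kusmin-Landau gives the first term; the
  range below is left to van der Corput and gives the second.\<close>

lemma norm_sum_ee_sqrt:
  assumes "\<beta> > 0" "A \<ge> 1" "A \<le> k"
  shows "norm (\<Sum>r\<in>{A..<k}. ee (\<beta> * sqrt (real r))) \<le>
    4 * sqrt (real k) / \<beta> + 60 * (\<beta> / sqrt (real A) + 2) * \<beta>"
proof -
  define A1 where "A1 = min k (max A (nat \<lceil>\<beta>\<^sup>2\<rceil>))"
  have A1: "A \<le> A1" "A1 \<le> k" using assms by (auto simp: A1_def)
  have "(\<Sum>r\<in>{A..<k}. ee (\<beta> * sqrt (real r))) =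
    (\<Sum>r\<in>{A..<A1}. ee (\<beta> * sqrt (real r))) + (\<Sum>r\<in>{A1..<k}. ee (\<beta> * sqrt (real r)))"
    using A1 by (simp add: sum.atLeastLessThan_concat)
  also have "norm \<dots> \<le> norm (\<Sum>r\<in>{A..<A1}. ee (\<beta> * sqrt (real r))) +
     norm (\<Sum>r\<in>{A1..<k}. ee (\<beta> * sqrt (real r)))"
    by (rule norm_triangle_ineq)
  also have "norm (\<Sum>r\<in>{A1..<k}. ee (\<beta> * sqrt (real r))) \<le> 4 * sqrt (real k) / \<beta>"
  proof (cases "A1 = k")
    case True
    thus ?thesis using \<open>\<beta> > 0\<close> by simp
  next
    case False
    hence A1': "A1 = max A (nat \<lceil>\<beta>\<^sup>2\<rceil>)" using A1 by (auto simp: A1_def)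
    define \<xi> where "\<xi> = min (1 / 2) (\<beta> / (2 * sqrt (real k)))"
    have "k > 0" using assms by auto
    hence \<xi>: "\<xi> > 0" "\<xi> \<le> 1 / 2" using \<open>\<beta> > 0\<close> by (auto simp: \<xi>_def)
    have "norm (\<Sum>r\<in>{A1..<k}. ee (\<beta> * sqrt (real r))) \<le> 2 / \<xi>"
    proof (rule kusmin_landau[where m = 0])
      fix r assume r: "A1 \<le> r" "r < k"
      hence "\<beta>\<^sup>2 \<le> real r" using A1' by linarith
      hence lr: "\<beta> \<le> sqrt (real r)" using \<open>\<beta> > 0\<close> real_le_rsqrt by blast
      have r0: "sqrt (real r) > 0" using lr \<open>\<beta> > 0\<close> by linarith
      have "\<beta> / (sqrt (real (Suc r)) + sqrt (real r)) \<le> \<beta> / (sqrt (real r) + sqrt (real r))"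
        using r0 \<open>\<beta> > 0\<close> by (intro divide_left_mono) (auto simp: add_pos_pos intro!: mult_pos_pos)
      also have "\<dots> \<le> 1 / 2" using lr r0 by (simp add: field_simps)
      finally have 1: "\<beta> / (sqrt (real (Suc r)) + sqrt (real r)) \<le> 1 / 2" .
      have "sqrt (real (Suc r)) \<le> sqrt (real k)" "sqrt (real r) \<le> sqrt (real k)" using r by auto
      hence "sqrt (real (Suc r)) + sqrt (real r) \<le> 2 * sqrt (real k)" by linarith
      moreover have "sqrt (real (Suc r)) + sqrt (real r) > 0" using r0 by (simp add: add_nonneg_pos)
      ultimately have "\<beta> / (2 * sqrt (real k)) \<le> \<beta> / (sqrt (real (Suc r)) + sqrt (real r))"
        using \<open>\<beta> > 0\<close> \<open>k > 0\<close> by (intro divide_left_mono) auto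
      hence 2: "\<xi> \<le> \<beta> / (sqrt (real (Suc r)) + sqrt (real r))" by (auto simp: \<xi>_def)
      have "\<beta> / (sqrt (real (Suc r)) + sqrt (real r)) \<le> 1 - \<xi>" using 1 \<xi>(2) by linarith
      with 2 show "of_int 0 + \<xi> \<le> \<beta> * sqrt (real (Suc r)) - \<beta> * sqrt (real r) \<and>
          \<beta> * sqrt (real (Suc r)) - \<beta> * sqrt (real r) \<le> of_int 0 + 1 - \<xi>"
        unfolding sqrt_increment(1)[OF \<open>\<beta> > 0\<close>] by simp
    qed (use A1 \<xi> sqrt_increment(2)[OF \<open>\<beta> > 0\<close>] in auto)
    also have "2 / \<xi> \<le> 4 * sqrt (real k) / \<beta>"
    proof -
      have "\<beta>\<^sup>2 \<le> real k" using A1' A1 by linarith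
      hence "\<beta> \<le> sqrt (real k)" using \<open>\<beta> > 0\<close> real_le_rsqrt by blast
      hence "\<xi> = \<beta> / (2 * sqrt (real k))" using \<open>k > 0\<close> by (auto simp: \<xi>_def field_simps)
      thus ?thesis by simp
    qed
    finally show ?thesis .
  qed
  also have "norm (\<Sum>r\<in>{A..<A1}. ee (\<beta> * sqrt (real r))) \<le> 60 * (\<beta> / sqrt (real A) + 2) * \<beta>"
  proof (cases "A1 = A")
    case True
    thus ?thesis using \<open>\<beta> > 0\<close> by simp
  next
    case False
    hence "A1 \<le> nat \<lceil>\<beta>\<^sup>2\<rceil>" "A < nat \<lceil>\<beta>\<^sup>2\<rceil>" using A1 by (auto simp: A1_def)
    hence rl: "real r < \<beta>\<^sup>2" if "r < A1" for r using that by linarith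
    have "1 < \<beta>\<^sup>2" using rl[of A] A1 False assms(2) by linarith
    hence l1: "\<beta> > 1" using power_le_one[of "\<beta>" 2] \<open>\<beta> > 0\<close> by linarith
    \<comment> \<open>This is the second difference from \<open>sqrt_increment\<close> with
      \<open>r + 2 \<le> 3 * \<beta>^2\<close>. The choice \<open>\<xi> = 1 / (4 * \<beta>)\<close>
      below balances \<open>2 / \<xi>\<close> against \<open>2 * \<xi> / \<rho>\<close>, both of
      order \<open>\<beta>\<close>.\<close>
    define \<rho> where "\<rho> = 1 / (24 * \<beta>\<^sup>2)"
    have "norm (\<Sum>r\<in>{A..<A1}. ee (\<beta> * sqrt (real r))) \<le>
       (\<beta> / sqrt (real A) + 2) * (2 / (1 / (4 * \<beta>)) + 2 * (1 / (4 * \<beta>)) / \<rho> + 1)"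
    proof (rule van_der_corput)
      fix r assume r: "A \<le> r" "Suc r < A1"
      have "real r + 2 \<le> 3 * \<beta>\<^sup>2" using rl[of r] r \<open>1 < \<beta>\<^sup>2\<close> by simp
      hence "sqrt (real r + 2) \<le> sqrt (3 * \<beta>\<^sup>2)" by simp
      also have "\<dots> \<le> 2 * \<beta>" by (rule real_le_lsqrt) (use l1 in auto)
      finally have "4 * (real r + 2) * sqrt (real r + 2) \<le> 4 * (3 * \<beta>\<^sup>2) * (2 * \<beta>)"
        using \<open>real r + 2 \<le> 3 * \<beta>\<^sup>2\<close> by (intro mult_mono) auto
      hence "\<beta> / (4 * (3 * \<beta>\<^sup>2) * (2 * \<beta>)) \<le> \<beta> / (4 * (real r + 2) * sqrt (real r + 2))"
        using l1 by (intro divide_left_mono mult_pos_pos) auto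
      also have "\<beta> / (4 * (3 * \<beta>\<^sup>2) * (2 * \<beta>)) = \<rho>" using l1 by (simp add: \<rho>_def)
      finally show "\<rho> \<le> \<beta> * sqrt (real (Suc r)) - \<beta> * sqrt (real r) -
           (\<beta> * sqrt (real (Suc (Suc r))) - \<beta> * sqrt (real (Suc r)))"
        using sqrt_increment(3)[OF \<open>\<beta> > 0\<close>, of r] by linarith
    next
      fix r assume r: "A \<le> r" "r < A1"
      have "\<beta> / (sqrt (real (Suc r)) + sqrt (real r)) \<le> \<beta> / sqrt (real A)"
      proof (rule divide_left_mono)
        have "sqrt (real A) \<le> sqrt (real r)" using r by simp
        thus "sqrt (real A) \<le> sqrt (real (Suc r)) + sqrt (real r)" by (simp add: add_increasing)
      qed (use l1 assms in \<open>auto intro!: mult_pos_pos add_pos_nonneg\<close>)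
      thus "0 \<le> \<beta> * sqrt (real (Suc r)) - \<beta> * sqrt (real r) \<and>
          \<beta> * sqrt (real (Suc r)) - \<beta> * sqrt (real r) \<le> \<beta> / sqrt (real A)"
        unfolding sqrt_increment(1)[OF \<open>\<beta> > 0\<close>] using l1 by simp
    qed (use l1 assms in \<open>auto simp: \<rho>_def field_simps\<close>)
    also have "\<dots> = (\<beta> / sqrt (real A) + 2) * (20 * \<beta> + 1)"
      using l1 by (simp add: \<rho>_def field_simps power2_eq_square)
    also have "\<dots> \<le> (\<beta> / sqrt (real A) + 2) * (60 * \<beta>)"
      using l1 by (intro mult_left_mono) auto
    finally show ?thesis by (simp add: mult_ac)
  qed
  finally show ?thesis by simp
qed

section \<open>Divisors and the Moebius function\<close>

definition ndiv :: "nat \<Rightarrow> nat" where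
  "ndiv n = card {d. d dvd n}"

lemma finite_divisors: "n > 0 \<Longrightarrow> finite {d::nat. d dvd n}"
  by (rule finite_subset[of _ "{..n}"]) (auto dest: dvd_imp_le)

lemma ndiv_le: "n > 0 \<Longrightarrow> ndiv n \<le> n"
proof -
  assume "n > 0"
  hence "card {d. d dvd n} \<le> card {1..n}"
    by (intro card_mono) (auto dest: dvd_imp_le simp: Suc_le_eq intro: Nat.gr0I)
  thus ?thesis by (simp add: ndiv_def)
qed

lemma ndiv_mult_le:
  assumes "a > 0" "b > 0"
  shows "ndiv (a * b) \<le> ndiv a * ndiv b"
proof -
  have "{d. d dvd a * b} \<subseteq> (\<lambda>(x, y). x * y) ` ({d. d dvd a} \<times> {d. d dvd b})"
  proof
    fix d assume "d \<in> {d. d dvd a * b}"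
    then obtain x y where "d = x * y" "x dvd a" "y dvd b" using division_decomp by blast
    thus "d \<in> (\<lambda>(x, y). x * y) ` ({d. d dvd a} \<times> {d. d dvd b})" by force
  qed
  hence "card {d. d dvd a * b} \<le> card ({d. d dvd a} \<times> {d. d dvd b})"
    by (rule surj_card_le[rotated]) (use assms in \<open>auto intro: finite_divisors\<close>)
  thus ?thesis by (simp add: ndiv_def card_cartesian_product)
qed

lemma ndiv_prime_power: "prime p \<Longrightarrow> ndiv (p ^ k) = Suc k"
proof -
  assume p: "prime p"
  have "{d. d dvd p ^ k} = (\<lambda>i. p ^ i) ` {..k}"
    using divides_primepow_nat[OF p] by auto
  moreover have "inj_on (\<lambda>i. p ^ i) {..k}"
    using prime_gt_1_nat[OF p] by (auto intro!: inj_onI)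
  ultimately show ?thesis by (simp add: ndiv_def card_image)
qed

text \<open>Only prime powers matter: \<open>v + 1 \<le> p powr (v * \<epsilon>)\<close> as soon as
  \<open>p \<ge> 2 powr (1 / \<epsilon>)\<close>, and each of the finitely many smaller primes costs
  a factor \<open>C0\<close>. The induction strips off the full power of one prime at a
  time.\<close>

lemma ndiv_bound:
  assumes "\<epsilon> > 0"
  shows "\<exists>C\<ge>1. \<forall>n>0. real (ndiv n) \<le> C * real n powr \<epsilon>"
proof -
  define P where "P = nat \<lceil>2 powr (1 / \<epsilon>)\<rceil>"
  \<comment> \<open>Chosen so that \<open>C0 * (1 + \<epsilon> * v * ln 2) \<ge> v + 1\<close>; the
    parenthesis is at most \<open>2 powr (v * \<epsilon>)\<close>.\<close>
  define C0 where "C0 = 1 + 1 / (\<epsilon> * ln 2)"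
  have C0: "C0 \<ge> 1" using assms by (simp add: C0_def)
  have small: "real (Suc v) \<le> C0 * real (p ^ v) powr \<epsilon>" if "p \<ge> 2" for p v :: nat
  proof -
    have "1 + \<epsilon> * (real v * ln 2) \<le> exp (\<epsilon> * (real v * ln 2))" by (rule exp_ge_add_one_self)
    also have "\<dots> = (2 ^ v) powr \<epsilon>" by (simp add: powr_def ln_realpow)
    also have "\<dots> \<le> real (p ^ v) powr \<epsilon>"
      using that assms by (intro powr_mono2) (auto intro!: power_mono)
    finally have 1: "1 + \<epsilon> * (real v * ln 2) \<le> real (p ^ v) powr \<epsilon>" .
    have "real (Suc v) \<le> C0 * (1 + \<epsilon> * (real v * ln 2))"
      using assms by (simp add: C0_def field_simps)
    also have "\<dots> \<le> C0 * real (p ^ v) powr \<epsilon>" using 1 C0 by (intro mult_left_mono) auto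
    finally show ?thesis .
  qed
  have big: "real (Suc v) \<le> real (p ^ v) powr \<epsilon>" if "p \<ge> P" for p v :: nat
  proof -
    have "2 powr (1 / \<epsilon>) \<le> real p" using that unfolding P_def by linarith
    hence "(2 powr (1 / \<epsilon>)) powr \<epsilon> \<le> real p powr \<epsilon>" using assms by (intro powr_mono2) auto
    hence p2: "2 \<le> real p powr \<epsilon>" using assms by (simp add: powr_powr)
    hence "p > 0" by (auto intro: Nat.gr0I)
    have "2 ^ v \<le> (real p powr \<epsilon>) ^ v" using p2 by (intro power_mono) auto
    also have "\<dots> = real (p ^ v) powr \<epsilon>"
      using \<open>p > 0\<close> by (simp add: powr_power powr_realpow[symmetric] powr_powr mult_ac)
    finally have "2 ^ v \<le> real (p ^ v) powr \<epsilon>" .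
    moreover have "real (Suc v) \<le> 2 ^ v" 
      using of_nat_mono[of "Suc v" "2 ^ v", where 'a = real] less_exp[of v] by (simp add: Suc_le_eq)
    ultimately show ?thesis by linarith
  qed
  define c where "c = (\<lambda>n::nat. card {p. prime p \<and> p dvd n \<and> p < P})"
  have main: "real (ndiv n) \<le> C0 ^ c n * real n powr \<epsilon>" if "n > 0" for n
    using that
  proof (induction n rule: less_induct)
    case (less n)
    show ?case
    proof (cases "n = 1")
      case True
      thus ?thesis using C0 by (auto simp: ndiv_def)
    next
      case False
      then obtain p where p: "prime p" "p dvd n" using prime_factor_nat by blast
      obtain m where m: "n = p ^ multiplicity p n * m" "\<not> p dvd m"
        using multiplicity_decompose'[of n p] less.prems p by (metis not_prime_unit neq0_conv)
      define v where "v = multiplicity p n"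
      have v: "v > 0" using p less.prems unfolding v_def
        by (metis m(1) m(2) gr0I mult_1 power_0)
      have m0: "m > 0" using m less.prems by (auto intro: Nat.gr0I)
      have p2: "p \<ge> 2" using p prime_ge_2_nat by blast
      have "p ^ 1 \<le> p ^ v" using p2 v by (intro power_increasing) auto
      hence "p ^ v \<ge> 2" using p2 by simp
      have nm: "n = p ^ v * m" using m(1) by (simp add: v_def)
      have "2 * m \<le> p ^ v * m" using \<open>p ^ v \<ge> 2\<close> by (rule mult_right_mono) simp
      hence "m < n" using m0 nm by linarith
      have IH: "real (ndiv m) \<le> C0 ^ c m * real m powr \<epsilon>" using less.IH[OF \<open>m < n\<close> m0] .
      have "ndiv n \<le> ndiv (p ^ v) * ndiv m"
        using ndiv_mult_le[of "p ^ v" m] m0 p2 unfolding nm[symmetric] by simp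
      hence "real (ndiv n) \<le> real (Suc v) * real (ndiv m)"
        unfolding ndiv_prime_power[OF p(1)] by (metis of_nat_mono of_nat_mult)
      also have "\<dots> \<le> real (Suc v) * (C0 ^ c m * real m powr \<epsilon>)" using IH by (intro mult_left_mono) auto
      also have "real (Suc v) * C0 ^ c m \<le> C0 ^ c n * real (p ^ v) powr \<epsilon>"
      proof (cases "p < P")
        case True
        have "{q. prime q \<and> q dvd m \<and> q < P} \<subset> {q. prime q \<and> q dvd n \<and> q < P}"
        proof
          show "{q. prime q \<and> q dvd m \<and> q < P} \<subseteq> {q. prime q \<and> q dvd n \<and> q < P}"
            unfolding nm by auto
          show "{q. prime q \<and> q dvd m \<and> q < P} \<noteq> {q. prime q \<and> q dvd n \<and> q < P}"
            using True p m(2) by blast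
        qed
        hence "c m < c n" unfolding c_def by (intro psubset_card_mono) auto
        hence "C0 * C0 ^ c m \<le> C0 ^ c n"
          using C0 power_increasing[of "Suc (c m)" "c n" C0] by simp
        moreover have "real (Suc v) * C0 ^ c m \<le> (C0 * real (p ^ v) powr \<epsilon>) * C0 ^ c m"
          using C0 by (intro mult_right_mono small[OF p2]) auto
        ultimately show ?thesis
          by (smt (verit, best) mult.commute mult.left_commute mult_right_mono powr_ge_zero)
      next
        case False
        have "c m \<le> c n" unfolding c_def by (intro card_mono) (auto simp: nm)
        hence "C0 ^ c m \<le> C0 ^ c n" using C0 by (intro power_increasing) auto
        thus ?thesis using big[of p v] False C0
          by (subst mult.commute) (intro mult_mono, auto)
      qed
      hence "real (Suc v) * (C0 ^ c m * real m powr \<epsilon>) \<le> C0 ^ c n * real (p ^ v) powr \<epsilon> * real m powr \<epsilon>"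
        by (subst mult.assoc[symmetric], intro mult_right_mono) auto
      also have "\<dots> = C0 ^ c n * real n powr \<epsilon>"
        by (simp add: nm powr_mult)
      finally show ?thesis .
    qed
  qed
  have "real (ndiv n) \<le> C0 ^ P * real n powr \<epsilon>" if "n > 0" for n
  proof -
    have "c n \<le> card {..<P}" unfolding c_def by (intro card_mono) auto
    hence "C0 ^ c n \<le> C0 ^ P" using C0 by (intro power_increasing) auto
    thus ?thesis using main[OF that] by (smt (verit) mult_right_mono powr_ge_zero)
  qed
  thus ?thesis using C0 by (intro exI[of _ "C0 ^ P"]) auto
qed

section \<open>The Moebius function and the detection of coprimality\<close>

definition mu :: "nat \<Rightarrow> real" where
  "mu n = (if squarefree n then (-1) ^ card (prime_factors n) else 0)"

lemma abs_mu_le: "\<bar>mu n\<bar> \<le> 1"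
  by (auto simp: mu_def)

lemma mu_1 [simp]: "mu (Suc 0) = 1"
  by (simp add: mu_def)

lemma mu_prime_mult:
  assumes p: "prime p" and "\<not> p dvd d" "d > 0"
  shows "mu (p * d) = - mu d"
proof -
  have cop: "coprime p d" using assms by (simp add: prime_imp_coprime)
  have "squarefree (p * d) \<longleftrightarrow> squarefree d"
    using squarefree_mult_coprime[OF cop] squarefree_prime[OF p] squarefree_multD(2)[of p d] by blast
  moreover have "prime_factors (p * d) = insert p (prime_factors d)"
    using assms p by (simp add: prime_factors_product prime_prime_factors)
  moreover have "p \<notin> prime_factors d" using assms by auto
  ultimately show ?thesis by (simp add: mu_def)
qed

text \<open>For a prime \<open>p\<close> dividing \<open>n\<close> the divisors split into those
  prime to \<open>p\<close>, \<open>p\<close> times these, and the multiples of \<open>p^2\<close>.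
  The first two families cancel because \<open>mu\<close> changes sign, and on the third it is
  zero.\<close>

lemma sum_mu_divisors:
  assumes "n > 0"
  shows "(\<Sum>d\<in>{d. d dvd n}. mu d) = (if n = 1 then 1 else 0)"
proof (cases "n = 1")
  case True
  thus ?thesis by simp
next
  case False
  then obtain p where p: "prime p" "p dvd n" using prime_factor_nat by blast
  have p0: "p > 0" using p prime_gt_0_nat by blast
  define A where "A = {d. d dvd n \<and> \<not> p dvd d}"
  define C where "C = {d. d dvd n \<and> p ^ 2 dvd d}"
  have fin: "finite {d. d dvd n}" using assms by (rule finite_divisors)
  have split: "{d. d dvd n} = (A \<union> (*) p ` A) \<union> C"
  proof (intro equalityI subsetI)
    fix d assume d: "d \<in> {d. d dvd n}"
    show "d \<in> (A \<union> (*) p ` A) \<union> C"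
    proof (cases "p dvd d \<and> \<not> p ^ 2 dvd d")
      case True
      then obtain k where k: "d = p * k" by auto
      with True have "\<not> p dvd k" by (auto simp: power2_eq_square)
      moreover have "k dvd n" using d k by (metis dvd_mult_right mem_Collect_eq)
      ultimately show ?thesis using k by (auto simp: A_def)
    qed (use d in \<open>auto simp: A_def C_def\<close>)
  next
    fix d assume "d \<in> (A \<union> (*) p ` A) \<union> C"
    thus "d \<in> {d. d dvd n}"
      using p by (auto simp: A_def C_def intro!: divides_mult prime_imp_coprime)
  qed
  have "(\<Sum>d\<in>{d. d dvd n}. mu d) = (\<Sum>d\<in>A \<union> (*) p ` A. mu d) + (\<Sum>d\<in>C. mu d)"
    unfolding split
  proof (rule sum.union_disjoint)
    show "finite (A \<union> (*) p ` A)" "finite C" using fin split by (metis finite_Un)+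
    show "(A \<union> (*) p ` A) \<inter> C = {}"
      using p0 by (auto simp: A_def C_def power2_eq_square)
  qed
  also have "(\<Sum>d\<in>C. mu d) = 0"
  proof (rule sum.neutral, intro ballI)
    fix d assume "d \<in> C"
    hence "p ^ 2 dvd d" by (auto simp: C_def)
    hence "\<not> squarefree d" using p unfolding squarefree_def by (metis not_prime_unit)
    thus "mu d = 0" by (simp add: mu_def)
  qed
  also have "(\<Sum>d\<in>A \<union> (*) p ` A. mu d) = (\<Sum>d\<in>A. mu d) + (\<Sum>d\<in>(*) p ` A. mu d)"
    by (rule sum.union_disjoint) (use fin in \<open>auto simp: A_def\<close>)
  also have "(\<Sum>d\<in>(*) p ` A. mu d) = (\<Sum>d\<in>A. mu (p * d))"
    using p0 by (subst sum.reindex) (auto intro!: inj_onI)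
  also have "\<dots> = (\<Sum>d\<in>A. - mu d)"
  proof (rule sum.cong)
    fix d assume "d \<in> A"
    hence "\<not> p dvd d" "d > 0" using assms by (auto simp: A_def intro: Nat.gr0I)
    thus "mu (p * d) = - mu d" using p by (intro mu_prime_mult) auto
  qed simp
  finally show ?thesis using False by (simp add: sum_negf)
qed

lemma sum_mu_coprime:
  assumes "Q > 0" "K > 0"
  shows "(\<Sum>j\<in>{j. j dvd Q \<and> j dvd K}. mu j) = (if coprime K Q then 1 else 0)"
proof -
  have "{j. j dvd Q \<and> j dvd K} = {j. j dvd gcd K Q}" by auto
  thus ?thesis using sum_mu_divisors[of "gcd K Q"] assms by (simp add: coprime_iff_gcd_eq_1)
qed

text \<open>The set of \<open>K\<close> with \<open>f dvd K^2\<close> is closed under gcd, so its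
  least positive element divides all the others.\<close>

lemma dvd_square_least:
  assumes "f > 0"
  obtains k0 :: nat where "k0 > 0" "f \<le> k0\<^sup>2" "\<And>K. f dvd K\<^sup>2 \<Longrightarrow> k0 dvd K"
proof -
  define k0 where "k0 = (LEAST k. k > 0 \<and> f dvd k\<^sup>2)"
  have k0: "k0 > 0 \<and> f dvd k0\<^sup>2"
    unfolding k0_def by (rule LeastI[of _ f]) (use assms in auto)
  have "k0 dvd K" if K: "f dvd K\<^sup>2" for K
  proof -
    have "gcd k0 K > 0 \<and> f dvd (gcd k0 K)\<^sup>2"
      using k0 K by (simp flip: gcd_exp)
    hence "k0 \<le> gcd k0 K" unfolding k0_def by (rule Least_le)
    moreover have "gcd k0 K \<le> k0" using k0 by (intro dvd_imp_le) auto
    ultimately show ?thesis by (metis gcd_dvd2 le_antisym)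
  qed
  thus ?thesis using that k0 by (auto dest: dvd_imp_le)
qed

section \<open>Harmonic sums and the size of the square sum of the divisor function\<close>

lemma sum_inverse_le_ln: "X \<ge> 1 \<Longrightarrow> (\<Sum>r\<in>{1..X}. 1 / real r) \<le> 1 + ln (real X)"
proof (induction X rule: dec_induct)
  case (step X)
  have "ln (real (Suc X)) - ln (real X) \<ge> 1 / real (Suc X)"
  proof -
    have "ln (real X / real (Suc X)) \<le> real X / real (Suc X) - 1"
      using step by (intro ln_le_minus_one) auto
    also have "\<dots> = - (1 / real (Suc X))" by (simp add: field_simps)
    finally show ?thesis using step by (simp add: ln_div)
  qed
  thus ?case using step by simp
qed simp

lemma sum_inverse_squares: "(\<Sum>g\<in>{1..Y}. 1 / (real g)\<^sup>2) \<le> 2"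
proof -
  \<comment> \<open>Subtracting \<open>1 / (Y + 1)\<close> strengthens the bound so that the
    induction telescopes.\<close>
  have "(\<Sum>g\<in>{1..Suc Y}. 1 / (real g)\<^sup>2) \<le> 2 - 1 / real (Suc Y)" for Y
  proof (induction Y)
    case (Suc Y)
    have "1 / (real (Suc (Suc Y)))\<^sup>2 \<le> 1 / real (Suc Y) - 1 / real (Suc (Suc Y))"
    proof -
      have "1 / real (Suc Y) - 1 / real (Suc (Suc Y)) = 1 / (real (Suc Y) * real (Suc (Suc Y)))"
        by (simp add: field_simps)
      thus ?thesis unfolding power2_eq_square by (auto intro!: divide_left_mono mult_right_mono simp del: of_nat_Suc)
    qed
    thus ?case using Suc by simp
  qed simp
  from this[of "Y - 1"] show ?thesis by (cases Y) (auto intro: order_trans)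
qed

definition coprime_sum :: "nat \<Rightarrow> nat \<Rightarrow> real" where
  "coprime_sum Q Y = (\<Sum>a\<in>{a\<in>{1..Y}. coprime a Q}. 1 / real a)"

text \<open>This one sum is both the diagonal main term and the square sum of the coefficients
  \<open>ndiv m / sqrt m\<close> of the test function.\<close>

definition ndiv2_sum :: "nat \<Rightarrow> nat \<Rightarrow> real" where
  "ndiv2_sum Q N = (\<Sum>m\<in>{m\<in>{1..N}. coprime m Q}. real (ndiv m) ^ 2 / real m)"

text \<open>The residue class 1 modulo \<open>Q\<close> consists of numbers coprime to
  \<open>Q\<close> and alone carries \<open>ln (Y / Q) / Q\<close>; the hypothesis
  \<open>Y \<ge> Q^2\<close> makes this logarithm at least half of \<open>ln Y\<close>.\<close>

lemma coprime_sum_lower: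
  assumes "Q \<ge> 1" "Y \<ge> Q\<^sup>2" "Y \<ge> 1"
  shows "coprime_sum Q Y \<ge> ln (real Y) / (2 * real Q)"
proof -
  \<comment> \<open>The number of integers \<open>i * Q + 1\<close> up to \<open>Y\<close>.\<close>
  define n where "n = Suc ((Y - 1) div Q)"
  have "Y - 1 < Q * n" unfolding n_def using assms by (simp add: dividend_less_times_div)
  hence "Y \<le> Q * n" using assms by linarith
  hence Yn: "real Y \<le> real Q * real n" by (simp flip: of_nat_mult)
  have n: "i * Q < Y" if "i < n" for i
  proof -
    have "i \<le> (Y - 1) div Q" using that by (simp add: n_def)
    hence "i * Q \<le> (Y - 1) div Q * Q" by (intro mult_right_mono) auto
    also have "\<dots> \<le> Y - 1" by simp
    finally show ?thesis using assms by linarith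
  qed
  have "ln (real Y) = 2 * ln (real Y) - ln (real Y)" by simp
  also have "ln (real Y) \<ge> ln (real Q ^ 2)" using assms by (simp flip: of_nat_power)
  hence "2 * ln (real Y) - ln (real Y) \<le> 2 * (ln (real Y) - ln (real Q))"
    using assms by (simp add: ln_realpow)
  also have "ln (real Y) - ln (real Q) = ln (real Y / real Q)"
    using assms by (simp add: ln_div)
  also have "\<dots> \<le> ln (real n + 1)"
    using Yn assms by (intro ln_mono) (auto simp: field_simps)
  also have "\<dots> \<le> harm n" by (rule ln_le_harm)
  finally have "ln (real Y) / (2 * real Q) \<le> harm n / real Q" using assms by (simp add: field_simps)
  also have "harm n / real Q = (\<Sum>i<n. 1 / (real Q * real (Suc i)))"
    unfolding harm_def One_nat_def sum.atLeast1_atMost_eq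
    by (simp add: sum_divide_distrib field_simps del: of_nat_Suc)
  also have "\<dots> \<le> (\<Sum>i<n. 1 / real (Suc (i * Q)))"
  proof (intro sum_mono divide_left_mono mult_pos_pos)
    fix i
    have "1 \<le> real Q" using assms by simp
    thus "real (Suc (i * Q)) \<le> real Q * real (Suc i)" by (simp add: algebra_simps)
  qed (use assms in \<open>auto simp: add_pos_nonneg\<close>)
  also have "\<dots> = (\<Sum>a\<in>(\<lambda>i. Suc (i * Q)) ` {..<n}. 1 / real a)"
    using assms by (subst sum.reindex) (auto intro!: inj_onI)
  also have "\<dots> \<le> coprime_sum Q Y"
    unfolding coprime_sum_def
  proof (intro sum_mono2)
    have "coprime (Suc (i * Q)) Q" for i
    proof -
      have "gcd (i * Q + 1) Q = gcd 1 Q" using gcd_add_mult[of Q i 1] by (metis add.commute gcd.commute)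
      thus ?thesis by (simp add: coprime_iff_gcd_eq_1)
    qed
    thus "(\<lambda>i. Suc (i * Q)) ` {..<n} \<subseteq> {a \<in> {1..Y}. coprime a Q}" using n by (auto simp: Suc_le_eq)
  qed auto
  finally show ?thesis .
qed

text \<open>A pair is its gcd \<open>g\<close> times a coprime pair, and this multiplies the weight
  by \<open>1 / g^2\<close>; these factors add up to at most 2.\<close>

lemma coprime_pairs_sum:
  fixes Q Y
  defines "A \<equiv> {a\<in>{1..Y}. coprime a Q}"
  shows "(coprime_sum Q Y)\<^sup>2 \<le> 2 * (\<Sum>(b, c)\<in>{(b, c)\<in>A \<times> A. coprime b c}. 1 / (real b * real c))"
proof -
  define P where "P = {(b, c)\<in>A \<times> A. coprime b c}"
  have fA: "finite A" by (simp add: A_def)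
  have fP: "finite P" unfolding P_def using fA by (auto intro: finite_subset[of _ "A \<times> A"])
  define \<phi> where "\<phi> = (\<lambda>(b::nat, c::nat). (gcd b c, (b div gcd b c, c div gcd b c)))"
  have "(coprime_sum Q Y)\<^sup>2 = (\<Sum>(b, c)\<in>A \<times> A. 1 / (real b * real c))"
    unfolding coprime_sum_def A_def[symmetric] power2_eq_square
    by (simp add: sum_product sum.cartesian_product)
  also have "\<dots> = (\<Sum>t\<in>A \<times> A. (\<lambda>(g, b, c). 1 / (real g)\<^sup>2 * (1 / (real b * real c))) (\<phi> t))"
  proof (rule sum.cong)
    fix t assume "t \<in> A \<times> A"
    then obtain b c where t: "t = (b, c)" "b > 0" "c > 0" by (auto simp: A_def)
    define g where "g = gcd b c"
    have "g > 0" using t by (simp add: g_def)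
    moreover have "b = g * (b div g)" "c = g * (c div g)" by (simp_all add: g_def)
    hence "real b = real g * real (b div g)" "real c = real g * real (c div g)"
      by (metis of_nat_mult)+
    ultimately show "(case t of (b, c) \<Rightarrow> 1 / (real b * real c)) =
        (\<lambda>(g, b, c). 1 / (real g)\<^sup>2 * (1 / (real b * real c))) (\<phi> t)"
      unfolding t \<phi>_def g_def[symmetric] by (simp add: power2_eq_square g_def[symmetric])
  qed simp
  also have "\<dots> = (\<Sum>t\<in>\<phi> ` (A \<times> A). (\<lambda>(g, b, c). 1 / (real g)\<^sup>2 * (1 / (real b * real c))) t)"
  proof (rule sum.reindex[symmetric, unfolded o_def])
    show "inj_on \<phi> (A \<times> A)"
      by (rule inj_on_inverseI[of _ "\<lambda>(g, b, c). (g * b, g * c)"]) (auto simp: \<phi>_def)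
  qed
  also have "\<dots> \<le> (\<Sum>t\<in>{1..Y} \<times> P. (\<lambda>(g, b, c). 1 / (real g)\<^sup>2 * (1 / (real b * real c))) t)"
  proof (intro sum_mono2)
    show "\<phi> ` (A \<times> A) \<subseteq> {1..Y} \<times> P"
    proof
      fix t assume "t \<in> \<phi> ` (A \<times> A)"
      then obtain b c where t: "t = (gcd b c, b div gcd b c, c div gcd b c)" "b \<in> A" "c \<in> A"
        by (auto simp: \<phi>_def)
      have bc: "b > 0" "c > 0" "b \<le> Y" "c \<le> Y" "coprime b Q" "coprime c Q" using t by (auto simp: A_def)
      have d: "b div gcd b c dvd b" "c div gcd b c dvd c"
        by (metis dvd_mult_div_cancel dvd_triv_right gcd_dvd1) (metis dvd_mult_div_cancel dvd_triv_right gcd_dvd2)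
      have "coprime (b div gcd b c) Q" "coprime (c div gcd b c) Q"
        using coprime_divisors[OF d(1) dvd_refl] coprime_divisors[OF d(2) dvd_refl] bc by auto
      moreover have "coprime (b div gcd b c) (c div gcd b c)"
        using bc by (intro div_gcd_coprime) auto
      moreover have "b div gcd b c > 0" "c div gcd b c > 0" using d bc by (auto intro!: Nat.gr0I)
      moreover have "b div gcd b c \<le> Y" "c div gcd b c \<le> Y"
        using d bc by (meson dvd_imp_le le_trans)+
      moreover have "gcd b c > 0" "gcd b c \<le> Y" using bc
        by (auto simp: Suc_le_eq) (meson dvd_imp_le gcd_dvd1 le_trans)
      ultimately show "t \<in> {1..Y} \<times> P" unfolding t P_def A_def by (auto simp: Suc_le_eq)
    qed
  qed (use fP in auto)
  also have "\<dots> = (\<Sum>g\<in>{1..Y}. 1 / (real g)\<^sup>2) * (\<Sum>(b, c)\<in>P. 1 / (real b * real c))"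
    by (simp add: sum_product sum.cartesian_product case_prod_unfold)
  also have "\<dots> \<le> 2 * (\<Sum>(b, c)\<in>P. 1 / (real b * real c))"
    by (intro mult_right_mono sum_inverse_squares sum_nonneg) auto
  finally show ?thesis unfolding P_def .
qed

text \<open>
  Quadruples \<open>(a, h, b, c)\<close> with \<open>a * h * b * c = m\<close> and coprime \<open>b, c\<close> are determined by the divisors
  \<open>a * b\<close> and \<open>a * c\<close> of \<open>m\<close>, so there are at most \<open>ndiv m ^ 2\<close> of them.
\<close>

lemma ndiv2_sum_lower: "ndiv2_sum Q (Y ^ 4) \<ge> coprime_sum Q Y ^ 4 / 2"
proof -
  define A where "A = {a\<in>{1..Y}. coprime a Q}"
  define P where "P = {(b, c)\<in>A \<times> A. coprime b c}"
  define B where "B = {m\<in>{1..Y ^ 4}. coprime m Q}"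
  define T where "T = (A \<times> A) \<times> P"
  define \<phi> where "\<phi> = (\<lambda>((a::nat, h::nat), (b::nat, c::nat)). a * h * (b * c))"
  have fA: "finite A" by (simp add: A_def)
  have fP: "finite P" unfolding P_def using fA by (auto intro: finite_subset[of _ "A \<times> A"])
  have fT: "finite T" using fA fP by (auto simp: T_def)
  have S: "coprime_sum Q Y = (\<Sum>a\<in>A. 1 / real a)" by (simp add: coprime_sum_def A_def)
  \<comment> \<open>Four factors, because the mean of \<open>ndiv m ^ 2\<close> grows like the cube
    of the logarithm. Restricting one pair to coprime \<open>(b, c)\<close>, which the injectivity
    below relies on, costs the factor 2.\<close>
  have "coprime_sum Q Y ^ 4 / 2 = (coprime_sum Q Y)\<^sup>2 * ((coprime_sum Q Y)\<^sup>2 / 2)"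
    by (simp add: power2_eq_square power4_eq_xxxx)
  also have "\<dots> \<le> (coprime_sum Q Y)\<^sup>2 * (\<Sum>(b, c)\<in>P. 1 / (real b * real c))"
    using coprime_pairs_sum[of Q Y] unfolding A_def[symmetric] P_def[symmetric] by (intro mult_left_mono) auto
  also have "(coprime_sum Q Y)\<^sup>2 = (\<Sum>(a, h)\<in>A \<times> A. 1 / (real a * real h))"
    unfolding S power2_eq_square by (simp add: sum_product sum.cartesian_product)
  also have "\<dots> * (\<Sum>(b, c)\<in>P. 1 / (real b * real c)) = (\<Sum>t\<in>T. 1 / real (\<phi> t))"
    unfolding T_def by (simp add: sum_product sum.cartesian_product case_prod_unfold \<phi>_def)
  also have "\<dots> = (\<Sum>m\<in>B. \<Sum>t\<in>{t\<in>T. \<phi> t = m}. 1 / real (\<phi> t))"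
  proof (rule sum.group[symmetric])
    show "\<phi> ` T \<subseteq> B"
    proof
      fix m assume "m \<in> \<phi> ` T"
      then obtain a h b c where m: "m = a * h * (b * c)" "a \<in> A" "h \<in> A" "b \<in> A" "c \<in> A"
        by (auto simp: T_def \<phi>_def P_def)
      have "a * h * (b * c) \<le> Y * Y * (Y * Y)" using m by (intro mult_mono) (auto simp: A_def)
      moreover have "m > 0" using m by (auto simp: A_def)
      moreover have "coprime m Q" using m by (auto simp: A_def)
      ultimately show "m \<in> B" using m by (simp add: B_def power4_eq_xxxx mult_ac)
    qed
  qed (use fT in \<open>auto simp: B_def\<close>)
  also have "\<dots> \<le> (\<Sum>m\<in>B. real (ndiv m) ^ 2 / real m)"
  proof (rule sum_mono)
    fix m assume m: "m \<in> B"
    hence m0: "m > 0" by (auto simp: B_def)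
    define F where "F = {t\<in>T. \<phi> t = m}"
    have "card F \<le> card ({d. d dvd m} \<times> {d. d dvd m})"
    proof (rule card_inj_on_le)
      define \<psi> where "\<psi> = (\<lambda>((a::nat, h::nat), (b::nat, c::nat)). (a * b, a * c))"
      show "inj_on \<psi> F"
      proof (rule inj_onI)
        fix s t assume st: "s \<in> F" "t \<in> F" "\<psi> s = \<psi> t"
        obtain a h b c where s: "s = ((a, h), (b, c))" by (metis surj_pair)
        obtain a' h' b' c' where t: "t = ((a', h'), (b', c'))" by (metis surj_pair)
        have pos: "a > 0" "h > 0" "b > 0" "c > 0" "a' > 0" "h' > 0" "b' > 0" "c' > 0"
          "coprime b c" "coprime b' c'" "a * h * (b * c) = m" "a' * h' * (b' * c') = m"
          using st unfolding s t by (auto simp: F_def T_def P_def A_def \<phi>_def)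
        have e: "a * b = a' * b'" "a * c = a' * c'" using st unfolding s t by (auto simp: \<psi>_def)
        \<comment> \<open>Coprimality of \<open>b\<close> and \<open>c\<close> recovers
          \<open>a\<close> as a gcd; then \<open>b\<close> and \<open>c\<close>, and finally
          \<open>h\<close>, follow by cancellation.\<close>
        have "gcd (a * b) (a * c) = a" "gcd (a' * b') (a' * c') = a'"
          using pos by (simp_all add: gcd_mult_distrib_nat[symmetric])
        hence "a = a'" using e by simp
        moreover from this e pos have "b = b'" "c = c'" by auto
        moreover from calculation pos have "h = h'" by (metis mult_cancel2 mult_cancel1 mult_is_0 neq0_conv)
        ultimately show "s = t" using s t by simp
      qed
      show "\<psi> ` F \<subseteq> {d. d dvd m} \<times> {d. d dvd m}"
      proof
        fix u assume "u \<in> \<psi> ` F"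
        then obtain a h b c where u: "u = (a * b, a * c)" "a * h * (b * c) = m"
          by (auto simp: F_def \<phi>_def \<psi>_def)
        have "m = a * b * (h * c)" "m = a * c * (h * b)" using u(2) by (simp_all add: mult_ac)
        thus "u \<in> {d. d dvd m} \<times> {d. d dvd m}" unfolding u(1) by (metis SigmaI dvd_triv_left mem_Collect_eq)
      qed
    qed (use m0 in \<open>auto intro: finite_divisors\<close>)
    hence cF: "card F \<le> ndiv m ^ 2" by (simp add: ndiv_def card_cartesian_product power2_eq_square)
    have "(\<Sum>t\<in>F. 1 / real (\<phi> t)) = real (card F) * (1 / real m)"
      by (simp add: F_def)
    also have "\<dots> \<le> real (ndiv m ^ 2) * (1 / real m)" using cF by (intro mult_right_mono) (auto simp flip: of_nat_power)
    finally show "(\<Sum>t\<in>{t\<in>T. \<phi> t = m}. 1 / real (\<phi> t)) \<le> real (ndiv m) ^ 2 / real m"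
      unfolding F_def by simp
  qed
  finally show ?thesis by (simp add: ndiv2_sum_def B_def)
qed

text \<open>Write a multiple of \<open>e\<close> as \<open>e * k\<close> and use that
  \<open>ndiv\<close> is submultiplicative.\<close>

lemma ndiv2_sum_dvd_le:
  assumes "e > 0"
  shows "(\<Sum>m\<in>{m\<in>{1..N}. coprime m Q \<and> e dvd m}. real (ndiv m) ^ 2 / real m) \<le>
     real (ndiv e) ^ 2 / real e * ndiv2_sum Q N"
proof -
  have "{m\<in>{1..N}. coprime m Q \<and> e dvd m} \<subseteq> (\<lambda>m. e * m) ` {m\<in>{1..N}. coprime m Q}"
  proof
    fix m assume m: "m \<in> {m\<in>{1..N}. coprime m Q \<and> e dvd m}"
    then obtain k where k: "m = e * k" by auto
    have "1 * k \<le> e * k" using assms by (intro mult_right_mono) auto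
    hence "k \<le> N" using m k by (metis (lifting) atLeastAtMost_iff le_trans mem_Collect_eq mult_1)
    hence "k \<in> {m\<in>{1..N}. coprime m Q}" using m k by (auto simp: Suc_le_eq intro: Nat.gr0I)
    thus "m \<in> (\<lambda>m. e * m) ` {m\<in>{1..N}. coprime m Q}" using k by auto
  qed
  hence "(\<Sum>m\<in>{m\<in>{1..N}. coprime m Q \<and> e dvd m}. real (ndiv m) ^ 2 / real m) \<le>
     (\<Sum>m\<in>(\<lambda>m. e * m) ` {m\<in>{1..N}. coprime m Q}. real (ndiv m) ^ 2 / real m)"
    by (intro sum_mono2) auto
  also have "\<dots> = (\<Sum>m\<in>{m\<in>{1..N}. coprime m Q}. real (ndiv (e * m)) ^ 2 / real (e * m))"
    using assms by (subst sum.reindex) (auto intro!: inj_onI)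
  also have "\<dots> \<le> (\<Sum>m\<in>{m\<in>{1..N}. coprime m Q}. real (ndiv e) ^ 2 / real e * (real (ndiv m) ^ 2 / real m))"
  proof (rule sum_mono)
    fix m assume "m \<in> {m\<in>{1..N}. coprime m Q}"
    hence "ndiv (e * m) \<le> ndiv e * ndiv m" using assms by (intro ndiv_mult_le) auto
    hence "real (ndiv (e * m)) \<le> real (ndiv e) * real (ndiv m)" by (metis of_nat_mono of_nat_mult)
    hence "real (ndiv (e * m)) ^ 2 \<le> (real (ndiv e) * real (ndiv m)) ^ 2" by (intro power_mono) auto
    hence "real (ndiv (e * m)) ^ 2 / real (e * m) \<le> (real (ndiv e) * real (ndiv m)) ^ 2 / real (e * m)"
      by (intro divide_right_mono) auto
    thus "real (ndiv (e * m)) ^ 2 / real (e * m) \<le> real (ndiv e) ^ 2 / real e * (real (ndiv m) ^ 2 / real m)"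
      by (simp add: power_mult_distrib)
  qed
  finally show ?thesis by (simp add: ndiv2_sum_def sum_distrib_left)
qed

text \<open>
  Restricting a sum of \<open>ndiv m ^ 2 / m\<close> to \<open>e dvd K^2 * m\<close>, that is, to the multiples of
  \<open>e div gcd e (K^2)\<close>, costs at most the factor in the inner parentheses.
\<close>

lemma eta_bound:
  "\<exists>C\<ge>0. \<forall>e>0. \<forall>X. (\<Sum>K\<in>{1..X}. real (ndiv (K\<^sup>2)) / (real K)\<^sup>2 *
       (real (ndiv (e div gcd e (K\<^sup>2))) ^ 2 / real (e div gcd e (K\<^sup>2)))) \<le> C * real e powr (- 3 / 4)"
proof -
  \<comment> \<open>The exponent 1/64 is small enough that all uses of the divisor bound together
    leave \<open>-61/64\<close>, still below \<open>-3/4\<close>.\<close>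
  obtain C0 where C0: "C0 \<ge> 1" "\<And>n. n > 0 \<Longrightarrow> real (ndiv n) \<le> C0 * real n powr (1 / 64)"
    using ndiv_bound[of "1 / 64"] by auto
  have "summable (\<lambda>n. real n powr (- (63 / 32)))" by (subst summable_real_powr_iff) auto
  then obtain C1 where C1: "C1 \<ge> 0" "\<And>X. (\<Sum>j\<in>{1..X}. real j powr (- (63 / 32))) \<le> C1"
    by (intro that[of "\<Sum>n. real n powr (- (63 / 32))"] suminf_nonneg sum_le_suminf) auto
  have k2: "real (ndiv (K\<^sup>2)) / (real K)\<^sup>2 \<le> C0 * real K powr (- (63 / 32))" if "K > 0" for K
  proof -
    have "real (ndiv (K\<^sup>2)) \<le> C0 * real (K\<^sup>2) powr (1 / 64)" using that by (intro C0) auto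
    also have "real (K\<^sup>2) powr (1 / 64) = real K powr (1 / 32)"
      using that by (simp add: powr_powr flip: powr_numeral)
    finally have "real (ndiv (K\<^sup>2)) / (real K)\<^sup>2 \<le> C0 * real K powr (1 / 32) / (real K)\<^sup>2"
      by (intro divide_right_mono) auto
    also have "\<dots> = C0 * (real K powr (1 / 32) / real K powr 2)" using that by simp
    also have "real K powr (1 / 32) / real K powr 2 = real K powr (- (63 / 32))"
      by (subst powr_diff[symmetric]) simp
    finally show ?thesis .
  qed
  have K: "(\<Sum>K\<in>{K\<in>{1..X}. f dvd K\<^sup>2}. real (ndiv (K\<^sup>2)) / (real K)\<^sup>2) \<le> C0 * C1 * real f powr (- (63 / 64))"
    if f: "f > 0" for f X :: nat
  proof -
    \<comment> \<open>All admissible \<open>K\<close> are multiples of \<open>k0\<close>, and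
      \<open>k0^2 \<ge> f\<close> converts the saving in \<open>k0\<close> into one in
      \<open>f\<close>.\<close>
    obtain k0 where k0: "k0 > 0" "f \<le> k0\<^sup>2" "\<And>K. f dvd K\<^sup>2 \<Longrightarrow> k0 dvd K"
      using dvd_square_least[OF f] by blast
    have "(\<Sum>K\<in>{K\<in>{1..X}. f dvd K\<^sup>2}. real (ndiv (K\<^sup>2)) / (real K)\<^sup>2) \<le>
       (\<Sum>K\<in>{K\<in>{1..X}. f dvd K\<^sup>2}. C0 * real K powr (- (63 / 32)))"
      by (intro sum_mono k2) auto
    also have "\<dots> \<le> (\<Sum>K\<in>(\<lambda>j. k0 * j) ` {1..X}. C0 * real K powr (- (63 / 32)))"
    proof (rule sum_mono2)
      show "{K \<in> {1..X}. f dvd K\<^sup>2} \<subseteq> (\<lambda>j. k0 * j) ` {1..X}"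
      proof
        fix K assume K: "K \<in> {K \<in> {1..X}. f dvd K\<^sup>2}"
        then obtain j where j: "K = k0 * j" using k0(3) by blast
        have "1 * j \<le> k0 * j" using k0 by (intro mult_right_mono) auto
        hence "j \<le> X" using K j by (metis (lifting) atLeastAtMost_iff le_trans mem_Collect_eq mult_1)
        thus "K \<in> (\<lambda>j. k0 * j) ` {1..X}" using K j by (auto simp: Suc_le_eq intro!: imageI Nat.gr0I)
      qed
    qed (use C0 in auto)
    also have "\<dots> = (\<Sum>j\<in>{1..X}. C0 * real (k0 * j) powr (- (63 / 32)))"
      using k0 by (subst sum.reindex) (auto intro!: inj_onI)
    also have "\<dots> = C0 * real k0 powr (- (63 / 32)) * (\<Sum>j\<in>{1..X}. real j powr (- (63 / 32)))"
      by (simp add: powr_mult sum_distrib_left mult_ac)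
    also have "\<dots> \<le> C0 * real k0 powr (- (63 / 32)) * C1"
      using C0 by (intro mult_left_mono C1) auto
    also have "real k0 powr (- (63 / 32)) = (real k0 powr 2) powr (- (63 / 64))"
      by (subst powr_powr) simp
    also have "\<dots> = real (k0\<^sup>2) powr (- (63 / 64))" using k0 by simp
    also have "\<dots> \<le> real f powr (- (63 / 64))"
      using k0 f by (intro powr_mono2') auto
    finally show ?thesis using C0 C1 by (simp add: mult_ac mult_left_mono mult_right_mono)
  qed
  have dq: "real (ndiv n) ^ 2 / real n \<le> C0 ^ 2 * real n powr (- (31 / 32))" if "n > 0" for n
  proof -
    have "real (ndiv n) ^ 2 \<le> (C0 * real n powr (1 / 64)) ^ 2" using that by (intro power_mono C0) auto
    also have "\<dots> = C0 ^ 2 * real n powr (1 / 32)"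
      by (simp add: power_mult_distrib power2_eq_square flip: powr_add)
    finally have "real (ndiv n) ^ 2 / real n \<le> C0 ^ 2 * real n powr (1 / 32) / real n"
      by (intro divide_right_mono) auto
    also have "\<dots> = C0 ^ 2 * (real n powr (1 / 32) / real n powr 1)" using that by simp
    also have "real n powr (1 / 32) / real n powr 1 = real n powr (- (31 / 32))"
      by (subst powr_diff[symmetric]) simp
    finally show ?thesis .
  qed
  show ?thesis
  proof (intro exI[of _ "C0 ^ 4 * C1"] conjI allI impI)
    fix e X :: nat assume e: "e > 0"
    define h where "h = (\<lambda>K. real (ndiv (K\<^sup>2)) / (real K)\<^sup>2)"
    have h0: "h K \<ge> 0" for K by (simp add: h_def)
    define D where "D = {f. f dvd e}"
    have D: "finite D" unfolding D_def using e by (rule finite_divisors)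
    \<comment> \<open>Once \<open>K\<close> is sorted by \<open>f = gcd e (K^2)\<close>, the second
      factor is constant on each class, and there are at most \<open>ndiv e\<close> classes.\<close>
    have "(\<Sum>K\<in>{1..X}. h K * (real (ndiv (e div gcd e (K\<^sup>2))) ^ 2 / real (e div gcd e (K\<^sup>2)))) =
      (\<Sum>f\<in>D. \<Sum>K\<in>{K\<in>{1..X}. gcd e (K\<^sup>2) = f}. h K * (real (ndiv (e div gcd e (K\<^sup>2))) ^ 2 / real (e div gcd e (K\<^sup>2))))"
      by (rule sum.group[symmetric]) (use D in \<open>auto simp: D_def\<close>)
    also have "\<dots> \<le> (\<Sum>f\<in>D. C0 ^ 3 * C1 * real e powr (- (31 / 32)))"
    proof (rule sum_mono)
      fix f assume "f \<in> D"
      hence f: "f dvd e" "f > 0" using e by (auto simp: D_def intro: Nat.gr0I)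
      then obtain q where q: "e = f * q" by auto
      have q0: "q > 0" using q e by (auto intro: Nat.gr0I)
      have eq: "e div f = q" using q f by simp
      have "(\<Sum>K\<in>{K\<in>{1..X}. gcd e (K\<^sup>2) = f}. h K * (real (ndiv (e div gcd e (K\<^sup>2))) ^ 2 / real (e div gcd e (K\<^sup>2)))) =
        (\<Sum>K\<in>{K\<in>{1..X}. gcd e (K\<^sup>2) = f}. h K) * (real (ndiv q) ^ 2 / real q)"
        unfolding sum_distrib_right by (rule sum.cong) (use eq in auto)
      also have "\<dots> \<le> (\<Sum>K\<in>{K\<in>{1..X}. f dvd K\<^sup>2}. h K) * (real (ndiv q) ^ 2 / real q)"
        using h0 by (intro mult_right_mono sum_mono2) auto
      also have "\<dots> \<le> (C0 * C1 * real f powr (- (63 / 64))) * (C0 ^ 2 * real q powr (- (31 / 32)))"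
        unfolding h_def using C0 C1 by (intro mult_mono K dq f q0) (auto intro!: mult_nonneg_nonneg)
      also have "\<dots> = C0 ^ 3 * C1 * (real f powr (- (63 / 64)) * real q powr (- (31 / 32)))"
        by (simp add: power2_eq_square power3_eq_cube mult_ac)
      also have "\<dots> \<le> C0 ^ 3 * C1 * (real f powr (- (31 / 32)) * real q powr (- (31 / 32)))"
        using C0 C1 f by (intro mult_left_mono mult_right_mono powr_mono) auto
      also have "real f powr (- (31 / 32)) * real q powr (- (31 / 32)) = real e powr (- (31 / 32))"
        unfolding q by (simp add: powr_mult)
      finally show "(\<Sum>K\<in>{K\<in>{1..X}. gcd e (K\<^sup>2) = f}. h K * (real (ndiv (e div gcd e (K\<^sup>2))) ^ 2 / real (e div gcd e (K\<^sup>2))))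
         \<le> C0 ^ 3 * C1 * real e powr (- (31 / 32))" .
    qed
    also have "\<dots> = real (ndiv e) * (C0 ^ 3 * C1 * real e powr (- (31 / 32)))"
      by (simp add: D_def ndiv_def)
    also have "\<dots> \<le> (C0 * real e powr (1 / 64)) * (C0 ^ 3 * C1 * real e powr (- (31 / 32)))"
      using C0 C1 e by (intro mult_right_mono C0) auto
    also have "\<dots> = C0 ^ 4 * C1 * (real e powr (1 / 64) * real e powr (- (31 / 32)))"
      by (simp add: power4_eq_xxxx power3_eq_cube mult_ac)
    also have "real e powr (1 / 64) * real e powr (- (31 / 32)) = real e powr (- (61 / 64))"
      by (subst powr_add[symmetric]) simp
    also have "C0 ^ 4 * C1 * \<dots> \<le> C0 ^ 4 * C1 * real e powr (- 3 / 4)"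
      using C0 C1 e by (intro mult_left_mono powr_mono) auto
    finally show "(\<Sum>K\<in>{1..X}. real (ndiv (K\<^sup>2)) / (real K)\<^sup>2 *
       (real (ndiv (e div gcd e (K\<^sup>2))) ^ 2 / real (e div gcd e (K\<^sup>2)))) \<le> C0 ^ 4 * C1 * real e powr (- 3 / 4)"
      unfolding h_def .
  qed (use C0 C1 in auto)
qed

section \<open>Waves and their sums\<close>

text \<open>The argument is clamped to \<open>[U, 2 U]\<close>: for positive \<open>U\<close> one
  formula then gives the quadratic inside, 0 outside, and a Lipschitz function everywhere.\<close>

definition bump :: "real \<Rightarrow> real \<Rightarrow> real" where
  "bump U v = (max U (min (2 * U) v) - U) * (2 * U - max U (min (2 * U) v)) / U\<^sup>2"

lemma bump_eq: "U \<le> v \<Longrightarrow> v \<le> 2 * U \<Longrightarrow> bump U v = (v - U) * (2 * U - v) / U\<^sup>2"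
  by (simp add: bump_def)

lemma bump_eq_0: "U > 0 \<Longrightarrow> v \<le> U \<or> v \<ge> 2 * U \<Longrightarrow> bump U v = 0"
  by (auto simp: bump_def)

lemma bump_bounds:
  assumes "U > 0"
  shows "0 \<le> bump U v" "bump U v \<le> 1 / 4"
proof -
  define c where "c = max U (min (2 * U) v)"
  have c: "U \<le> c" "c \<le> 2 * U" using assms by (auto simp: c_def)
  show "0 \<le> bump U v" unfolding bump_def c_def[symmetric] using c by auto
  have "(c - U) * (2 * U - c) = U\<^sup>2 / 4 - (c - 3 / 2 * U)\<^sup>2"
    by (simp add: power2_eq_square algebra_simps)
  also have "\<dots> \<le> U\<^sup>2 / 4" by simp
  finally have "(c - U) * (2 * U - c) / U\<^sup>2 \<le> U\<^sup>2 / 4 / U\<^sup>2" by (intro divide_right_mono) auto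
  thus "bump U v \<le> 1 / 4" unfolding bump_def c_def[symmetric] using assms by simp
qed

text \<open>Clamping does not increase distances, and the divided difference
  \<open>(3 * U - c - c') / U^2\<close> of the quadratic is at most \<open>1 / U\<close> in modulus
  for clamped arguments.\<close>

lemma bump_lipschitz:
  assumes "U > 0"
  shows "\<bar>bump U v - bump U v'\<bar> \<le> \<bar>v - v'\<bar> / U"
proof -
  define c c' where "c = max U (min (2 * U) v)" and "c' = max U (min (2 * U) v')"
  have c: "U \<le> c" "c \<le> 2 * U" "U \<le> c'" "c' \<le> 2 * U" "\<bar>c - c'\<bar> \<le> \<bar>v - v'\<bar>"
    using assms by (auto simp: c_def c'_def)
  have "bump U v - bump U v' = (c - c') * (3 * U - c - c') / U\<^sup>2"
    unfolding bump_def c_def[symmetric] c'_def[symmetric]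
    by (simp add: diff_divide_distrib[symmetric] algebra_simps)
  hence "\<bar>bump U v - bump U v'\<bar> = \<bar>c - c'\<bar> * \<bar>3 * U - c - c'\<bar> / U\<^sup>2"
    by (simp add: abs_mult)
  also have "\<dots> \<le> \<bar>v - v'\<bar> * U / U\<^sup>2"
    using c by (intro divide_right_mono mult_mono) auto
  finally show ?thesis using assms by (simp add: power2_eq_square)
qed

section \<open>Waves and their double sums over \<open>r1\<close> and \<open>r2\<close>\<close>

definition wave :: "nat \<Rightarrow> nat \<Rightarrow> real \<Rightarrow> complex" where
  "wave U n v = of_real (bump (real U) v) * ee (v / sqrt (real n))"

lemma norm_wave: "U > 0 \<Longrightarrow> norm (wave U n v) = bump (real U) v"
  using bump_bounds(1)[of "real U" v] by (simp add: wave_def norm_mult)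

lemma wave_eq_0: "U > 0 \<Longrightarrow> v \<ge> 2 * real U \<Longrightarrow> wave U n v = 0"
  by (simp add: wave_def bump_eq_0)

text \<open>Letting the inner variable exceed the outer one keeps the frequency of the phase in
  \<open>r1\<close> small against \<open>sqrt r1\<close>, so that the van der Corput term of
  \<open>norm_sum_ee_sqrt\<close> stays under control.\<close>

lemma sum_sum_symmetric:
  fixes \<phi> :: "nat \<Rightarrow> complex"
  shows "(\<Sum>r1\<in>{1..X}. \<Sum>r2\<in>{1..X}. \<phi> (r1 * r2)) =
    (\<Sum>r\<in>{1..X}. \<phi> (r * r)) + 2 * (\<Sum>r2\<in>{1..X}. \<Sum>r1\<in>{Suc r2..X}. \<phi> (r1 * r2))"
proof -
  have *: "(\<Sum>r1\<in>{1..X}. \<phi> (r1 * r2)) =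
     (\<Sum>r1\<in>{1..<r2}. \<phi> (r1 * r2)) + \<phi> (r2 * r2) + (\<Sum>r1\<in>{Suc r2..X}. \<phi> (r1 * r2))"
    if "r2 \<in> {1..X}" for r2
  proof -
    have "{1..X} = ({1..<r2} \<union> {r2}) \<union> {Suc r2..X}" using that by auto
    hence "(\<Sum>r1\<in>{1..X}. \<phi> (r1 * r2)) = (\<Sum>r1\<in>({1..<r2} \<union> {r2}) \<union> {Suc r2..X}. \<phi> (r1 * r2))" by simp
    also have "\<dots> = (\<Sum>r1\<in>{1..<r2} \<union> {r2}. \<phi> (r1 * r2)) + (\<Sum>r1\<in>{Suc r2..X}. \<phi> (r1 * r2))"
      by (rule sum.union_disjoint) auto
    also have "(\<Sum>r1\<in>{1..<r2} \<union> {r2}. \<phi> (r1 * r2)) = (\<Sum>r1\<in>{1..<r2}. \<phi> (r1 * r2)) + (\<Sum>r1\<in>{r2}. \<phi> (r1 * r2))"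
      by (rule sum.union_disjoint) auto
    finally show ?thesis by simp
  qed
  have "(\<Sum>r1\<in>{1..X}. \<Sum>r2\<in>{1..X}. \<phi> (r1 * r2)) = (\<Sum>r2\<in>{1..X}. \<Sum>r1\<in>{1..X}. \<phi> (r1 * r2))"
    by (rule sum.swap)
  also have "\<dots> = (\<Sum>r2\<in>{1..X}. \<Sum>r1\<in>{1..<r2}. \<phi> (r1 * r2)) + (\<Sum>r\<in>{1..X}. \<phi> (r * r)) +
     (\<Sum>r2\<in>{1..X}. \<Sum>r1\<in>{Suc r2..X}. \<phi> (r1 * r2))"
    unfolding sum.distrib[symmetric] by (rule sum.cong[OF refl *])
  also have "(\<Sum>r2\<in>{1..X}. \<Sum>r1\<in>{1..<r2}. \<phi> (r1 * r2)) =
     (\<Sum>(r2, r1)\<in>{(r2, r1). r2 \<in> {1..X} \<and> r1 \<in> {1..<r2}}. \<phi> (r1 * r2))"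
    by (subst sum.Sigma) (auto intro!: sum.cong)
  also have "\<dots> = (\<Sum>(r2, r1)\<in>{(r2, r1). r2 \<in> {1..X} \<and> r1 \<in> {Suc r2..X}}. \<phi> (r1 * r2))"
    by (rule sum.reindex_bij_witness[of _ prod.swap prod.swap]) (auto simp: mult.commute)
  also have "\<dots> = (\<Sum>r2\<in>{1..X}. \<Sum>r1\<in>{Suc r2..X}. \<phi> (r1 * r2))"
    by (subst sum.Sigma) (auto intro!: sum.cong)
  finally show ?thesis by simp
qed

text \<open>For fixed \<open>r2\<close> the phase is \<open>b * sqrt r1\<close> with
  \<open>b = c * sqrt r2 / sqrt n\<close>, so \<open>norm_sum_ee_sqrt\<close> bounds its partial
  sums. The bump ends at 0 and has variation at most 3 along the row, which multiplies that bound by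
  3; hence the constants 36 and 270.\<close>

lemma sum_wave_row:
  fixes U n r2 :: nat and c :: real
  assumes "U \<ge> 1" "n \<ge> 1" "c \<ge> 1" "r2 \<ge> 1" and X: "X = 4 * U\<^sup>2"
  shows "norm (\<Sum>r1\<in>{Suc r2..X}. wave U n (c * sqrt (real (r1 * r2)))) \<le>
    (if r2 \<le> 2 * U then 36 * real U * sqrt (real n) / real r2 + 270 * (c + 2) * c * sqrt (real U) else 0)"
proof -
  \<comment> \<open>The last \<open>r1\<close> with \<open>c * sqrt (r1 * r2) \<le> 2 * U\<close>;
    beyond it the bump is zero.\<close>
  define R where "R = nat \<lfloor>4 * (real U)\<^sup>2 / (c\<^sup>2 * real r2)\<rfloor>"
  have c0: "c > 0" "c\<^sup>2 \<ge> 1" using assms by auto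
  have sq: "c * sqrt (real (r * r2)) \<ge> 2 * real U \<longleftrightarrow> 4 * (real U)\<^sup>2 \<le> c\<^sup>2 * real r2 * real r" for r
  proof -
    have "c * sqrt (real (r * r2)) \<ge> 2 * real U \<longleftrightarrow> (2 * real U)\<^sup>2 \<le> (c * sqrt (real (r * r2)))\<^sup>2"
      using c0 by (intro power_mono_iff[symmetric]) auto
    thus ?thesis by (simp add: power_mult_distrib mult_ac)
  qed
  have den: "c\<^sup>2 * real r2 > 0" using c0 assms by auto
  have RX: "R \<le> X"
  proof -
    have "1 * 1 \<le> c\<^sup>2 * real r2" using c0 assms by (intro mult_mono) auto
    hence "4 * (real U)\<^sup>2 / (c\<^sup>2 * real r2) \<le> 4 * (real U)\<^sup>2 / 1"
      by (intro divide_left_mono) auto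
    also have "\<dots> = real X" by (simp add: X)
    finally show ?thesis unfolding R_def by linarith
  qed
  have z: "wave U n (c * sqrt (real (r * r2))) = 0" if "r > R" for r
  proof (rule wave_eq_0)
    have "4 * (real U)\<^sup>2 / (c\<^sup>2 * real r2) < real r" using that unfolding R_def by linarith
    thus "2 * real U \<le> c * sqrt (real (r * r2))" unfolding sq using den by (simp add: field_simps)
  qed (use assms in auto)
  have red: "(\<Sum>r1\<in>{Suc r2..X}. wave U n (c * sqrt (real (r1 * r2)))) =
     (\<Sum>r1\<in>{Suc r2..<Suc R}. wave U n (c * sqrt (real (r1 * r2))))"
  proof (rule sum.mono_neutral_right)
    show "\<forall>r1\<in>{Suc r2..X} - {Suc r2..<Suc R}. wave U n (c * sqrt (real (r1 * r2))) = 0"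
      by (intro ballI z) auto
  qed (use RX in auto)
  show ?thesis
  proof (cases "R > r2")
    case False
    hence "{Suc r2..<Suc R} = {}" by auto
    thus ?thesis unfolding red using assms by auto
  next
    case True
    have RR: "c\<^sup>2 * real r2 * real R \<le> 4 * (real U)\<^sup>2"
    proof -
      have "real R \<le> 4 * (real U)\<^sup>2 / (c\<^sup>2 * real r2)" unfolding R_def using den by simp
      thus ?thesis using den by (simp add: field_simps)
    qed
    \<comment> \<open>Since \<open>r2 < R\<close>, the square of \<open>r2\<close> is at most
      \<open>4 * U^2\<close>, which gives the condition on \<open>r2\<close> in the
      conclusion.\<close>
    have "real r2 * real r2 \<le> (1 * real r2) * real R" using True by (intro mult_mono) auto
    also have "\<dots> \<le> (c\<^sup>2 * real r2) * real R" using c0 by (intro mult_right_mono) auto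
    finally have "(real r2)\<^sup>2 \<le> (2 * real U)\<^sup>2" using RR by (simp add: power2_eq_square)
    hence "real r2 \<le> 2 * real U" by (rule power2_le_imp_le) simp
    hence r2U: "r2 \<le> 2 * U" by linarith
    define b where "b = c * sqrt (real r2) / sqrt (real n)"
    have b0: "b > 0" using c0 assms by (simp add: b_def)
    define q where "q = (\<lambda>r. complex_of_real (bump (real U) (c * sqrt (real (r * r2)))))"
    define P where "P = 12 * real U * sqrt (real n) / real r2 + 90 * (c + 2) * c * sqrt (real U)"
    \<comment> \<open>One step past \<open>R\<close> at most doubles the product, and
      \<open>sqrt 8 < 3\<close>.\<close>
    have c2: "c * sqrt (real r2) * sqrt (real (Suc R)) \<le> 3 * real U"
    proof -
      have "c * sqrt (real r2) * sqrt (real (Suc R)) = sqrt (c\<^sup>2 * real r2 * real (Suc R))"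
        using c0 by (simp add: real_sqrt_mult)
      also have "\<dots> \<le> sqrt (9 * (real U)\<^sup>2)"
      proof (rule real_sqrt_le_mono)
        have "c\<^sup>2 * real r2 * real (Suc R) \<le> c\<^sup>2 * real r2 * (2 * real R)"
          using True den by (intro mult_left_mono) auto
        also have "\<dots> \<le> 2 * (4 * (real U)\<^sup>2)" using RR by linarith
        finally show "c\<^sup>2 * real r2 * real (Suc R) \<le> 9 * (real U)\<^sup>2" by (smt (verit) zero_le_power2)
      qed
      finally show ?thesis by (simp add: real_sqrt_mult)
    qed
    define TV where "TV = (\<Sum>r\<in>{Suc r2..<Suc R}. norm (q (Suc r) - q r))"
    have e: "(\<Sum>r1\<in>{Suc r2..<Suc R}. wave U n (c * sqrt (real (r1 * r2)))) =
        (\<Sum>r\<in>{Suc r2..<Suc R}. q r * ee (b * sqrt (real r)))"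
      by (intro sum.cong) (auto simp: wave_def q_def b_def real_sqrt_mult mult_ac)
    have f1: "norm (\<Sum>r\<in>{Suc r2..<Suc R}. q r * ee (b * sqrt (real r))) \<le> P * (norm (q (Suc R)) + (\<Sum>r\<in>{Suc r2..<Suc R}. norm (q (Suc r) - q r)))"
    proof (rule abel_bound[where q = q and A = "Suc r2" and B = "Suc R"])
      fix k assume k: "Suc r2 \<le> k" "k \<le> Suc R"
      have e0: "norm (\<Sum>r\<in>{Suc r2..<k}. ee (b * sqrt (real r))) \<le>
         4 * sqrt (real k) / b + 60 * (b / sqrt (real (Suc r2)) + 2) * b"
        using k b0 by (intro norm_sum_ee_sqrt) auto
      have e1: "4 * sqrt (real k) / b \<le> 12 * real U * sqrt (real n) / real r2"
      proof -
        have "c * sqrt (real r2) * sqrt (real k) \<le> c * sqrt (real r2) * sqrt (real (Suc R))"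
          using k c0 by (intro mult_left_mono) auto
        hence 1: "c * sqrt (real r2) * sqrt (real k) \<le> 3 * real U" using c2 by linarith
        have "4 * sqrt (real k) / b = 4 * sqrt (real n) * (c * sqrt (real r2) * sqrt (real k)) / (c\<^sup>2 * real r2)"
          using c0 assms by (simp add: b_def field_simps power2_eq_square)
        also have "\<dots> \<le> 4 * sqrt (real n) * (3 * real U) / (1 * real r2)"
          using 1 c0 assms by (intro frac_le mult_left_mono mult_right_mono) auto
        finally show ?thesis by (simp add: mult_ac)
      qed
      have e2: "60 * (b / sqrt (real (Suc r2)) + 2) * b \<le> 60 * (c + 2) * (c * (3 / 2 * sqrt (real U)))"
      proof (rule mult_mono)
        have n1: "sqrt (real n) \<ge> 1" using assms by simp
        have "b \<le> c * sqrt (real r2) / 1" unfolding b_def using c0 n1 by (intro divide_left_mono) auto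
        hence bc: "b \<le> c * sqrt (real r2)" by simp
        also have "\<dots> \<le> c * sqrt (real (Suc r2))" using c0 by (intro mult_left_mono) auto
        finally have "b / sqrt (real (Suc r2)) \<le> c" by (simp add: field_simps)
        thus "60 * (b / sqrt (real (Suc r2)) + 2) \<le> 60 * (c + 2)" by simp
        have "sqrt (real r2) \<le> sqrt ((3 / 2)\<^sup>2 * real U)" using r2U by (intro real_sqrt_le_mono) (simp add: power2_eq_square)
        also have "\<dots> = 3 / 2 * sqrt (real U)" by (simp add: real_sqrt_mult)
        finally have "c * sqrt (real r2) \<le> c * (3 / 2 * sqrt (real U))" using c0 by (intro mult_left_mono) auto
        with bc show "b \<le> c * (3 / 2 * sqrt (real U))" by linarith
      qed (use b0 c0 in auto)
      have "60 * (c + 2) * (c * (3 / 2 * sqrt (real U))) = 90 * (c + 2) * c * sqrt (real U)" by simp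
      thus "norm (\<Sum>r\<in>{Suc r2..<k}. ee (b * sqrt (real r))) \<le> P"
        using e0 e1 e2 unfolding P_def by linarith
    qed (use True in auto)
    \<comment> \<open>\<open>Suc R\<close> lies outside the support, so there is no boundary
      term.\<close>
    have q0: "q (Suc R) = 0"
      using z[of "Suc R"] ee_nonzero by (simp add: q_def wave_def del: of_nat_mult of_nat_Suc mult_Suc)
    have "TV \<le> (\<Sum>r\<in>{Suc r2..<Suc R}. (c * sqrt (real (Suc r * r2)) - c * sqrt (real (r * r2))) / real U)"
      unfolding TV_def
    proof (rule sum_mono)
      fix r
      have "norm (q (Suc r) - q r) = \<bar>bump (real U) (c * sqrt (real (Suc r * r2))) - bump (real U) (c * sqrt (real (r * r2)))\<bar>"
        unfolding q_def by (metis norm_of_real of_real_diff)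
      also have "\<dots> \<le> \<bar>c * sqrt (real (Suc r * r2)) - c * sqrt (real (r * r2))\<bar> / real U"
        using assms by (intro bump_lipschitz) auto
      also have "c * sqrt (real (Suc r * r2)) \<ge> c * sqrt (real (r * r2))"
        using c0 by (intro mult_left_mono real_sqrt_le_mono) auto
      hence "\<bar>c * sqrt (real (Suc r * r2)) - c * sqrt (real (r * r2))\<bar> = c * sqrt (real (Suc r * r2)) - c * sqrt (real (r * r2))"
        by simp
      finally show "norm (q (Suc r) - q r) \<le> (c * sqrt (real (Suc r * r2)) - c * sqrt (real (r * r2))) / real U" .
    qed
    also have "\<dots> = (c * sqrt (real (Suc R * r2)) - c * sqrt (real (Suc r2 * r2))) / real U"
      using True by (subst sum_divide_distrib[symmetric], subst sum_Suc_diff') auto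
    also have "\<dots> \<le> 3 * real U / real U"
    proof (rule divide_right_mono)
      have "c * sqrt (real (Suc R * r2)) = c * sqrt (real r2) * sqrt (real (Suc R))"
        by (simp only: of_nat_mult real_sqrt_mult) (simp add: mult_ac)
      moreover have "c * sqrt (real (Suc r2 * r2)) \<ge> 0" using c0 by simp
      ultimately show "c * sqrt (real (Suc R * r2)) - c * sqrt (real (Suc r2 * r2)) \<le> 3 * real U" using c2 by linarith
    qed auto
    also have "\<dots> = 3" using assms by simp
    finally have "TV \<le> 3" .
    moreover have "P \<ge> 0" using c0 by (simp add: P_def)
    ultimately have "P * TV \<le> P * 3" by (intro mult_left_mono) auto
    hence "norm (\<Sum>r1\<in>{Suc r2..X}. wave U n (c * sqrt (real (r1 * r2)))) \<le> 3 * P"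
      using f1 unfolding red e TV_def[symmetric] q0 by simp
    also have "3 * P = 36 * real U * sqrt (real n) / real r2 + 270 * (c + 2) * c * sqrt (real U)"
      by (simp add: P_def algebra_simps)
    finally show ?thesis using r2U by simp
  qed
qed

text \<open>The diagonal is estimated trivially and the rest row by row; the harmonic sum over
  \<open>r2\<close> gives the logarithm.\<close>

lemma sum_wave_pairs:
  fixes U n :: nat and c :: real
  assumes "U \<ge> 1" "n \<ge> 1" "c \<ge> 1" and X: "X = 4 * U\<^sup>2"
  shows "norm (\<Sum>r1\<in>{1..X}. \<Sum>r2\<in>{1..X}. wave U n (c * sqrt (real (r1 * r2)))) \<le>
    80 * real U * sqrt (real n) * (1 + ln (2 * real U)) + 1080 * (c + 2)\<^sup>2 * (real U * sqrt (real U))"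
proof -
  have UX: "2 * U \<le> X"
  proof -
    have "U \<le> U\<^sup>2" using assms by (simp add: power2_eq_square)
    thus ?thesis by (simp add: X)
  qed
  define g where "g = (\<lambda>r2. 36 * real U * sqrt (real n) / real r2 + 270 * (c + 2) * c * sqrt (real U))"
  have ln0: "ln (2 * real U) \<ge> 0" using assms by simp
  define D where "D = (\<Sum>r\<in>{1..X}. wave U n (c * sqrt (real (r * r))))"
  define E where "E = (\<Sum>r2\<in>{1..X}. \<Sum>r1\<in>{Suc r2..X}. wave U n (c * sqrt (real (r1 * r2))))"
  have split: "(\<Sum>r1\<in>{1..X}. \<Sum>r2\<in>{1..X}. wave U n (c * sqrt (real (r1 * r2)))) = D + 2 * E"
    unfolding D_def E_def by (rule sum_sum_symmetric)
  have "D = (\<Sum>r\<in>{1..2*U}. wave U n (c * sqrt (real (r * r))))"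
    unfolding D_def
  proof (rule sum.mono_neutral_right)
    show "\<forall>r\<in>{1..X} - {1..2 * U}. wave U n (c * sqrt (real (r * r))) = 0"
    proof
      fix r assume "r \<in> {1..X} - {1..2 * U}"
      hence r: "2 * real U \<le> real r" by auto
      have "1 * real r \<le> c * real r" using assms by (intro mult_right_mono) auto
      hence "2 * real U \<le> c * real r" using r by linarith
      thus "wave U n (c * sqrt (real (r * r))) = 0" using r assms by (intro wave_eq_0) auto
    qed
  qed (use UX in auto)
  moreover have "norm (\<Sum>r\<in>{1..2*U}. wave U n (c * sqrt (real (r * r)))) \<le> (\<Sum>r\<in>{1..2*U}. 1)"
  proof (rule sum_norm_le)
    fix r
    have "bump (real U) (c * sqrt (real (r * r))) \<le> 1 / 4" using assms by (intro bump_bounds) auto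
    thus "norm (wave U n (c * sqrt (real (r * r)))) \<le> 1" using assms by (simp add: norm_wave)
  qed
  ultimately have D: "norm D \<le> 2 * real U" by simp
  have "norm E \<le> (\<Sum>r2\<in>{1..X}. if r2 \<le> 2 * U then g r2 else 0)"
    unfolding g_def E_def using assms by (intro sum_norm_le sum_wave_row) auto
  also have "\<dots> = (\<Sum>r2\<in>{r2\<in>{1..X}. r2 \<le> 2 * U}. g r2)" by (rule sum.inter_filter[symmetric]) auto
  also have "{r2\<in>{1..X}. r2 \<le> 2 * U} = {1..2*U}" using UX by auto
  also have "(\<Sum>r2\<in>{1..2*U}. g r2) = 36 * real U * sqrt (real n) * (\<Sum>r2\<in>{1..2*U}. 1 / real r2) +
     2 * real U * (270 * (c + 2) * c * sqrt (real U))"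
    unfolding g_def by (simp add: sum.distrib sum_distrib_left)
  also have "\<dots> \<le> 36 * real U * sqrt (real n) * (1 + ln (2 * real U)) + 2 * real U * (270 * (c + 2) * c * sqrt (real U))"
    using sum_inverse_le_ln[of "2 * U"] assms by (intro add_right_mono mult_left_mono) auto
  finally have E: "norm E \<le> 36 * real U * sqrt (real n) * (1 + ln (2 * real U)) + 2 * real U * (270 * (c + 2) * c * sqrt (real U))" .
  have "norm (D + 2 * E) \<le> norm D + norm (2 * E)" by (rule norm_triangle_ineq)
  also have "\<dots> = norm D + 2 * norm E" by (simp add: norm_mult)
  also have "\<dots> \<le> 2 * real U + 2 * (36 * real U * sqrt (real n) * (1 + ln (2 * real U)) + 2 * real U * (270 * (c + 2) * c * sqrt (real U)))"
    using D E by (intro add_mono mult_left_mono) auto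
  also have "\<dots> \<le> 80 * real U * sqrt (real n) * (1 + ln (2 * real U)) + 1080 * (c + 2)\<^sup>2 * (real U * sqrt (real U))"
  proof -
    have "1 * 1 \<le> sqrt (real n) * (1 + ln (2 * real U))"
      using assms ln0 by (intro mult_mono) auto
    hence "2 * real U * 1 \<le> 2 * real U * (sqrt (real n) * (1 + ln (2 * real U)))" by (intro mult_left_mono) auto
    moreover have "(c + 2) * c * (real U * sqrt (real U)) \<le> (c + 2)\<^sup>2 * (real U * sqrt (real U))"
      using assms by (intro mult_right_mono) (auto simp: power2_eq_square)
    moreover have "0 \<le> real U * sqrt (real n) * (1 + ln (2 * real U))" using ln0 by simp
    ultimately show ?thesis by (simp add: algebra_simps)
  qed
  finally show ?thesis unfolding split .
qed

text \<open>The sum over \<open>l > L\<close> at resonance, where all phases equal 1. Being real and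
  nonnegative, it allows terms to be dropped from lower bounds.\<close>

definition bump_tail :: "nat \<Rightarrow> nat \<Rightarrow> nat \<Rightarrow> real \<Rightarrow> real" where
  "bump_tail U L X v = (\<Sum>l\<in>{Suc L..X}. real l * bump (real U) (real l * v))"

lemma bump_tail_nonneg: "U \<ge> 1 \<Longrightarrow> bump_tail U L X v \<ge> 0"
  unfolding bump_tail_def by (intro sum_nonneg mult_nonneg_nonneg bump_bounds) auto

lemma sum_bump_upper:
  assumes "U \<ge> 1" "v > 0"
  shows "(\<Sum>l\<in>{1..X}. real l * bump (real U) (real l * v)) \<le> (real U)\<^sup>2 / v\<^sup>2"
proof -
  define m where "m = nat \<lfloor>2 * real U / v\<rfloor>"
  have "2 * real U / v \<ge> 0" using assms by simp
  hence m: "real m \<le> 2 * real U / v" by (simp add: m_def)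
  have "(\<Sum>l\<in>{1..X}. real l * bump (real U) (real l * v)) = (\<Sum>l\<in>{l\<in>{1..X}. l \<le> m}. real l * bump (real U) (real l * v))"
  proof (rule sum.mono_neutral_right)
    show "\<forall>l\<in>{1..X} - {l \<in> {1..X}. l \<le> m}. real l * bump (real U) (real l * v) = 0"
    proof
      fix l assume "l \<in> {1..X} - {l \<in> {1..X}. l \<le> m}"
      hence "l > m" by auto
      hence "2 * real U / v < real l" unfolding m_def by linarith
      hence "2 * real U \<le> real l * v" using assms by (simp add: field_simps)
      thus "real l * bump (real U) (real l * v) = 0" using assms by (simp add: bump_eq_0)
    qed
  qed auto
  also have "\<dots> \<le> (\<Sum>l\<in>{1..m}. real l * bump (real U) (real l * v))"
    using assms by (intro sum_mono2 mult_nonneg_nonneg bump_bounds) auto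
  also have "\<dots> \<le> (\<Sum>l\<in>{1..m}. real m * (1 / 4))"
    using assms by (intro sum_mono mult_mono bump_bounds) auto
  also have "\<dots> = (real m)\<^sup>2 / 4" by (simp add: power2_eq_square)
  also have "\<dots> \<le> (2 * real U / v)\<^sup>2 / 4" using m by (intro divide_right_mono power_mono) auto
  also have "\<dots> = (real U)\<^sup>2 / v\<^sup>2" by (simp add: power_divide power_mult_distrib)
  finally show ?thesis .
qed

lemma bump_tail_upper:
  assumes "U \<ge> 1" "v > 0"
  shows "bump_tail U L X v \<le> (real U)\<^sup>2 / v\<^sup>2"
proof -
  have "bump_tail U L X v \<le> (\<Sum>l\<in>{1..X}. real l * bump (real U) (real l * v))"
    unfolding bump_tail_def using assms by (intro sum_mono2 mult_nonneg_nonneg bump_bounds) auto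
  thus ?thesis using sum_bump_upper[OF assms, of X] by linarith
qed

lemma bump_tail_eq_0:
  assumes "U \<ge> 1" "v \<ge> 2 * real U"
  shows "bump_tail U L X v = 0"
  unfolding bump_tail_def
proof (rule sum.neutral, intro ballI)
  fix l assume "l \<in> {Suc L..X}"
  hence "1 * v \<le> real l * v" using assms by (intro mult_right_mono) auto
  hence "2 * real U \<le> real l * v" using assms by linarith
  thus "real l * bump (real U) (real l * v) = 0" using assms by (simp add: bump_eq_0)
qed

text \<open>Only the middle half \<open>5/4 * U \<le> l * v \<le> 7/4 * U\<close> is kept, where the
  bump is at least 3/16; the hypothesis on \<open>L\<close> puts this range beyond the
  cut-off.\<close>

lemma bump_tail_lower:
  assumes "U \<ge> 1" "v \<ge> 1" and L: "real (Suc L) \<le> 5 / 4 * real U / v" "4 * v \<le> real U" and X: "X = 4 * U\<^sup>2"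
  shows "bump_tail U L X v \<ge> (real U)\<^sup>2 / (20 * v\<^sup>2)"
proof -
  define x where "x = real U / v"
  have x: "x \<ge> 4" "x \<le> real U" using assms by (auto simp: x_def field_simps)
  have Ux: "real U = x * v" using assms by (simp add: x_def)
  define a b where "a = nat \<lceil>5 / 4 * x\<rceil>" and "b = nat \<lfloor>7 / 4 * x\<rfloor>"
  have ab: "real a \<ge> 5 / 4 * x" "real a < 5 / 4 * x + 1" "real b \<le> 7 / 4 * x" "real b > 7 / 4 * x - 1"
    unfolding a_def b_def using x by (simp_all add: of_nat_nat) linarith+
  have "b \<le> X"
  proof -
    have "real b \<le> 2 * real U" using ab x by linarith
    also have "\<dots> \<le> real X" unfolding X using assms by (simp add: power2_eq_square)
    finally show ?thesis by simp
  qed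
  have La: "Suc L \<le> a" using L ab unfolding x_def by simp
  \<comment> \<open>The range from \<open>a\<close> to \<open>b\<close> holds more than
    \<open>x / 2 - 1\<close> integers, at least \<open>x / 4\<close> because
    \<open>x \<ge> 4\<close>; each contributes \<open>5 / 4 * x * (3 / 16)\<close> or more.\<close>
  have "(3 / 16) * (5 / 4 * x) * (x / 4) \<le> (3 / 16) * (5 / 4 * x) * (real b + 1 - real a)"
    using x ab by (intro mult_left_mono) auto
  also have "real b + 1 - real a \<le> real (card {a..b})" by simp
  hence "(3 / 16) * (5 / 4 * x) * (real b + 1 - real a) \<le> (3 / 16) * (5 / 4 * x) * real (card {a..b})"
    using x by (intro mult_left_mono) auto
  also have "\<dots> = (\<Sum>l\<in>{a..b}. (5 / 4 * x) * (3 / 16))" by simp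
  also have "\<dots> \<le> (\<Sum>l\<in>{a..b}. real l * bump (real U) (real l * v))"
  proof (intro sum_mono mult_mono)
    fix l assume l: "l \<in> {a..b}"
    show "5 / 4 * x \<le> real l" using l ab by auto
    have "5 / 4 * x \<le> real l" "real l \<le> 7 / 4 * x" using l ab by auto
    hence "5 / 4 * x * v \<le> real l * v" "real l * v \<le> 7 / 4 * x * v"
      using assms by (auto intro!: mult_right_mono)
    hence lv: "5 / 4 * real U \<le> real l * v" "real l * v \<le> 7 / 4 * real U" using Ux by auto
    hence "bump (real U) (real l * v) = (real l * v - real U) * (2 * real U - real l * v) / (real U)\<^sup>2"
      by (intro bump_eq) auto
    moreover have "(real l * v - real U) * (2 * real U - real l * v) \<ge> 3 / 16 * (real U)\<^sup>2"
    proof -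
      have "(real l * v - 5 / 4 * real U) * (7 / 4 * real U - real l * v) \<ge> 0" using lv by simp
      thus ?thesis by (simp add: algebra_simps power2_eq_square)
    qed
    moreover have "(real U)\<^sup>2 > 0" using assms by simp
    ultimately show "3 / 16 \<le> bump (real U) (real l * v)" by (simp only: pos_le_divide_eq)
  qed (use x in auto)
  also have "\<dots> \<le> bump_tail U L X v"
    unfolding bump_tail_def using La \<open>b \<le> X\<close> assms by (intro sum_mono2 mult_nonneg_nonneg bump_bounds) auto
  finally have "(15 / 256) * x\<^sup>2 \<le> bump_tail U L X v" by (simp add: power2_eq_square)
  moreover have "(real U)\<^sup>2 / (20 * v\<^sup>2) = x\<^sup>2 / 20" by (simp add: x_def power_divide)
  moreover have "x\<^sup>2 / 20 \<le> (15 / 256) * x\<^sup>2" by simp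
  ultimately show ?thesis by linarith
qed

section \<open>Sums over \<open>l\<close> away from resonance\<close>

definition near_root :: "nat \<Rightarrow> nat \<Rightarrow> nat" where
  "near_root n r = nat (round (sqrt (real r / real n)))"

text \<open>
  The defect vanishes precisely when \<open>r\<close> is \<open>n\<close> times a square, the resonant case.
\<close>

definition square_defect :: "nat \<Rightarrow> nat \<Rightarrow> int" where
  "square_defect n r = int r - int n * int (near_root n r) ^ 2"

text \<open>With \<open>t = sqrt (r / n)\<close> and \<open>k\<close> the nearest integer,
  \<open>r - n * k^2 = n * (t - k) * (t + k)\<close>. The integer defect thus measures how far the
  slope \<open>t\<close> of the phase is from an integer.\<close>

lemma near_root_square_defect:
  assumes "n \<ge> 1"
  shows "\<bar>sqrt (real r / real n) - real (near_root n r)\<bar> \<le> 1 / 2"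
    and "\<bar>of_int (square_defect n r)\<bar> = real n * \<bar>sqrt (real r / real n) - real (near_root n r)\<bar> * (sqrt (real r / real n) + real (near_root n r))"
proof -
  define t where "t = sqrt (real r / real n)"
  have t: "t \<ge> 0" "t\<^sup>2 = real r / real n" by (simp_all add: t_def)
  hence "round t \<ge> 0" by (simp add: round_def)
  hence k: "real (near_root n r) = of_int (round t)" by (simp add: near_root_def t_def)
  show "\<bar>sqrt (real r / real n) - real (near_root n r)\<bar> \<le> 1 / 2"
    unfolding k t_def[symmetric] using of_int_round_abs_le[of t] by (simp add: abs_minus_commute)
  have "of_int (square_defect n r) = real r - real n * (real (near_root n r))\<^sup>2" by (simp add: square_defect_def)
  also have "\<dots> = real n * (t\<^sup>2 - (real (near_root n r))\<^sup>2)" using t assms by (simp add: algebra_simps)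
  also have "\<dots> = real n * (t - real (near_root n r)) * (t + real (near_root n r))"
    by (simp add: algebra_simps power2_eq_square)
  finally show "\<bar>of_int (square_defect n r)\<bar> = real n * \<bar>sqrt (real r / real n) - real (near_root n r)\<bar> * (sqrt (real r / real n) + real (near_root n r))"
    unfolding t_def[symmetric] using t by (simp add: abs_mult)
qed

text \<open>In \<open>l\<close> the phase is linear with slope \<open>t = sqrt (r / n)\<close>, so
  the partial sums are geometric and bounded through the distance of \<open>t\<close> to the nearest
  integer, hence through the defect. With \<open>v = sqrt r\<close> the amplitude
  \<open>l * bump\<close> has end value and variation \<open>O(U / v)\<close>; this \<open>v\<close>
  cancels the one coming from \<open>t + k\<close>.\<close>

lemma sum_wave_nonresonant:
  fixes U n r :: nat
  assumes "U \<ge> 1" "n \<ge> 1" "r \<ge> 1" "square_defect n r \<noteq> 0"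
  shows "norm (\<Sum>l\<in>{Suc L..X}. of_nat l * wave U n (real l * sqrt (real r))) \<le>
    (if real L * sqrt (real r) < 2 * real U then 60 * real n * real U / \<bar>of_int (square_defect n r)\<bar> else 0)"
proof -
  define v where "v = sqrt (real r)"
  have v: "v \<ge> 1" using assms by (simp add: v_def)
  define t where "t = sqrt (real r / real n)"
  have tv: "t = v / sqrt (real n)" by (simp add: t_def v_def real_sqrt_divide)
  have t: "t \<ge> 0" "t \<le> v"
  proof -
    have "v / sqrt (real n) \<le> v / 1" using v assms by (intro divide_left_mono) auto
    thus "t \<le> v" using tv by simp
  qed (simp add: t_def)
  define B where "B = min (Suc X) (Suc (nat \<lfloor>2 * real U / v\<rfloor>))"
  have z: "wave U n (real l * v) = 0" if "l > nat \<lfloor>2 * real U / v\<rfloor>" for l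
  proof (rule wave_eq_0)
    have "2 * real U / v < real l" using that by linarith
    thus "2 * real U \<le> real l * v" using v by (simp add: field_simps)
  qed (use assms in auto)
  have red: "(\<Sum>l\<in>{Suc L..X}. of_nat l * wave U n (real l * v)) = (\<Sum>l\<in>{Suc L..<B}. of_nat l * wave U n (real l * v))"
    by (rule sum.mono_neutral_right) (auto simp: B_def intro!: z)
  show ?thesis
  proof (cases "Suc L < B")
    case False
    hence "{Suc L..<B} = {}" by auto
    thus ?thesis using red v_def by simp
  next
    case True
    have fl: "real (nat \<lfloor>2 * real U / v\<rfloor>) \<le> 2 * real U / v" using v by simp
    have "real L < 2 * real U / v" using True fl by (simp add: B_def)
    hence L: "real L * v < 2 * real U" using v by (simp add: field_simps)
    have "1 \<le> nat \<lfloor>2 * real U / v\<rfloor>" using True by (simp add: B_def)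
    hence U1: "1 \<le> 2 * real U / v" using fl by linarith
    define m where "m = 2 * real U / v"
    have "B \<le> Suc (nat \<lfloor>2 * real U / v\<rfloor>)" by (simp add: B_def)
    hence "real B \<le> m + 1" using fl unfolding m_def by linarith
    hence m: "m \<ge> 1" "real B \<le> m + 1" "m * v = 2 * real U" using U1 v by (auto simp: m_def)
    define q where "q = (\<lambda>l. complex_of_real (real l * bump (real U) (real l * v)))"
    define d where "d = norm (ee t - 1)"
    have k: "\<bar>t - real (near_root n r)\<bar> \<le> 1 / 2" "\<bar>of_int (square_defect n r)\<bar> = real n * \<bar>t - real (near_root n r)\<bar> * (t + real (near_root n r))"
      using near_root_square_defect[of n r] assms by (auto simp: t_def)
    have "ee t = ee (t - real (near_root n r))" using ee_diff_int[of t "int (near_root n r)"] by simp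
    hence d4: "d \<ge> 4 * \<bar>t - real (near_root n r)\<bar>" using norm_ee_minus_1_ge[OF k(1)] by (simp add: d_def)
    have h0: "\<bar>of_int (square_defect n r)\<bar> > (0::real)" using assms by simp
    \<comment> \<open>\<open>t \<le> v\<close>, \<open>k \<le> t + 1/2\<close> and
      \<open>v \<ge> 1\<close> give the factor \<open>5/2 * v\<close>.\<close>
    have "\<bar>of_int (square_defect n r)\<bar> \<le> real n * (d / 4) * (5 / 2 * v)"
      unfolding k(2)
    proof (intro mult_mono)
      show "t + real (near_root n r) \<le> 5 / 2 * v" using k(1) t v by linarith
      show "0 \<le> real n * (d / 4)" by (simp add: d_def)
    qed (use d4 t in auto)
    hence dh: "\<bar>of_int (square_defect n r)\<bar> * 8 \<le> 5 * real n * d * v" by simp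
    have d0: "d > 0"
    proof (rule ccontr)
      assume "\<not> d > 0"
      hence "d = 0" by (simp add: d_def)
      thus False using dh h0 by simp
    qed
    have "(\<Sum>l\<in>{Suc L..<B}. of_nat l * wave U n (real l * v)) = (\<Sum>l\<in>{Suc L..<B}. q l * ee (real l * t))"
      by (intro sum.cong) (auto simp: wave_def q_def tv)
    also have "norm \<dots> \<le> (2 / d) * (norm (q B) + (\<Sum>l\<in>{Suc L..<B}. norm (q (Suc l) - q l)))"
    proof (rule abel_bound[where q = q and A = "Suc L" and B = B])
      fix k assume "Suc L \<le> k" "k \<le> B"
      thus "norm (\<Sum>r\<in>{Suc L..<k}. ee (real r * t)) \<le> 2 / d"
        unfolding d_def using d0 by (intro norm_sum_ee_linear) (auto simp: d_def)
    qed (use True in auto)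
    also have "norm (q B) + (\<Sum>l\<in>{Suc L..<B}. norm (q (Suc l) - q l)) \<le> (m + 1) * (1 / 4) + (m + 1) * 5"
    proof (rule add_mono)
      have "norm (q B) = real B * bump (real U) (real B * v)"
        using bump_bounds(1)[of "real U"] assms by (simp add: q_def norm_mult)
      also have "\<dots> \<le> (m + 1) * (1 / 4)"
        using m assms by (intro mult_mono bump_bounds) auto
      finally show "norm (q B) \<le> (m + 1) * (1 / 4)" .
      have "norm (q (Suc l) - q l) \<le> 5" if l: "l \<in> {Suc L..<B}" for l
      proof -
        have "q (Suc l) - q l = of_real (bump (real U) (real (Suc l) * v) + real l * (bump (real U) (real (Suc l) * v) - bump (real U) (real l * v)))"
          by (simp add: q_def algebra_simps)
        also have "norm \<dots> \<le> \<bar>bump (real U) (real (Suc l) * v)\<bar> + \<bar>real l * (bump (real U) (real (Suc l) * v) - bump (real U) (real l * v))\<bar>"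
          unfolding norm_of_real by (rule abs_triangle_ineq)
        also have "\<bar>bump (real U) (real (Suc l) * v)\<bar> \<le> 1"
          using bump_bounds[of "real U" "real (Suc l) * v"] assms by simp
        also have "\<bar>real l * (bump (real U) (real (Suc l) * v) - bump (real U) (real l * v))\<bar> \<le> m * (v / real U)"
          unfolding abs_mult
        proof (intro mult_mono)
          show "\<bar>real l\<bar> \<le> m" using l fl by (auto simp: B_def m_def)
          show "\<bar>bump (real U) (real (Suc l) * v) - bump (real U) (real l * v)\<bar> \<le> v / real U"
            using bump_lipschitz[of "real U" "real (Suc l) * v" "real l * v"] assms v by (simp add: algebra_simps)
        qed (use m in auto)
        also have "m * (v / real U) = 2" using m assms by (simp add: field_simps)
        finally show ?thesis by simp
      qed
      hence "(\<Sum>l\<in>{Suc L..<B}. norm (q (Suc l) - q l)) \<le> (\<Sum>l\<in>{Suc L..<B}. 5)" by (rule sum_mono)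
      also have "\<dots> \<le> (m + 1) * 5" using m True by (simp add: of_nat_diff)
      finally show "(\<Sum>l\<in>{Suc L..<B}. norm (q (Suc l) - q l)) \<le> (m + 1) * 5" .
    qed
    also have "\<dots> = 21 / 4 * m + 21 / 4" by (simp add: field_simps)
    also have "\<dots> \<le> 11 * m" using m(1) by simp
    finally have "norm (\<Sum>l\<in>{Suc L..<B}. of_nat l * wave U n (real l * v)) \<le> 2 / d * (11 * m)"
      using d0 by (simp add: mult_left_mono divide_right_mono)
    also have "2 / d * (11 * m) = 44 * real U / (d * v)" using v by (simp add: m_def)
    also have "\<dots> \<le> 44 * real U * (5 * real n / (8 * \<bar>of_int (square_defect n r)\<bar>))"
    proof -
      have "1 / (d * v) \<le> 5 * real n / (8 * \<bar>of_int (square_defect n r)\<bar>)"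
        using dh h0 d0 v by (simp add: field_simps)
      hence "44 * real U * (1 / (d * v)) \<le> 44 * real U * (5 * real n / (8 * \<bar>of_int (square_defect n r)\<bar>))"
        by (intro mult_left_mono) auto
      thus ?thesis by simp
    qed
    also have "\<dots> \<le> 60 * real n * real U / \<bar>of_int (square_defect n r)\<bar>" using h0 by (simp add: field_simps)
    finally show ?thesis using red L by (simp add: v_def)
  qed
qed

text \<open>\<open>r\<close> is recovered from its nearest root and its defect. The condition on
  \<open>L\<close> leaves about \<open>2 * U / L\<close> roots, and for each root the defects are
  distinct nonzero integers up to \<open>X\<close> in modulus: a harmonic sum.\<close>

lemma sum_inverse_square_defect:
  assumes "U \<ge> 1" "n \<ge> 1" "n \<le> U" "L \<ge> 1" and X: "X = 4 * U\<^sup>2"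
  shows "(\<Sum>r\<in>{r\<in>{1..X}. real L * sqrt (real r) < 2 * real U \<and> square_defect n r \<noteq> 0}. 1 / \<bar>of_int (square_defect n r)\<bar>)
    \<le> (2 * real U / real L + 2) * (2 * (1 + ln (real X)))"
proof -
  define S where "S = {r\<in>{1..X}. real L * sqrt (real r) < 2 * real U \<and> square_defect n r \<noteq> 0}"
  define K where "K = nat \<lfloor>2 * real U / real L + 1 / 2\<rfloor>"
  define H where "H = {h::int. h \<noteq> 0 \<and> \<bar>h\<bar> \<le> int X}"
  have H: "H = int ` {1..X} \<union> (\<lambda>i. - int i) ` {1..X}"
  proof (intro equalityI subsetI)
    fix h assume h: "h \<in> H"
    hence "h = int (nat \<bar>h\<bar>) \<or> h = - int (nat \<bar>h\<bar>)" "nat \<bar>h\<bar> \<in> {1..X}" by (auto simp: H_def)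
    thus "h \<in> int ` {1..X} \<union> (\<lambda>i. - int i) ` {1..X}" by (metis UnI1 UnI2 image_eqI)
  qed (auto simp: H_def)
  have fH: "finite H" unfolding H by auto
  have X1: "X \<ge> 1" using assms by simp
  have "(\<Sum>r\<in>S. 1 / \<bar>of_int (square_defect n r)\<bar>) = (\<Sum>r\<in>S. (\<lambda>(k::nat, h::int). 1 / \<bar>real_of_int h\<bar>) (near_root n r, square_defect n r))" by simp
  also have "\<dots> = (\<Sum>p\<in>(\<lambda>r. (near_root n r, square_defect n r)) ` S. (\<lambda>(k, h). 1 / \<bar>real_of_int h\<bar>) p)"
  proof (rule sum.reindex[symmetric, unfolded o_def])
    show "inj_on (\<lambda>r. (near_root n r, square_defect n r)) S"
      by (rule inj_onI) (auto simp: square_defect_def)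
  qed
  also have "\<dots> \<le> (\<Sum>p\<in>{0..K} \<times> H. (\<lambda>(k, h). 1 / \<bar>real_of_int h\<bar>) p)"
  proof (rule sum_mono2)
    show "(\<lambda>r. (near_root n r, square_defect n r)) ` S \<subseteq> {0..K} \<times> H"
    proof
      fix p assume "p \<in> (\<lambda>r. (near_root n r, square_defect n r)) ` S"
      then obtain r where r: "p = (near_root n r, square_defect n r)" "r \<in> S" by auto
      define t where "t = sqrt (real r / real n)"
      have k: "\<bar>t - real (near_root n r)\<bar> \<le> 1 / 2" "\<bar>of_int (square_defect n r)\<bar> = real n * \<bar>t - real (near_root n r)\<bar> * (t + real (near_root n r))"
        using near_root_square_defect[of n r] assms by (auto simp: t_def)
      have "real r / real n \<le> real r / 1" using assms by (intro divide_left_mono) auto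
      hence "t \<le> sqrt (real r)" by (simp add: t_def)
      also have "\<dots> < 2 * real U / real L" using r assms by (simp add: S_def field_simps)
      finally have t: "t < 2 * real U / real L" .
      have "near_root n r \<le> K"
      proof -
        have "real (near_root n r) \<le> 2 * real U / real L + 1 / 2" using k(1) t by linarith
        thus ?thesis unfolding K_def by linarith
      qed
      moreover have "\<bar>square_defect n r\<bar> \<le> int X"
      proof -
        have t0: "t \<ge> 0" by (simp add: t_def)
        have "2 * real U / real L \<le> 2 * real U / 1" using assms by (intro divide_left_mono) auto
        hence t2: "t \<le> 2 * real U" using t by linarith
        have "real n * t \<le> real n * (sqrt (real r) / 1)"
          using \<open>t \<le> sqrt (real r)\<close> by (intro mult_left_mono) auto
        have "\<bar>of_int (square_defect n r)\<bar> \<le> real n * (1 / 2) * (2 * t + 1 / 2)"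
          unfolding k(2)
        proof (intro mult_mono)
          show "t + real (near_root n r) \<le> 2 * t + 1 / 2" using k(1) by linarith
        qed (use k(1) t0 in auto)
        also have "\<dots> \<le> real U * (1 / 2) * (2 * (2 * real U) + 1 / 2)"
          using assms t2 t0 by (intro mult_mono) auto
        also have "\<dots> = 2 * (real U)\<^sup>2 + real U / 4" by (simp add: power2_eq_square algebra_simps)
        also have "\<dots> \<le> real X"
        proof -
          have "real U * 1 \<le> real U * real U" using assms by (intro mult_left_mono) auto
          hence "real U \<le> (real U)\<^sup>2" by (simp add: power2_eq_square)
          moreover have "real X = 4 * (real U)\<^sup>2" by (simp add: X)
          ultimately show ?thesis by linarith
        qed
        finally show ?thesis by linarith
      qed
      ultimately show "p \<in> {0..K} \<times> H" using r by (auto simp: H_def S_def)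
    qed
  qed (use fH in auto)
  also have "\<dots> = real (Suc K) * (\<Sum>h\<in>H. 1 / \<bar>real_of_int h\<bar>)"
    by (simp add: sum.cartesian_product[symmetric])
  also have "(\<Sum>h\<in>H. 1 / \<bar>real_of_int h\<bar>) = 2 * (\<Sum>i\<in>{1..X}. 1 / real i)"
  proof -
    have "(\<Sum>h\<in>H. 1 / \<bar>real_of_int h\<bar>) = (\<Sum>h\<in>int ` {1..X}. 1 / \<bar>real_of_int h\<bar>) + (\<Sum>h\<in>(\<lambda>i. - int i) ` {1..X}. 1 / \<bar>real_of_int h\<bar>)"
      unfolding H by (rule sum.union_disjoint) auto
    also have "\<dots> = 2 * (\<Sum>i\<in>{1..X}. 1 / real i)"
      by (subst (1 2) sum.reindex) (auto simp: inj_on_def)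
    finally show ?thesis .
  qed
  also have "real (Suc K) * (2 * (\<Sum>i\<in>{1..X}. 1 / real i)) \<le> (2 * real U / real L + 2) * (2 * (1 + ln (real X)))"
  proof (rule mult_mono)
    have "2 * real U / real L \<ge> 0" by simp
    thus "real (Suc K) \<le> 2 * real U / real L + 2" unfolding K_def by linarith
    show "2 * (\<Sum>i\<in>{1..X}. 1 / real i) \<le> 2 * (1 + ln (real X))"
      using sum_inverse_le_ln[OF X1] by simp
  qed (auto intro!: sum_nonneg)
  finally show ?thesis unfolding S_def .
qed

section \<open>Resonance\<close>

text \<open>The sum of \<open>f\<close> against a wave with all four convolution variables written
  out. Cutting each of them at \<open>4 * U^2\<close> loses nothing, because beyond it the wave
  vanishes.\<close>

definition wave_sum :: "(nat \<Rightarrow> complex) \<Rightarrow> nat \<Rightarrow> nat \<Rightarrow> complex" where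
  "wave_sum g U n = (\<Sum>e\<in>{1..4 * U\<^sup>2}. g e * (\<Sum>r1\<in>{1..4 * U\<^sup>2}. \<Sum>r2\<in>{1..4 * U\<^sup>2}. \<Sum>l\<in>{1..4 * U\<^sup>2}.
     of_nat l * wave U n (real l * sqrt (real (r1 * r2 * e)))))"

text \<open>What is left of \<open>wave_sum\<close> for \<open>e \<le> E\<close> and
  \<open>l > L\<close> when only the resonant products are kept.\<close>

definition resonant_part :: "(nat \<Rightarrow> complex) \<Rightarrow> nat \<Rightarrow> nat \<Rightarrow> nat \<Rightarrow> nat \<Rightarrow> complex" where
  "resonant_part g U L E n = (\<Sum>e\<in>{1..E}. g e * (\<Sum>r1\<in>{1..4 * U\<^sup>2}. \<Sum>r2\<in>{1..4 * U\<^sup>2}.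
     of_real (if square_defect n (r1 * r2 * e) = 0 then bump_tail U L (4 * U\<^sup>2) (sqrt (real (r1 * r2 * e))) else 0)))"

section \<open>Reduction of the test sum to its resonant part\<close>

lemma sum_pairs_eq:
  fixes \<psi> :: "nat \<Rightarrow> real"
  assumes "\<And>t. t > X \<Longrightarrow> \<psi> t = 0"
  shows "(\<Sum>r1\<in>{1..X}. \<Sum>r2\<in>{1..X}. \<psi> (r1 * r2)) = (\<Sum>t\<in>{1..X}. real (ndiv t) * \<psi> t)"
proof -
  define P where "P = {p\<in>{1..X} \<times> {1..X}. fst p * snd p \<in> {1..X}}"
  have "(\<Sum>r1\<in>{1..X}. \<Sum>r2\<in>{1..X}. \<psi> (r1 * r2)) = (\<Sum>p\<in>{1..X} \<times> {1..X}. \<psi> (fst p * snd p))"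
    by (simp add: sum.cartesian_product case_prod_unfold)
  also have "\<dots> = (\<Sum>p\<in>P. \<psi> (fst p * snd p))"
    by (rule sum.mono_neutral_right) (auto simp: P_def intro!: assms)
  also have "\<dots> = (\<Sum>t\<in>{1..X}. \<Sum>p\<in>{p\<in>P. fst p * snd p = t}. \<psi> (fst p * snd p))"
    by (rule sum.group[symmetric]) (auto simp: P_def)
  also have "\<dots> = (\<Sum>t\<in>{1..X}. real (ndiv t) * \<psi> t)"
  proof (rule sum.cong)
    fix t assume t: "t \<in> {1..X}"
    have "card {p\<in>P. fst p * snd p = t} = card {d. d dvd t}"
    proof (rule bij_betw_same_card)
      show "bij_betw fst {p\<in>P. fst p * snd p = t} {d. d dvd t}"
      proof (rule bij_betwI[of _ _ _ "\<lambda>d. (d, t div d)"])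
        show "(\<lambda>d. (d, t div d)) \<in> {d. d dvd t} \<rightarrow> {p \<in> P. fst p * snd p = t}"
        proof
          fix d assume d: "d \<in> {d. d dvd t}"
          then obtain k where k: "t = d * k" by auto
          with t have "d > 0" "k > 0" by (auto intro: Nat.gr0I)
          moreover have "d \<le> t" "k \<le> t" using k t by (auto intro!: dvd_imp_le)
          hence "d \<le> X" "k \<le> X" using t by auto
          ultimately show "(d, t div d) \<in> {p \<in> P. fst p * snd p = t}"
            using k t by (auto simp: P_def)
        qed
      qed (use t in \<open>auto simp: P_def\<close>)
    qed
    thus "(\<Sum>p\<in>{p\<in>P. fst p * snd p = t}. \<psi> (fst p * snd p)) = real (ndiv t) * \<psi> t"
      by (simp add: ndiv_def)
  qed simp
  finally show ?thesis .
qed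

lemma sum_norm_g_le:
  fixes g :: "nat \<Rightarrow> complex"
  assumes "\<And>m. (\<Sum>e\<in>{1..m}. norm (g e) * real e powr (- 3 / 4)) \<le> G1"
  shows "(\<Sum>e\<in>{1..E}. norm (g e)) \<le> real E * G1"
proof -
  have "(\<Sum>e\<in>{1..E}. norm (g e)) \<le> (\<Sum>e\<in>{1..E}. real E * (norm (g e) * real e powr (- 3 / 4)))"
  proof (rule sum_mono)
    fix e assume e: "e \<in> {1..E}"
    have "1 = real e powr (3 / 4) * real e powr (- 3 / 4)" using e by (simp flip: powr_add)
    also have "real e powr (3 / 4) \<le> real e powr 1" using e by (intro powr_mono) auto
    also have "\<dots> \<le> real E" using e by simp
    finally have "1 \<le> real E * real e powr (- 3 / 4)" by (simp add: mult_right_mono)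
    hence "norm (g e) * 1 \<le> norm (g e) * (real E * real e powr (- 3 / 4))" by (intro mult_left_mono) auto
    thus "norm (g e) \<le> real E * (norm (g e) * real e powr (- 3 / 4))" by (simp add: mult_ac)
  qed
  also have "\<dots> = real E * (\<Sum>e\<in>{1..E}. norm (g e) * real e powr (- 3 / 4))" by (simp add: sum_distrib_left)
  also have "\<dots> \<le> real E * G1" by (intro mult_left_mono assms) auto
  finally show ?thesis .
qed

text \<open>Rankin's trick: beyond \<open>E\<close> the factor \<open>e powr (- 1 / 4)\<close> of
  \<open>1 / e\<close> is traded for \<open>E powr (- 1 / 4)\<close>.\<close>

lemma sum_norm_g_tail:
  fixes g :: "nat \<Rightarrow> complex"
  assumes "\<And>m. (\<Sum>e\<in>{1..m}. norm (g e) * real e powr (- 3 / 4)) \<le> G1" "E \<ge> 1"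
  shows "(\<Sum>e\<in>{Suc E..X}. norm (g e) / real e) \<le> real E powr (- 1 / 4) * G1"
proof -
  have "(\<Sum>e\<in>{Suc E..X}. norm (g e) / real e) \<le> (\<Sum>e\<in>{Suc E..X}. real E powr (- 1 / 4) * (norm (g e) * real e powr (- 3 / 4)))"
  proof (rule sum_mono)
    fix e assume e: "e \<in> {Suc E..X}"
    have "1 / real e = real e powr (- 1 / 4) * real e powr (- 3 / 4)"
      using e by (simp add: powr_minus_divide flip: powr_add)
    also have "\<dots> \<le> real E powr (- 1 / 4) * real e powr (- 3 / 4)"
      using e assms by (intro mult_right_mono powr_mono2') auto
    finally have "norm (g e) * (1 / real e) \<le> norm (g e) * (real E powr (- 1 / 4) * real e powr (- 3 / 4))"
      by (intro mult_left_mono) auto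
    thus "norm (g e) / real e \<le> real E powr (- 1 / 4) * (norm (g e) * real e powr (- 3 / 4))"
      by (simp add: mult_ac)
  qed
  also have "\<dots> = real E powr (- 1 / 4) * (\<Sum>e\<in>{Suc E..X}. norm (g e) * real e powr (- 3 / 4))"
    by (simp add: sum_distrib_left)
  also have "(\<Sum>e\<in>{Suc E..X}. norm (g e) * real e powr (- 3 / 4)) \<le> (\<Sum>e\<in>{1..X}. norm (g e) * real e powr (- 3 / 4))"
    by (rule sum_mono2) auto
  also have "\<dots> \<le> G1" by (rule assms)
  finally show ?thesis by (simp add: mult_left_mono)
qed

lemma square_defect_eq_0D: "square_defect n r = 0 \<Longrightarrow> r = n * (near_root n r)\<^sup>2"
proof -
  assume "square_defect n r = 0"
  hence "int r = int (n * (near_root n r)\<^sup>2)" by (simp add: square_defect_def)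
  thus ?thesis by linarith
qed

lemma square_defect_eq_0_iff:
  assumes "n \<ge> 1"
  shows "square_defect n r = 0 \<longleftrightarrow> (\<exists>k. r = n * k\<^sup>2)"
proof
  assume "\<exists>k. r = n * k\<^sup>2"
  then obtain k where k: "r = n * k\<^sup>2" by auto
  have "sqrt (real r / real n) = real k" using k assms by (simp add: real_sqrt_mult)
  hence "near_root n r = k" by (simp add: near_root_def)
  thus "square_defect n r = 0" using k by (simp add: square_defect_def)
qed (auto dest: square_defect_eq_0D)

lemma sum_wave_resonant:
  assumes "n \<ge> 1" "square_defect n r = 0"
  shows "(\<Sum>l\<in>{Suc L..X}. of_nat l * wave U n (real l * sqrt (real r))) = of_real (bump_tail U L X (sqrt (real r)))"
proof -
  have "r = n * (near_root n r)\<^sup>2" by (rule square_defect_eq_0D) fact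
  hence "real r = real n * (real (near_root n r))\<^sup>2" by (metis of_nat_mult of_nat_power)
  hence s: "sqrt (real r) = real (near_root n r) * sqrt (real n)" by (simp add: real_sqrt_mult)
  have "real l * sqrt (real r) / sqrt (real n) = real (l * near_root n r)" for l
    unfolding s using assms by simp
  hence "ee (real l * sqrt (real r) / sqrt (real n)) = 1" for l by (simp only: ee_of_nat)
  thus ?thesis by (simp add: wave_def bump_tail_def)
qed

text \<open>Resonant products match exactly. For the others, pairs with the same product are counted
  by \<open>ndiv\<close>, and the multiples of \<open>e\<close> are relaxed to all \<open>r\<close>,
  the bounds being nonnegative.\<close>

lemma res_error:
  fixes U n e L :: nat
  assumes "U \<ge> 1" "n \<ge> 1" "n \<le> U" "L \<ge> 1" "e \<ge> 1" and X: "X = 4 * U\<^sup>2"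
    and M0: "\<And>t. t \<in> {1..X} \<Longrightarrow> real (ndiv t) \<le> M0" "M0 \<ge> 0"
  shows "norm (\<Sum>r1\<in>{1..X}. \<Sum>r2\<in>{1..X}. ((\<Sum>l\<in>{Suc L..X}. of_nat l * wave U n (real l * sqrt (real (r1 * r2 * e)))) -
      of_real (if square_defect n (r1 * r2 * e) = 0 then bump_tail U L X (sqrt (real (r1 * r2 * e))) else 0)))
    \<le> M0 * (60 * real n * real U * ((2 * real U / real L + 2) * (2 * (1 + ln (real X)))))"
proof -
  define \<beta> where "\<beta> = (\<lambda>r. if real L * sqrt (real r) < 2 * real U \<and> square_defect n r \<noteq> 0 then 60 * real n * real U / \<bar>of_int (square_defect n r)\<bar> else 0)"
  have b0: "\<beta> r \<ge> 0" for r by (simp add: \<beta>_def)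
  have bX: "\<beta> r = 0" if "r > X" for r
  proof -
    have "2 * real U = sqrt (real X)" by (simp add: X real_sqrt_mult)
    also have "\<dots> \<le> sqrt (real r)" using that by simp
    also have "\<dots> \<le> real L * sqrt (real r)" using assms by (simp add: mult_le_cancel_right1)
    finally show ?thesis by (simp add: \<beta>_def)
  qed
  have "norm (\<Sum>r1\<in>{1..X}. \<Sum>r2\<in>{1..X}. ((\<Sum>l\<in>{Suc L..X}. of_nat l * wave U n (real l * sqrt (real (r1 * r2 * e)))) -
      of_real (if square_defect n (r1 * r2 * e) = 0 then bump_tail U L X (sqrt (real (r1 * r2 * e))) else 0)))
    \<le> (\<Sum>r1\<in>{1..X}. \<Sum>r2\<in>{1..X}. \<beta> (r1 * r2 * e))"
  proof (intro sum_norm_le)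
    fix r1 r2 assume r: "r1 \<in> {1..X}" "r2 \<in> {1..X}"
    define r where "r = r1 * r2 * e"
    have r1: "r \<ge> 1" using r assms by (simp add: r_def Suc_le_eq)
    have "norm ((\<Sum>l\<in>{Suc L..X}. of_nat l * wave U n (real l * sqrt (real r))) -
      of_real (if square_defect n r = 0 then bump_tail U L X (sqrt (real r)) else 0)) \<le> \<beta> r"
    proof (cases "square_defect n r = 0")
      case True
      thus ?thesis using sum_wave_resonant[where n = n and r = r and L = L and X = X and U = U] assms b0 by simp
    next
      case False
      have "norm (\<Sum>l\<in>{Suc L..X}. of_nat l * wave U n (real l * sqrt (real r))) \<le>
        (if real L * sqrt (real r) < 2 * real U then 60 * real n * real U / \<bar>of_int (square_defect n r)\<bar> else 0)"
        using False r1 assms by (intro sum_wave_nonresonant) auto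
      thus ?thesis using False by (simp add: \<beta>_def)
    qed
    thus "norm ((\<Sum>l\<in>{Suc L..X}. of_nat l * wave U n (real l * sqrt (real (r1 * r2 * e)))) -
      of_real (if square_defect n (r1 * r2 * e) = 0 then bump_tail U L X (sqrt (real (r1 * r2 * e))) else 0)) \<le> \<beta> (r1 * r2 * e)"
      unfolding r_def .
  qed
  also have "\<dots> = (\<Sum>t\<in>{1..X}. real (ndiv t) * \<beta> (t * e))"
  proof (rule sum_pairs_eq)
    fix t assume "t > X"
    moreover have "t * 1 \<le> t * e" using assms by (intro mult_left_mono) auto
    ultimately have "t * e > X" by linarith
    thus "\<beta> (t * e) = 0" by (rule bX)
  qed
  also have "\<dots> \<le> (\<Sum>t\<in>{1..X}. M0 * \<beta> (t * e))" by (intro sum_mono mult_right_mono M0 b0) auto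
  also have "\<dots> = M0 * (\<Sum>r\<in>(\<lambda>t. t * e) ` {1..X}. \<beta> r)"
    using assms by (subst sum.reindex) (auto simp: inj_on_def sum_distrib_left)
  also have "(\<Sum>r\<in>(\<lambda>t. t * e) ` {1..X}. \<beta> r) \<le> (\<Sum>r\<in>{1..X}. \<beta> r)"
  proof -
    have "(\<Sum>r\<in>(\<lambda>t. t * e) ` {1..X}. \<beta> r) = (\<Sum>r\<in>(\<lambda>t. t * e) ` {1..X} \<inter> {1..X}. \<beta> r)"
      using assms by (intro sum.mono_neutral_right) (auto intro!: bX)
    also have "\<dots> \<le> (\<Sum>r\<in>{1..X}. \<beta> r)" by (intro sum_mono2 b0) auto
    finally show ?thesis .
  qed
  also have "(\<Sum>r\<in>{1..X}. \<beta> r) = (\<Sum>r\<in>{r\<in>{1..X}. real L * sqrt (real r) < 2 * real U \<and> square_defect n r \<noteq> 0}. 60 * real n * real U / \<bar>of_int (square_defect n r)\<bar>)"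
    unfolding \<beta>_def by (rule sum.inter_filter[symmetric]) auto
  also have "\<dots> = 60 * real n * real U * (\<Sum>r\<in>{r\<in>{1..X}. real L * sqrt (real r) < 2 * real U \<and> square_defect n r \<noteq> 0}. 1 / \<bar>of_int (square_defect n r)\<bar>)"
    by (simp add: sum_distrib_left)
  also have "M0 * \<dots> \<le> M0 * (60 * real n * real U * ((2 * real U / real L + 2) * (2 * (1 + ln (real X)))))"
    using assms by (intro mult_left_mono sum_inverse_square_defect) auto
  finally show ?thesis using M0 by (simp add: mult_left_mono)
qed

text \<open>The bound of \<open>res_error\<close> is of order \<open>n * U^2 / L\<close> up to lower
  factors, so it beats the main term only when \<open>L\<close> is large. The terms with
  \<open>l \<le> L\<close> left over by this draw their cancellation from \<open>r1\<close> instead,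
  with \<open>c = l * sqrt e\<close>; powers of \<open>L\<close> are lost, but \<open>U\<close>
  enters only to the exponent 3/2.\<close>

lemma small_l_error:
  fixes U n e L :: nat
  assumes "U \<ge> 1" "n \<ge> 1" "e \<ge> 1" "e \<le> E" and X: "X = 4 * U\<^sup>2"
  shows "norm (\<Sum>r1\<in>{1..X}. \<Sum>r2\<in>{1..X}. \<Sum>l\<in>{1..L}. of_nat l * wave U n (real l * sqrt (real (r1 * r2 * e))))
    \<le> real L * real L * (80 * real U * sqrt (real n) * (1 + ln (2 * real U)) + 1080 * (real L * sqrt (real E) + 2)\<^sup>2 * (real U * sqrt (real U)))"
proof -
  define W where "W = 80 * real U * sqrt (real n) * (1 + ln (2 * real U)) + 1080 * (real L * sqrt (real E) + 2)\<^sup>2 * (real U * sqrt (real U))"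
  have "(\<Sum>r1\<in>{1..X}. \<Sum>r2\<in>{1..X}. \<Sum>l\<in>{1..L}. of_nat l * wave U n (real l * sqrt (real (r1 * r2 * e)))) =
    (\<Sum>r1\<in>{1..X}. \<Sum>l\<in>{1..L}. \<Sum>r2\<in>{1..X}. of_nat l * wave U n (real l * sqrt (real (r1 * r2 * e))))"
    by (intro sum.cong refl sum.swap)
  also have "\<dots> = (\<Sum>l\<in>{1..L}. \<Sum>r1\<in>{1..X}. \<Sum>r2\<in>{1..X}. of_nat l * wave U n (real l * sqrt (real (r1 * r2 * e))))"
    by (rule sum.swap)
  also have "\<dots> = (\<Sum>l\<in>{1..L}. of_nat l * (\<Sum>r1\<in>{1..X}. \<Sum>r2\<in>{1..X}. wave U n ((real l * sqrt (real e)) * sqrt (real (r1 * r2)))))"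
    unfolding sum_distrib_left by (intro sum.cong refl) (simp add: real_sqrt_mult mult_ac)
  also have "norm \<dots> \<le> (\<Sum>l\<in>{1..L}. real L * W)"
  proof (rule sum_norm_le)
    fix l assume l: "l \<in> {1..L}"
    have "1 * 1 \<le> real l * sqrt (real e)" using l assms by (intro mult_mono) auto
    hence "norm (\<Sum>r1\<in>{1..X}. \<Sum>r2\<in>{1..X}. wave U n ((real l * sqrt (real e)) * sqrt (real (r1 * r2)))) \<le>
      80 * real U * sqrt (real n) * (1 + ln (2 * real U)) + 1080 * (real l * sqrt (real e) + 2)\<^sup>2 * (real U * sqrt (real U))"
      using assms by (intro sum_wave_pairs) auto
    also have "\<dots> \<le> W" unfolding W_def
      using l assms by (intro add_left_mono mult_right_mono mult_left_mono power_mono add_right_mono mult_mono) auto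
    finally show "norm (of_nat l * (\<Sum>r1\<in>{1..X}. \<Sum>r2\<in>{1..X}. wave U n ((real l * sqrt (real e)) * sqrt (real (r1 * r2))))) \<le> real L * W"
      unfolding norm_mult using l by (intro mult_mono) auto
  qed
  also have "\<dots> = real L * real L * W" by simp
  finally show ?thesis unfolding W_def .
qed

text \<open>A trivial estimate without cancellation; the factor \<open>1 / e\<close>, summed against
  \<open>norm (g e)\<close> beyond \<open>E\<close>, will leave a negative power of
  \<open>E\<close>.\<close>

lemma large_e_error:
  fixes U n e :: nat
  assumes "U \<ge> 1" "n \<ge> 1" "e \<ge> 1" and X: "X = 4 * U\<^sup>2"
  shows "norm (\<Sum>r1\<in>{1..X}. \<Sum>r2\<in>{1..X}. \<Sum>l\<in>{1..X}. of_nat l * wave U n (real l * sqrt (real (r1 * r2 * e))))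
    \<le> (real U)\<^sup>2 * (1 + ln (real X))\<^sup>2 / real e"
proof -
  have X1: "X \<ge> 1" using assms by simp
  have "norm (\<Sum>r1\<in>{1..X}. \<Sum>r2\<in>{1..X}. \<Sum>l\<in>{1..X}. of_nat l * wave U n (real l * sqrt (real (r1 * r2 * e))))
    \<le> (\<Sum>r1\<in>{1..X}. \<Sum>r2\<in>{1..X}. (real U)\<^sup>2 / real (r1 * r2 * e))"
  proof (intro sum_norm_le)
    fix r1 r2 assume r: "r1 \<in> {1..X}" "r2 \<in> {1..X}"
    define v where "v = sqrt (real (r1 * r2 * e))"
    have "norm (\<Sum>l\<in>{1..X}. of_nat l * wave U n (real l * v)) \<le> (\<Sum>l\<in>{1..X}. real l * bump (real U) (real l * v))"
      using assms by (intro sum_norm_le) (simp add: norm_mult norm_wave)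
    also have "\<dots> \<le> (real U)\<^sup>2 / v\<^sup>2" using r assms by (intro sum_bump_upper) (auto simp: v_def)
    also have "v\<^sup>2 = real (r1 * r2 * e)" unfolding v_def by (rule real_sqrt_pow2) simp
    finally show "norm (\<Sum>l\<in>{1..X}. of_nat l * wave U n (real l * sqrt (real (r1 * r2 * e)))) \<le> (real U)\<^sup>2 / real (r1 * r2 * e)"
      unfolding v_def .
  qed
  also have "\<dots> = (real U)\<^sup>2 / real e * ((\<Sum>r\<in>{1..X}. 1 / real r) * (\<Sum>r\<in>{1..X}. 1 / real r))"
  proof -
    have "(\<Sum>r1\<in>{1..X}. \<Sum>r2\<in>{1..X}. (real U)\<^sup>2 / real (r1 * r2 * e)) =
       (\<Sum>r1\<in>{1..X}. \<Sum>r2\<in>{1..X}. (real U)\<^sup>2 / real e * (1 / real r1 * (1 / real r2)))"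
      by (intro sum.cong refl) simp
    thus ?thesis by (simp only: sum_distrib_left[symmetric] sum_distrib_right[symmetric])
  qed
  also have "\<dots> \<le> (real U)\<^sup>2 / real e * ((1 + ln (real X)) * (1 + ln (real X)))"
    using X1 by (intro mult_left_mono mult_mono sum_inverse_le_ln sum_nonneg) auto
  finally show ?thesis by (simp add: power2_eq_square)
qed

text \<open>The three errors are, in order, those of large \<open>e\<close>, of small
  \<open>l\<close> and of the non-resonant products. \<open>E\<close> and \<open>L\<close> stay free
  here, to be balanced in \<open>wave_sum_error_bound\<close>.\<close>

lemma wave_sum_approx:
  fixes g :: "nat \<Rightarrow> complex" and U n L E :: nat
  assumes "U \<ge> 1" "n \<ge> 1" "n \<le> U" "L \<ge> 1" "L \<le> X" "E \<ge> 1" "E \<le> X" and X: "X = 4 * U\<^sup>2"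
    and M0: "\<And>t. t \<in> {1..X} \<Longrightarrow> real (ndiv t) \<le> M0" "M0 \<ge> 0"
    and G1: "\<And>m. (\<Sum>e\<in>{1..m}. norm (g e) * real e powr (- 3 / 4)) \<le> G1"
  shows "norm (wave_sum g U n - resonant_part g U L E n) \<le> G1 * (
      real E powr (- 1 / 4) * ((real U)\<^sup>2 * (1 + ln (real X))\<^sup>2)
      + real E * (real L * real L * (80 * real U * sqrt (real n) * (1 + ln (2 * real U)) + 1080 * (real L * sqrt (real E) + 2)\<^sup>2 * (real U * sqrt (real U))))
      + real E * (M0 * (60 * real n * real U * ((2 * real U / real L + 2) * (2 * (1 + ln (real X)))))))"
proof -
  define S where "S = (\<lambda>e. \<Sum>r1\<in>{1..X}. \<Sum>r2\<in>{1..X}. \<Sum>l\<in>{1..X}. of_nat l * wave U n (real l * sqrt (real (r1 * r2 * e))))"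
  define B where "B = (\<lambda>e. \<Sum>r1\<in>{1..X}. \<Sum>r2\<in>{1..X}. \<Sum>l\<in>{1..L}. of_nat l * wave U n (real l * sqrt (real (r1 * r2 * e))))"
  define R where "R = (\<lambda>e. \<Sum>r1\<in>{1..X}. \<Sum>r2\<in>{1..X}. complex_of_real (if square_defect n (r1 * r2 * e) = 0 then bump_tail U L X (sqrt (real (r1 * r2 * e))) else 0))"
  define A where "A = (\<lambda>e. \<Sum>r1\<in>{1..X}. \<Sum>r2\<in>{1..X}. ((\<Sum>l\<in>{Suc L..X}. of_nat l * wave U n (real l * sqrt (real (r1 * r2 * e)))) -
      of_real (if square_defect n (r1 * r2 * e) = 0 then bump_tail U L X (sqrt (real (r1 * r2 * e))) else 0)))"
  define b1 where "b1 = (real U)\<^sup>2 * (1 + ln (real X))\<^sup>2"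
  define b2 where "b2 = real L * real L * (80 * real U * sqrt (real n) * (1 + ln (2 * real U)) + 1080 * (real L * sqrt (real E) + 2)\<^sup>2 * (real U * sqrt (real U)))"
  define b3 where "b3 = M0 * (60 * real n * real U * ((2 * real U / real L + 2) * (2 * (1 + ln (real X)))))"
  have dec: "S e - R e = B e + A e" for e
  proof -
    have "(\<Sum>l\<in>{1..X}. f l) = (\<Sum>l\<in>{1..L}. f l) + (\<Sum>l\<in>{Suc L..X}. f l)" for f :: "nat \<Rightarrow> complex"
    proof -
      have "{1..X} = {1..L} \<union> {Suc L..X}" using assms by auto
      thus ?thesis by (simp only:) (intro sum.union_disjoint, auto)
    qed
    thus ?thesis unfolding S_def R_def B_def A_def by (simp add: sum.distrib sum_subtractf)
  qed
  have split: "{1..X} = {1..E} \<union> {Suc E..X}" using assms by auto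
  have "wave_sum g U n = (\<Sum>e\<in>{1..X}. g e * S e)" by (simp add: wave_sum_def S_def X)
  also have "\<dots> = (\<Sum>e\<in>{1..E}. g e * S e) + (\<Sum>e\<in>{Suc E..X}. g e * S e)"
    unfolding split by (rule sum.union_disjoint) auto
  finally have "wave_sum g U n - resonant_part g U L E n = (\<Sum>e\<in>{1..E}. g e * S e) - (\<Sum>e\<in>{1..E}. g e * R e) + (\<Sum>e\<in>{Suc E..X}. g e * S e)"
    unfolding resonant_part_def R_def X by simp
  also have "\<dots> = (\<Sum>e\<in>{1..E}. g e * (B e + A e)) + (\<Sum>e\<in>{Suc E..X}. g e * S e)"
    unfolding dec[symmetric] by (simp add: sum_subtractf right_diff_distrib)
  finally have eq: "wave_sum g U n - resonant_part g U L E n = (\<Sum>e\<in>{1..E}. g e * (B e + A e)) + (\<Sum>e\<in>{Suc E..X}. g e * S e)" .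
  have "X \<ge> 1" using assms by linarith
  hence ln0: "ln (2 * real U) \<ge> 0" "ln (real X) \<ge> 0" using assms(1) by simp_all
  have b0: "b1 \<ge> 0" "b2 \<ge> 0" "b3 \<ge> 0"
    unfolding b1_def b2_def b3_def using ln0 M0 by (auto intro!: mult_nonneg_nonneg add_nonneg_nonneg)
  have "norm (\<Sum>e\<in>{1..E}. g e * (B e + A e)) \<le> (\<Sum>e\<in>{1..E}. norm (g e) * (b2 + b3))"
  proof (rule sum_norm_le)
    fix e assume e: "e \<in> {1..E}"
    have "norm (B e) \<le> b2" unfolding B_def b2_def using e assms by (intro small_l_error) auto
    moreover have "norm (A e) \<le> b3" unfolding A_def b3_def using e assms M0 by (intro res_error) auto
    ultimately have "norm (B e + A e) \<le> b2 + b3" by (meson add_mono norm_triangle_ineq order_trans)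
    thus "norm (g e * (B e + A e)) \<le> norm (g e) * (b2 + b3)" by (simp add: norm_mult mult_left_mono)
  qed
  also have "\<dots> = (\<Sum>e\<in>{1..E}. norm (g e)) * (b2 + b3)" by (simp add: sum_distrib_right)
  also have "\<dots> \<le> real E * G1 * (b2 + b3)"
    using b0 by (intro mult_right_mono sum_norm_g_le G1) auto
  finally have 1: "norm (\<Sum>e\<in>{1..E}. g e * (B e + A e)) \<le> real E * G1 * (b2 + b3)" .
  have "norm (\<Sum>e\<in>{Suc E..X}. g e * S e) \<le> (\<Sum>e\<in>{Suc E..X}. norm (g e) / real e * b1)"
  proof (rule sum_norm_le)
    fix e assume e: "e \<in> {Suc E..X}"
    have "norm (S e) \<le> b1 / real e" unfolding S_def b1_def using e assms by (intro large_e_error) auto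
    hence "norm (g e) * norm (S e) \<le> norm (g e) * (b1 / real e)" by (intro mult_left_mono) auto
    thus "norm (g e * S e) \<le> norm (g e) / real e * b1" by (simp add: norm_mult)
  qed
  also have "\<dots> = (\<Sum>e\<in>{Suc E..X}. norm (g e) / real e) * b1" by (simp add: sum_distrib_right)
  also have "\<dots> \<le> real E powr (- 1 / 4) * G1 * b1"
    using b0 assms by (intro mult_right_mono sum_norm_g_tail G1) auto
  finally have 2: "norm (\<Sum>e\<in>{Suc E..X}. g e * S e) \<le> real E powr (- 1 / 4) * G1 * b1" .
  have "norm (wave_sum g U n - resonant_part g U L E n) \<le> real E * G1 * (b2 + b3) + real E powr (- 1 / 4) * G1 * b1"
    unfolding eq using 1 2 by (meson add_mono norm_triangle_ineq order_trans)
  also have "\<dots> = G1 * (real E powr (- 1 / 4) * b1 + real E * b2 + real E * b3)"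
    by (simp add: algebra_simps)
  finally show ?thesis unfolding b1_def b2_def b3_def .
qed

section \<open>The Moebius sieve and the main term\<close>

lemma mobius_sieve:
  fixes \<Phi> :: "nat \<Rightarrow> real"
  assumes "Q > 0" and \<Phi>: "\<And>K. K > X \<Longrightarrow> \<Phi> K = 0"
  shows "(\<Sum>j\<in>{j. j dvd Q}. mu j * (\<Sum>k\<in>{1..X}. \<Phi> (j * k))) = (\<Sum>K\<in>{K\<in>{1..X}. coprime K Q}. \<Phi> K)"
proof -
  have fQ: "finite {j. j dvd Q}" using assms by (intro finite_divisors)
  have "(\<Sum>j\<in>{j. j dvd Q}. mu j * (\<Sum>k\<in>{1..X}. \<Phi> (j * k))) =
        (\<Sum>j\<in>{j. j dvd Q}. \<Sum>K\<in>{1..X}. if j dvd K then mu j * \<Phi> K else 0)"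
  proof (rule sum.cong)
    fix j assume "j \<in> {j. j dvd Q}"
    hence j: "j > 0" using assms by (auto intro: Nat.gr0I)
    have "(\<Sum>k\<in>{1..X}. \<Phi> (j * k)) = (\<Sum>K\<in>(\<lambda>k. j * k) ` {1..X}. \<Phi> K)"
      using j by (subst sum.reindex) (auto simp: inj_on_def)
    also have "\<dots> = (\<Sum>K\<in>{K\<in>{1..X}. j dvd K}. \<Phi> K)"
    proof (rule sum.mono_neutral_right)
      show "{K \<in> {1..X}. j dvd K} \<subseteq> (\<lambda>k. j * k) ` {1..X}"
      proof
        fix K assume K: "K \<in> {K \<in> {1..X}. j dvd K}"
        then obtain k where k: "K = j * k" by auto
        have "1 * k \<le> j * k" using j by (intro mult_right_mono) auto
        hence "k \<le> K" using k by simp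
        hence "k \<le> X" using K by simp
        thus "K \<in> (\<lambda>k. j * k) ` {1..X}" using K k by (auto simp: Suc_le_eq)
      qed
    qed (use j in \<open>auto intro!: \<Phi> simp: Suc_le_eq\<close>)
    also have "\<dots> = (\<Sum>K\<in>{1..X}. if j dvd K then \<Phi> K else 0)"
      by (rule sum.inter_filter) auto
    finally show "mu j * (\<Sum>k\<in>{1..X}. \<Phi> (j * k)) = (\<Sum>K\<in>{1..X}. if j dvd K then mu j * \<Phi> K else 0)"
      by (simp add: sum_distrib_left if_distrib cong: if_cong)
  qed simp
  also have "\<dots> = (\<Sum>K\<in>{1..X}. \<Sum>j\<in>{j. j dvd Q}. if j dvd K then mu j * \<Phi> K else 0)"
    by (rule sum.swap)
  also have "\<dots> = (\<Sum>K\<in>{1..X}. if coprime K Q then \<Phi> K else 0)"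
  proof (rule sum.cong)
    fix K assume K: "K \<in> {1..X}"
    \<comment> \<open>For each value \<open>K\<close> of \<open>j * k\<close> the weights add up
      over the common divisors of \<open>K\<close> and \<open>Q\<close>, which detects
      coprimality.\<close>
    have "(\<Sum>j\<in>{j. j dvd Q}. if j dvd K then mu j * \<Phi> K else 0) = (\<Sum>j\<in>{j\<in>{j. j dvd Q}. j dvd K}. mu j * \<Phi> K)"
      using fQ by (rule sum.inter_filter[symmetric])
    also have "\<dots> = (\<Sum>j\<in>{j. j dvd Q \<and> j dvd K}. mu j) * \<Phi> K"
      by (simp add: sum_distrib_right)
    also have "\<dots> = (if coprime K Q then \<Phi> K else 0)"
      using K assms by (subst sum_mu_coprime) auto
    finally show "(\<Sum>j\<in>{j. j dvd Q}. if j dvd K then mu j * \<Phi> K else 0) = (if coprime K Q then \<Phi> K else 0)" .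
  qed simp
  also have "\<dots> = (\<Sum>K\<in>{K\<in>{1..X}. coprime K Q}. \<Phi> K)" by (rule sum.inter_filter[symmetric]) auto
  finally show ?thesis .
qed

text \<open>Each resonant product has exactly one root \<open>k\<close> with
  \<open>r1 * r2 * e = n * k^2\<close>, so the pairs can be sorted by it. Roots beyond
  \<open>X\<close> may be dropped because the bump tail vanishes there.\<close>

lemma resonant_part_eq:
  fixes U n L E :: nat
  assumes "U \<ge> 1" "n \<ge> 1" and e: "e \<ge> 1" and X: "X = 4 * U\<^sup>2"
  shows "(\<Sum>r1\<in>{1..X}. \<Sum>r2\<in>{1..X}. (if square_defect n (r1 * r2 * e) = 0 then bump_tail U L X (sqrt (real (r1 * r2 * e))) else 0))
    = (\<Sum>k\<in>{1..X}. real (card {p\<in>{1..X} \<times> {1..X}. fst p * snd p * e = n * k\<^sup>2}) * bump_tail U L X (real k * sqrt (real n)))"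
    (is "?lhs = ?rhs")
proof -
  define P where "P = {1..X} \<times> {1..X}"
  define F where "F = (\<lambda>p::nat \<times> nat. fst p * snd p * e)"
  have fP: "finite P" by (simp add: P_def)
  have "?lhs = (\<Sum>p\<in>P. if square_defect n (F p) = 0 then bump_tail U L X (sqrt (real (F p))) else 0)"
    unfolding P_def F_def by (simp add: sum.cartesian_product case_prod_unfold)
  also have "\<dots> = (\<Sum>p\<in>P. \<Sum>k\<in>{1..X}. if F p = n * k\<^sup>2 then bump_tail U L X (real k * sqrt (real n)) else 0)"
  proof (rule sum.cong)
    fix p assume p: "p \<in> P"
    have Fp: "F p > 0" using p e by (auto simp: P_def F_def)
    show "(if square_defect n (F p) = 0 then bump_tail U L X (sqrt (real (F p))) else 0) =
       (\<Sum>k\<in>{1..X}. if F p = n * k\<^sup>2 then bump_tail U L X (real k * sqrt (real n)) else 0)"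
    proof (cases "square_defect n (F p) = 0")
      case False
      hence "F p \<noteq> n * k\<^sup>2" for k using square_defect_eq_0_iff[of n "F p"] assms by auto
      thus ?thesis using False by simp
    next
      case True
      define k where "k = near_root n (F p)"
      have k: "F p = n * k\<^sup>2" using square_defect_eq_0D[OF True] by (simp add: k_def)
      hence k0: "k > 0" using Fp by (auto intro: Nat.gr0I)
      have s: "sqrt (real (F p)) = real k * sqrt (real n)" unfolding k by (simp add: real_sqrt_mult)
      have iff: "F p = n * k'\<^sup>2 \<longleftrightarrow> k' = k" for k' using k assms by auto
      show ?thesis
      proof (cases "k \<le> X")
        case True2: True
        thus ?thesis using True k0 s by (simp add: iff)
      next
        case False
        have "2 * U \<le> X" using assms by (simp add: power2_eq_square)
        hence "2 * real U \<le> real k" using False by linarith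
        also have "\<dots> \<le> real k * sqrt (real n)" using assms k0 by simp
        finally have "bump_tail U L X (real k * sqrt (real n)) = 0" using assms by (intro bump_tail_eq_0) auto
        thus ?thesis using True s False by (simp add: iff)
      qed
    qed
  qed simp
  also have "\<dots> = (\<Sum>k\<in>{1..X}. \<Sum>p\<in>P. if F p = n * k\<^sup>2 then bump_tail U L X (real k * sqrt (real n)) else 0)"
    by (rule sum.swap)
  also have "\<dots> = ?rhs"
  proof (rule sum.cong)
    fix k
    have "(\<Sum>p\<in>P. if F p = n * k\<^sup>2 then bump_tail U L X (real k * sqrt (real n)) else 0) =
      (\<Sum>p\<in>{p\<in>P. F p = n * k\<^sup>2}. bump_tail U L X (real k * sqrt (real n)))"
      using fP by (rule sum.inter_filter[symmetric])
    thus "(\<Sum>p\<in>P. if F p = n * k\<^sup>2 then bump_tail U L X (real k * sqrt (real n)) else 0) =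
      real (card {p\<in>{1..X} \<times> {1..X}. fst p * snd p * e = n * k\<^sup>2}) * bump_tail U L X (real k * sqrt (real n))"
      by (simp add: P_def F_def)
  qed simp
  finally show ?thesis .
qed

lemma card_pairs_le:
  assumes "s > 0"
  shows "card {p\<in>{1..X} \<times> {1..X}. fst p * snd p * e = s} \<le> (if e dvd s then ndiv s else 0)"
proof (cases "e dvd s")
  case True
  hence e: "e > 0" using assms by (auto intro: Nat.gr0I)
  have "card {p\<in>{1..X} \<times> {1..X}. fst p * snd p * e = s} \<le> card {d. d dvd s}"
  proof (rule card_inj_on_le[of fst])
    show "inj_on fst {p\<in>{1..X} \<times> {1..X}. fst p * snd p * e = s}"
      using e by (intro inj_onI) (auto simp: prod_eq_iff)
    show "fst ` {p\<in>{1..X} \<times> {1..X}. fst p * snd p * e = s} \<subseteq> {d. d dvd s}"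
      by (auto simp: mult.assoc)
  qed (use assms finite_divisors in auto)
  thus ?thesis using True by (simp add: ndiv_def)
next
  case False
  hence "{p\<in>{1..X} \<times> {1..X}. fst p * snd p * e = s} = {}" by auto
  thus ?thesis by (simp only: card.empty)
qed

lemma card_pairs_eq:
  assumes "m \<in> {1..X}"
  shows "card {p\<in>{1..X} \<times> {1..X}. fst p * snd p * 1 = m} = ndiv m"
proof -
  have "bij_betw fst {p\<in>{1..X} \<times> {1..X}. fst p * snd p * 1 = m} {d. d dvd m}"
  proof (rule bij_betwI[of _ _ _ "\<lambda>d. (d, m div d)"])
    show "(\<lambda>d. (d, m div d)) \<in> {d. d dvd m} \<rightarrow> {p\<in>{1..X} \<times> {1..X}. fst p * snd p * 1 = m}"
    proof
      fix d assume d: "d \<in> {d. d dvd m}"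
      then obtain k where k: "m = d * k" by auto
      with assms have "d > 0" "k > 0" by (auto intro: Nat.gr0I)
      moreover have "d \<le> m" "k \<le> m" using k assms by (auto intro!: dvd_imp_le)
      hence "d \<le> X" "k \<le> X" using assms by auto
      ultimately show "(d, m div d) \<in> {p\<in>{1..X} \<times> {1..X}. fst p * snd p * 1 = m}"
        using k assms by auto
    qed
  qed (use assms in auto)
  thus ?thesis unfolding ndiv_def by (rule bij_betw_same_card)
qed

lemma dvd_mult_reduce:
  fixes e a m :: nat
  assumes "e dvd a * m" "e > 0"
  shows "e div gcd e a dvd m"
proof -
  have g: "gcd e a > 0" using assms by simp
  have "coprime (e div gcd e a) (a div gcd e a)" using assms by (intro div_gcd_coprime) auto
  moreover have "e div gcd e a dvd (a div gcd e a) * m"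
  proof -
    have "gcd e a * (e div gcd e a) dvd gcd e a * ((a div gcd e a) * m)"
      using assms by (simp add: mult.assoc[symmetric])
    thus ?thesis using g by (simp only: nat_mult_dvd_cancel1)
  qed
  ultimately show ?thesis by (simp add: coprime_dvd_mult_right_iff)
qed

text \<open>After the sieve everything is a count of \<open>r1 * r2 * e = K^2 * m\<close> with
  \<open>K\<close> coprime to \<open>Q\<close>. Submultiplicativity of \<open>ndiv\<close> produces
  a second factor \<open>ndiv m\<close> beside the weight, so each \<open>e\<close> is compared with
  the same sum \<open>D\<close>, at the relative cost that \<open>eta_bound\<close> supplies as the
  hypothesis on \<open>C\<eta>\<close>.\<close>

lemma main_lower_bound:
  fixes g :: "nat \<Rightarrow> complex" and U L E N P0 :: nat
  assumes "U \<ge> 1" and X: "X = 4 * U\<^sup>2" and "E \<ge> 1" "N \<ge> 1"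
    and LN: "real (Suc L) * real N \<le> real U" "4 * real N \<le> real U"
    and g1: "g 1 = 1"
    and C\<eta>: "C\<eta> \<ge> 0" "\<And>e X. e > 0 \<Longrightarrow> (\<Sum>K\<in>{1..X}. real (ndiv (K\<^sup>2)) / (real K)\<^sup>2 *
       (real (ndiv (e div gcd e (K\<^sup>2))) ^ 2 / real (e div gcd e (K\<^sup>2)))) \<le> C\<eta> * real e powr (- 3 / 4)"
  defines "Q \<equiv> fact P0 :: nat"
  defines "B \<equiv> {m\<in>{1..N}. coprime m Q}"
  shows "norm (\<Sum>m\<in>B. \<Sum>j\<in>{j. j dvd Q}. of_real (real (ndiv m) * mu j) * resonant_part g U L E (j\<^sup>2 * m)) \<ge>
     (real U)\<^sup>2 * ndiv2_sum Q N * (1 / 20 - C\<eta> * (\<Sum>e\<in>{Suc P0..E}. norm (g e) * real e powr (- 3 / 4)))"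
proof -
  define \<nu> where "\<nu> = (\<lambda>e s. real (card {p\<in>{1..X} \<times> {1..X}. fst p * snd p * e = s}))"
  define C where "C = {K\<in>{1..X}. coprime K Q}"
  define R where "R = (\<lambda>e. \<Sum>m\<in>B. real (ndiv m) * (\<Sum>K\<in>C. \<nu> e (K\<^sup>2 * m) * bump_tail U L X (real K * sqrt (real m))))"
  define D where "D = ndiv2_sum Q N"
  have D: "D = (\<Sum>m\<in>B. real (ndiv m) ^ 2 / real m)" by (simp add: D_def B_def ndiv2_sum_def)
  have D0: "D \<ge> 0" unfolding D by (intro sum_nonneg) auto
  have Q0: "Q > 0" by (simp add: Q_def)
  have UX: "2 * U \<le> X" using assms by (simp add: X power2_eq_square)
  have TT0: "bump_tail U L X v \<ge> 0" for v using assms by (intro bump_tail_nonneg) auto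
  \<comment> \<open>For \<open>n = j^2 * m\<close> both \<open>n * k^2\<close> and the argument of
    the bump tail depend on \<open>j\<close> and \<open>k\<close> only through
    \<open>K = j * k\<close>; this is what lets the Moebius weights act on \<open>K\<close>.\<close>
  have sieve: "(\<Sum>j\<in>{j. j dvd Q}. mu j * (\<Sum>r1\<in>{1..X}. \<Sum>r2\<in>{1..X}. (if square_defect (j\<^sup>2 * m) (r1 * r2 * e) = 0 then bump_tail U L X (sqrt (real (r1 * r2 * e))) else 0)))
     = (\<Sum>K\<in>C. \<nu> e (K\<^sup>2 * m) * bump_tail U L X (real K * sqrt (real m)))" if m: "m \<in> B" and e: "e \<ge> 1" for m e
  proof -
    define \<Phi> where "\<Phi> = (\<lambda>K. \<nu> e (K\<^sup>2 * m) * bump_tail U L X (real K * sqrt (real m)))"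
    have m0: "m \<ge> 1" using m by (simp add: B_def)
    have "(\<Sum>j\<in>{j. j dvd Q}. mu j * (\<Sum>r1\<in>{1..X}. \<Sum>r2\<in>{1..X}. (if square_defect (j\<^sup>2 * m) (r1 * r2 * e) = 0 then bump_tail U L X (sqrt (real (r1 * r2 * e))) else 0)))
      = (\<Sum>j\<in>{j. j dvd Q}. mu j * (\<Sum>k\<in>{1..X}. \<Phi> (j * k)))"
    proof (rule sum.cong)
      fix j assume "j \<in> {j. j dvd Q}"
      hence j: "j > 0" using Q0 by (auto intro: Nat.gr0I)
      have "(\<Sum>r1\<in>{1..X}. \<Sum>r2\<in>{1..X}. (if square_defect (j\<^sup>2 * m) (r1 * r2 * e) = 0 then bump_tail U L X (sqrt (real (r1 * r2 * e))) else 0))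
        = (\<Sum>k\<in>{1..X}. \<nu> e (j\<^sup>2 * m * k\<^sup>2) * bump_tail U L X (real k * sqrt (real (j\<^sup>2 * m))))"
        unfolding \<nu>_def using assms m0 j e by (intro resonant_part_eq) auto
      also have "\<dots> = (\<Sum>k\<in>{1..X}. \<Phi> (j * k))"
      proof (rule sum.cong)
        fix k
        have "j\<^sup>2 * m * k\<^sup>2 = (j * k)\<^sup>2 * m" by (simp add: power_mult_distrib mult_ac)
        moreover have "real k * sqrt (real (j\<^sup>2 * m)) = real (j * k) * sqrt (real m)"
          by (simp add: real_sqrt_mult mult_ac)
        ultimately show "\<nu> e (j\<^sup>2 * m * k\<^sup>2) * bump_tail U L X (real k * sqrt (real (j\<^sup>2 * m))) = \<Phi> (j * k)"
          by (simp only: \<Phi>_def)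
      qed simp
      finally show "mu j * (\<Sum>r1\<in>{1..X}. \<Sum>r2\<in>{1..X}. (if square_defect (j\<^sup>2 * m) (r1 * r2 * e) = 0 then bump_tail U L X (sqrt (real (r1 * r2 * e))) else 0))
        = mu j * (\<Sum>k\<in>{1..X}. \<Phi> (j * k))" by (simp only:)
    qed simp
    also have "\<dots> = (\<Sum>K\<in>{K\<in>{1..X}. coprime K Q}. \<Phi> K)"
    proof (rule mobius_sieve[OF Q0])
      fix K assume "K > X"
      hence "2 * real U \<le> real K" using UX by linarith
      also have "\<dots> \<le> real K * sqrt (real m)" using m0 by (simp add: mult_le_cancel_left1)
      finally have "bump_tail U L X (real K * sqrt (real m)) = 0" using assms by (intro bump_tail_eq_0) auto
      thus "\<Phi> K = 0" by (simp add: \<Phi>_def)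
    qed
    finally show ?thesis by (simp add: \<Phi>_def C_def)
  qed
  have "(\<Sum>m\<in>B. \<Sum>j\<in>{j. j dvd Q}. of_real (real (ndiv m) * mu j) * resonant_part g U L E (j\<^sup>2 * m)) =
     (\<Sum>m\<in>B. \<Sum>j\<in>{j. j dvd Q}. \<Sum>e\<in>{1..E}. g e * of_real (real (ndiv m) * (mu j *
       (\<Sum>r1\<in>{1..X}. \<Sum>r2\<in>{1..X}. (if square_defect (j\<^sup>2 * m) (r1 * r2 * e) = 0 then bump_tail U L X (sqrt (real (r1 * r2 * e))) else 0)))))"
    unfolding resonant_part_def X[symmetric] sum_distrib_left[of "of_real _"]
    by (intro sum.cong refl) (simp only: of_real_mult of_real_sum mult_ac)
  also have "\<dots> = (\<Sum>m\<in>B. \<Sum>e\<in>{1..E}. \<Sum>j\<in>{j. j dvd Q}. g e * of_real (real (ndiv m) * (mu j *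
       (\<Sum>r1\<in>{1..X}. \<Sum>r2\<in>{1..X}. (if square_defect (j\<^sup>2 * m) (r1 * r2 * e) = 0 then bump_tail U L X (sqrt (real (r1 * r2 * e))) else 0)))))"
    by (intro sum.cong refl sum.swap)
  also have "\<dots> = (\<Sum>m\<in>B. \<Sum>e\<in>{1..E}. g e * of_real (real (ndiv m) * (\<Sum>K\<in>C. \<nu> e (K\<^sup>2 * m) * bump_tail U L X (real K * sqrt (real m)))))"
  proof (intro sum.cong refl)
    fix m e assume me: "m \<in> B" "e \<in> {1..E}"
    have "e \<ge> 1" using me by simp
    show "(\<Sum>j\<in>{j. j dvd Q}. g e * of_real (real (ndiv m) * (mu j *
       (\<Sum>r1\<in>{1..X}. \<Sum>r2\<in>{1..X}. (if square_defect (j\<^sup>2 * m) (r1 * r2 * e) = 0 then bump_tail U L X (sqrt (real (r1 * r2 * e))) else 0)))))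
      = g e * of_real (real (ndiv m) * (\<Sum>K\<in>C. \<nu> e (K\<^sup>2 * m) * bump_tail U L X (real K * sqrt (real m))))"
      unfolding sieve[OF me(1) \<open>e \<ge> 1\<close>, symmetric] sum_distrib_left[of "real (ndiv m)"] of_real_sum sum_distrib_left[of "g e"] ..
  qed
  also have "\<dots> = (\<Sum>e\<in>{1..E}. \<Sum>m\<in>B. g e * of_real (real (ndiv m) * (\<Sum>K\<in>C. \<nu> e (K\<^sup>2 * m) * bump_tail U L X (real K * sqrt (real m)))))"
    by (rule sum.swap)
  also have "\<dots> = (\<Sum>e\<in>{1..E}. g e * of_real (R e))"
    unfolding R_def of_real_sum sum_distrib_left[of "g _"] ..
  also have "{1..E} = insert 1 {2..E}" using assms by auto
  also have "(\<Sum>e\<in>insert 1 {2..E}. g e * of_real (R e)) = of_real (R 1) + (\<Sum>e\<in>{2..E}. g e * of_real (R e))"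
    using g1 by (subst sum.insert) auto
  finally have Main: "(\<Sum>m\<in>B. \<Sum>j\<in>{j. j dvd Q}. of_real (real (ndiv m) * mu j) * resonant_part g U L E (j\<^sup>2 * m)) =
     of_real (R 1) + (\<Sum>e\<in>{2..E}. g e * of_real (R e))" .
  have R0: "R e \<ge> 0" for e
    unfolding R_def \<nu>_def by (intro sum_nonneg mult_nonneg_nonneg TT0) auto
  have NX: "N \<le> X"
  proof -
    have "real N \<le> real X" using LN(2) UX by linarith
    thus ?thesis by simp
  qed
  \<comment> \<open>For \<open>e = 1\<close> only \<open>K = 1\<close> is kept, all terms being
    nonnegative; there the count is exactly \<open>ndiv m\<close>, and with the weight it gives the
    square.\<close>
  have R1: "R 1 \<ge> (real U)\<^sup>2 * D / 20"
  proof -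
    have "(real U)\<^sup>2 * D / 20 = (\<Sum>m\<in>B. real (ndiv m) * (real (ndiv m) * ((real U)\<^sup>2 / (20 * (sqrt (real m))\<^sup>2))))"
      unfolding D sum_distrib_left sum_divide_distrib
      by (intro sum.cong refl) (simp add: power2_eq_square mult_ac)
    also have "\<dots> \<le> R 1"
      unfolding R_def
    proof (rule sum_mono)
      fix m assume m: "m \<in> B"
      hence m': "m \<ge> 1" "m \<le> N" "coprime m Q" by (auto simp: B_def)
      have sm: "sqrt (real m) \<ge> 1" using m' by simp
      have "sqrt (real m) * sqrt (real m) = real m" by simp
      hence sN: "sqrt (real m) \<le> real N" using sm m'
        by (metis (no_types, opaque_lifting) dual_order.trans mult.commute mult_le_cancel_left1 of_nat_mono order_less_le_trans zero_less_one linorder_not_le real_sqrt_ge_0_iff of_nat_0_le_iff)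
      have "bump_tail U L X (sqrt (real m)) \<ge> (real U)\<^sup>2 / (20 * (sqrt (real m))\<^sup>2)"
      proof (rule bump_tail_lower)
        have "real (Suc L) * sqrt (real m) \<le> real (Suc L) * real N" using sN by (intro mult_left_mono) auto
        hence "real (Suc L) * sqrt (real m) \<le> 5 / 4 * real U" using LN by linarith
        thus "real (Suc L) \<le> 5 / 4 * real U / sqrt (real m)" using sm by (simp add: field_simps)
        show "4 * sqrt (real m) \<le> real U" using sN LN by linarith
      qed (use assms sm in auto)
      hence "real (ndiv m) * ((real U)\<^sup>2 / (20 * (sqrt (real m))\<^sup>2)) \<le> real (ndiv m) * bump_tail U L X (sqrt (real m))"
        by (intro mult_left_mono) auto
      also have "\<dots> = (\<Sum>K\<in>{1::nat}. \<nu> 1 (K\<^sup>2 * m) * bump_tail U L X (real K * sqrt (real m)))"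
        using card_pairs_eq[of m X] m' NX by (simp add: \<nu>_def)
      also have "\<dots> \<le> (\<Sum>K\<in>C. \<nu> 1 (K\<^sup>2 * m) * bump_tail U L X (real K * sqrt (real m)))"
        using assms UX by (intro sum_mono2 mult_nonneg_nonneg TT0) (auto simp: C_def \<nu>_def)
      finally show "real (ndiv m) * (real (ndiv m) * ((real U)\<^sup>2 / (20 * (sqrt (real m))\<^sup>2))) \<le>
        real (ndiv m) * (\<Sum>K\<in>C. \<nu> 1 (K\<^sup>2 * m) * bump_tail U L X (real K * sqrt (real m)))"
        by (intro mult_left_mono) auto
    qed
    finally show ?thesis .
  qed
  have Re: "R e \<le> (real U)\<^sup>2 * D * (C\<eta> * real e powr (- 3 / 4))" if e: "e \<ge> 2" for e
  proof -
    \<comment> \<open>\<open>e dvd K^2 * m\<close> forces \<open>e' K dvd m\<close>, so the sum over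
      \<open>m\<close> shrinks to the multiples of \<open>e' K\<close>.\<close>
    define e' where "e' = (\<lambda>K::nat. e div gcd e (K\<^sup>2))"
    have e'0: "e' K > 0" for K
    proof -
      have "e' K dvd e" unfolding e'_def by (metis dvd_div_mult_self dvd_triv_left gcd_dvd1)
      thus ?thesis using e by (auto intro!: Nat.gr0I)
    qed
    have "R e \<le> (\<Sum>m\<in>B. \<Sum>K\<in>C. (real U)\<^sup>2 * (real (ndiv (K\<^sup>2)) / (real K)\<^sup>2) * (if e' K dvd m then real (ndiv m) ^ 2 / real m else 0))"
      unfolding R_def sum_distrib_left
    proof (intro sum_mono)
      fix m K assume mK: "m \<in> B" "K \<in> C"
      hence pos: "m > 0" "K > 0" by (auto simp: B_def C_def)
      have "\<nu> e (K\<^sup>2 * m) \<le> (if e' K dvd m then real (ndiv (K\<^sup>2)) * real (ndiv m) else 0)"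
      proof (cases "e dvd K\<^sup>2 * m")
        case False
        hence "card {p\<in>{1..X} \<times> {1..X}. fst p * snd p * e = K\<^sup>2 * m} \<le> 0"
          using card_pairs_le[of "K\<^sup>2 * m" X e] pos by (simp only: if_False) simp
        hence "\<nu> e (K\<^sup>2 * m) = 0" unfolding \<nu>_def by linarith
        thus ?thesis by simp
      next
        case True
        have "\<nu> e (K\<^sup>2 * m) \<le> real (ndiv (K\<^sup>2 * m))"
          unfolding \<nu>_def using card_pairs_le[of "K\<^sup>2 * m" X e] pos True by simp
        also have "\<dots> \<le> real (ndiv (K\<^sup>2)) * real (ndiv m)"
          using ndiv_mult_le[of "K\<^sup>2" m] pos by (simp flip: of_nat_mult)
        finally show ?thesis using dvd_mult_reduce[OF True] e by (simp add: e'_def)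
      qed
      moreover have "bump_tail U L X (real K * sqrt (real m)) \<le> (real U)\<^sup>2 / (real K * sqrt (real m))\<^sup>2"
        using pos assms by (intro bump_tail_upper) auto
      moreover have "(real K * sqrt (real m))\<^sup>2 = (real K)\<^sup>2 * real m" by (simp add: power_mult_distrib)
      ultimately have "\<nu> e (K\<^sup>2 * m) * bump_tail U L X (real K * sqrt (real m)) \<le>
         (if e' K dvd m then real (ndiv (K\<^sup>2)) * real (ndiv m) else 0) * ((real U)\<^sup>2 / ((real K)\<^sup>2 * real m))"
        by (intro mult_mono TT0) auto
      hence "real (ndiv m) * (\<nu> e (K\<^sup>2 * m) * bump_tail U L X (real K * sqrt (real m))) \<le>
         real (ndiv m) * ((if e' K dvd m then real (ndiv (K\<^sup>2)) * real (ndiv m) else 0) * ((real U)\<^sup>2 / ((real K)\<^sup>2 * real m)))"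
        by (intro mult_left_mono) auto
      thus "real (ndiv m) * (\<nu> e (K\<^sup>2 * m) * bump_tail U L X (real K * sqrt (real m))) \<le>
        (real U)\<^sup>2 * (real (ndiv (K\<^sup>2)) / (real K)\<^sup>2) * (if e' K dvd m then real (ndiv m) ^ 2 / real m else 0)"
        by (auto simp: power2_eq_square mult_ac split: if_splits)
    qed
    also have "\<dots> = (\<Sum>K\<in>C. (real U)\<^sup>2 * (real (ndiv (K\<^sup>2)) / (real K)\<^sup>2) * (\<Sum>m\<in>B. if e' K dvd m then real (ndiv m) ^ 2 / real m else 0))"
      unfolding sum_distrib_left by (rule sum.swap)
    also have "\<dots> \<le> (\<Sum>K\<in>C. (real U)\<^sup>2 * (real (ndiv (K\<^sup>2)) / (real K)\<^sup>2) * (real (ndiv (e' K)) ^ 2 / real (e' K) * D))"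
    proof (intro sum_mono mult_left_mono)
      fix K
      have "(\<Sum>m\<in>B. if e' K dvd m then real (ndiv m) ^ 2 / real m else 0) = (\<Sum>m\<in>{m\<in>B. e' K dvd m}. real (ndiv m) ^ 2 / real m)"
        by (rule sum.inter_filter[symmetric]) (simp add: B_def)
      also have "{m\<in>B. e' K dvd m} = {m\<in>{1..N}. coprime m Q \<and> e' K dvd m}" by (auto simp: B_def)
      also have "(\<Sum>m\<in>\<dots>. real (ndiv m) ^ 2 / real m) \<le> real (ndiv (e' K)) ^ 2 / real (e' K) * D"
        unfolding D_def by (rule ndiv2_sum_dvd_le[OF e'0])
      finally show "(\<Sum>m\<in>B. if e' K dvd m then real (ndiv m) ^ 2 / real m else 0) \<le> real (ndiv (e' K)) ^ 2 / real (e' K) * D" .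
    qed auto
    also have "\<dots> = (real U)\<^sup>2 * D * (\<Sum>K\<in>C. real (ndiv (K\<^sup>2)) / (real K)\<^sup>2 * (real (ndiv (e' K)) ^ 2 / real (e' K)))"
      unfolding sum_distrib_left by (intro sum.cong refl) simp
    also have "\<dots> \<le> (real U)\<^sup>2 * D * (\<Sum>K\<in>{1..X}. real (ndiv (K\<^sup>2)) / (real K)\<^sup>2 * (real (ndiv (e' K)) ^ 2 / real (e' K)))"
      using D0 by (intro mult_left_mono sum_mono2) (auto simp: C_def)
    also have "\<dots> \<le> (real U)\<^sup>2 * D * (C\<eta> * real e powr (- 3 / 4))"
      unfolding e'_def using D0 e by (intro mult_left_mono C\<eta>) auto
    finally show ?thesis .
  qed
  have Rz: "R e = 0" if e: "e \<ge> 2" "e \<le> P0" for e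
  proof -
    have "\<nu> e (K\<^sup>2 * m) = 0" if mK: "m \<in> B" "K \<in> C" for m K
    proof -
      have "e dvd Q" unfolding Q_def using e by (intro dvd_fact) auto
      moreover have "coprime (K\<^sup>2 * m) Q" using mK by (auto simp: B_def C_def)
      ultimately have "\<not> e dvd K\<^sup>2 * m"
        using e coprime_common_divisor_nat[of "K\<^sup>2 * m" Q e] by auto
      thus ?thesis unfolding \<nu>_def using card_pairs_le[of "K\<^sup>2 * m" X e] mK by (simp add: B_def C_def)
    qed
    thus ?thesis by (simp add: R_def)
  qed
  define G where "G = (\<Sum>e\<in>{Suc P0..E}. norm (g e) * real e powr (- 3 / 4))"
  have "norm (\<Sum>e\<in>{2..E}. g e * of_real (R e)) \<le> (\<Sum>e\<in>{2..E}. norm (g e) * R e)"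
    using R0 by (intro sum_norm_le) (simp add: norm_mult)
  also have "\<dots> = (\<Sum>e\<in>{e\<in>{2..E}. e > P0}. norm (g e) * R e)"
    by (rule sum.mono_neutral_right) (auto intro!: Rz)
  also have "\<dots> \<le> (\<Sum>e\<in>{e\<in>{2..E}. e > P0}. norm (g e) * ((real U)\<^sup>2 * D * (C\<eta> * real e powr (- 3 / 4))))"
    by (intro sum_mono mult_left_mono Re) auto
  also have "\<dots> \<le> (\<Sum>e\<in>{Suc P0..E}. norm (g e) * ((real U)\<^sup>2 * D * (C\<eta> * real e powr (- 3 / 4))))"
    using D0 C\<eta> by (intro sum_mono2) auto
  also have "\<dots> = (real U)\<^sup>2 * D * (C\<eta> * G)"
    unfolding G_def sum_distrib_left by (intro sum.cong refl) simp
  finally have tail: "norm (\<Sum>e\<in>{2..E}. g e * of_real (R e)) \<le> (real U)\<^sup>2 * D * (C\<eta> * G)" .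
  have "R 1 - norm (\<Sum>e\<in>{2..E}. g e * of_real (R e)) \<le> norm (of_real (R 1) + (\<Sum>e\<in>{2..E}. g e * of_real (R e)))"
    using norm_diff_ineq[of "complex_of_real (R 1)" "\<Sum>e\<in>{2..E}. g e * of_real (R e)"] R0[of 1] by simp
  moreover have "(real U)\<^sup>2 * D * (1 / 20 - C\<eta> * G) = (real U)\<^sup>2 * D / 20 - (real U)\<^sup>2 * D * (C\<eta> * G)"
    by (simp add: algebra_simps)
  ultimately show ?thesis unfolding Main D_def[symmetric] G_def[symmetric] using R1 tail by linarith
qed

section \<open>Integrals against the test function\<close>

lemma ee_conv_exp: "ee x = exp (2 * of_real pi * \<i> * of_real x)"
  by (simp add: ee_def cis_conv_exp mult_ac)

text \<open>The polynomial branch of the wave on complex arguments, without clamping, so that the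
  real derivative comes from a complex one. All integrals run over \<open>[U, 2 U]\<close>, where it
  agrees with \<open>wave\<close>.\<close>

definition wave_cx :: "nat \<Rightarrow> nat \<Rightarrow> complex \<Rightarrow> complex" where
  "wave_cx U n z = (z - of_nat U) * (2 * of_nat U - z) / (of_nat U)\<^sup>2 * exp (2 * of_real pi * \<i> * z / of_real (sqrt (real n)))"

definition wave_deriv :: "nat \<Rightarrow> nat \<Rightarrow> real \<Rightarrow> complex" where
  "wave_deriv U n u = (of_real ((3 * real U - 2 * u) / (real U)\<^sup>2) +
     of_real ((u - real U) * (2 * real U - u) / (real U)\<^sup>2) * (2 * of_real pi * \<i> / of_real (sqrt (real n)))) * ee (u / sqrt (real n))"

lemma wave_eq_wave_cx: "real U \<le> u \<Longrightarrow> u \<le> 2 * real U \<Longrightarrow> wave U n u = wave_cx U n (of_real u)"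
  by (simp add: wave_def wave_cx_def bump_eq ee_conv_exp)

lemma wave_cx_deriv:
  assumes "U \<ge> 1" "n \<ge> 1"
  shows "((\<lambda>u. wave_cx U n (of_real u)) has_vector_derivative wave_deriv U n u) (at u within A)"
proof -
  define a where "a = complex_of_real (sqrt (real n))"
  have "a \<noteq> 0" using assms by (simp add: a_def)
  have "(wave_cx U n has_field_derivative wave_deriv U n u) (at (of_real u))"
    unfolding wave_cx_def[abs_def] wave_deriv_def a_def[symmetric] ee_conv_exp using assms \<open>a \<noteq> 0\<close>
    by (auto intro!: derivative_eq_intros simp: a_def[symmetric] divide_simps) (auto simp: algebra_simps)
  thus ?thesis by (rule has_vector_derivative_real_field)
qed

lemma continuous_wave_deriv: "continuous_on A (wave_deriv U n)"
  unfolding wave_deriv_def[abs_def] ee_conv_exp by (cases "U = 0"; cases "n = 0") (auto intro!: continuous_intros)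

text \<open>For fixed \<open>m\<close> the condition \<open>m \<le> u^2\<close> cuts the integral of
  the derivative down to \<open>[max U (sqrt m), 2 U]\<close>. The bump vanishes at
  \<open>2 U\<close>, leaving minus the value at the lower end; if that end is \<open>U\<close>,
  both this value and the wave at \<open>sqrt m\<close> are zero.\<close>

lemma abel_identity:
  fixes f :: "nat \<Rightarrow> complex"
  assumes "U \<ge> 1" "n \<ge> 1"
  defines "S \<equiv> \<lambda>y. \<Sum>m\<in>{m. 1 \<le> m \<and> real m \<le> y}. f m"
  shows "((\<lambda>u. S (u\<^sup>2) * wave_deriv U n u) has_integral (- (\<Sum>m\<in>{1..4 * U\<^sup>2}. f m * wave U n (sqrt (real m))))) {real U..2 * real U}"
proof -
  have 1: "((\<lambda>u. if u \<in> {max (real U) (sqrt (real m))..2 * real U} then wave_deriv U n u else 0) has_integral - wave U n (sqrt (real m))) {real U..2 * real U}"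
    if m: "m \<in> {1..4 * U\<^sup>2}" for m
  proof -
    define b where "b = max (real U) (sqrt (real m))"
    have "real m \<le> 4 * (real U)\<^sup>2" using m by (metis atLeastAtMost_iff of_nat_le_iff of_nat_mult of_nat_numeral of_nat_power)
    hence "real m \<le> (2 * real U)\<^sup>2" by (simp add: power_mult_distrib)
    hence "sqrt (real m) \<le> 2 * real U" by (intro real_le_lsqrt) auto
    hence b: "real U \<le> b" "b \<le> 2 * real U" by (auto simp: b_def)
    have "(wave_deriv U n has_integral (wave_cx U n (of_real (2 * real U)) - wave_cx U n (of_real b))) {b..2 * real U}"
      using b assms by (intro fundamental_theorem_of_calculus wave_cx_deriv) auto
    moreover have "wave_cx U n (of_real (2 * real U)) = 0" by (simp add: wave_cx_def)
    moreover have "wave_cx U n (of_real b) = wave U n (sqrt (real m))"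
    proof (cases "sqrt (real m) \<le> real U")
      case True
      thus ?thesis using assms by (auto simp: b_def wave_cx_def wave_def bump_eq_0 max_def)
    next
      case False
      thus ?thesis using b by (subst wave_eq_wave_cx) (auto simp: b_def)
    qed
    ultimately have "(wave_deriv U n has_integral - wave U n (sqrt (real m))) {b..2 * real U}" by simp
    thus ?thesis using b unfolding b_def[symmetric] by (subst has_integral_restrict) auto
  qed
  have "((\<lambda>u. \<Sum>m\<in>{1..4 * U\<^sup>2}. f m * (if u \<in> {max (real U) (sqrt (real m))..2 * real U} then wave_deriv U n u else 0))
      has_integral (\<Sum>m\<in>{1..4 * U\<^sup>2}. f m * - wave U n (sqrt (real m)))) {real U..2 * real U}"
    by (intro has_integral_sum has_integral_mult_right 1) auto
  moreover have "(\<Sum>m\<in>{1..4 * U\<^sup>2}. f m * (if u \<in> {max (real U) (sqrt (real m))..2 * real U} then wave_deriv U n u else 0)) = S (u\<^sup>2) * wave_deriv U n u"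
    if u: "u \<in> {real U..2 * real U}" for u
  proof -
    have "u\<^sup>2 \<le> (2 * real U)\<^sup>2" using u by (intro power_mono) auto
    hence u2: "u\<^sup>2 \<le> 4 * (real U)\<^sup>2" by (simp add: power_mult_distrib)
    have "m \<le> 4 * U\<^sup>2" if "real m \<le> u\<^sup>2" for m
    proof -
      have "real m \<le> real (4 * U\<^sup>2)" using that u2 by simp
      thus ?thesis by (simp only: of_nat_le_iff)
    qed
    hence eq: "{m. 1 \<le> m \<and> real m \<le> u\<^sup>2} = {m\<in>{1..4 * U\<^sup>2}. real m \<le> u\<^sup>2}" by auto
    have "(\<Sum>m\<in>{1..4 * U\<^sup>2}. f m * (if u \<in> {max (real U) (sqrt (real m))..2 * real U} then wave_deriv U n u else 0)) =
      (\<Sum>m\<in>{1..4 * U\<^sup>2}. if real m \<le> u\<^sup>2 then f m * wave_deriv U n u else 0)"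
    proof (rule sum.cong)
      fix m
      have "sqrt (real m) \<le> u \<longleftrightarrow> real m \<le> u\<^sup>2"
        using u by (metis atLeastAtMost_iff of_nat_0_le_iff order_trans real_sqrt_le_iff real_sqrt_unique)
      thus "f m * (if u \<in> {max (real U) (sqrt (real m))..2 * real U} then wave_deriv U n u else 0) = (if real m \<le> u\<^sup>2 then f m * wave_deriv U n u else 0)"
        using u by auto
    qed simp
    also have "\<dots> = (\<Sum>m\<in>{m\<in>{1..4 * U\<^sup>2}. real m \<le> u\<^sup>2}. f m * wave_deriv U n u)"
      by (rule sum.inter_filter[symmetric]) auto
    also have "\<dots> = S (u\<^sup>2) * wave_deriv U n u" unfolding S_def eq by (simp add: sum_distrib_right)
    finally show ?thesis .
  qed
  ultimately have "((\<lambda>u. S (u\<^sup>2) * wave_deriv U n u) has_integral (\<Sum>m\<in>{1..4 * U\<^sup>2}. f m * - wave U n (sqrt (real m)))) {real U..2 * real U}"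
    by (rule has_integral_eq[rotated])
  thus ?thesis by (simp add: sum_negf)
qed

section \<open>Mean square and first moment of the test function\<close>

lemma norm_integral_ee:
  assumes "\<kappa> \<noteq> 0" "a \<le> b"
  shows "norm (integral {a..b} (\<lambda>u. ee (\<kappa> * u))) \<le> 1 / \<bar>\<kappa>\<bar>"
proof -
  define c where "c = 2 * of_real pi * \<i> * complex_of_real \<kappa>"
  have c0: "c \<noteq> 0" using assms by (simp add: c_def)
  have "((\<lambda>u. ee (\<kappa> * u)) has_integral (exp (c * of_real b) / c - exp (c * of_real a) / c)) {a..b}"
  proof (rule fundamental_theorem_of_calculus)
    fix x
    have "((\<lambda>z. exp (c * z) / c) has_field_derivative ee (\<kappa> * x)) (at (of_real x))"
      unfolding ee_conv_exp using c0 by (auto intro!: derivative_eq_intros simp: c_def mult_ac)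
    thus "((\<lambda>u. exp (c * of_real u) / c) has_vector_derivative ee (\<kappa> * x)) (at x within {a..b})"
      by (rule has_vector_derivative_real_field)
  qed fact
  hence "integral {a..b} (\<lambda>u. ee (\<kappa> * u)) = (exp (c * of_real b) - exp (c * of_real a)) / c"
    by (simp add: integral_unique diff_divide_distrib)
  also have "norm \<dots> \<le> 2 / norm c"
  proof -
    have "norm (exp (c * of_real x)) = 1" for x by (simp add: c_def)
    hence "norm (exp (c * of_real b) - exp (c * of_real a)) \<le> 2"
      using norm_triangle_ineq4[of "exp (c * of_real b)" "exp (c * of_real a)"] by (simp only:)
    thus ?thesis by (simp add: norm_divide divide_right_mono)
  qed
  also have "norm c = 2 * pi * \<bar>\<kappa>\<bar>" by (simp add: c_def norm_mult)
  also have "2 / (2 * pi * \<bar>\<kappa>\<bar>) \<le> 1 / \<bar>\<kappa>\<bar>"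
    using assms pi_ge_two by (simp add: field_simps)
  finally show ?thesis .
qed

lemma continuous_ee [continuous_intros]: "continuous_on A f \<Longrightarrow> continuous_on A (\<lambda>x. ee (f x))"
  unfolding ee_conv_exp by (intro continuous_intros)

text \<open>Expanding the square, the diagonal gives the first term and each off-diagonal integral
  is at most the reciprocal of the frequency gap. No finer inequality is called for, since
  \<open>U\<close> will be a high power of \<open>N\<close>.\<close>

lemma mean_square:
  fixes c :: "'a \<Rightarrow> complex" and \<kappa> :: "'a \<Rightarrow> real"
  assumes "finite I" "d > 0" "V \<ge> 0"
    and sep: "\<And>i j. i \<in> I \<Longrightarrow> j \<in> I \<Longrightarrow> i \<noteq> j \<Longrightarrow> \<bar>\<kappa> i - \<kappa> j\<bar> \<ge> d"
  shows "integral {V..2 * V} (\<lambda>u. (norm (\<Sum>i\<in>I. c i * ee (\<kappa> i * u)))\<^sup>2) \<le>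
    V * (\<Sum>i\<in>I. (norm (c i))\<^sup>2) + (\<Sum>i\<in>I. norm (c i))\<^sup>2 / d"
proof -
  have sq: "complex_of_real ((norm (\<Sum>i\<in>I. c i * ee (\<kappa> i * u)))\<^sup>2) =
      (\<Sum>i\<in>I. \<Sum>j\<in>I. c i * cnj (c j) * ee ((\<kappa> i - \<kappa> j) * u))" for u
  proof -
    have "complex_of_real ((norm (\<Sum>i\<in>I. c i * ee (\<kappa> i * u)))\<^sup>2) =
       (\<Sum>i\<in>I. c i * ee (\<kappa> i * u)) * (\<Sum>j\<in>I. cnj (c j) * cnj (ee (\<kappa> j * u)))"
      by (subst complex_norm_square) (simp add: cnj_sum)
    also have "\<dots> = (\<Sum>i\<in>I. \<Sum>j\<in>I. c i * cnj (c j) * ee ((\<kappa> i - \<kappa> j) * u))"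
      unfolding sum_product
    proof (intro sum.cong refl)
      fix i j
      have "cnj (ee (\<kappa> j * u)) = ee (- (\<kappa> j * u))" by (simp add: ee_def cis_cnj)
      hence "ee ((\<kappa> i - \<kappa> j) * u) = ee (\<kappa> i * u) * cnj (ee (\<kappa> j * u))"
        by (simp add: left_diff_distrib flip: ee_add)
      thus "c i * ee (\<kappa> i * u) * (cnj (c j) * cnj (ee (\<kappa> j * u))) = c i * cnj (c j) * ee ((\<kappa> i - \<kappa> j) * u)"
        by simp
    qed
    finally show ?thesis .
  qed
  define T where "T = (\<lambda>i j. integral {V..2 * V} (\<lambda>u. ee ((\<kappa> i - \<kappa> j) * u)))"
  have "((\<lambda>u. \<Sum>i\<in>I. \<Sum>j\<in>I. c i * cnj (c j) * ee ((\<kappa> i - \<kappa> j) * u)) has_integral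
     (\<Sum>i\<in>I. \<Sum>j\<in>I. c i * cnj (c j) * T i j)) {V..2 * V}"
    unfolding T_def
    by (intro has_integral_sum has_integral_mult_right integrable_integral integrable_continuous_interval continuous_intros assms)
  hence hi: "((\<lambda>u. complex_of_real ((norm (\<Sum>i\<in>I. c i * ee (\<kappa> i * u)))\<^sup>2)) has_integral
     (\<Sum>i\<in>I. \<Sum>j\<in>I. c i * cnj (c j) * T i j)) {V..2 * V}" by (simp only: sq)
  have "((\<lambda>u. (norm (\<Sum>i\<in>I. c i * ee (\<kappa> i * u)))\<^sup>2) has_integral
     Re (\<Sum>i\<in>I. \<Sum>j\<in>I. c i * cnj (c j) * T i j)) {V..2 * V}"
    using has_integral_linear[OF hi bounded_linear_Re] by (simp add: o_def)
  hence "integral {V..2 * V} (\<lambda>u. (norm (\<Sum>i\<in>I. c i * ee (\<kappa> i * u)))\<^sup>2) = Re (\<Sum>i\<in>I. \<Sum>j\<in>I. c i * cnj (c j) * T i j)"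
    by (rule integral_unique)
  also have "\<dots> \<le> norm (\<Sum>i\<in>I. \<Sum>j\<in>I. c i * cnj (c j) * T i j)" by (rule complex_Re_le_cmod)
  also have "\<dots> \<le> (\<Sum>i\<in>I. \<Sum>j\<in>I. (if i = j then V * (norm (c i))\<^sup>2 else 0) + norm (c i) * norm (c j) * (1 / d))"
  proof (intro sum_norm_le)
    fix i j assume ij: "i \<in> I" "j \<in> I"
    show "norm (c i * cnj (c j) * T i j) \<le> (if i = j then V * (norm (c i))\<^sup>2 else 0) + norm (c i) * norm (c j) * (1 / d)"
    proof (cases "i = j")
      case True
      have "T i j = of_real V" using \<open>V \<ge> 0\<close> True by (simp add: T_def scaleR_conv_of_real)
      thus ?thesis using True \<open>V \<ge> 0\<close> \<open>d > 0\<close> by (simp add: norm_mult power2_eq_square)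
    next
      case False
      have "norm (T i j) \<le> 1 / \<bar>\<kappa> i - \<kappa> j\<bar>"
        unfolding T_def using sep[OF ij False] \<open>d > 0\<close> \<open>V \<ge> 0\<close> by (intro norm_integral_ee) auto
      also have "\<dots> \<le> 1 / d" using sep[OF ij False] \<open>d > 0\<close> by (intro divide_left_mono mult_pos_pos) auto
      finally have "norm (c i) * norm (c j) * norm (T i j) \<le> norm (c i) * norm (c j) * (1 / d)"
        by (intro mult_left_mono) auto
      thus ?thesis using False by (simp add: norm_mult)
    qed
  qed
  also have "\<dots> = (\<Sum>i\<in>I. V * (norm (c i))\<^sup>2) + (\<Sum>i\<in>I. \<Sum>j\<in>I. norm (c i) * norm (c j) * (1 / d))"
    using \<open>finite I\<close> by (simp add: sum.distrib)
  also have "(\<Sum>i\<in>I. \<Sum>j\<in>I. norm (c i) * norm (c j) * (1 / d)) = (\<Sum>i\<in>I. norm (c i))\<^sup>2 / d"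
    by (simp add: power2_eq_square sum_product sum_divide_distrib)
  finally show ?thesis by (simp add: sum_distrib_left)
qed

text \<open>Distinct integers differ by at least 1, hence their square roots by at least
  \<open>1 / (2 * N)\<close>; passing to reciprocals costs the product of the roots, at most
  \<open>N\<close>.\<close>

lemma inverse_sqrt_sep:
  fixes m m' N j :: nat
  assumes "m \<in> {1..N}" "m' \<in> {1..N}" "m \<noteq> m'" "j \<ge> 1"
  shows "\<bar>1 / (real j * sqrt (real m)) - 1 / (real j * sqrt (real m'))\<bar> \<ge> 1 / (2 * real j * (real N)\<^sup>2)"
proof -
  define a b where "a = sqrt (real m)" and "b = sqrt (real m')"
  have ab: "a \<ge> 1" "b \<ge> 1" "a\<^sup>2 = real m" "b\<^sup>2 = real m'" using assms by (auto simp: a_def b_def)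
  have N: "a\<^sup>2 \<le> real N" "b\<^sup>2 \<le> real N" using ab assms by auto
  have "a * 1 \<le> a * a" "b * 1 \<le> b * b" using ab by (intro mult_left_mono; simp)+
  hence aN: "a \<le> real N" "b \<le> real N" using N by (auto simp: power2_eq_square)
  have "1 \<le> \<bar>real m' - real m\<bar>" using assms by linarith
  also have "\<dots> = \<bar>b - a\<bar> * (a + b)"
  proof -
    have "real m' - real m = (b - a) * (a + b)"
      unfolding ab(3,4)[symmetric] by (simp add: power2_eq_square algebra_simps)
    thus ?thesis using ab by (simp add: abs_mult)
  qed
  also have "\<dots> \<le> \<bar>b - a\<bar> * (2 * real N)" using aN by (intro mult_left_mono) auto
  finally have 1: "1 \<le> \<bar>b - a\<bar> * (2 * real N)" .
  have "a * b \<le> real N"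
  proof -
    have "(a * b)\<^sup>2 \<le> real N * real N" unfolding power_mult_distrib using N by (intro mult_mono) auto
    thus ?thesis using power2_le_imp_le[of "a * b" "real N"] by (simp add: power2_eq_square)
  qed
  have N0: "real N > 0" using aN ab by linarith
  have j0: "real j > 0" using assms by simp
  have "1 / (2 * real N) \<le> \<bar>b - a\<bar>" using 1 N0 by (simp add: field_simps)
  hence "1 / (2 * real N) / (real j * real N) \<le> \<bar>b - a\<bar> / (real j * (a * b))"
    using \<open>a * b \<le> real N\<close> ab j0 N0 by (intro frac_le mult_left_mono mult_pos_pos) auto
  also have "\<bar>b - a\<bar> / (real j * (a * b)) = \<bar>(b - a) / (real j * (a * b))\<bar>"
    using ab j0 by (simp add: abs_mult)
  also have "(b - a) / (real j * (a * b)) = 1 / (real j * a) - 1 / (real j * b)"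
    using ab j0 by (simp add: field_simps)
  finally show ?thesis unfolding a_def b_def using N0 by (simp add: power2_eq_square mult_ac)
qed

text \<open>The sum over \<open>j\<close> is taken outside: for fixed \<open>j\<close> the
  frequencies are separated and the mean square applies, and there are at most \<open>Q\<close>
  values of \<open>j\<close>.\<close>

lemma integral_norm_test:
  fixes U N Q :: nat
  assumes "U \<ge> 1" "N \<ge> 1" "Q \<ge> 1"
  defines "B \<equiv> {m\<in>{1..N}. coprime m Q}" and "D \<equiv> ndiv2_sum Q N"
  shows "integral {real U..2 * real U} (\<lambda>u. norm (\<Sum>m\<in>B. \<Sum>j\<in>{j. j dvd Q}. of_real (real (ndiv m) * mu j) * wave_deriv U (j\<^sup>2 * m) u))
     \<le> 2 * real Q * (real U * sqrt D + 2 * real Q * real N ^ 6)"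
proof -
  define J where "J = {j. j dvd Q}"
  have J: "finite J" "card J \<le> Q" "\<And>j. j \<in> J \<Longrightarrow> 1 \<le> j \<and> j \<le> Q"
  proof -
    show "finite J" using assms unfolding J_def by (intro finite_divisors) auto
    show "card J \<le> Q" using ndiv_le[of Q] assms by (simp add: J_def ndiv_def)
    show "1 \<le> j \<and> j \<le> Q" if "j \<in> J" for j
      using that assms by (auto simp: J_def Suc_le_eq dest: dvd_imp_le intro: Nat.gr0I)
  qed
  have fB: "finite B" by (simp add: B_def)
  have B1: "m \<ge> 1" "m \<le> N" if "m \<in> B" for m using that by (auto simp: B_def)
  have nN: "real (ndiv m) \<le> real N" if "m \<in> B" for m
    using ndiv_le[of m] B1[OF that] by linarith
  have cB: "real (card B) \<le> real N"
  proof -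
    have "card B \<le> card {1..N}" unfolding B_def by (intro card_mono) auto
    thus ?thesis by simp
  qed
  have D1: "1 \<le> D"
  proof -
    have "(\<Sum>m\<in>{1::nat}. real (ndiv m) ^ 2 / real m) \<le> D"
      unfolding D_def ndiv2_sum_def using assms by (intro sum_mono2) auto
    thus ?thesis by (simp add: ndiv_def)
  qed
  \<comment> \<open>The part of the derivative coming from the phase. The part in which the bump is
    differentiated is bounded trivially by \<open>N^2 / U\<close>.\<close>
  define A where "A = (\<lambda>j u. \<Sum>m\<in>B. of_real (real (ndiv m) / sqrt (real m)) * ee (1 / (real j * sqrt (real m)) * u))"
  have contA: "continuous_on S (A j)" for S j
    unfolding A_def by (intro continuous_intros)
  have A2: "integral {real U..2 * real U} (\<lambda>u. (norm (A j u))\<^sup>2) \<le> real U * D + 2 * real Q * real N ^ 6" if j: "j \<in> J" for j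
  proof -
    have "integral {real U..2 * real U} (\<lambda>u. (norm (A j u))\<^sup>2) \<le>
       real U * (\<Sum>m\<in>B. (norm (complex_of_real (real (ndiv m) / sqrt (real m))))\<^sup>2) +
       (\<Sum>m\<in>B. norm (complex_of_real (real (ndiv m) / sqrt (real m))))\<^sup>2 / (1 / (2 * real j * (real N)\<^sup>2))"
      unfolding A_def
      by (rule mean_square) (use fB J[OF ] j assms in \<open>auto intro!: inverse_sqrt_sep simp: B_def Suc_le_eq\<close>)
    also have "(\<Sum>m\<in>B. (norm (complex_of_real (real (ndiv m) / sqrt (real m))))\<^sup>2) = D"
      unfolding D_def ndiv2_sum_def B_def[symmetric]
      by (intro sum.cong refl) (simp add: power_divide norm_divide)
    also have "(\<Sum>m\<in>B. norm (complex_of_real (real (ndiv m) / sqrt (real m))))\<^sup>2 / (1 / (2 * real j * (real N)\<^sup>2)) \<le>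
       ((real N)\<^sup>2)\<^sup>2 / (1 / (2 * real Q * (real N)\<^sup>2))"
    proof (rule frac_le, simp, rule power_mono)
      have "(\<Sum>m\<in>B. norm (complex_of_real (real (ndiv m) / sqrt (real m)))) \<le> (\<Sum>m\<in>B. real N)"
      proof (rule sum_mono)
        fix m assume m: "m \<in> B"
        have "real (ndiv m) / sqrt (real m) \<le> real N / 1"
          using nN[OF m] B1[OF m] by (intro frac_le) auto
        thus "norm (complex_of_real (real (ndiv m) / sqrt (real m))) \<le> real N" by (simp add: norm_divide)
      qed
      also have "\<dots> \<le> real N * real N" using cB by (simp add: mult_right_mono)
      finally show "(\<Sum>m\<in>B. norm (complex_of_real (real (ndiv m) / sqrt (real m)))) \<le> (real N)\<^sup>2"
        by (simp add: power2_eq_square)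
      show "1 / (2 * real Q * (real N)\<^sup>2) \<le> 1 / (2 * real j * (real N)\<^sup>2)"
        using J(3)[OF j] assms by (intro divide_left_mono mult_right_mono mult_pos_pos) auto
    qed (use assms in \<open>auto intro!: sum_nonneg\<close>)
    also have "((real N)\<^sup>2)\<^sup>2 / (1 / (2 * real Q * (real N)\<^sup>2)) = 2 * real Q * real N ^ 6"
      by (simp add: power_mult[symmetric] power_add[symmetric] mult_ac flip: power_mult power_add)
    finally show ?thesis by simp
  qed
  have A1: "integral {real U..2 * real U} (\<lambda>u. norm (A j u)) \<le> real U * sqrt D + real Q * real N ^ 6" if j: "j \<in> J" for j
  proof -
    \<comment> \<open>The pointwise inequality \<open>2 * s * x \<le> x^2 + s^2\<close> replaces
      Cauchy-Schwarz for integrals; \<open>s = sqrt D\<close> balances its two sides.\<close>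
    define s where "s = sqrt D"
    have s: "s \<ge> 1" "s * s = D" using D1 by (auto simp: s_def)
    have "integral {real U..2 * real U} (\<lambda>u. norm (A j u)) \<le> integral {real U..2 * real U} (\<lambda>u. (norm (A j u))\<^sup>2 * (1 / (2 * s)) + s / 2)"
    proof (rule integral_le)
      fix u
      have "0 \<le> (norm (A j u) - s)\<^sup>2" by simp
      hence "2 * s * norm (A j u) \<le> (norm (A j u))\<^sup>2 + s * s" by (simp add: power2_eq_square algebra_simps)
      thus "norm (A j u) \<le> (norm (A j u))\<^sup>2 * (1 / (2 * s)) + s / 2" using s by (simp add: field_simps)
    qed (use s in \<open>auto intro!: integrable_continuous_interval continuous_intros contA\<close>)
    also have "\<dots> = integral {real U..2 * real U} (\<lambda>u. (norm (A j u))\<^sup>2) * (1 / (2 * s)) + real U * (s / 2)"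
      using s by (subst integral_add) (auto intro!: integrable_continuous_interval continuous_intros contA)
    also have "\<dots> \<le> (real U * D + 2 * real Q * real N ^ 6) * (1 / (2 * s)) + real U * (s / 2)"
      using s A2[OF j] by (intro add_right_mono mult_right_mono) auto
    also have "\<dots> = real U * s + real Q * real N ^ 6 * (1 / s)"
      using s by (simp add: field_simps)
    also have "\<dots> \<le> real U * s + real Q * real N ^ 6 * 1"
      using s by (intro add_left_mono mult_left_mono) auto
    finally show ?thesis by (simp add: s_def)
  qed
  have pw: "norm (\<Sum>m\<in>B. \<Sum>j\<in>J. of_real (real (ndiv m) * mu j) * wave_deriv U (j\<^sup>2 * m) u) \<le>
      (\<Sum>j\<in>J. (real N)\<^sup>2 / real U + 2 * norm (A j u))" if u: "u \<in> {real U..2 * real U}" for u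
  proof -
    define p1 p2 where "p1 = (3 * real U - 2 * u) / (real U)\<^sup>2" and "p2 = (u - real U) * (2 * real U - u) / (real U)\<^sup>2"
    have "\<bar>p1\<bar> = \<bar>3 * real U - 2 * u\<bar> / (real U)\<^sup>2" by (simp add: p1_def)
    also have "\<dots> \<le> real U / (real U)\<^sup>2" using u by (intro divide_right_mono) auto
    also have "\<dots> = 1 / real U" by (simp add: power2_eq_square)
    finally have p1: "\<bar>p1\<bar> \<le> 1 / real U" .
    have p2: "0 \<le> p2" "p2 \<le> 1 / 4"
      using bump_bounds[of "real U" u] bump_eq[of "real U" u] u assms by (auto simp: p2_def)
    have "(\<Sum>m\<in>B. \<Sum>j\<in>J. of_real (real (ndiv m) * mu j) * wave_deriv U (j\<^sup>2 * m) u) =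
      (\<Sum>j\<in>J. \<Sum>m\<in>B. of_real (real (ndiv m) * mu j) * wave_deriv U (j\<^sup>2 * m) u)" by (rule sum.swap)
    also have "norm \<dots> \<le> (\<Sum>j\<in>J. (real N)\<^sup>2 / real U + 2 * norm (A j u))"
    proof (rule sum_norm_le)
      fix j assume j: "j \<in> J"
      hence j1: "j \<ge> 1" using J by blast
      have "(\<Sum>m\<in>B. of_real (real (ndiv m) * mu j) * wave_deriv U (j\<^sup>2 * m) u) =
         of_real (mu j) * ((\<Sum>m\<in>B. of_real (real (ndiv m) * p1) * ee (u / sqrt (real (j\<^sup>2 * m)))) + of_real p2 * (2 * of_real pi * \<i> / of_nat j) * A j u)"
        unfolding A_def wave_deriv_def p1_def[symmetric] p2_def[symmetric] sum_distrib_left sum.distrib[symmetric]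
      proof (intro sum.cong refl)
        fix m assume m: "m \<in> B"
        have sq: "sqrt (real (j\<^sup>2 * m)) = real j * sqrt (real m)" by (simp add: real_sqrt_mult)
        have s0: "sqrt (real m) > 0" using B1[OF m] by simp
        show "of_real (real (ndiv m) * mu j) * ((of_real p1 + of_real p2 * (2 * of_real pi * \<i> / of_real (sqrt (real (j\<^sup>2 * m))))) * ee (u / sqrt (real (j\<^sup>2 * m)))) =
          of_real (mu j) * (of_real (real (ndiv m) * p1) * ee (u / sqrt (real (j\<^sup>2 * m))) + of_real p2 * (2 * of_real pi * \<i> / of_nat j) * (of_real (real (ndiv m) / sqrt (real m)) * ee (1 / (real j * sqrt (real m)) * u)))"
          unfolding sq using s0 j1 by (simp add: algebra_simps)
      qed
      also have "norm \<dots> \<le> 1 * ((real N)\<^sup>2 / real U + 2 * norm (A j u))"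
        unfolding norm_mult[of "of_real (mu j)"]
      proof (intro mult_mono)
        show "norm (complex_of_real (mu j)) \<le> 1" using abs_mu_le[of j] by simp
        have "norm (\<Sum>m\<in>B. of_real (real (ndiv m) * p1) * ee (u / sqrt (real (j\<^sup>2 * m)))) \<le> (\<Sum>m\<in>B. real N * (1 / real U))"
          using p1 nN by (intro sum_norm_le) (simp only: norm_mult norm_ee norm_of_real abs_mult mult_1_right abs_of_nat, intro mult_mono, auto)
        also have "\<dots> \<le> real N * (real N * (1 / real U))" using cB by (simp add: divide_right_mono mult_right_mono)
        finally have 1: "norm (\<Sum>m\<in>B. of_real (real (ndiv m) * p1) * ee (u / sqrt (real (j\<^sup>2 * m)))) \<le> (real N)\<^sup>2 / real U"
          by (simp add: power2_eq_square)
        have "p2 * (2 * pi / real j) \<le> 1 / 4 * (8 / 1)"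
          using p2 j1 pi_less_4 by (intro mult_mono frac_le) auto
        hence "norm (of_real p2 * (2 * of_real pi * \<i> / of_nat j)) \<le> 2"
          using p2 by (simp add: norm_mult norm_divide)
        hence 2: "norm (of_real p2 * (2 * of_real pi * \<i> / of_nat j) * A j u) \<le> 2 * norm (A j u)"
          unfolding norm_mult[of _ "A j u"] by (intro mult_right_mono) auto
        show "norm ((\<Sum>m\<in>B. of_real (real (ndiv m) * p1) * ee (u / sqrt (real (j\<^sup>2 * m)))) + of_real p2 * (2 * of_real pi * \<i> / of_nat j) * A j u)
          \<le> (real N)\<^sup>2 / real U + 2 * norm (A j u)"
          using 1 2 by (meson add_mono norm_triangle_ineq order_trans)
      qed auto
      finally show "norm (\<Sum>m\<in>B. of_real (real (ndiv m) * mu j) * wave_deriv U (j\<^sup>2 * m) u) \<le> (real N)\<^sup>2 / real U + 2 * norm (A j u)" by simp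
    qed
    finally show ?thesis .
  qed
  have "integral {real U..2 * real U} (\<lambda>u. norm (\<Sum>m\<in>B. \<Sum>j\<in>J. of_real (real (ndiv m) * mu j) * wave_deriv U (j\<^sup>2 * m) u)) \<le>
     integral {real U..2 * real U} (\<lambda>u. \<Sum>j\<in>J. (real N)\<^sup>2 / real U + 2 * norm (A j u))"
    by (intro integral_le pw integrable_continuous_interval continuous_intros contA continuous_wave_deriv)
  also have "\<dots> = (\<Sum>j\<in>J. integral {real U..2 * real U} (\<lambda>u. (real N)\<^sup>2 / real U + 2 * norm (A j u)))"
    by (intro integral_sum J integrable_continuous_interval continuous_intros contA)
  also have "\<dots> = (\<Sum>j\<in>J. (real N)\<^sup>2 + 2 * integral {real U..2 * real U} (\<lambda>u. norm (A j u)))"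
    using assms by (intro sum.cong refl, subst integral_add) (auto intro!: integrable_continuous_interval continuous_intros contA)
  also have "\<dots> \<le> (\<Sum>j\<in>J. real N ^ 6 * real Q * 2 + 2 * (real U * sqrt D + real Q * real N ^ 6))"
  proof (intro sum_mono add_mono mult_left_mono A1)
    have "(real N)\<^sup>2 * 1 * 1 \<le> real N ^ 6 * real Q * 2"
      using assms by (intro mult_mono power_increasing) auto
    thus "(real N)\<^sup>2 \<le> real N ^ 6 * real Q * 2" by simp
  qed auto
  also have "\<dots> = real (card J) * (2 * (real U * sqrt D + 2 * real Q * real N ^ 6))"
    by (simp add: algebra_simps)
  also have "\<dots> \<le> real Q * (2 * (real U * sqrt D + 2 * real Q * real N ^ 6))"
    using J D1 by (intro mult_right_mono) auto
  finally show ?thesis unfolding J_def by (simp add: mult_ac)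
qed

text \<open>
  Two integrations by parts: the boundary terms vanish with the bump, and each step saves a factor
  \<open>U\<close> over the trivial bound.
\<close>

lemma exp_wave_deriv_integral:
  fixes s :: complex and U n :: nat
  assumes "U \<ge> 1" "n \<ge> 1" "norm (s - 1) \<le> 1 / 8"
  shows "norm (integral {real U..2 * real U} (\<lambda>u. exp (s * of_real (ln (u\<^sup>2))) * wave_deriv U n u)) \<le> 8 * sqrt (real n) * (2 * real U) powr (5 / 4)"
proof -
  define \<kappa> where "\<kappa> = 1 / sqrt (real n)"
  define c where "c = 2 * of_real pi * \<i> * complex_of_real \<kappa>"
  have \<kappa>: "\<kappa> > 0" using assms by (simp add: \<kappa>_def)
  have c0: "c \<noteq> 0" using \<kappa> by (simp add: c_def)
  define p where "p = (\<lambda>z::complex. (z - of_nat U) * (2 * of_nat U - z) / (of_nat U)\<^sup>2)"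
  define p' where "p' = (\<lambda>z::complex. (3 * of_nat U - 2 * z) / (of_nat U)\<^sup>2)"
  define G where "G = (\<lambda>z. 2 * s * exp ((2 * s - 1) * Ln z) * p z)"
  define G' where "G' = (\<lambda>z. 2 * s * exp ((2 * s - 1) * Ln z) * ((2 * s - 1) / z * p z + p' z))"
  \<comment> \<open>An antiderivative of \<open>E - W\<close>: its first term undoes the derivative
    in \<open>wave_deriv\<close>, and the second integrates the resulting
    \<open>G z * exp (c * z)\<close> by parts. Both contain \<open>p\<close>, so \<open>V\<close>
    vanishes at the two ends.\<close>
  define V where "V = (\<lambda>z. exp (2 * s * Ln z) * (p z * exp (c * z)) - G z * exp (c * z) / c)"
  define W where "W = (\<lambda>u::real. G' (of_real u) * exp (c * of_real u) / c)"
  define E where "E = (\<lambda>u::real. exp (s * of_real (ln (u\<^sup>2))) * wave_deriv U n u)"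
  have dp: "(p has_field_derivative p' z) (at z)" for z
    unfolding p_def[abs_def] p'_def using assms
    by (auto intro!: derivative_eq_intros simp: divide_simps algebra_simps)
  have s_b: "norm s \<le> 9 / 8" "norm (2 * s - 1) \<le> 5 / 4" "Re s \<le> 9 / 8" "Re s \<ge> 7 / 8"
  proof -
    have "norm s \<le> norm (s - 1) + norm (1::complex)" using norm_triangle_ineq[of "s - 1" 1] by simp
    thus "norm s \<le> 9 / 8" using assms by simp
    have "2 * s - 1 = 2 * (s - 1) + 1" by simp
    hence "norm (2 * s - 1) \<le> norm (2 * (s - 1)) + norm (1::complex)" by (metis norm_triangle_ineq)
    also have "norm (2 * (s - 1)) = 2 * norm (s - 1)" by (simp only: norm_mult) simp
    finally show "norm (2 * s - 1) \<le> 5 / 4" using assms by simp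
    have "\<bar>Re (s - 1)\<bar> \<le> 1 / 8" using abs_Re_le_cmod[of "s - 1"] assms by linarith
    hence "\<bar>Re s - 1\<bar> \<le> 1 / 8" by simp
    thus "Re s \<le> 9 / 8" "Re s \<ge> 7 / 8" by linarith+
  qed
  have dV: "((\<lambda>u. V (of_real u)) has_vector_derivative (E u - W u)) (at u within A)" if u: "u > 0" for u A
  proof -
    define z where "z = complex_of_real u"
    have z: "z \<notin> \<real>\<^sub>\<le>\<^sub>0" "z \<noteq> 0" using u by (auto simp: z_def)
    have e1: "exp (2 * s * Ln z) / z = exp ((2 * s - 1) * Ln z)"
      using z by (simp add: left_diff_distrib exp_diff)
    have dG: "(G has_field_derivative G' z) (at z)"
      unfolding G_def[abs_def] G'_def using z
      by (auto intro!: derivative_eq_intros dp simp: inverse_eq_divide algebra_simps diff_divide_distrib)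
    have "(V has_field_derivative ((2 * s / z) * exp (2 * s * Ln z) * (p z * exp (c * z)) +
        exp (2 * s * Ln z) * (p' z * exp (c * z) + p z * (c * exp (c * z))) -
        (G' z * exp (c * z) + G z * (c * exp (c * z))) / c)) (at z)"
      unfolding V_def[abs_def] using z c0 
      by (auto intro!: derivative_eq_intros dp dG simp: inverse_eq_divide algebra_simps add_divide_distrib)
    also have "(2 * s / z) * exp (2 * s * Ln z) * (p z * exp (c * z)) = G z * exp (c * z)"
      unfolding G_def e1[symmetric] by simp
    also have "G z * exp (c * z) + exp (2 * s * Ln z) * (p' z * exp (c * z) + p z * (c * exp (c * z))) -
        (G' z * exp (c * z) + G z * (c * exp (c * z))) / c = exp (2 * s * Ln z) * ((p' z + p z * c) * exp (c * z)) - G' z * exp (c * z) / c"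
      using c0 by (simp add: field_simps)
    also have "\<dots> = E u - W u"
    proof -
      have "Ln z = of_real (ln u)" using u by (simp add: z_def Ln_of_real)
      moreover have "ln (u\<^sup>2) = 2 * ln u" using u by (simp add: ln_realpow)
      ultimately have "exp (2 * s * Ln z) = exp (s * of_real (ln (u\<^sup>2)))" by (simp add: mult_ac)
      moreover have "(p' z + p z * c) * exp (c * z) = wave_deriv U n u"
        unfolding wave_deriv_def p_def p'_def ee_conv_exp c_def \<kappa>_def z_def by simp
      ultimately show ?thesis by (simp add: E_def W_def z_def)
    qed
    finally show ?thesis unfolding z_def by (rule has_vector_derivative_real_field)
  qed
  have "((\<lambda>u. E u - W u) has_integral (V (of_real (2 * real U)) - V (of_real (real U)))) {real U..2 * real U}"
    using assms by (intro fundamental_theorem_of_calculus dV) auto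
  moreover have "V (of_real (2 * real U)) = 0" "V (of_real (real U)) = 0"
    by (simp_all add: V_def G_def p_def)
  ultimately have hi: "((\<lambda>u. E u - W u) has_integral 0) {real U..2 * real U}" by simp
  have contW: "continuous_on {real U..2 * real U} W"
    unfolding W_def G'_def p_def p'_def using c0 assms
    by (intro continuous_intros) (auto simp: complex_nonpos_Reals_iff)
  hence "W integrable_on {real U..2 * real U}" by (rule integrable_continuous_interval)
  from has_integral_add[OF hi integrable_integral[OF this]]
  have "integral {real U..2 * real U} E = integral {real U..2 * real U} W"
    by (simp add: integral_unique)
  also have "norm \<dots> \<le> (8 * sqrt (real n) * (2 * real U) powr (1 / 4)) * (2 * real U - real U)"
  proof (rule integral_bound)
    fix u assume u: "u \<in> {real U..2 * real U}"
    have u0: "u > 0" using u assms by auto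
    define x where "x = (2 * real U) powr (1 / 4)"
    have "norm (exp ((2 * s - 1) * Ln (of_real u))) = u powr (2 * Re s - 1)"
      using u0 by (simp add: Ln_of_real powr_def)
    moreover have "u powr (2 * Re s - 1) = u * u powr (2 * Re s - 2)"
      using u0 powr_add[of u 1 "2 * Re s - 2"] by simp
    moreover have "u powr (2 * Re s - 2) \<le> x"
    proof -
      \<comment> \<open>Here the radius 1/8 enters: \<open>2 * Re s - 2\<close> is at most 1/4, so
        the final bound has \<open>U powr (5 / 4)\<close>, well below \<open>U^2\<close>.\<close>
      have "u powr (2 * Re s - 2) \<le> u powr (1 / 4)" using s_b u assms by (intro powr_mono) auto
      also have "\<dots> \<le> x" unfolding x_def using u u0 by (intro powr_mono2) auto
      finally show ?thesis .
    qed
    ultimately have ex: "norm (exp ((2 * s - 1) * Ln (of_real u))) \<le> u * x" using u0 by simp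
    have pr: "p (of_real u) = of_real (bump (real U) u)" using u bump_eq[of "real U" u] by (simp add: p_def)
    have "norm ((2 * s - 1) / of_real u * p (of_real u)) \<le> 5 / 4 / u * (1 / 4)"
      unfolding pr norm_mult norm_divide norm_of_real
    proof (rule mult_mono)
      show "norm (2 * s - 1) / \<bar>u\<bar> \<le> 5 / 4 / u" using s_b u0 by (auto intro!: divide_right_mono simp: field_simps)
    qed (use u0 bump_bounds[of "real U" u] assms in auto)
    moreover have "norm (p' (of_real u)) \<le> 2 / u"
    proof -
      have "p' (of_real u) = of_real ((3 * real U - 2 * u) / (real U)\<^sup>2)" by (simp add: p'_def)
      hence "norm (p' (of_real u)) = \<bar>3 * real U - 2 * u\<bar> / (real U)\<^sup>2" by (simp only: norm_of_real) simp
      also have "\<dots> \<le> real U / (real U)\<^sup>2" using u by (intro divide_right_mono) auto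
      also have "\<dots> = 1 / real U" by (simp add: power2_eq_square)
      also have "\<dots> \<le> 2 / u" using u u0 assms by (simp add: field_simps)
      finally show ?thesis .
    qed
    ultimately have pp: "norm ((2 * s - 1) / of_real u * p (of_real u) + p' (of_real u)) \<le> 5 / 4 / u * (1 / 4) + 2 / u"
      by (meson add_mono norm_triangle_ineq order_trans)
    have "norm (G' (of_real u)) \<le> (9 / 4) * (u * x) * (5 / 4 / u * (1 / 4) + 2 / u)"
      unfolding G'_def norm_mult using s_b ex pp u0 by (intro mult_mono) (auto simp: x_def)
    also have "\<dots> \<le> 8 * x" using u0 by (simp add: field_simps x_def)
    finally have "norm (G' (of_real u)) \<le> 8 * x" .
    moreover have "norm (exp (c * of_real u)) = 1" by (simp add: c_def)
    moreover have nc: "norm c \<ge> \<kappa>"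
    proof -
      have "norm c = 2 * pi * \<kappa>" using \<kappa> by (simp add: c_def norm_mult)
      thus ?thesis using \<kappa> pi_ge_two by (simp add: mult_le_cancel_right1)
    qed
    ultimately have "norm (W u) \<le> 8 * x / \<kappa>"
      unfolding W_def norm_divide norm_mult using \<kappa> by (intro frac_le) (auto simp: x_def)
    thus "norm (W u) \<le> 8 * sqrt (real n) * (2 * real U) powr (1 / 4)" by (simp add: \<kappa>_def x_def mult_ac)
  qed (use contW in auto)
  also have "\<dots> \<le> 8 * sqrt (real n) * ((2 * real U) powr (1 / 4) * (2 * real U) powr 1)"
    using assms by (simp add: mult_left_mono)
  also have "(2 * real U) powr (1 / 4) * (2 * real U) powr 1 = (2 * real U) powr (5 / 4)"
    by (subst powr_add[symmetric]) simp
  finally show ?thesis unfolding E_def .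
qed

text \<open>\<open>R\<close> depends on \<open>u\<close> only through the powers
  \<open>exp (\<gamma> t * ln (u^2))\<close>. Exchanging the two integrals reduces the claim to
  single powers, and the supremum of \<open>h\<close> gives a constant independent of
  \<open>U\<close> and \<open>n\<close>.\<close>

lemma residue_wave_deriv_integral:
  fixes h \<gamma> :: "real \<Rightarrow> complex" and R :: "real \<Rightarrow> complex"
  assumes h: "continuous_on {0..1} h" and \<gamma>: "continuous_on {0..1} \<gamma>"
    and \<gamma>1: "\<And>t. t \<in> {0..1} \<Longrightarrow> norm (\<gamma> t - 1) \<le> 1 / 8"
    and R: "\<And>x. x > 0 \<Longrightarrow> R x = integral {0..1} (\<lambda>t. h t * exp (\<gamma> t * of_real (ln x)))"
  obtains C where "C \<ge> 0" "\<And>U n. U \<ge> 1 \<Longrightarrow> n \<ge> 1 \<Longrightarrow>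
     (\<lambda>u. R (u\<^sup>2) * wave_deriv U n u) integrable_on {real U..2 * real U} \<and>
     norm (integral {real U..2 * real U} (\<lambda>u. R (u\<^sup>2) * wave_deriv U n u)) \<le> C * sqrt (real n) * (2 * real U) powr (5 / 4)"
proof -
  have "compact (h ` {0..1})" by (intro compact_continuous_image h) auto
  then obtain M where M: "\<And>t. t \<in> {0..1} \<Longrightarrow> norm (h t) \<le> M"
    by (meson bounded_iff compact_imp_bounded imageI)
  have M0: "M \<ge> 0" using order_trans[OF norm_ge_zero M[of 0]] by simp
  show ?thesis
  proof (rule that[of "M * 8"])
    show "M * 8 \<ge> 0" using M0 by simp
    fix U n :: nat assume U: "U \<ge> 1" and n: "n \<ge> 1"
    define f where "f = (\<lambda>u t. h t * exp (\<gamma> t * of_real (ln (u\<^sup>2))) * wave_deriv U n u)"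
    have cont: "continuous_on (cbox (real U, 0) (2 * real U, 1)) (\<lambda>(u, t). f u t)"
    proof -
      have c1: "continuous_on (cbox (real U, 0::real) (2 * real U, 1)) (\<lambda>x. h (snd x))"
        by (rule continuous_on_compose2[OF h]) (auto intro!: continuous_intros simp: cbox_Pair_eq)
      have c2: "continuous_on (cbox (real U, 0::real) (2 * real U, 1)) (\<lambda>x. \<gamma> (snd x))"
        by (rule continuous_on_compose2[OF \<gamma>]) (auto intro!: continuous_intros simp: cbox_Pair_eq)
      have c3: "continuous_on (cbox (real U, 0::real) (2 * real U, 1)) (\<lambda>x. wave_deriv U n (fst x))"
        by (rule continuous_on_compose2[OF continuous_wave_deriv[of UNIV]]) (auto intro!: continuous_intros)
      show ?thesis unfolding f_def case_prod_unfold
        by (intro continuous_intros c1 c2 c3) (use U in \<open>auto simp: cbox_Pair_eq\<close>)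
    qed
    have inner: "R (u\<^sup>2) * wave_deriv U n u = integral {0..1} (\<lambda>t. f u t)" if "u \<in> {real U..2 * real U}" for u
    proof -
      have "u > 0" using that U by auto
      hence "R (u\<^sup>2) = integral {0..1} (\<lambda>t. h t * exp (\<gamma> t * of_real (ln (u\<^sup>2))))" by (intro R) auto
      thus ?thesis unfolding f_def by simp
    qed
    have ci: "continuous_on (cbox (real U) (2 * real U)) (\<lambda>u. integral (cbox 0 1) (f u))"
      by (rule integral_continuous_on_param) (use cont in \<open>simp add: cbox_Pair_eq\<close>)
    have "(\<lambda>u. R (u\<^sup>2) * wave_deriv U n u) integrable_on {real U..2 * real U}"
    proof -
      have "(\<lambda>u. integral {0..1} (f u)) integrable_on {real U..2 * real U}"
        using ci by (intro integrable_continuous_interval) auto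
      thus ?thesis using inner by (subst integrable_cong) auto
    qed
    moreover have "norm (integral {real U..2 * real U} (\<lambda>u. R (u\<^sup>2) * wave_deriv U n u)) \<le> M * 8 * sqrt (real n) * (2 * real U) powr (5 / 4)"
    proof -
      have "integral {real U..2 * real U} (\<lambda>u. R (u\<^sup>2) * wave_deriv U n u) = integral {real U..2 * real U} (\<lambda>u. integral {0..1} (\<lambda>t. f u t))"
        by (rule integral_cong) (rule inner)
      also have "\<dots> = integral {0..1} (\<lambda>t. integral {real U..2 * real U} (\<lambda>u. f u t))"
        using integral_swap_continuous[OF cont] by simp
      also have "norm \<dots> \<le> (M * (8 * sqrt (real n) * (2 * real U) powr (5 / 4))) * (1 - 0)"
      proof (rule integral_bound)
        have "continuous_on (cbox (0, real U) (1, 2 * real U)) (\<lambda>(t, u). f u t)"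
        proof -
          have "continuous_on (cbox (0::real, real U) (1, 2 * real U)) (\<lambda>x. (\<lambda>(u, t). f u t) (snd x, fst x))"
            by (rule continuous_on_compose2[OF cont]) (auto intro!: continuous_intros simp: cbox_Pair_eq)
          thus ?thesis by (simp add: case_prod_unfold)
        qed
        hence "continuous_on (cbox 0 1) (\<lambda>t. integral (cbox (real U) (2 * real U)) (\<lambda>u. f u t))"
          by (intro integral_continuous_on_param) (simp add: cbox_Pair_eq)
        thus "continuous_on {0..1} (\<lambda>t. integral {real U..2 * real U} (\<lambda>u. f u t))" by simp
        fix t :: real assume t: "t \<in> {0..1}"
        have "integral {real U..2 * real U} (\<lambda>u. f u t) = h t * integral {real U..2 * real U} (\<lambda>u. exp (\<gamma> t * of_real (ln (u\<^sup>2))) * wave_deriv U n u)"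
          unfolding f_def mult.assoc by simp
        also have "norm \<dots> \<le> M * (8 * sqrt (real n) * (2 * real U) powr (5 / 4))"
          unfolding norm_mult using M[OF t] M0 by (intro mult_mono exp_wave_deriv_integral U n \<gamma>1 t) auto
        finally show "norm (integral {real U..2 * real U} (\<lambda>u. f u t)) \<le> M * (8 * sqrt (real n) * (2 * real U) powr (5 / 4))" .
      qed auto
      finally show ?thesis by (simp add: mult_ac)
    qed
    ultimately show "(\<lambda>u. R (u\<^sup>2) * wave_deriv U n u) integrable_on {real U..2 * real U} \<and>
     norm (integral {real U..2 * real U} (\<lambda>u. R (u\<^sup>2) * wave_deriv U n u)) \<le> M * 8 * sqrt (real n) * (2 * real U) powr (5 / 4)" ..
  qed
qed

section \<open>Dirichlet series\<close>

text \<open>A bound on all finite sums rather than mere summability: the explicit \<open>K\<close>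
  passes through convolutions and can be kept uniform over the partial Euler products.\<close>

definition dirichlet_bound :: "(nat \<Rightarrow> complex) \<Rightarrow> real \<Rightarrow> real \<Rightarrow> bool" where
  "dirichlet_bound a \<sigma> K \<longleftrightarrow> (\<forall>X. (\<Sum>n\<in>{1..X}. norm (a n) * real n powr (- \<sigma>)) \<le> K)"

definition dirichlet_term :: "(nat \<Rightarrow> complex) \<Rightarrow> complex \<Rightarrow> nat \<Rightarrow> complex" where
  "dirichlet_term a s n = a n * of_nat n powr (- s)"

text \<open>Summation is unordered, so that a product of two series can be regrouped along
  divisors.\<close>

definition dirichlet :: "(nat \<Rightarrow> complex) \<Rightarrow> complex \<Rightarrow> complex" where
  "dirichlet a s = (\<Sum>\<^sub>\<infinity>n\<in>{1..}. dirichlet_term a s n)"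

definition dirichlet_conv :: "(nat \<Rightarrow> complex) \<Rightarrow> (nat \<Rightarrow> complex) \<Rightarrow> nat \<Rightarrow> complex" where
  "dirichlet_conv a b n = (\<Sum>d\<in>{d. d dvd n}. a d * b (n div d))"

definition unit1 :: "nat \<Rightarrow> complex" where
  "unit1 n = (if n = 1 then 1 else 0)"

section \<open>Absolutely convergent Dirichlet series and convolution\<close>

lemma nboundD: "dirichlet_bound a \<sigma> K \<Longrightarrow> (\<Sum>n\<in>{1..X}. norm (a n) * real n powr (- \<sigma>)) \<le> K"
  by (simp add: dirichlet_bound_def)

lemma dirichlet_bound_nonneg: "dirichlet_bound a \<sigma> K \<Longrightarrow> K \<ge> 0"
  using nboundD[of a \<sigma> K 0] by simp

lemma dirichlet_bound_mono:
  assumes "dirichlet_bound a \<sigma> K" "\<sigma> \<le> \<sigma>'"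
  shows "dirichlet_bound a \<sigma>' K"
  unfolding dirichlet_bound_def
proof
  fix X
  have "(\<Sum>n\<in>{1..X}. norm (a n) * real n powr (- \<sigma>')) \<le> (\<Sum>n\<in>{1..X}. norm (a n) * real n powr (- \<sigma>))"
    using assms(2) by (intro sum_mono mult_left_mono powr_mono) auto
  thus "(\<Sum>n\<in>{1..X}. norm (a n) * real n powr (- \<sigma>')) \<le> K" using nboundD[OF assms(1), of X] by linarith
qed

lemma norm_dirichlet_term:
  assumes "n \<ge> 1"
  shows "norm (dirichlet_term a s n) = norm (a n) * real n powr (- Re s)"
proof -
  have "norm (of_nat n powr (- s)) = real n powr Re (- s)"
    using norm_powr_real_powr[of "of_nat n" "- s"] assms by simp
  thus ?thesis by (simp add: dirichlet_term_def norm_mult)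
qed

lemma dirichlet_bound_abs_summable:
  assumes "dirichlet_bound a \<sigma> K" "Re s \<ge> \<sigma>"
  shows "(\<lambda>n. norm (dirichlet_term a s n)) summable_on {1..}" and "norm (dirichlet a s) \<le> K"
proof -
  have fin: "(\<Sum>n\<in>F. norm (dirichlet_term a s n)) \<le> K" if F: "finite F" "F \<subseteq> {1..}" for F
  proof -
    have "F \<subseteq> {1..Max (insert 0 F)}" using F by auto
    hence "(\<Sum>n\<in>F. norm (dirichlet_term a s n)) \<le> (\<Sum>n\<in>{1..Max (insert 0 F)}. norm (dirichlet_term a s n))"
      by (intro sum_mono2) auto
    also have "\<dots> = (\<Sum>n\<in>{1..Max (insert 0 F)}. norm (a n) * real n powr (- Re s))"
      by (intro sum.cong refl norm_dirichlet_term) auto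
    also have "\<dots> \<le> K" using nboundD[OF dirichlet_bound_mono[OF assms]] .
    finally show ?thesis .
  qed
  show abs: "(\<lambda>n. norm (dirichlet_term a s n)) summable_on {1..}"
    by (rule nonneg_bdd_above_summable_on) (auto intro!: bdd_aboveI[of _ K] fin)
  have "((\<lambda>n. norm (dirichlet_term a s n)) has_sum (\<Sum>\<^sub>\<infinity>n\<in>{1..}. norm (dirichlet_term a s n))) {1..}"
    using abs by (rule has_sum_infsum)
  moreover have "(dirichlet_term a s has_sum dirichlet a s) {1..}"
    unfolding dirichlet_def by (rule has_sum_infsum[OF abs_summable_summable[OF abs]])
  ultimately have "norm (dirichlet a s) \<le> (\<Sum>\<^sub>\<infinity>n\<in>{1..}. norm (dirichlet_term a s n))"
    by (rule norm_has_sum_bound)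
  also have "\<dots> \<le> K" by (rule infsum_le_finite_sums[OF abs]) (use fin in auto)
  finally show "norm (dirichlet a s) \<le> K" .
qed

lemma has_sum_dirichlet: "dirichlet_bound a \<sigma> K \<Longrightarrow> Re s \<ge> \<sigma> \<Longrightarrow> (dirichlet_term a s has_sum dirichlet a s) {1..}"
  unfolding dirichlet_def by (rule has_sum_infsum[OF abs_summable_summable[OF dirichlet_bound_abs_summable(1)]])

lemma has_sum_atLeast_1_Suc: "(f has_sum x) {1..} \<longleftrightarrow> ((\<lambda>n. f (Suc n)) has_sum x) (UNIV :: nat set)"
  by (rule has_sum_reindex_bij_witness[of _ Suc "\<lambda>n. n - 1"]) auto

lemma sums_dirichlet:
  assumes "dirichlet_bound a \<sigma> K" "Re s \<ge> \<sigma>"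
  shows "(\<lambda>n. dirichlet_term a s (Suc n)) sums dirichlet a s"
  using has_sum_dirichlet[OF assms] unfolding has_sum_atLeast_1_Suc by (rule has_sum_imp_sums)

lemma sum_divisor_pairs:
  fixes \<phi> :: "nat \<Rightarrow> nat \<Rightarrow> 'a :: comm_monoid_add"
  shows "(\<Sum>n\<in>{1..X}. \<Sum>d\<in>{d. d dvd n}. \<phi> d (n div d)) = (\<Sum>(d, e)\<in>{p\<in>{1..X} \<times> {1..X}. fst p * snd p \<le> X}. \<phi> d e)"
proof -
  have "(\<Sum>n\<in>{1..X}. \<Sum>d\<in>{d. d dvd n}. \<phi> d (n div d)) =
     (\<Sum>(n, d)\<in>Sigma {1..X} (\<lambda>n. {d. d dvd n}). \<phi> d (n div d))"
    by (rule sum.Sigma) (auto intro: finite_divisors)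
  also have "\<dots> = (\<Sum>(d, e)\<in>{p\<in>{1..X} \<times> {1..X}. fst p * snd p \<le> X}. \<phi> d e)"
  proof (rule sum.reindex_bij_witness[of _ "\<lambda>(d, e). (d * e, d)" "\<lambda>(n, d). (d, n div d)"])
    fix p assume "p \<in> Sigma {1..X} (\<lambda>n. {d. d dvd n})"
    then obtain n d where p: "p = (n, d)" "1 \<le> n" "n \<le> X" "d dvd n" by auto
    then obtain k where k: "n = d * k" by auto
    have "d > 0" "k > 0" using p k by (auto intro: Nat.gr0I)
    moreover have "d \<le> n" "k \<le> n" using k p by (auto intro!: dvd_imp_le)
    hence "d \<le> X" "k \<le> X" using p by auto
    ultimately show "(case p of (n, d) \<Rightarrow> (d, n div d)) \<in> {p\<in>{1..X} \<times> {1..X}. fst p * snd p \<le> X}"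
      using p k by auto
  qed (auto simp: Suc_le_eq)
  finally show ?thesis .
qed

text \<open>Because \<open>\<phi>\<close> vanishes past \<open>X\<close>, the hyperbolic condition
  \<open>d * e \<le> X\<close> can be relaxed to a square.\<close>

lemma sum_dirichlet_conv:
  assumes "\<And>n. n > X \<Longrightarrow> \<phi> n = 0"
  shows "(\<Sum>n\<in>{1..X}. dirichlet_conv a b n * \<phi> n) = (\<Sum>d\<in>{1..X}. \<Sum>e\<in>{1..X}. a d * b e * \<phi> (d * e))"
proof -
  have "(\<Sum>n\<in>{1..X}. dirichlet_conv a b n * \<phi> n) = (\<Sum>n\<in>{1..X}. \<Sum>d\<in>{d. d dvd n}. a d * b (n div d) * \<phi> (d * (n div d)))"
    unfolding dirichlet_conv_def sum_distrib_right by (intro sum.cong refl) auto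
  also have "\<dots> = (\<Sum>(d, e)\<in>{p\<in>{1..X} \<times> {1..X}. fst p * snd p \<le> X}. a d * b e * \<phi> (d * e))"
    by (rule sum_divisor_pairs)
  also have "\<dots> = (\<Sum>(d, e)\<in>{1..X} \<times> {1..X}. a d * b e * \<phi> (d * e))"
    by (rule sum.mono_neutral_left) (auto simp: not_le intro!: assms)
  finally show ?thesis by (simp add: sum.cartesian_product)
qed

lemma dirichlet_bound_dirichlet_conv:
  assumes "dirichlet_bound a \<sigma> K" "dirichlet_bound b \<sigma> K'"
  shows "dirichlet_bound (dirichlet_conv a b) \<sigma> (K * K')"
  unfolding dirichlet_bound_def
proof
  fix X
  define A where "A = (\<lambda>n. norm (a n) * real n powr (- \<sigma>))"
  define B where "B = (\<lambda>n. norm (b n) * real n powr (- \<sigma>))"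
  have AB: "A n \<ge> 0" "B n \<ge> 0" for n by (auto simp: A_def B_def)
  have "(\<Sum>n\<in>{1..X}. norm (dirichlet_conv a b n) * real n powr (- \<sigma>)) \<le> (\<Sum>n\<in>{1..X}. \<Sum>d\<in>{d. d dvd n}. A d * B (n div d))"
  proof (rule sum_mono)
    fix n
    have "norm (dirichlet_conv a b n) * real n powr (- \<sigma>) \<le> (\<Sum>d\<in>{d. d dvd n}. norm (a d) * norm (b (n div d))) * real n powr (- \<sigma>)"
      unfolding dirichlet_conv_def by (intro mult_right_mono sum_norm_le) (auto simp: norm_mult)
    also have "\<dots> = (\<Sum>d\<in>{d. d dvd n}. A d * B (n div d))"
      unfolding sum_distrib_right
    proof (rule sum.cong)
      fix d assume "d \<in> {d. d dvd n}"
      hence "real n = real d * real (n div d)" by (metis dvd_mult_div_cancel mem_Collect_eq of_nat_mult)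
      hence "real n powr (- \<sigma>) = real d powr (- \<sigma>) * real (n div d) powr (- \<sigma>)"
        by (metis of_nat_0_le_iff powr_mult)
      thus "norm (a d) * norm (b (n div d)) * real n powr (- \<sigma>) = A d * B (n div d)"
        by (simp add: A_def B_def)
    qed simp
    finally show "norm (dirichlet_conv a b n) * real n powr (- \<sigma>) \<le> (\<Sum>d\<in>{d. d dvd n}. A d * B (n div d))" .
  qed
  also have "\<dots> = (\<Sum>(d, e)\<in>{p\<in>{1..X} \<times> {1..X}. fst p * snd p \<le> X}. A d * B e)"
    by (rule sum_divisor_pairs)
  also have "\<dots> \<le> (\<Sum>(d, e)\<in>{1..X} \<times> {1..X}. A d * B e)"
    using AB by (intro sum_mono2) auto
  also have "\<dots> = (\<Sum>d\<in>{1..X}. A d) * (\<Sum>e\<in>{1..X}. B e)"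
    by (simp add: sum_product sum.cartesian_product)
  also have "\<dots> \<le> K * K'"
    using nboundD[OF assms(1)] nboundD[OF assms(2)] dirichlet_bound_nonneg[OF assms(1)] AB
    by (intro mult_mono sum_nonneg) (auto simp: A_def B_def)
  finally show "(\<Sum>n\<in>{1..X}. norm (dirichlet_conv a b n) * real n powr (- \<sigma>)) \<le> K * K'" .
qed

lemma dirichlet_dirichlet_conv:
  assumes a: "dirichlet_bound a \<sigma> K" and b: "dirichlet_bound b \<sigma> K'" and s: "Re s \<ge> \<sigma>"
  shows "dirichlet (dirichlet_conv a b) s = dirichlet a s * dirichlet b s"
proof -
  define f where "f = (\<lambda>(x, y). dirichlet_term a s x * dirichlet_term b s y)"
  have abs: "(\<lambda>p. norm (f p)) summable_on {1..} \<times> {1..}"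
  proof -
    have "(\<lambda>x. norm (f x)) summable_on Sigma {1..} (\<lambda>_. {1..})"
    proof (rule summable_on_SigmaI)
      fix x :: nat
      show "((\<lambda>y. norm (f (x, y))) has_sum (norm (dirichlet_term a s x) * (\<Sum>\<^sub>\<infinity>y\<in>{1..}. norm (dirichlet_term b s y)))) {1..}"
        unfolding f_def norm_mult prod.case
        by (intro has_sum_cmult_right has_sum_infsum dirichlet_bound_abs_summable[OF b s])
    next
      show "(\<lambda>x. norm (dirichlet_term a s x) * (\<Sum>\<^sub>\<infinity>y\<in>{1..}. norm (dirichlet_term b s y))) summable_on {1..}"
        by (intro summable_on_cmult_left dirichlet_bound_abs_summable[OF a s])
    qed auto
    thus ?thesis by simp
  qed
  have "(f has_sum dirichlet a s * dirichlet b s) (Sigma {1..} (\<lambda>_. {1..}))"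
  proof (rule has_sum_SigmaI)
    fix x :: nat
    show "((\<lambda>y. f (x, y)) has_sum (dirichlet_term a s x * dirichlet b s)) {1..}"
      unfolding f_def prod.case by (intro has_sum_cmult_right has_sum_dirichlet[OF b s])
  next
    show "((\<lambda>x. dirichlet_term a s x * dirichlet b s) has_sum dirichlet a s * dirichlet b s) {1..}"
      by (intro has_sum_cmult_left has_sum_dirichlet[OF a s])
    show "f summable_on {1..} \<times> {1..}" by (rule abs_summable_summable[OF abs])
  qed
  also have "?this \<longleftrightarrow> ((\<lambda>(n, d). f (d, n div d)) has_sum dirichlet a s * dirichlet b s) (Sigma {1..} (\<lambda>n. {d. d dvd n}))"
  proof (rule has_sum_reindex_bij_witness[of _ "\<lambda>(n, d). (d, n div d)" "\<lambda>(d, e). (d * e, d)"])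
    fix p assume "p \<in> Sigma {1::nat..} (\<lambda>n. {d. d dvd n})"
    then obtain n d where p: "p = (n, d)" "1 \<le> n" "d dvd n" by auto
    then obtain k where k: "n = d * k" by auto
    have "d > 0" "k > 0" using p k by (auto intro: Nat.gr0I)
    thus "(case p of (n, d) \<Rightarrow> (d, n div d)) \<in> {1..} \<times> {1..}" using p k by auto
  qed (auto simp: Suc_le_eq)
  finally have "((\<lambda>(n, d). f (d, n div d)) has_sum dirichlet a s * dirichlet b s) (Sigma {1..} (\<lambda>n. {d. d dvd n}))" .
  hence "(dirichlet_term (dirichlet_conv a b) s has_sum dirichlet a s * dirichlet b s) {1..}"
  proof (rule has_sum_SigmaD)
    fix n :: nat assume n: "n \<in> {1..}"
    have "(\<Sum>d\<in>{d. d dvd n}. f (d, n div d)) = dirichlet_term (dirichlet_conv a b) s n"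
      unfolding dirichlet_term_def dirichlet_conv_def sum_distrib_right
    proof (rule sum.cong)
      fix d assume "d \<in> {d. d dvd n}"
      then obtain k where k: "n = d * k" by auto
      have "d > 0" using n k by (auto intro: Nat.gr0I)
      hence "n div d = k" using k by simp
      have "(of_nat n :: complex) powr (- s) = of_nat d powr (- s) * of_nat k powr (- s)"
        unfolding k of_nat_mult
        using powr_times_real[of "of_nat d" "of_nat k" "- s"] by simp
      thus "f (d, n div d) = a d * b (n div d) * of_nat n powr (- s)"
        by (simp add: f_def dirichlet_term_def \<open>n div d = k\<close>)
    qed simp
    thus "((\<lambda>y. case (n, y) of (n, d) \<Rightarrow> f (d, n div d)) has_sum dirichlet_term (dirichlet_conv a b) s n) {d. d dvd n}"
      using n by (intro has_sum_finiteI) (auto intro: finite_divisors)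
  qed
  thus ?thesis unfolding dirichlet_def by (simp add: infsumI)
qed

lemma dirichlet_bound_unit1: "dirichlet_bound unit1 \<sigma> 1"
  unfolding dirichlet_bound_def
proof
  fix X
  have "(\<Sum>n\<in>{1..X}. norm (unit1 n) * real n powr (- \<sigma>)) = (\<Sum>n\<in>{1..X}. if n = 1 then 1 else 0)"
    by (intro sum.cong refl) (auto simp: unit1_def)
  thus "(\<Sum>n\<in>{1..X}. norm (unit1 n) * real n powr (- \<sigma>)) \<le> 1" by simp
qed

lemma dirichlet_unit1: "dirichlet unit1 s = 1"
proof -
  have "(dirichlet_term unit1 s has_sum 1) {1..}"
    by (rule has_sum_finite_neutralI[of "{1}"]) (auto simp: dirichlet_term_def unit1_def)
  thus ?thesis unfolding dirichlet_def by (rule infsumI)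
qed

lemma dirichlet_conv_1: "dirichlet_conv a b 1 = a 1 * b 1"
  by (simp add: dirichlet_conv_def)

lemma dirichlet_power:
  assumes "dirichlet_bound b \<sigma> K" "b 1 = 1"
  shows "\<exists>c K'. dirichlet_bound c \<sigma> K' \<and> c 1 = 1 \<and> (\<forall>s. Re s \<ge> \<sigma> \<longrightarrow> dirichlet c s = dirichlet b s ^ k)"
proof (induction k)
  case 0
  show ?case using dirichlet_bound_unit1 by (intro exI[of _ unit1] exI[of _ 1]) (auto simp: dirichlet_unit1, simp add: unit1_def)
next
  case (Suc k)
  then obtain c K' where c: "dirichlet_bound c \<sigma> K'" "c 1 = 1" "\<And>s. Re s \<ge> \<sigma> \<Longrightarrow> dirichlet c s = dirichlet b s ^ k" by blast
  show ?case
    by (rule exI[of _ "dirichlet_conv b c"], rule exI[of _ "K * K'"])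
       (use c assms dirichlet_bound_dirichlet_conv dirichlet_dirichlet_conv dirichlet_conv_1 in auto)
qed

text \<open>The coefficients of \<open>dirichlet a (2 * s)\<close>: the value at \<open>k\<close> is
  moved to \<open>k^2\<close>.\<close>

definition lift2 :: "(nat \<Rightarrow> complex) \<Rightarrow> nat \<Rightarrow> complex" where
  "lift2 a n = (if \<exists>k. n = k\<^sup>2 then a (THE k. n = k\<^sup>2) else 0)"

lemma lift2_square [simp]: "lift2 a (k\<^sup>2) = a k"
proof -
  have "(THE j. k\<^sup>2 = j\<^sup>2) = k" by (rule the_equality) auto
  thus ?thesis by (auto simp: lift2_def)
qed

lemma lift2_nonsquare: "(\<And>k. n \<noteq> k\<^sup>2) \<Longrightarrow> lift2 a n = 0"
  by (auto simp: lift2_def)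

lemma sum_lift2:
  fixes \<phi> :: "nat \<Rightarrow> 'a :: comm_monoid_add"
  assumes "\<And>n. n \<in> {1..X} \<Longrightarrow> (\<And>k. n \<noteq> k\<^sup>2) \<Longrightarrow> \<phi> n = 0" "\<And>n. n > X \<Longrightarrow> \<phi> n = 0"
  shows "(\<Sum>n\<in>{1..X}. \<phi> n) = (\<Sum>k\<in>{1..X}. \<phi> (k\<^sup>2))"
proof -
  have "(\<Sum>n\<in>{1..X}. \<phi> n) = (\<Sum>n\<in>(\<lambda>k. k\<^sup>2) ` {1..X} \<inter> {1..X}. \<phi> n)"
  proof (rule sum.mono_neutral_right)
    show "\<forall>n\<in>{1..X} - (\<lambda>k. k\<^sup>2) ` {1..X} \<inter> {1..X}. \<phi> n = 0"
    proof
      fix n assume n: "n \<in> {1..X} - (\<lambda>k. k\<^sup>2) ` {1..X} \<inter> {1..X}"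
      have "n \<noteq> k\<^sup>2" for k
      proof
        assume k: "n = k\<^sup>2"
        have "k > 0" using n k by (auto intro: Nat.gr0I)
        moreover have "k \<le> k\<^sup>2" by (simp add: power2_eq_square)
        hence "k \<le> X" using k n by auto
        ultimately show False using n k by auto
      qed
      thus "\<phi> n = 0" using n assms by auto
    qed
  qed auto
  also have "\<dots> = (\<Sum>n\<in>(\<lambda>k. k\<^sup>2) ` {1..X}. \<phi> n)"
    by (rule sum.mono_neutral_left) (auto intro!: assms(2))
  also have "\<dots> = (\<Sum>k\<in>{1..X}. \<phi> (k\<^sup>2))"
    by (subst sum.reindex) (auto simp: inj_on_def)
  finally show ?thesis .
qed

lemma dirichlet_bound_lift2:
  assumes "dirichlet_bound a (2 * \<sigma>) K"
  shows "dirichlet_bound (lift2 a) \<sigma> K"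
  unfolding dirichlet_bound_def
proof
  fix X
  define \<phi> where "\<phi> = (\<lambda>n. if n \<le> X then norm (lift2 a n) * real n powr (- \<sigma>) else 0)"
  have "(\<Sum>n\<in>{1..X}. norm (lift2 a n) * real n powr (- \<sigma>)) = (\<Sum>n\<in>{1..X}. \<phi> n)"
    by (simp add: \<phi>_def)
  also have "\<dots> = (\<Sum>k\<in>{1..X}. \<phi> (k\<^sup>2))"
    by (rule sum_lift2) (auto simp: \<phi>_def lift2_nonsquare)
  also have "\<dots> \<le> (\<Sum>k\<in>{1..X}. norm (a k) * real k powr (- (2 * \<sigma>)))"
  proof (rule sum_mono)
    fix k assume "k \<in> {1..X}"
    hence "real (k\<^sup>2) powr (- \<sigma>) = real k powr (- (2 * \<sigma>))"
      by (simp add: powr_powr flip: powr_numeral)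
    thus "\<phi> (k\<^sup>2) \<le> norm (a k) * real k powr (- (2 * \<sigma>))"
      unfolding \<phi>_def by (simp del: of_nat_power)
  qed
  also have "\<dots> \<le> K" by (rule nboundD[OF assms])
  finally show "(\<Sum>n\<in>{1..X}. norm (lift2 a n) * real n powr (- \<sigma>)) \<le> K" .
qed

lemma dirichlet_lift2:
  assumes "dirichlet_bound a (2 * \<sigma>) K" "Re s \<ge> \<sigma>"
  shows "dirichlet (lift2 a) s = dirichlet a (2 * s)"
proof -
  have "(dirichlet_term (lift2 a) s has_sum dirichlet a (2 * s)) ((\<lambda>k. k\<^sup>2) ` {1..})"
  proof (subst has_sum_reindex)
    show "inj_on (\<lambda>k. k\<^sup>2) {1::nat..}" by (auto simp: inj_on_def)
    have "(dirichlet_term a (2 * s) has_sum dirichlet a (2 * s)) {1..}"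
      by (rule has_sum_dirichlet[OF assms(1)]) (use assms in auto)
    also have "?this \<longleftrightarrow> ((dirichlet_term (lift2 a) s \<circ> (\<lambda>k. k\<^sup>2)) has_sum dirichlet a (2 * s)) {1..}"
    proof (rule has_sum_cong)
      fix k :: nat assume "k \<in> {1..}"
      have "(of_nat (k\<^sup>2) :: complex) powr (- s) = of_nat k powr (- s) * of_nat k powr (- s)"
        using powr_times_real[of "of_nat k" "of_nat k" "- s"] by (simp add: power2_eq_square)
      also have "\<dots> = of_nat k powr (- (2 * s))" by (simp flip: powr_add)
      finally show "dirichlet_term a (2 * s) k = (dirichlet_term (lift2 a) s \<circ> (\<lambda>k. k\<^sup>2)) k"
        by (simp add: dirichlet_term_def)
    qed
    finally show "((dirichlet_term (lift2 a) s \<circ> (\<lambda>k. k\<^sup>2)) has_sum dirichlet a (2 * s)) {1..}" .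
  qed
  also have "?this \<longleftrightarrow> (dirichlet_term (lift2 a) s has_sum dirichlet a (2 * s)) {1..}"
  proof (rule has_sum_cong_neutral)
    fix n :: nat assume "n \<in> {1..} - (\<lambda>k. k\<^sup>2) ` {1..}"
    hence n: "n \<ge> 1" "n \<notin> (\<lambda>k. k\<^sup>2) ` {1..}" by auto
    have "n \<noteq> k\<^sup>2" for k
    proof
      assume k: "n = k\<^sup>2"
      hence "k \<ge> 1" using n by (auto simp: Suc_le_eq intro: Nat.gr0I)
      thus False using n k by auto
    qed
    thus "dirichlet_term (lift2 a) s n = 0" by (simp add: dirichlet_term_def lift2_nonsquare)
  qed (auto simp: Suc_le_eq)
  finally show ?thesis unfolding dirichlet_def[of "lift2 a"] by (rule infsumI)
qed

section \<open>The series for zeta, its shift and its inverse\<close>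

lemma dirichlet_bound_powr:
  assumes "\<sigma> - \<tau> > 1" and "\<And>n. n \<ge> 1 \<Longrightarrow> norm (a n) \<le> real n powr \<tau>"
  obtains K where "dirichlet_bound a \<sigma> K"
proof -
  have sm: "summable (\<lambda>n. real n powr (\<tau> - \<sigma>))" by (subst summable_real_powr_iff) (use assms in auto)
  have "dirichlet_bound a \<sigma> (\<Sum>n. real n powr (\<tau> - \<sigma>))"
    unfolding dirichlet_bound_def
  proof
    fix X
    have "(\<Sum>n\<in>{1..X}. norm (a n) * real n powr (- \<sigma>)) \<le> (\<Sum>n\<in>{1..X}. real n powr (\<tau> - \<sigma>))"
    proof (rule sum_mono)
      fix n assume n: "n \<in> {1..X}"
      have "norm (a n) * real n powr (- \<sigma>) \<le> real n powr \<tau> * real n powr (- \<sigma>)"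
        using n assms by (intro mult_right_mono) auto
      thus "norm (a n) * real n powr (- \<sigma>) \<le> real n powr (\<tau> - \<sigma>)" by (simp flip: powr_add)
    qed
    also have "\<dots> \<le> (\<Sum>n. real n powr (\<tau> - \<sigma>))" by (rule sum_le_suminf[OF sm]) auto
    finally show "(\<Sum>n\<in>{1..X}. norm (a n) * real n powr (- \<sigma>)) \<le> (\<Sum>n. real n powr (\<tau> - \<sigma>))" .
  qed
  thus ?thesis by (rule that)
qed

lemma dirichlet_one:
  assumes "Re s > 1"
  shows "dirichlet (\<lambda>_. 1) s = zeta s"
proof -
  obtain K where K: "dirichlet_bound (\<lambda>_. 1) (Re s) K"
    by (rule dirichlet_bound_powr[of "Re s" 0 "\<lambda>_. 1"]) (use assms in auto)
  have "(\<lambda>n. dirichlet_term (\<lambda>_. 1) s (Suc n)) sums dirichlet (\<lambda>_. 1) s" by (rule sums_dirichlet[OF K]) simp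
  moreover have "(\<lambda>n. dirichlet_term (\<lambda>_. 1) s (Suc n)) sums zeta s"
    using is_zeta_zeta assms by (simp add: is_zeta_def dirichlet_term_def)
  ultimately show ?thesis by (rule sums_unique2)
qed

lemma dirichlet_id:
  assumes "Re s > 2"
  shows "dirichlet of_nat s = zeta (s - 1)"
proof -
  have "dirichlet of_nat s = dirichlet (\<lambda>_. 1) (s - 1)"
    unfolding dirichlet_def
  proof (rule infsum_cong)
    fix n :: nat assume "n \<in> {1..}"
    hence n: "(of_nat n :: complex) \<noteq> 0" by auto
    have "(of_nat n :: complex) powr (- (s - 1)) = of_nat n powr (1 + - s)" by simp
    also have "\<dots> = of_nat n powr 1 * of_nat n powr (- s)" by (rule powr_add)
    finally show "dirichlet_term of_nat s n = dirichlet_term (\<lambda>_. 1) (s - 1) n" using n by (simp add: dirichlet_term_def)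
  qed
  thus ?thesis using dirichlet_one[of "s - 1"] assms by simp
qed

lemma dirichlet_mu:
  assumes "Re s > 1"
  shows "zeta s * dirichlet (\<lambda>n. of_real (mu n)) s = 1"
proof -
  obtain K where K: "dirichlet_bound (\<lambda>_. 1) (Re s) K"
    by (rule dirichlet_bound_powr[of "Re s" 0 "\<lambda>_. 1"]) (use assms in auto)
  obtain K' where K': "dirichlet_bound (\<lambda>n. of_real (mu n)) (Re s) K'"
    by (rule dirichlet_bound_powr[of "Re s" 0 "\<lambda>n. of_real (mu n)"]) (use assms abs_mu_le in auto)
  have "dirichlet (\<lambda>_. 1) s * dirichlet (\<lambda>n. of_real (mu n)) s = dirichlet (dirichlet_conv (\<lambda>n. of_real (mu n)) (\<lambda>_. 1)) s"
    using dirichlet_dirichlet_conv[OF K' K] by simp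
  also have "\<dots> = dirichlet unit1 s"
    unfolding dirichlet_def
  proof (rule infsum_cong)
    fix n :: nat assume "n \<in> {1..}"
    hence "(\<Sum>d\<in>{d. d dvd n}. mu d) = (if n = 1 then 1 else 0)" by (intro sum_mu_divisors) auto
    hence "dirichlet_conv (\<lambda>n. of_real (mu n)) (\<lambda>_. 1) n = unit1 n"
      unfolding dirichlet_conv_def unit1_def by (simp flip: of_real_sum)
    thus "dirichlet_term (dirichlet_conv (\<lambda>n. of_real (mu n)) (\<lambda>_. 1)) s n = dirichlet_term unit1 s n" by (simp add: dirichlet_term_def)
  qed
  finally show ?thesis by (simp add: dirichlet_unit1 dirichlet_one[OF assms])
qed

text \<open>For \<open>Re s \<ge> 3/4\<close> the argument \<open>2 * s\<close> has real part at
  least 3/2, where both zeta and its inverse, the series of \<open>mu\<close>, converge absolutely;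
  the sign of \<open>M\<close> decides which of them is raised to a power.\<close>

lemma zeta_square_powi:
  "\<exists>c K. dirichlet_bound c (3 / 4) K \<and> c 1 = 1 \<and> (\<forall>s. Re s \<ge> 3 / 4 \<longrightarrow> dirichlet c s = zeta (2 * s) powi M)"
proof -
  obtain K where K: "dirichlet_bound (\<lambda>_. 1) (2 * (3 / 4)) K"
    by (rule dirichlet_bound_powr[of "2 * (3 / 4)" 0 "\<lambda>_. 1"]) auto
  obtain K' where K': "dirichlet_bound (\<lambda>n. of_real (mu n)) (2 * (3 / 4)) K'"
    by (rule dirichlet_bound_powr[of "2 * (3 / 4)" 0 "\<lambda>n. of_real (mu n)"]) (use abs_mu_le in auto)
  have l1: "lift2 a 1 = a 1" for a using lift2_square[of a 1] by simp
  show ?thesis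
  proof (cases "M \<ge> 0")
    case True
    have "\<exists>c K'. dirichlet_bound c (3 / 4) K' \<and> c 1 = 1 \<and> (\<forall>s. Re s \<ge> 3 / 4 \<longrightarrow> dirichlet c s = dirichlet (lift2 (\<lambda>_. 1)) s ^ nat M)"
      by (rule dirichlet_power[OF dirichlet_bound_lift2[OF K]]) (simp only: l1)
    moreover have "dirichlet (lift2 (\<lambda>_. 1)) s ^ nat M = zeta (2 * s) powi M" if "Re s \<ge> 3 / 4" for s
      using dirichlet_lift2[OF K that] dirichlet_one[of "2 * s"] that True by (simp add: power_int_def)
    ultimately show ?thesis by auto
  next
    case False
    have "\<exists>c K'. dirichlet_bound c (3 / 4) K' \<and> c 1 = 1 \<and> (\<forall>s. Re s \<ge> 3 / 4 \<longrightarrow> dirichlet c s = dirichlet (lift2 (\<lambda>n. of_real (mu n))) s ^ nat (- M))"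
      by (rule dirichlet_power[OF dirichlet_bound_lift2[OF K']]) (simp add: l1 del: One_nat_def, simp)
    moreover have "dirichlet (lift2 (\<lambda>n. of_real (mu n))) s ^ nat (- M) = zeta (2 * s) powi M" if s: "Re s \<ge> 3 / 4" for s
    proof -
      have "zeta (2 * s) * dirichlet (\<lambda>n. of_real (mu n)) (2 * s) = 1" using s by (intro dirichlet_mu) auto
      hence "dirichlet (\<lambda>n. of_real (mu n)) (2 * s) = inverse (zeta (2 * s))" by (simp add: inverse_unique)
      thus ?thesis using dirichlet_lift2[OF K' s] False by (simp add: power_int_def)
    qed
    ultimately show ?thesis by auto
  qed
qed

text \<open>If \<open>N\<close> is the first index carrying a nonzero coefficient, its term is
  compared with all later ones as the real argument grows: relative to it they decay like
  \<open>(N / (N + 1)) powr y\<close>.\<close>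

lemma dirichlet_coeffs_unique:
  fixes c :: "nat \<Rightarrow> complex"
  assumes sums0: "\<And>x::real. x \<ge> 2 \<Longrightarrow> (\<lambda>n. dirichlet_term c (of_real x) (Suc n)) sums 0"
  assumes "n \<ge> 1"
  shows "c n = 0"
proof (rule ccontr)
  assume "c n \<noteq> 0"
  define N where "N = (LEAST n. n \<ge> 1 \<and> c n \<noteq> 0)"
  have N: "N \<ge> 1 \<and> c N \<noteq> 0"
    unfolding N_def by (rule LeastI[of _ n]) (use \<open>c n \<noteq> 0\<close> assms in auto)
  have below: "c m = 0" if "m \<ge> 1" "m < N" for m
    using not_less_Least[of m "\<lambda>n. n \<ge> 1 \<and> c n \<noteq> 0"] that by (auto simp: N_def)
  have "(\<lambda>n. dirichlet_term c (of_real 2) (Suc n)) \<longlonglongrightarrow> 0"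
    using sums0[of 2] by (intro summable_LIMSEQ_zero) (auto simp: sums_iff)
  hence "Bseq (\<lambda>n. dirichlet_term c (of_real 2) (Suc n))" by (intro convergent_imp_Bseq convergentI)
  then obtain K where K: "K > 0" "\<And>n. norm (dirichlet_term c (of_real 2) (Suc n)) \<le> K" by (auto elim: BseqE)
  have cK: "norm (c m) \<le> K * real m powr 2" if "m \<ge> 1" for m
  proof -
    define k where "k = m - 1"
    have "m = Suc k" using that by (simp add: k_def)
    hence "norm (c m) * real m powr (- 2) \<le> K"
      using K(2)[of k] norm_dirichlet_term[of m c "of_real 2"] that by simp
    hence "norm (c m) * real m powr (- 2) * real m powr 2 \<le> K * real m powr 2"
      by (intro mult_right_mono) auto
    moreover have "real m powr (- 2) * real m powr 2 = 1"
      using that by (subst powr_add[symmetric]) auto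
    ultimately show ?thesis by (simp only: mult.assoc mult_1_right)
  qed
  define S where "S = (\<Sum>n. real (Suc n) powr (- 2))"
  have smS: "summable (\<lambda>n. real (Suc n) powr (- 2))" by (rule summable_Suc_powr) auto
  have key: "norm (c N) \<le> K * real N powr 4 * S * (real N / real (Suc N)) powr y" if y: "y \<ge> 0" for y
  proof -
    \<comment> \<open>Of the shift by 4, two powers absorb the bound
      \<open>norm (c m) \<le> K * m^2\<close> and two make the remaining series converge.\<close>
    define x where "x = y + 4"
    define N0 where "N0 = N - 1"
    have NN: "N = Suc N0" using N by (simp add: N0_def)
    define t where "t = (\<lambda>n. dirichlet_term c (of_real x) (Suc n))"
    have t: "t sums 0" unfolding t_def using y by (intro sums0) (simp add: x_def)
    have t0: "t m = 0" if "m < N0" for m using below[of "Suc m"] that NN by (simp add: t_def dirichlet_term_def)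
    have "(\<lambda>m. t (m + Suc N0)) sums (0 - (\<Sum>i<Suc N0. t i))"
      using t by (rule sums_split_initial_segment)
    moreover have "(\<Sum>i<Suc N0. t i) = t N0" using t0 by simp
    ultimately have s1: "(\<lambda>m. t (m + Suc N0)) sums (- t N0)" by simp
    define q where "q = real N / real (Suc N)"
    have q: "0 < q" using N by (simp add: q_def)
    define B where "B = K * real N powr (4 - x) * q powr y"
    have bd: "norm (t (m + Suc N0)) \<le> B * real (Suc m) powr (- 2)" for m
    proof -
      define k where "k = Suc (m + Suc N0)"
      have k: "k \<ge> Suc N" "k \<ge> Suc m" using NN by (auto simp: k_def)
      have k0: "real k > 0" using k by simp
      have "norm (t (m + Suc N0)) = norm (c k) * real k powr (- x)"
        unfolding t_def k_def[symmetric] using norm_dirichlet_term[of k c "of_real x"] k by simp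
      also have "\<dots> \<le> K * real k powr 2 * real k powr (- x)" using cK[of k] k by (intro mult_right_mono) auto
      also have "\<dots> = K * (real k powr 2 * real k powr (- x))" by simp
      also have "real k powr 2 * real k powr (- x) = real k powr (- 2) * real k powr (- y)"
      proof -
        have "2 + - x = - 2 + - y" by (simp add: x_def)
        thus ?thesis by (simp only: powr_add[symmetric])
      qed
      also have "real k powr (- y) \<le> real N powr (- y) * q powr y"
      proof -
        have "real k powr (- y) \<le> real (Suc N) powr (- y)" using k y by (intro powr_mono2') auto
        also have "\<dots> = real N powr (- y) * q powr y"
          unfolding q_def using N by (simp add: powr_divide powr_minus field_simps)
        finally show ?thesis .
      qed
      also have "real k powr (- 2) \<le> real (Suc m) powr (- 2)" using k by (intro powr_mono2') auto
      finally have "norm (t (m + Suc N0)) \<le> K * (real (Suc m) powr (- 2) * (real N powr (- y) * q powr y))"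
        using K by (simp add: mult_left_mono mult_right_mono)
      thus ?thesis by (simp add: B_def x_def mult_ac)
    qed
    have "norm (- t N0) \<le> (\<Sum>m. B * real (Suc m) powr (- 2))"
    proof -
      have sB: "summable (\<lambda>m. B * real (Suc m) powr (- 2))" by (intro summable_mult smS)
      have "summable (\<lambda>m. norm (t (m + Suc N0)))"
        by (rule summable_comparison_test[OF _ sB]) (use bd in auto)
      hence "norm (\<Sum>m. t (m + Suc N0)) \<le> (\<Sum>m. norm (t (m + Suc N0)))" by (rule summable_norm)
      also have "\<dots> \<le> (\<Sum>m. B * real (Suc m) powr (- 2))"
        by (intro suminf_le bd sB) fact
      finally show ?thesis using s1 by (simp add: sums_iff)
    qed
    also have "\<dots> = B * S" unfolding S_def by (rule suminf_mult[OF smS])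
    also have "norm (- t N0) = norm (c N) * real N powr (- x)"
      unfolding t_def NN[symmetric] using norm_dirichlet_term[of N c "of_real x"] N by simp
    finally have "norm (c N) * real N powr (- x) * real N powr x \<le> B * S * real N powr x"
      by (intro mult_right_mono) auto
    moreover have "real N powr (- x) * real N powr x = 1"
      using N by (subst powr_add[symmetric]) auto
    ultimately have "norm (c N) \<le> B * S * real N powr x" by (simp only: mult.assoc mult_1_right)
    also have "\<dots> = K * (real N powr (4 - x) * real N powr x) * S * q powr y" by (simp add: B_def)
    also have "real N powr (4 - x) * real N powr x = real N powr 4" by (subst powr_add[symmetric]) simp
    finally show ?thesis unfolding q_def .
  qed
  have "((\<lambda>y. K * real N powr 4 * S * (real N / real (Suc N)) powr y) \<longlongrightarrow> K * real N powr 4 * S * 0) at_top"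
  proof (rule tendsto_mult_left)
    define q where "q = real N / real (Suc N)"
    have "0 < q" "q < 1" using N by (auto simp: q_def)
    thus "((\<lambda>y. q powr y) \<longlongrightarrow> 0) at_top" by real_asymp
  qed
  moreover have "eventually (\<lambda>y. norm (c N) \<le> K * real N powr 4 * S * (real N / real (Suc N)) powr y) at_top"
    using eventually_ge_at_top[of 0] by eventually_elim (rule key)
  ultimately have "norm (c N) \<le> K * real N powr 4 * S * 0"
    by (intro tendsto_lowerbound) auto
  thus False using N by simp
qed

section \<open>Euler products\<close>

lemma exp_periodic_integral:
  fixes m :: int and lp t0 T :: real and j :: nat
  assumes "lp > 0" "T = 2 * pi * real j / lp" "T \<ge> 0"
  shows "((\<lambda>t. exp (\<i> * of_real (of_int m * lp * t))) has_integral (if m = 0 then of_real T else 0)) {t0..t0 + T}"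
proof (cases "m = 0")
  case True
  have "((\<lambda>t::real. 1::complex) has_integral of_real T) {t0..t0 + T}"
    using has_integral_const_real[of "1::complex" t0 "t0 + T"] assms by (simp add: scaleR_conv_of_real)
  thus ?thesis using True by simp
next
  case False
  define c where "c = \<i> * of_real (of_int m * lp)"
  have c0: "c \<noteq> 0" using False assms by (simp add: c_def)
  have "((\<lambda>t. exp (\<i> * of_real (of_int m * lp * t))) has_integral
     (exp (c * of_real (t0 + T)) / c - exp (c * of_real t0) / c)) {t0..t0 + T}"
  proof (rule fundamental_theorem_of_calculus)
    fix x
    have "((\<lambda>z. exp (c * z) / c) has_field_derivative exp (\<i> * of_real (of_int m * lp * x))) (at (of_real x))"
      using c0 by (auto intro!: derivative_eq_intros simp: c_def mult_ac)
    thus "((\<lambda>t. exp (c * of_real t) / c) has_vector_derivative exp (\<i> * of_real (of_int m * lp * x))) (at x within {t0..t0 + T})"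
      by (rule has_vector_derivative_real_field)
  qed (use assms in auto)
  moreover have "exp (c * of_real (t0 + T)) = exp (c * of_real t0)"
  proof -
    have "c * of_real (t0 + T) = c * of_real t0 + \<i> * of_real (of_int m * lp * T)"
      by (simp add: c_def algebra_simps)
    also have "of_int m * lp * T = 2 * pi * of_int (m * int j)"
      using assms by (simp add: field_simps)
    finally have "exp (c * of_real (t0 + T)) = exp (c * of_real t0) * cis (2 * pi * of_int (m * int j))"
      by (simp add: exp_add cis_conv_exp)
    also have "cis (2 * pi * of_int (m * int j)) = 1" by (rule cis_multiple_2pi) auto
    finally show ?thesis by simp
  qed
  ultimately show ?thesis using False by simp
qed

text \<open>
  An interval of length \<open>\<eta>\<close> contains a full period of \<open>E\<close> once \<open>lp\<close> is large, so the size of the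
  local factor on that interval controls all its coefficients.
\<close>

lemma fourier_coeff_bound:
  fixes A :: "nat \<Rightarrow> complex" and lp \<eta> t0 :: real
  assumes "summable (\<lambda>k. norm (A k))" "A 0 = 1" "lp > 0" "\<eta> > 0" "2 * pi \<le> \<eta> * lp" "k \<ge> 1"
  defines "E \<equiv> \<lambda>t::real. (\<Sum>k. A k * exp (- \<i> * of_real (real k * lp * t))) - 1"
  shows "continuous_on UNIV E" and "norm (A k) \<le> 2 / \<eta> * integral {t0..t0 + \<eta>} (\<lambda>t. norm (E t))"
proof -
  define g where "g = (\<lambda>K (t::real). \<Sum>k<K. A k * exp (- \<i> * of_real (real k * lp * t)))"
  have ul: "uniform_limit UNIV g (\<lambda>t. \<Sum>k. A k * exp (- \<i> * of_real (real k * lp * t))) sequentially"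
    unfolding g_def by (rule Weierstrass_m_test[where M = "\<lambda>k. norm (A k)"]) (use assms in \<open>auto simp: norm_mult\<close>)
  have contg: "continuous_on S (g K)" for S K unfolding g_def by (intro continuous_intros)
  have "continuous_on UNIV (\<lambda>t. \<Sum>k. A k * exp (- \<i> * of_real (real k * lp * t)))"
    by (rule uniform_limit_theorem[OF _ ul]) (auto intro!: always_eventually contg)
  thus contE: "continuous_on UNIV E" unfolding E_def by (intro continuous_intros)
  define x where "x = \<eta> * lp / (2 * pi)"
  have x1: "x \<ge> 1" using assms by (simp add: x_def)
  \<comment> \<open>The interval of length \<open>\<eta>\<close> measures \<open>x\<close> periods;
    as \<open>x \<ge> 1\<close>, its \<open>j\<close> full periods fill at least half of it.\<close>
  define j where "j = nat \<lfloor>x\<rfloor>"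
  have j: "real j \<le> x" "real j \<ge> x / 2"
  proof -
    have "real j = of_int \<lfloor>x\<rfloor>" using x1 by (simp add: j_def)
    moreover have "of_int \<lfloor>x\<rfloor> \<le> x" "of_int \<lfloor>x\<rfloor> > x - 1" "\<lfloor>x\<rfloor> \<ge> 1" using x1 by (simp, linarith, simp)
    moreover from this(3) have "real_of_int \<lfloor>x\<rfloor> \<ge> 1" by simp
    ultimately show "real j \<le> x" "real j \<ge> x / 2" by linarith+
  qed
  define T where "T = 2 * pi * real j / lp"
  have T: "T \<le> \<eta>" "T \<ge> \<eta> / 2"
  proof -
    have "2 * pi * x / lp = \<eta>" using assms by (simp add: x_def)
    moreover have "2 * pi * real j / lp \<le> 2 * pi * x / lp" "2 * pi * (x / 2) / lp \<le> 2 * pi * real j / lp"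
      using j assms by (intro divide_right_mono mult_left_mono; simp)+
    ultimately show "T \<le> \<eta>" "T \<ge> \<eta> / 2" by (auto simp: T_def)
  qed
  have T0: "T > 0" using T assms by linarith
  define w where "w = (\<lambda>t. exp (\<i> * of_real (real k * lp * t)))"
  define G where "G = (\<lambda>K t. (g K t - 1) * w t)"
  have contG: "continuous_on {t0..t0 + T} (G K)" for K
    unfolding G_def w_def by (intro continuous_intros contg)
  have nw: "norm (w t) = 1" for t by (simp add: w_def)
  have ulG: "uniform_limit {t0..t0 + T} G (\<lambda>t. E t * w t) sequentially"
  proof (rule uniform_limitI)
    fix e :: real assume "e > 0"
    have "\<forall>\<^sub>F K in sequentially. \<forall>t\<in>UNIV. dist (g K t) (\<Sum>k. A k * exp (- \<i> * of_real (real k * lp * t))) < e"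
      using ul \<open>e > 0\<close> by (rule uniform_limitD)
    thus "\<forall>\<^sub>F K in sequentially. \<forall>t\<in>{t0..t0 + T}. dist (G K t) (E t * w t) < e"
    proof eventually_elim
      case (elim K)
      have "dist (G K t) (E t * w t) = dist (g K t) (\<Sum>k. A k * exp (- \<i> * of_real (real k * lp * t)))" for t
      proof -
        have "G K t - E t * w t = (g K t - (\<Sum>k. A k * exp (- \<i> * of_real (real k * lp * t)))) * w t"
          by (simp add: G_def E_def algebra_simps)
        thus ?thesis by (simp add: dist_norm norm_mult nw)
      qed
      thus ?case using elim by simp
    qed
  qed
  obtain I J where IJ: "\<And>K. (G K has_integral I K) {t0..t0 + T}" "((\<lambda>t. E t * w t) has_integral J) {t0..t0 + T}" "I \<longlonglongrightarrow> J"
    using uniform_limit_integral[OF ulG contG trivial_limit_sequentially] by blast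
  \<comment> \<open>Over whole periods the exponentials are orthogonal, so only the coefficient at
    \<open>k\<close> survives; the subtracted 1 drops out because \<open>k \<ge> 1\<close>.\<close>
  have IK: "I K = A k * of_real T" if "K > k" for K
  proof -
    have "((\<lambda>t. (\<Sum>k'<K. A k' * exp (\<i> * of_real (of_int (int k - int k') * lp * t))) - exp (\<i> * of_real (of_int (int k) * lp * t))) has_integral
       ((\<Sum>k'<K. A k' * (if int k - int k' = 0 then of_real T else 0)) - (if int k = 0 then of_real T else 0))) {t0..t0 + T}"
      by (intro has_integral_diff has_integral_sum has_integral_mult_right exp_periodic_integral) (use assms T0 T_def in auto)
    also have "(\<Sum>k'<K. A k' * (if int k - int k' = 0 then of_real T else 0)) = (\<Sum>k'<K. if k' = k then A k * of_real T else 0)"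
      by (intro sum.cong) auto
    also have "\<dots> = A k * of_real T" using that by simp
    also have "(if int k = 0 then complex_of_real T else 0) = 0" using assms by simp
    also have "(\<lambda>t. (\<Sum>k'<K. A k' * exp (\<i> * of_real (of_int (int k - int k') * lp * t))) - exp (\<i> * of_real (of_int (int k) * lp * t))) = G K"
    proof
      fix t
      have h1: "A k' * exp (\<i> * of_real (of_int (int k - int k') * lp * t)) = A k' * exp (- \<i> * of_real (real k' * lp * t)) * w t" for k'
      proof -
        have "\<i> * of_real (of_int (int k - int k') * lp * t) = - \<i> * of_real (real k' * lp * t) + \<i> * of_real (real k * lp * t)"
          by (simp add: algebra_simps)
        thus ?thesis unfolding w_def by (simp only: exp_add) simp
      qed
      show "(\<Sum>k'<K. A k' * exp (\<i> * of_real (of_int (int k - int k') * lp * t))) - exp (\<i> * of_real (of_int (int k) * lp * t)) = G K t"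
        unfolding h1 G_def g_def left_diff_distrib sum_distrib_right by (simp add: w_def)
    qed
    finally have "(G K has_integral A k * of_real T) {t0..t0 + T}" by simp
    with IJ(1)[of K] show ?thesis by (rule has_integral_unique)
  qed
  have "I \<longlonglongrightarrow> A k * of_real T"
    by (rule tendsto_eventually[OF eventually_mono[OF eventually_gt_at_top[of k] IK]])
  with IJ(3) have "J = A k * of_real T" by (rule LIMSEQ_unique)
  hence "norm (A k) * T = norm (integral {t0..t0 + T} (\<lambda>t. E t * w t))"
    using integral_unique[OF IJ(2)] T0 by (simp add: norm_mult)
  also have "\<dots> \<le> integral {t0..t0 + T} (\<lambda>t. norm (E t))"
  proof (rule integral_norm_bound_integral)
    show "(\<lambda>t. E t * w t) integrable_on {t0..t0 + T}" using IJ(2) by blast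
    show "(\<lambda>t. norm (E t)) integrable_on {t0..t0 + T}"
      by (intro integrable_continuous_interval continuous_intros continuous_on_subset[OF contE]) auto
  qed (simp add: norm_mult nw)
  also have "\<dots> \<le> integral {t0..t0 + \<eta>} (\<lambda>t. norm (E t))"
  proof (rule integral_subset_le)
    show "(\<lambda>t. norm (E t)) integrable_on {t0..t0 + T}" "(\<lambda>t. norm (E t)) integrable_on {t0..t0 + \<eta>}"
      by (intro integrable_continuous_interval continuous_intros continuous_on_subset[OF contE]; simp)+
  qed (use T in auto)
  finally have "norm (A k) * T \<le> integral {t0..t0 + \<eta>} (\<lambda>t. norm (E t))" .
  moreover have "norm (A k) * (\<eta> / 2) \<le> norm (A k) * T" using T by (intro mult_left_mono) auto
  ultimately have "norm (A k) * (\<eta> / 2) \<le> integral {t0..t0 + \<eta>} (\<lambda>t. norm (E t))" by linarith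
  thus "norm (A k) \<le> 2 / \<eta> * integral {t0..t0 + \<eta>} (\<lambda>t. norm (E t))"
    using \<open>\<eta> > 0\<close> by (simp add: field_simps)
qed

text \<open>
  Absolute convergence of the Euler product is only assumed pointwise; Baire's theorem makes it uniform
  on some interval.
\<close>

lemma bounded_on_some_interval:
  fixes E :: "nat \<Rightarrow> real \<Rightarrow> complex"
  assumes cont: "\<And>p. continuous_on UNIV (E p)" and sm: "\<And>t. summable (\<lambda>p. norm (E p t))"
  obtains t0 \<eta> B :: real where "\<eta> > 0" "\<And>t X. t \<in> {t0..t0 + \<eta>} \<Longrightarrow> (\<Sum>p<X. norm (E p t)) \<le> B"
proof -
  \<comment> \<open>By pointwise summability these closed sets cover the line. If none had interior,
    their complements would be open and dense with empty intersection, against Baire.\<close>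
  define T where "T = (\<lambda>N::nat. {t. \<forall>X. (\<Sum>p<X. norm (E p t)) \<le> real N})"
  have closedT: "closed (T N)" for N
    unfolding T_def by (intro closed_Collect_all closed_Collect_le continuous_intros cont)
  have "\<exists>N. \<not> UNIV \<subseteq> closure (- T N)"
  proof (rule ccontr)
    assume dense: "\<nexists>N. \<not> UNIV \<subseteq> closure (- T N)"
    have "UNIV \<subseteq> closure (\<Inter> (range (\<lambda>N. - T N)))"
    proof (rule Baire)
      show "openin (top_of_set UNIV) S \<and> UNIV \<subseteq> closure S" if "S \<in> range (\<lambda>N. - T N)" for S
        using that dense closedT by (auto simp: open_Compl)
    qed auto
    moreover have "\<Inter> (range (\<lambda>N. - T N)) = {}"
    proof -
      have "\<exists>N. t \<in> T N" for t
      proof -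
        obtain N :: nat where N: "(\<Sum>p. norm (E p t)) \<le> real N" using real_arch_simple by blast
        have "(\<Sum>p<X. norm (E p t)) \<le> real N" for X
          using sum_le_suminf[OF sm[of t], of "{..<X}"] N by auto
        thus ?thesis by (auto simp: T_def)
      qed
      thus ?thesis by auto
    qed
    ultimately show False by simp
  qed
  then obtain N x where x: "x \<notin> closure (- T N)" by auto
  have "open (- closure (- T N))" by (simp add: open_Compl)
  then obtain e where e: "e > 0" "ball x e \<subseteq> - closure (- T N)" using x by (auto simp: open_contains_ball)
  show ?thesis
  proof (rule that[of "e / 2" x "real N"])
    fix t X assume "t \<in> {x..x + e / 2}"
    hence "t \<in> ball x e" using e by (auto simp: dist_real_def)
    hence "t \<notin> closure (- T N)" using e by blast
    hence "t \<in> T N" using closure_subset[of "- T N"] by blast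
    thus "(\<Sum>p<X. norm (E p t)) \<le> real N" by (simp add: T_def)
  qed (use e in auto)
qed

text \<open>The argument runs on the line Re s = 1/2, inside the half-plane of convergence. There,
  for all but finitely many \<open>p\<close>, one number \<open>I p\<close> bounds every coefficient
  of positive index of the local factor, and \<open>I\<close> is summable. Moving to the exponent
  3/4 supplies a factor \<open>p powr (- k / 4)\<close>, which makes the sum over \<open>k\<close>
  geometric.\<close>

lemma euler_coeffs_summable:
  fixes a :: "nat \<Rightarrow> nat \<Rightarrow> complex"
  assumes a0: "\<And>p. prime p \<Longrightarrow> a p 0 = 1"
    and sm: "\<And>s p. Re s > 1 / 3 \<Longrightarrow> prime p \<Longrightarrow> summable (\<lambda>k. norm (a p k * of_nat p powr (- (of_nat k * s))))"
    and pr: "\<And>s. Re s > 1 / 3 \<Longrightarrow> abs_convergent_prod (euler_factor a s)"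
  shows "\<exists>x :: nat \<Rightarrow> real. summable x \<and> (\<forall>p. x p \<ge> 0) \<and>
    (\<forall>p X. prime p \<longrightarrow> (\<Sum>k\<in>{1..X}. norm (a p k) * real (p ^ k) powr (- 3 / 4)) \<le> x p)"
proof -
  define lp where "lp = (\<lambda>p::nat. ln (real p))"
  define A where "A = (\<lambda>p k. a p k * of_real (exp (- (real k / 2 * lp p))))"
  define E where "E = (\<lambda>p t. euler_factor a (Complex (1 / 2) t) p - 1)"
  have pw: "of_nat p powr (- (of_nat k * z)) = exp (- (of_nat k * z * of_real (lp p)))" if "prime p" for p k and z :: complex
    using prime_gt_0_nat[OF that] by (simp add: powr_def lp_def Ln_of_nat)
  have lp0: "lp p > 0" if "prime p" for p using prime_gt_1_nat[OF that] by (simp add: lp_def)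
  have trm: "a p k * of_nat p powr (- (of_nat k * Complex (1 / 2) t)) = A p k * exp (- \<i> * of_real (real k * lp p * t))"
    if p: "prime p" for p k t
  proof -
    have "- (of_nat k * Complex (1 / 2) t * of_real (lp p)) = of_real (- (real k / 2 * lp p)) + (- \<i> * of_real (real k * lp p * t))"
      by (simp add: complex_eq_iff)
    thus ?thesis unfolding pw[OF p] A_def exp_of_real[symmetric] by (simp only: exp_add mult.assoc)
  qed
  have smA: "summable (\<lambda>k. norm (A p k))" if p: "prime p" for p
  proof -
    have "norm (a p k * of_nat p powr (- (of_nat k * Complex (1 / 2) 0))) = norm (A p k)" for k
      unfolding trm[OF p] by simp
    thus ?thesis using sm[of "Complex (1 / 2) 0" p] p by simp
  qed
  have A0: "A p 0 = 1" if "prime p" for p using a0[OF that] by (simp add: A_def)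
  have Ep: "E p t = (\<Sum>k. A p k * exp (- \<i> * of_real (real k * lp p * t))) - 1" if p: "prime p" for p t
    using p by (simp only: E_def euler_factor_def trm[OF p] if_True)
  have En: "E p t = 0" if "\<not> prime p" for p t using that by (simp add: E_def euler_factor_def)
  have contE: "continuous_on UNIV (E p)" for p
  proof (cases "prime p")
    case True
    have "continuous_on UNIV (\<lambda>t. (\<Sum>k. A p k * exp (- \<i> * of_real (real k * lp p * t))) - 1)"
      by (rule fourier_coeff_bound(1)[where \<eta> = "2 * pi / lp p" and k = 1])
         (use True smA A0 lp0[OF True] in auto)
    thus ?thesis using Ep[OF True] by (simp cong: continuous_on_cong)
  qed (simp add: En cong: continuous_on_cong)
  have "summable (\<lambda>p. norm (E p t))" for t
    unfolding E_def by (rule abs_convergent_prod_imp_summable[OF pr]) simp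
  with contE obtain t0 \<eta> B where \<eta>: "\<eta> > 0" and B: "\<And>t X. t \<in> {t0..t0 + \<eta>} \<Longrightarrow> (\<Sum>p<X. norm (E p t)) \<le> B"
    using bounded_on_some_interval by metis
  define I where "I = (\<lambda>p. 2 / \<eta> * integral {t0..t0 + \<eta>} (\<lambda>t. norm (E p t)))"
  have intE: "(\<lambda>t. norm (E p t)) integrable_on {t0..t0 + \<eta>}" for p
    by (intro integrable_continuous_interval continuous_intros continuous_on_subset[OF contE]) auto
  have I0: "I p \<ge> 0" for p unfolding I_def using \<eta> by (intro mult_nonneg_nonneg integral_nonneg intE) auto
  have smI: "summable I"
  proof (rule summableI_nonneg_bounded[of _ "2 * B"])
    fix X
    have "(\<Sum>p<X. I p) = 2 / \<eta> * integral {t0..t0 + \<eta>} (\<lambda>t. \<Sum>p<X. norm (E p t))"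
      unfolding I_def by (subst integral_sum) (auto simp: intE sum_distrib_left)
    also have "integral {t0..t0 + \<eta>} (\<lambda>t. \<Sum>p<X. norm (E p t)) \<le> integral {t0..t0 + \<eta>} (\<lambda>t. B)"
      by (intro integral_le integrable_sum intE B) auto
    also have "\<dots> = \<eta> * B" using \<eta> by simp
    finally show "(\<Sum>p<X. I p) \<le> 2 * B" using \<eta> by (simp add: mult_left_mono divide_right_mono)
  qed (rule I0)
  define C where "C = (\<Sum>k. (2 powr (- 1 / 4)) ^ k :: real)"
  have q: "2 powr (- 1 / 4) < (1::real)" by (rule powr_less_one) auto
  have smq: "summable (\<lambda>k. (2 powr (- 1 / 4)) ^ k :: real)" using q by (intro summable_geometric) auto
  have C0: "C \<ge> 0" unfolding C_def by (intro suminf_nonneg smq) auto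
  define n34 where "n34 = (\<lambda>p k. norm (a p k) * real (p ^ k) powr (- 3 / 4))"
  have n34: "n34 p k = norm (A p k) * (real p powr (- 1 / 4)) ^ k" if p: "prime p" for p k
  proof -
    have p0: "real p > 0" using prime_gt_0_nat[OF p] by simp
    have "real (p ^ k) powr (- 3 / 4) = exp (- (3 / 4 * (real k * lp p)))"
      using p0 by (simp add: powr_def ln_realpow lp_def)
    also have "\<dots> = exp (- (real k / 2 * lp p)) * exp (real k * (- 1 / 4 * lp p))"
      by (subst exp_add[symmetric]) (simp add: algebra_simps)
    also have "exp (real k * (- 1 / 4 * lp p)) = (real p powr (- 1 / 4)) ^ k"
      using p0 by (simp only: exp_of_nat_mult) (simp add: powr_def lp_def)
    finally show ?thesis by (simp add: n34_def A_def norm_mult)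
  qed
  \<comment> \<open>Primes whose period \<open>2 * pi / lp p\<close> exceeds \<open>\<eta>\<close>
    escape the Fourier bound. There are finitely many, and for them the convergence of the local
    series itself is used.\<close>
  define small where "small = (\<lambda>p. prime p \<and> \<eta> * lp p < 2 * pi)"
  define x where "x = (\<lambda>p. if small p then (\<Sum>k. n34 p k) else I p * C)"
  have sm34: "summable (n34 p)" if p: "prime p" for p
  proof (rule summable_comparison_test[OF _ smA[OF p]], intro exI allI impI)
    fix k :: nat
    have "real p powr (- 1 / 4) \<le> 1" using prime_gt_1_nat[OF p] powr_mono[of "- 1 / 4" 0 "real p"] by simp
    hence "(real p powr (- 1 / 4)) ^ k \<le> 1" by (intro power_le_one) auto
    thus "norm (n34 p k) \<le> norm (A p k)" unfolding n34[OF p] by (simp add: mult_left_le)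
  qed
  have n34_0: "n34 p k \<ge> 0" for p k by (simp add: n34_def)
  show ?thesis
  proof (intro exI[of _ x] conjI allI impI)
    have "eventually (\<lambda>p. x p = I p * C) sequentially"
    proof -
      have "eventually (\<lambda>p. real p > exp (2 * pi / \<eta>)) sequentially"
        using filterlim_real_sequentially unfolding filterlim_at_top_dense by auto
      thus ?thesis
      proof eventually_elim
        case (elim p)
        hence "0 < real p" by (rule less_trans[OF exp_gt_zero])
        hence "ln (exp (2 * pi / \<eta>)) < lp p"
          unfolding lp_def using elim by (subst ln_less_cancel_iff) simp_all
        hence "\<not> small p" using \<eta> by (simp add: small_def field_simps)
        thus ?case by (simp add: x_def)
      qed
    qed
    thus "summable x" by (subst summable_cong) (auto intro: summable_mult2 smI)
    show "x p \<ge> 0" for p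
      unfolding x_def using I0 C0 by (auto intro!: suminf_nonneg sm34 n34_0 simp: small_def)
    fix p X :: nat assume p: "prime p"
    have "(\<Sum>k\<in>{1..X}. n34 p k) \<le> x p"
    proof (cases "small p")
      case True
      thus ?thesis unfolding x_def using sum_le_suminf[OF sm34[OF p], of "{1..X}"] n34_0 by auto
    next
      case False
      have "n34 p k \<le> I p * (2 powr (- 1 / 4)) ^ k" if k: "k \<in> {1..X}" for k
      proof -
        have "norm (A p k) \<le> 2 / \<eta> * integral {t0..t0 + \<eta>} (\<lambda>t. norm ((\<Sum>k. A p k * exp (- \<i> * of_real (real k * lp p * t))) - 1))"
          by (rule fourier_coeff_bound(2)) (use p smA A0 lp0 \<eta> False k in \<open>auto simp: small_def\<close>)
        also have "\<dots> = I p" by (simp add: I_def Ep[OF p])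
        finally have 1: "norm (A p k) \<le> I p" .
        have "real p powr (- 1 / 4) \<le> 2 powr (- 1 / 4)"
          using prime_ge_2_nat[OF p] by (intro powr_mono2') auto
        hence "(real p powr (- 1 / 4)) ^ k \<le> (2 powr (- 1 / 4)) ^ k" by (intro power_mono) auto
        with 1 show ?thesis unfolding n34[OF p] using I0 by (intro mult_mono) auto
      qed
      hence "(\<Sum>k\<in>{1..X}. n34 p k) \<le> (\<Sum>k\<in>{1..X}. I p * (2 powr (- 1 / 4)) ^ k)" by (rule sum_mono)
      also have "\<dots> = I p * (\<Sum>k\<in>{1..X}. (2 powr (- 1 / 4)) ^ k)" by (simp add: sum_distrib_left)
      also have "\<dots> \<le> I p * C"
        unfolding C_def using I0 by (intro mult_left_mono sum_le_suminf smq) auto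
      finally show ?thesis using False by (simp add: x_def)
    qed
    thus "(\<Sum>k\<in>{1..X}. norm (a p k) * real (p ^ k) powr (- 3 / 4)) \<le> x p" by (simp add: n34_def)
  qed
qed

text \<open>Indices that are not prime get the convolution unit, matching the factor 1 in
  \<open>euler_factor\<close>, so partial products can run over all naturals.\<close>

definition local_coef :: "(nat \<Rightarrow> nat \<Rightarrow> complex) \<Rightarrow> nat \<Rightarrow> nat \<Rightarrow> complex" where
  "local_coef a p n = (if prime p then (if \<exists>k. n = p ^ k then a p (THE k. n = p ^ k) else 0) else unit1 n)"

lemma local_coef_prime_power: "prime p \<Longrightarrow> local_coef a p (p ^ k) = a p k"
proof -
  assume p: "prime p"
  have "(THE j. p ^ k = p ^ j) = k"
    using prime_gt_1_nat[OF p] by (intro the_equality) auto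
  thus ?thesis using p by (auto simp: local_coef_def)
qed

lemma dirichlet_bound_local_coef:
  assumes a0: "\<And>p. prime p \<Longrightarrow> a p 0 = 1" and x0: "x p \<ge> 0"
    and x: "\<And>X. prime p \<Longrightarrow> (\<Sum>k\<in>{1..X}. norm (a p k) * real (p ^ k) powr (- 3 / 4)) \<le> x p"
  shows "dirichlet_bound (\<lambda>n. local_coef a p n - unit1 n) (3 / 4) (x p)"
proof (cases "prime p")
  case False
  thus ?thesis using x0 by (simp add: dirichlet_bound_def local_coef_def)
next
  case p: True
  show ?thesis unfolding dirichlet_bound_def
  proof
    fix X
    define f where "f = (\<lambda>n. norm (local_coef a p n - unit1 n) * real n powr (- (3 / 4)))"
    have "(\<Sum>n\<in>{1..X}. f n) = (\<Sum>n\<in>{1..X} \<inter> (\<lambda>k. p ^ k) ` {1..X}. f n)"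
    proof (rule sum.mono_neutral_right)
      show "\<forall>n\<in>{1..X} - {1..X} \<inter> (\<lambda>k. p ^ k) ` {1..X}. f n = 0"
      proof
        fix n assume n: "n \<in> {1..X} - {1..X} \<inter> (\<lambda>k. p ^ k) ` {1..X}"
        show "f n = 0"
        proof (cases "\<exists>k. n = p ^ k")
          case True
          then obtain k where k: "n = p ^ k" by auto
          have "k < p ^ k" using prime_gt_1_nat[OF p] by (simp add: power_gt_expt)
          hence "k \<le> X" using n k by auto
          \<comment> \<open>A power of \<open>p\<close> up to \<open>X\<close> whose exponent is not
            in \<open>{1..X}\<close> can only be the zeroth, where the local coefficient and the
            unit cancel.\<close>
          hence "k = 0" using n k by (auto simp: Suc_le_eq)
          hence "local_coef a p n = 1" using local_coef_prime_power[OF p, of a 0] a0[OF p] k by simp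
          thus ?thesis using k \<open>k = 0\<close> by (simp add: f_def unit1_def)
        next
          case False
          hence "n \<noteq> 1" by (metis power_0)
          thus ?thesis using False p by (auto simp: f_def local_coef_def unit1_def)
        qed
      qed
    qed auto
    also have "\<dots> \<le> (\<Sum>n\<in>(\<lambda>k. p ^ k) ` {1..X}. f n)"
      by (intro sum_mono2) (auto simp: f_def)
    also have "\<dots> = (\<Sum>k\<in>{1..X}. f (p ^ k))"
      using prime_gt_1_nat[OF p] by (subst sum.reindex) (auto simp: inj_on_def)
    also have "\<dots> = (\<Sum>k\<in>{1..X}. norm (a p k) * real (p ^ k) powr (- 3 / 4))"
    proof (rule sum.cong)
      fix k assume k: "k \<in> {1..X}"
      have "p ^ k > 1" using prime_gt_1_nat[OF p] k by (intro one_less_power) auto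
      hence "p ^ k \<noteq> 1" by linarith
      hence "unit1 (p ^ k) = 0" by (simp only: unit1_def if_False)
      thus "f (p ^ k) = norm (a p k) * real (p ^ k) powr (- 3 / 4)"
        by (simp add: f_def local_coef_prime_power[OF p])
    qed simp
    also have "\<dots> \<le> x p" by (rule x[OF p])
    finally show "(\<Sum>n\<in>{1..X}. norm (local_coef a p n - unit1 n) * real n powr (- (3 / 4))) \<le> x p"
      by (simp add: f_def)
  qed
qed

lemma dirichlet_bound_add:
  assumes "dirichlet_bound a \<sigma> K" "dirichlet_bound b \<sigma> K'"
  shows "dirichlet_bound (\<lambda>n. a n + b n) \<sigma> (K + K')"
  unfolding dirichlet_bound_def
proof
  fix X
  have "(\<Sum>n\<in>{1..X}. norm (a n + b n) * real n powr (- \<sigma>)) \<le> (\<Sum>n\<in>{1..X}. norm (a n) * real n powr (- \<sigma>) + norm (b n) * real n powr (- \<sigma>))"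
    by (intro sum_mono) (metis distrib_right mult_right_mono norm_triangle_ineq powr_ge_zero)
  also have "\<dots> \<le> K + K'" unfolding sum.distrib by (intro add_mono nboundD assms)
  finally show "(\<Sum>n\<in>{1..X}. norm (a n + b n) * real n powr (- \<sigma>)) \<le> K + K'" .
qed

lemma dirichlet_local_coef:
  assumes nb: "dirichlet_bound (local_coef a p) (3 / 4) K" and s: "Re s \<ge> 3 / 4"
    and sm: "prime p \<Longrightarrow> summable (\<lambda>k. norm (a p k * of_nat p powr (- (of_nat k * s))))"
  shows "dirichlet (local_coef a p) s = euler_factor a s p"
proof (cases "prime p")
  case False
  hence "local_coef a p = unit1" by (auto simp: local_coef_def)
  thus ?thesis using False by (simp add: dirichlet_unit1 euler_factor_def)
next
  case p: True
  have p0: "p > 0" using prime_gt_0_nat[OF p] .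
  have eq: "dirichlet_term (local_coef a p) s (p ^ k) = a p k * of_nat p powr (- (of_nat k * s))" for k
  proof -
    have "of_nat (p ^ k) powr (- s) = (of_nat p :: complex) powr (- (of_nat k * s))"
    proof (induction k)
      case (Suc k)
      have "(of_nat (p ^ Suc k) :: complex) powr (- s) = of_nat p powr (- s) * of_nat (p ^ k) powr (- s)"
        using powr_times_real[of "of_nat p" "of_nat (p ^ k)" "- s"] by simp
      also have "\<dots> = of_nat p powr (- s + - (of_nat k * s))" by (simp only: Suc powr_add)
      also have "- s + - (of_nat k * s) = - (of_nat (Suc k) * s)" by (simp add: algebra_simps)
      finally show ?case .
    qed (use p0 in simp)
    thus ?thesis by (simp add: dirichlet_term_def local_coef_prime_power[OF p])
  qed
  have "((\<lambda>k. a p k * of_nat p powr (- (of_nat k * s))) has_sum euler_factor a s p) UNIV"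
    using p sm[OF p] by (intro norm_summable_imp_has_sum) (auto simp: euler_factor_def intro: summable_sums summable_norm_cancel)
  hence "((dirichlet_term (local_coef a p) s \<circ> (\<lambda>k. p ^ k)) has_sum euler_factor a s p) UNIV" by (simp add: o_def eq)
  hence "(dirichlet_term (local_coef a p) s has_sum euler_factor a s p) (range (\<lambda>k. p ^ k))"
    using prime_gt_1_nat[OF p] by (subst has_sum_reindex) (auto simp: inj_on_def)
  also have "?this \<longleftrightarrow> (dirichlet_term (local_coef a p) s has_sum euler_factor a s p) {1..}"
    by (rule has_sum_cong_neutral) (use p p0 in \<open>auto simp: dirichlet_term_def local_coef_def Suc_le_eq\<close>)
  finally show ?thesis unfolding dirichlet_def by (rule infsumI)
qed

fun partial_euler :: "(nat \<Rightarrow> nat \<Rightarrow> complex) \<Rightarrow> nat \<Rightarrow> nat \<Rightarrow> complex" where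
  "partial_euler a 0 = unit1"
| "partial_euler a (Suc p) = dirichlet_conv (partial_euler a p) (local_coef a p)"

lemma dirichlet_conv_unit1: "n > 0 \<Longrightarrow> dirichlet_conv f unit1 n = f n"
proof -
  assume n: "n > 0"
  have "dirichlet_conv f unit1 n = (\<Sum>d\<in>{d. d dvd n}. if d = n then f n else 0)"
    unfolding dirichlet_conv_def
  proof (rule sum.cong)
    fix d assume "d \<in> {d. d dvd n}"
    then obtain k where "n = d * k" by auto
    thus "f d * unit1 (n div d) = (if d = n then f n else 0)" using n by (auto simp: unit1_def)
  qed simp
  thus ?thesis using n finite_divisors[OF n] by simp
qed

text \<open>The coefficient at \<open>n\<close> of the partial products no longer changes once all
  factors up to \<open>n\<close> have entered; \<open>h\<close> collects these final values. The
  bound of \<open>\<Prod>(1 + x p)\<close> by \<open>exp (\<Sum>x p)\<close> is uniform in the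
  number of factors, and the distance from \<open>h\<close> to a partial product is controlled by
  the tail of \<open>x\<close>, so the values of the series converge as well.\<close>

theorem euler_product_dirichlet:
  assumes "has_abs_conv_euler_product H (1 / 3)"
  obtains h K where "dirichlet_bound h (3 / 4) K" "h 1 = 1" "\<And>s. Re s \<ge> 3 / 4 \<Longrightarrow> dirichlet h s = H s"
proof -
  obtain a where a: "(\<forall>p. prime p \<longrightarrow> a p 0 = 1) \<and>
       (\<forall>s. Re s > 1 / 3 \<longrightarrow>
          (\<forall>p. prime p \<longrightarrow> summable (\<lambda>k. norm (a p k * of_nat p powr (- (of_nat k * s))))) \<and>
          abs_convergent_prod (euler_factor a s) \<and> euler_factor a s has_prod H s)"
    using assms unfolding has_abs_conv_euler_product_def by (elim exE)
  have a0: "a p 0 = 1" if "prime p" for p using conjunct1[OF a] that by simp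
  have sm: "summable (\<lambda>k. norm (a p k * of_nat p powr (- (of_nat k * s))))" if "Re s > 1 / 3" "prime p" for s p
    using conjunct1[OF mp[OF spec[OF conjunct2[OF a], of s] that(1)], THEN spec, of p] that(2) by simp
  have pr: "abs_convergent_prod (euler_factor a s)" and hp: "euler_factor a s has_prod H s" if "Re s > 1 / 3" for s
    using conjunct2[OF mp[OF spec[OF conjunct2[OF a], of s] that]] by (rule conjunct1, rule conjunct2)
  obtain x where x: "summable x" "\<And>p. x p \<ge> 0"
    "\<And>p X. prime p \<Longrightarrow> (\<Sum>k\<in>{1..X}. norm (a p k) * real (p ^ k) powr (- 3 / 4)) \<le> x p"
    using euler_coeffs_summable[OF a0 sm pr] by blast
  define L where "L = local_coef a"
  define hP where "hP = partial_euler a"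
  have nL': "dirichlet_bound (\<lambda>n. L p n - unit1 n) (3 / 4) (x p)" for p
    unfolding L_def using dirichlet_bound_local_coef[of a x p, OF a0 x(2) x(3)] .
  have nL: "dirichlet_bound (L p) (3 / 4) (1 + x p)" for p
    using dirichlet_bound_add[OF dirichlet_bound_unit1 nL'[of p]] by simp
  have nP: "dirichlet_bound (hP P) (3 / 4) (\<Prod>p<P. 1 + x p)" for P
  proof (induction P)
    case 0
    show ?case using dirichlet_bound_unit1 by (simp add: hP_def)
  next
    case (Suc P)
    show ?case using dirichlet_bound_dirichlet_conv[OF Suc nL[of P]] by (simp add: hP_def L_def)
  qed
  define C where "C = exp (\<Sum>p. x p)"
  have C0: "C > 0" by (simp add: C_def)
  have prod_le: "(\<Prod>p<P. 1 + x p) \<le> C" for P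
  proof -
    have "(\<Prod>p<P. 1 + x p) \<le> (\<Prod>p<P. exp (x p))"
      using x(2) by (intro prod_mono) (auto intro: add_nonneg_nonneg)
    also have "\<dots> = exp (\<Sum>p<P. x p)" by (simp add: exp_sum)
    also have "\<dots> \<le> C" unfolding C_def using x by (simp add: sum_le_suminf)
    finally show ?thesis .
  qed
  have nPC: "dirichlet_bound (hP P) (3 / 4) C" for P
    using nP[of P] prod_le[of P] unfolding dirichlet_bound_def by (meson order_trans)
  have dsP: "dirichlet (hP P) s = (\<Prod>p<P. euler_factor a s p)" if s: "Re s \<ge> 3 / 4" for P s
  proof (induction P)
    case 0
    show ?case by (simp add: hP_def dirichlet_unit1)
  next
    case (Suc P)
    have "dirichlet (hP (Suc P)) s = dirichlet (hP P) s * dirichlet (L P) s"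
      unfolding hP_def L_def partial_euler.simps
      using dirichlet_dirichlet_conv[OF nPC nL s] by (simp add: hP_def L_def)
    also have "dirichlet (L P) s = euler_factor a s P"
      unfolding L_def by (rule dirichlet_local_coef[OF nL[unfolded L_def] s]) (use sm s in auto)
    finally show ?case using Suc by simp
  qed
  have Lsmall: "L p n = unit1 n" if "0 < n" "n < p" for n p
  proof (cases "prime p")
    case False
    thus ?thesis by (simp add: L_def local_coef_def)
  next
    case True
    show ?thesis
    proof (cases "n = 1")
      case True2: True
      thus ?thesis using local_coef_prime_power[OF True, of a 0] a0[OF True] by (simp add: L_def unit1_def)
    next
      case False
      have "n \<noteq> p ^ k" for k
      proof
        assume k: "n = p ^ k"
        hence "k > 0" using False by (auto intro: Nat.gr0I)
        hence "p ^ 1 \<le> p ^ k" using prime_gt_0_nat[OF True] by (intro power_increasing) auto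
        thus False using k that by simp
      qed
      thus ?thesis using True False by (simp add: L_def local_coef_def unit1_def)
    qed
  qed
  have step: "hP (Suc p) n = hP p n" if n: "0 < n" "n < p" for n p
  proof -
    have "hP (Suc p) n = dirichlet_conv (hP p) unit1 n"
      unfolding hP_def partial_euler.simps dirichlet_conv_def
    proof (rule sum.cong)
      fix d assume "d \<in> {d. d dvd n}"
      then obtain k where k: "n = d * k" by auto
      hence "0 < n div d" "n div d \<le> n" using n by (auto intro!: Nat.gr0I)
      hence "local_coef a p (n div d) = unit1 (n div d)" 
        using Lsmall[OF \<open>0 < n div d\<close> le_less_trans[OF \<open>n div d \<le> n\<close> n(2)]] by (simp add: L_def)
      thus "partial_euler a p d * local_coef a p (n div d) = partial_euler a p d * unit1 (n div d)" by simp
    qed simp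
    thus ?thesis using dirichlet_conv_unit1[OF n(1)] by simp
  qed
  \<comment> \<open>\<open>hP P\<close> contains the factors at indices below \<open>P\<close>, so
    \<open>Suc n\<close> is the first index at which the factor at \<open>n\<close> has
    entered.\<close>
  define h where "h = (\<lambda>n. hP (Suc n) n)"
  have stable: "hP P n = h n" if "0 < n" "n < P" for P n
  proof -
    have "Suc n \<le> P" using that by simp
    thus ?thesis
      by (induction P rule: dec_induct) (use step that in \<open>auto simp: h_def\<close>)
  qed
  have nh: "dirichlet_bound h (3 / 4) C"
    unfolding dirichlet_bound_def
  proof
    fix X
    have "(\<Sum>n\<in>{1..X}. norm (h n) * real n powr (- (3 / 4))) = (\<Sum>n\<in>{1..X}. norm (hP (Suc X) n) * real n powr (- (3 / 4)))"
      by (intro sum.cong refl) (use stable in auto)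
    also have "\<dots> \<le> C" by (rule nboundD[OF nPC])
    finally show "(\<Sum>n\<in>{1..X}. norm (h n) * real n powr (- (3 / 4))) \<le> C" .
  qed
  have nstep: "(\<Sum>n\<in>{1..X}. norm (hP (Suc p) n - hP p n) * real n powr (- (3 / 4))) \<le> C * x p" for p X
  proof -
    have "(\<Sum>n\<in>{1..X}. norm (hP (Suc p) n - hP p n) * real n powr (- (3 / 4))) =
      (\<Sum>n\<in>{1..X}. norm (dirichlet_conv (hP p) (\<lambda>n. L p n - unit1 n) n) * real n powr (- (3 / 4)))"
    proof (rule sum.cong)
      fix n assume "n \<in> {1..X}"
      hence n: "n > 0" by auto
      have "dirichlet_conv (hP p) (\<lambda>n. L p n - unit1 n) n = dirichlet_conv (hP p) (L p) n - dirichlet_conv (hP p) unit1 n"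
        by (simp add: dirichlet_conv_def right_diff_distrib sum_subtractf)
      also have "\<dots> = hP (Suc p) n - hP p n" using dirichlet_conv_unit1[OF n] by (simp add: hP_def L_def)
      finally show "norm (hP (Suc p) n - hP p n) * real n powr (- (3 / 4)) =
         norm (dirichlet_conv (hP p) (\<lambda>n. L p n - unit1 n) n) * real n powr (- (3 / 4))" by simp
    qed simp
    also have "\<dots> \<le> C * x p" by (rule nboundD[OF dirichlet_bound_dirichlet_conv[OF nPC nL']])
    finally show ?thesis .
  qed
  \<comment> \<open>The factor at \<open>p\<close> moves the weighted norm by at most
    \<open>C * x p\<close>, so the tail of \<open>x\<close> bounds the distance to the
    limit.\<close>
  define tail where "tail = (\<lambda>P. C * ((\<Sum>p. x p) - (\<Sum>p<P. x p)))"
  have ndiff: "dirichlet_bound (\<lambda>n. h n - hP P n) (3 / 4) (tail P)" for P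
    unfolding dirichlet_bound_def
  proof
    fix X
    define R where "R = max P (Suc X)"
    have "(\<Sum>n\<in>{1..X}. norm (h n - hP P n) * real n powr (- (3 / 4))) =
       (\<Sum>n\<in>{1..X}. norm (\<Sum>p\<in>{P..<R}. hP (Suc p) n - hP p n) * real n powr (- (3 / 4)))"
    proof (rule sum.cong)
      fix n assume n: "n \<in> {1..X}"
      have "(\<Sum>p\<in>{P..<R}. hP (Suc p) n - hP p n) = hP R n - hP P n"
        by (rule sum_Suc_diff') (simp add: R_def)
      moreover have "hP R n = h n" using n by (intro stable) (auto simp: R_def)
      ultimately show "norm (h n - hP P n) * real n powr (- (3 / 4)) =
         norm (\<Sum>p\<in>{P..<R}. hP (Suc p) n - hP p n) * real n powr (- (3 / 4))" by simp
    qed simp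
    also have "\<dots> \<le> (\<Sum>n\<in>{1..X}. \<Sum>p\<in>{P..<R}. norm (hP (Suc p) n - hP p n) * real n powr (- (3 / 4)))"
      unfolding sum_distrib_right[symmetric] by (intro sum_mono mult_right_mono norm_sum) auto
    also have "\<dots> = (\<Sum>p\<in>{P..<R}. \<Sum>n\<in>{1..X}. norm (hP (Suc p) n - hP p n) * real n powr (- (3 / 4)))"
      by (rule sum.swap)
    also have "\<dots> \<le> (\<Sum>p\<in>{P..<R}. C * x p)" by (intro sum_mono nstep)
    also have "\<dots> = C * (\<Sum>p\<in>{P..<R}. x p)" by (simp add: sum_distrib_left)
    also have "(\<Sum>p\<in>{P..<R}. x p) = (\<Sum>p<R. x p) - (\<Sum>p<P. x p)"
      using sum_diff_nat_ivl[of 0 P R x] by (simp add: atLeast0LessThan R_def)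
    also have "C * \<dots> \<le> tail P"
      unfolding tail_def using C0 x by (intro mult_left_mono diff_right_mono sum_le_suminf) auto
    finally show "(\<Sum>n\<in>{1..X}. norm (h n - hP P n) * real n powr (- (3 / 4))) \<le> tail P" .
  qed
  have tail0: "tail \<longlonglongrightarrow> 0"
  proof -
    have "(\<lambda>P. C * ((\<Sum>p. x p) - (\<Sum>p<P. x p))) \<longlonglongrightarrow> C * ((\<Sum>p. x p) - (\<Sum>p. x p))"
      by (intro tendsto_intros summable_LIMSEQ x)
    thus ?thesis by (simp add: tail_def)
  qed
  show ?thesis
  proof (rule that[OF nh])
    have "hP (Suc 1) 1 = 1"
    proof -
      have "\<not> prime (0::nat)" "\<not> prime (1::nat)" by auto
      thus ?thesis by (simp add: hP_def dirichlet_conv_def local_coef_def unit1_def)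
    qed
    thus "h 1 = 1" by (simp add: h_def)
    fix s :: complex assume s: "Re s \<ge> 3 / 4"
    have "(\<lambda>P. dirichlet h s - dirichlet (hP P) s) \<longlonglongrightarrow> 0"
    proof (rule Lim_null_comparison[OF always_eventually tail0], intro allI)
      fix P
      have "((\<lambda>n. dirichlet_term h s n - dirichlet_term (hP P) s n) has_sum (dirichlet h s - dirichlet (hP P) s)) {1..}"
        using has_sum_add[OF has_sum_dirichlet[OF nh s] has_sum_cmult_right[OF has_sum_dirichlet[OF nPC s], of "- 1"]] by simp
      moreover have "(\<lambda>n. dirichlet_term h s n - dirichlet_term (hP P) s n) = dirichlet_term (\<lambda>n. h n - hP P n) s"
        by (auto simp: dirichlet_term_def left_diff_distrib)
      ultimately have "dirichlet (\<lambda>n. h n - hP P n) s = dirichlet h s - dirichlet (hP P) s"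
        unfolding dirichlet_def by (simp add: infsumI)
      thus "norm (dirichlet h s - dirichlet (hP P) s) \<le> tail P" using dirichlet_bound_abs_summable(2)[OF ndiff s] by metis
    qed
    hence "(\<lambda>P. dirichlet h s - (dirichlet h s - dirichlet (hP P) s)) \<longlonglongrightarrow> dirichlet h s - 0" by (intro tendsto_intros)
    hence "(\<lambda>P. \<Prod>p<P. euler_factor a s p) \<longlonglongrightarrow> dirichlet h s" by (simp add: dsP[OF s])
    moreover have "(\<lambda>P. \<Prod>p<P. euler_factor a s p) \<longlonglongrightarrow> H s"
      using s by (intro has_prod_imp_tendsto' hp) auto
    ultimately show "dirichlet h s = H s" by (rule LIMSEQ_unique)
  qed
qed

section \<open>Comparison of the two sides\<close>

text \<open>The shifted zeta function is the series of \<open>l / l^(2 s)\<close>, so its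
  coefficients sit on squares with the root as weight; this is the origin of the variable
  \<open>l\<close>. The two constant sequences produce \<open>r1\<close> and
  \<open>r2\<close>.\<close>

definition fcoef :: "(nat \<Rightarrow> complex) \<Rightarrow> nat \<Rightarrow> complex" where
  "fcoef g = dirichlet_conv (lift2 of_nat) (dirichlet_conv (\<lambda>_. 1) (dirichlet_conv (\<lambda>_. 1) g))"

text \<open>At each unfolding the new variable can be cut at \<open>X\<close>, since multiplying the
  argument by a positive integer keeps it beyond the support of the wave.\<close>

lemma sum_fcoef_wave:
  assumes "U \<ge> 1"
  shows "(\<Sum>m\<in>{1..4 * U\<^sup>2}. fcoef g m * wave U n (sqrt (real m))) = wave_sum g U n"
proof -
  define X where "X = 4 * U\<^sup>2"
  define \<phi> where "\<phi> = (\<lambda>m. wave U n (sqrt (real m)))"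
  have \<phi>0: "\<phi> m = 0" if "m > X" for m
  proof -
    have "(2 * real U)\<^sup>2 \<le> real m" using that unfolding X_def
      by (metis (mono_tags) less_imp_le of_nat_le_iff of_nat_mult of_nat_numeral of_nat_power power2_eq_square power_mult_distrib four_x_squared)
    hence "2 * real U \<le> sqrt (real m)" by (rule real_le_rsqrt)
    thus ?thesis unfolding \<phi>_def using assms by (intro wave_eq_0) auto
  qed
  have \<phi>0': "\<phi> (d * m) = 0" if "m > X" "d \<ge> 1" for d m
  proof (rule \<phi>0)
    have "1 * m \<le> d * m" using that by (intro mult_right_mono) auto
    hence "m \<le> d * m" by simp
    thus "d * m > X" using that by linarith
  qed
  have "(\<Sum>m\<in>{1..X}. fcoef g m * \<phi> m) =
     (\<Sum>d\<in>{1..X}. \<Sum>b\<in>{1..X}. lift2 of_nat d * dirichlet_conv (\<lambda>_. 1) (dirichlet_conv (\<lambda>_. 1) g) b * \<phi> (d * b))"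
    unfolding fcoef_def by (rule sum_dirichlet_conv) (rule \<phi>0)
  also have "\<dots> = (\<Sum>d\<in>{1..X}. lift2 of_nat d * (\<Sum>r1\<in>{1..X}. \<Sum>r2\<in>{1..X}. \<Sum>e\<in>{1..X}. g e * \<phi> (d * (r1 * (r2 * e)))))"
  proof (rule sum.cong)
    fix d assume d: "d \<in> {1..X}"
    have "(\<Sum>b\<in>{1..X}. lift2 of_nat d * dirichlet_conv (\<lambda>_. 1) (dirichlet_conv (\<lambda>_. 1) g) b * \<phi> (d * b)) =
      lift2 of_nat d * (\<Sum>b\<in>{1..X}. dirichlet_conv (\<lambda>_. 1) (dirichlet_conv (\<lambda>_. 1) g) b * \<phi> (d * b))"
      by (simp add: sum_distrib_left mult.assoc)
    also have "(\<Sum>b\<in>{1..X}. dirichlet_conv (\<lambda>_. 1) (dirichlet_conv (\<lambda>_. 1) g) b * \<phi> (d * b)) =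
      (\<Sum>r1\<in>{1..X}. \<Sum>b\<in>{1..X}. 1 * dirichlet_conv (\<lambda>_. 1) g b * \<phi> (d * (r1 * b)))"
      by (rule sum_dirichlet_conv) (use d in \<open>auto intro!: \<phi>0'\<close>)
    also have "\<dots> = (\<Sum>r1\<in>{1..X}. \<Sum>r2\<in>{1..X}. \<Sum>e\<in>{1..X}. 1 * g e * \<phi> (d * (r1 * (r2 * e))))"
    proof (rule sum.cong)
      fix r1 assume r1: "r1 \<in> {1..X}"
      have "(\<Sum>b\<in>{1..X}. dirichlet_conv (\<lambda>_. 1) g b * \<phi> (d * (r1 * b))) = (\<Sum>r2\<in>{1..X}. \<Sum>e\<in>{1..X}. 1 * g e * \<phi> (d * (r1 * (r2 * e))))"
      proof (rule sum_dirichlet_conv)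
        fix b assume "b > X"
        moreover have "d * r1 \<ge> 1" using d r1 by (simp add: Suc_le_eq)
        ultimately show "\<phi> (d * (r1 * b)) = 0" using \<phi>0'[of b "d * r1"] by (simp add: mult.assoc)
      qed
      thus "(\<Sum>b\<in>{1..X}. 1 * dirichlet_conv (\<lambda>_. 1) g b * \<phi> (d * (r1 * b))) = (\<Sum>r2\<in>{1..X}. \<Sum>e\<in>{1..X}. 1 * g e * \<phi> (d * (r1 * (r2 * e))))"
        by simp
    qed simp
    finally show "(\<Sum>b\<in>{1..X}. lift2 of_nat d * dirichlet_conv (\<lambda>_. 1) (dirichlet_conv (\<lambda>_. 1) g) b * \<phi> (d * b)) =
      lift2 of_nat d * (\<Sum>r1\<in>{1..X}. \<Sum>r2\<in>{1..X}. \<Sum>e\<in>{1..X}. g e * \<phi> (d * (r1 * (r2 * e))))" by simp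
  qed simp
  also have "\<dots> = (\<Sum>l\<in>{1..X}. lift2 of_nat (l\<^sup>2) * (\<Sum>r1\<in>{1..X}. \<Sum>r2\<in>{1..X}. \<Sum>e\<in>{1..X}. g e * \<phi> (l\<^sup>2 * (r1 * (r2 * e)))))"
  proof (rule sum_lift2)
    fix d assume d: "d > X"
    have "\<phi> (d * (r1 * (r2 * e))) = 0" if "r1 \<in> {1..X}" "r2 \<in> {1..X}" "e \<in> {1..X}" for r1 r2 e
    proof -
      have "r1 * (r2 * e) \<ge> 1" using that by (simp add: Suc_le_eq)
      thus ?thesis using \<phi>0'[of d "r1 * (r2 * e)"] d by (simp add: mult_ac)
    qed
    thus "lift2 of_nat d * (\<Sum>r1\<in>{1..X}. \<Sum>r2\<in>{1..X}. \<Sum>e\<in>{1..X}. g e * \<phi> (d * (r1 * (r2 * e)))) = 0" by simp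
  qed (simp add: lift2_nonsquare)
  also have "\<dots> = (\<Sum>l\<in>{1..X}. \<Sum>r1\<in>{1..X}. \<Sum>r2\<in>{1..X}. \<Sum>e\<in>{1..X}. g e * (of_nat l * wave U n (real l * sqrt (real (r1 * r2 * e)))))"
    unfolding lift2_square sum_distrib_left
  proof (intro sum.cong refl)
    fix l r1 r2 e
    have "sqrt (real (l\<^sup>2 * (r1 * (r2 * e)))) = real l * sqrt (real (r1 * r2 * e))"
      by (simp add: real_sqrt_mult)
    thus "of_nat l * (g e * \<phi> (l\<^sup>2 * (r1 * (r2 * e)))) = g e * (of_nat l * wave U n (real l * sqrt (real (r1 * r2 * e))))"
      by (simp only: \<phi>_def) simp
  qed
  also have "\<dots> = (\<Sum>r1\<in>{1..X}. \<Sum>l\<in>{1..X}. \<Sum>r2\<in>{1..X}. \<Sum>e\<in>{1..X}. g e * (of_nat l * wave U n (real l * sqrt (real (r1 * r2 * e)))))"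
    by (rule sum.swap)
  also have "\<dots> = (\<Sum>r1\<in>{1..X}. \<Sum>r2\<in>{1..X}. \<Sum>l\<in>{1..X}. \<Sum>e\<in>{1..X}. g e * (of_nat l * wave U n (real l * sqrt (real (r1 * r2 * e)))))"
    by (intro sum.cong refl sum.swap)
  also have "\<dots> = (\<Sum>r1\<in>{1..X}. \<Sum>r2\<in>{1..X}. \<Sum>e\<in>{1..X}. \<Sum>l\<in>{1..X}. g e * (of_nat l * wave U n (real l * sqrt (real (r1 * r2 * e)))))"
    by (intro sum.cong refl sum.swap)
  also have "\<dots> = (\<Sum>r1\<in>{1..X}. \<Sum>e\<in>{1..X}. \<Sum>r2\<in>{1..X}. \<Sum>l\<in>{1..X}. g e * (of_nat l * wave U n (real l * sqrt (real (r1 * r2 * e)))))"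
    by (intro sum.cong refl sum.swap)
  also have "\<dots> = (\<Sum>e\<in>{1..X}. \<Sum>r1\<in>{1..X}. \<Sum>r2\<in>{1..X}. \<Sum>l\<in>{1..X}. g e * (of_nat l * wave U n (real l * sqrt (real (r1 * r2 * e)))))"
    by (rule sum.swap)
  also have "\<dots> = wave_sum g U n" unfolding wave_sum_def X_def[symmetric] sum_distrib_left ..
  finally show ?thesis unfolding \<phi>_def X_def .
qed

text \<open>On the real axis from 2 on all factors converge absolutely, so both sequences have the
  series \<open>F s\<close> there and agree by uniqueness.\<close>

lemma coefficients_eq_fcoef:
  fixes f :: "nat \<Rightarrow> complex" and F G :: "complex \<Rightarrow> complex"
  assumes g: "dirichlet_bound g (3 / 4) G1" "\<And>s. Re s \<ge> 3 / 4 \<Longrightarrow> dirichlet g s = G s"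
    and F: "\<And>s. Re s > 1 \<Longrightarrow> F s = zeta s ^ 2 * zeta (2 * s - 1) * G s"
    and f: "\<And>s. Re s > 1 \<Longrightarrow> (\<lambda>n. f (Suc n) / of_nat (Suc n) powr s) sums F s"
    and "n \<ge> 1"
  shows "f n = fcoef g n"
proof -
  obtain K1 where "dirichlet_bound of_nat 4 K1"
    by (rule dirichlet_bound_powr[of 4 1 of_nat]) auto
  hence K1': "dirichlet_bound of_nat (2 * 2) K1" by simp
  hence K1: "dirichlet_bound (lift2 of_nat) 2 K1" by (rule dirichlet_bound_lift2)
  obtain K2 where K2: "dirichlet_bound (\<lambda>_. 1) 2 K2"
    by (rule dirichlet_bound_powr[of 2 0 "\<lambda>_. 1"]) auto
  have K3: "dirichlet_bound g 2 G1" by (rule dirichlet_bound_mono[OF g(1)]) simp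
  note K4 = dirichlet_bound_dirichlet_conv[OF K2 K3]
  note K5 = dirichlet_bound_dirichlet_conv[OF K2 K4]
  note K6 = dirichlet_bound_dirichlet_conv[OF K1 K5]
  have "f n - fcoef g n = 0"
  proof (rule dirichlet_coeffs_unique[of "\<lambda>n. f n - fcoef g n"])
    fix x :: real assume x: "x \<ge> 2"
    define s where "s = complex_of_real x"
    have s: "Re s \<ge> 2" using x by (simp add: s_def)
    have "dirichlet (fcoef g) s = dirichlet (lift2 of_nat) s * (dirichlet (\<lambda>_. 1) s * (dirichlet (\<lambda>_. 1) s * dirichlet g s))"
      unfolding fcoef_def using dirichlet_dirichlet_conv[OF K1 K5 s] dirichlet_dirichlet_conv[OF K2 K4 s] dirichlet_dirichlet_conv[OF K2 K3 s] by simp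
    also have "dirichlet (lift2 of_nat) s = zeta (2 * s - 1)"
      using dirichlet_lift2[OF K1' s] dirichlet_id[of "2 * s"] s by simp
    also have "dirichlet (\<lambda>_. 1) s = zeta s" using s by (intro dirichlet_one) auto
    also have "dirichlet g s = G s" using s by (intro g) auto
    also have "zeta (2 * s - 1) * (zeta s * (zeta s * G s)) = F s"
      using s by (subst F) (auto simp: power2_eq_square)
    finally have "(\<lambda>n. dirichlet_term (fcoef g) s (Suc n)) sums F s"
      using sums_dirichlet[OF K6 s] by (simp add: fcoef_def)
    moreover have "(\<lambda>n. dirichlet_term f s (Suc n)) sums F s"
      using f[of s] s by (simp add: dirichlet_term_def powr_minus_divide)
    ultimately have "(\<lambda>n. dirichlet_term f s (Suc n) - dirichlet_term (fcoef g) s (Suc n)) sums (F s - F s)"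
      by (rule sums_diff[rotated])
    thus "(\<lambda>n. dirichlet_term (\<lambda>n. f n - fcoef g n) (of_real x) (Suc n)) sums 0"
      by (simp add: dirichlet_term_def left_diff_distrib s_def)
  qed fact
  thus ?thesis by simp
qed

section \<open>The residue as an integral over a circle\<close>

lemma holomorphic_dirichlet:
  assumes g: "dirichlet_bound g (3 / 4) G1"
  shows "dirichlet g holomorphic_on {s. Re s > 3 / 4}"
proof -
  have sm: "summable (\<lambda>n. norm (g (Suc n)) * real (Suc n) powr (- 3 / 4))"
  proof (rule summableI_nonneg_bounded[of _ G1])
    fix X
    have "(\<Sum>n<X. norm (g (Suc n)) * real (Suc n) powr (- 3 / 4)) = (\<Sum>n\<in>{1..X}. norm (g n) * real n powr (- (3 / 4)))"
      by (simp add: sum.atLeast1_atMost_eq)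
    also have "\<dots> \<le> G1" by (rule nboundD[OF g])
    finally show "(\<Sum>n<X. norm (g (Suc n)) * real (Suc n) powr (- 3 / 4)) \<le> G1" .
  qed auto
  have "(\<lambda>s. \<Sum>n. dirichlet_term g s (Suc n)) holomorphic_on {s. Re s > 3 / 4}"
  proof (rule holomorphic_suminf)
    show "open {s. Re s > 3 / 4}" by (rule open_halfspace_Re_gt)
    show "(\<lambda>s. dirichlet_term g s (Suc n)) holomorphic_on {s. Re s > 3 / 4}" for n
      unfolding dirichlet_term_def by (auto intro!: holomorphic_intros simp del: of_nat_Suc)
    fix z :: complex assume "z \<in> {s. Re s > 3 / 4}"
    then obtain d a where d: "d > 0" "a > 3 / 4" "\<And>s. s \<in> cball z d \<Longrightarrow> Re s \<ge> a"
      using cball_halfplane[of "3 / 4" z] by auto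
    show "\<exists>d>0. cball z d \<subseteq> {s. Re s > 3 / 4} \<and> (\<exists>M. summable M \<and> (\<forall>n. \<forall>x\<in>cball z d. norm (dirichlet_term g x (Suc n)) \<le> M n))"
    proof (intro exI[of _ d] exI[of _ "\<lambda>n. norm (g (Suc n)) * real (Suc n) powr (- 3 / 4)"] conjI allI ballI)
      show "cball z d \<subseteq> {s. Re s > 3 / 4}" using d by fastforce
      fix n x assume x: "x \<in> cball z d"
      have "norm (dirichlet_term g x (Suc n)) = norm (g (Suc n)) * real (Suc n) powr (- Re x)" by (rule norm_dirichlet_term) simp
      also have "\<dots> \<le> norm (g (Suc n)) * real (Suc n) powr (- 3 / 4)"
        using d(2) d(3)[OF x] by (intro mult_left_mono powr_mono) auto
      finally show "norm (dirichlet_term g x (Suc n)) \<le> norm (g (Suc n)) * real (Suc n) powr (- 3 / 4)" .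
    qed (use d sm in auto)
  qed
  thus ?thesis
    by (rule holomorphic_transform) (use sums_dirichlet[OF g] in \<open>auto simp: sums_iff\<close>)
qed

text \<open>The circle of radius 1/8 about 1 stays in \<open>Re s > 3/4\<close> and away from the
  pole of \<open>1 / s\<close>, and on it \<open>x\<close> enters only through the power
  \<open>x powr \<gamma> t\<close>. The factor \<open>2 * pi * \<i>\<close> cancels against the
  derivative of the circle.\<close>

lemma residue_representation:
  fixes F G :: "complex \<Rightarrow> complex"
  assumes G: "G holomorphic_on {s. Re s > 3 / 4}"
    and F: "\<And>s. Re s > 3 / 4 \<Longrightarrow> F s = zeta s ^ 2 * zeta (2 * s - 1) * G s"
  obtains h \<gamma> :: "real \<Rightarrow> complex" where "continuous_on {0..1} h" "continuous_on {0..1} \<gamma>"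
    "\<And>t. t \<in> {0..1} \<Longrightarrow> norm (\<gamma> t - 1) \<le> 1 / 8"
    "\<And>x. x > 0 \<Longrightarrow> residue (\<lambda>s. F s * (of_real x powr s / s)) 1 = integral {0..1} (\<lambda>t. h t * exp (\<gamma> t * of_real (ln x)))"
proof -
  define B where "B = ball (1::complex) (1 / 4)"
  have Re_B: "Re s > 3 / 4" if "s \<in> B" for s
  proof -
    have "\<bar>Re (1 - s)\<bar> < 1 / 4" using that abs_Re_le_cmod[of "1 - s"] by (simp add: B_def dist_norm)
    hence "\<bar>1 - Re s\<bar> < 1 / 4" by simp
    thus ?thesis by linarith
  qed
  have zh: "zeta holomorphic_on (- {1})" using is_zeta_zeta by (simp add: is_zeta_def)
  have z2: "(\<lambda>s. zeta (2 * s - 1)) holomorphic_on (B - {1})"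
    by (rule holomorphic_on_compose_gen[OF _ zh, of "\<lambda>s. 2 * s - 1", unfolded o_def]) (auto intro!: holomorphic_intros)
  have Fh: "F holomorphic_on (B - {1})"
  proof (rule holomorphic_transform)
    show "(\<lambda>s. zeta s ^ 2 * zeta (2 * s - 1) * G s) holomorphic_on (B - {1})"
      by (intro holomorphic_intros z2 holomorphic_on_subset[OF zh] holomorphic_on_subset[OF G]) (use Re_B in auto)
  qed (use F Re_B in auto)
  define \<gamma> where "\<gamma> = circlepath (1::complex) (1 / 8)"
  have \<gamma>t: "\<gamma> t = 1 + of_real (1 / 8) * exp (2 * of_real pi * \<i> * of_real t)" for t
    by (simp add: \<gamma>_def circlepath)
  have n\<gamma>: "norm (\<gamma> t - 1) = 1 / 8" for t
  proof -
    have "norm (exp (2 * of_real pi * \<i> * of_real t)) = 1" by simp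
    thus ?thesis unfolding \<gamma>t by (simp add: norm_mult)
  qed
  have \<gamma>B: "\<gamma> t \<in> B - {1}" for t using n\<gamma>[of t] by (auto simp: B_def dist_norm norm_minus_commute)
  have c\<gamma>: "continuous_on {0..1} \<gamma>" unfolding \<gamma>t[abs_def] by (intro continuous_intros)
  have \<gamma>0: "\<gamma> t \<noteq> 0" for t using \<gamma>B[of t] Re_B[of "\<gamma> t"] by auto
  define h where "h = (\<lambda>t. F (\<gamma> t) / \<gamma> t * (of_real (1 / 8) * exp (2 * of_real pi * \<i> * of_real t)))"
  show ?thesis
  proof (rule that[of h \<gamma>])
    have "continuous_on {0..1} (\<lambda>t. F (\<gamma> t))"
      by (rule continuous_on_compose2[OF holomorphic_on_imp_continuous_on[OF Fh] c\<gamma>]) (use \<gamma>B in auto)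
    thus "continuous_on {0..1} h" unfolding h_def by (intro continuous_intros c\<gamma>) (use \<gamma>0 in auto)
    show "continuous_on {0..1} \<gamma>" by (rule c\<gamma>)
    show "norm (\<gamma> t - 1) \<le> 1 / 8" for t using n\<gamma>[of t] by simp
    fix x :: real assume x: "x > 0"
    define f where "f = (\<lambda>s. F s * (of_real x powr s / s))"
    have "f holomorphic_on (B - {1})"
      unfolding f_def by (intro holomorphic_intros Fh) (use x Re_B[of 0] in auto)
    hence "(f has_contour_integral 2 * pi * \<i> * residue f 1) (circlepath 1 (1 / 8))"
      by (intro base_residue[of B]) (auto simp: B_def)
    hence "((\<lambda>t. f (\<gamma> t) * vector_derivative \<gamma> (at t within {0..1})) has_integral (2 * pi * \<i> * residue f 1)) {0..1}"
      unfolding \<gamma>_def has_contour_integral_def .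
    hence "((\<lambda>t. 2 * pi * \<i> * (h t * exp (\<gamma> t * of_real (ln x)))) has_integral (2 * pi * \<i> * residue f 1)) {0..1}"
    proof (rule has_integral_eq[rotated])
      fix t :: real assume t: "t \<in> {0..1}"
      have vd: "vector_derivative \<gamma> (at t within {0..1}) = 2 * pi * \<i> * (1 / 8) * exp (2 * of_real pi * \<i> * t)"
        unfolding \<gamma>_def using t by (subst vector_derivative_circlepath01) auto
      have px: "of_real x powr \<gamma> t = exp (\<gamma> t * of_real (ln x))"
        using x by (simp add: powr_def Ln_of_real)
      show "f (\<gamma> t) * vector_derivative \<gamma> (at t within {0..1}) = 2 * pi * \<i> * (h t * exp (\<gamma> t * of_real (ln x)))"
        unfolding f_def h_def vd px by (simp add: mult_ac)
    qed
    from has_integral_mult_right[OF this, of "1 / (2 * pi * \<i>)"]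
    have "((\<lambda>t. h t * exp (\<gamma> t * of_real (ln x))) has_integral residue f 1) {0..1}" by simp
    thus "residue (\<lambda>s. F s * (of_real x powr s / s)) 1 = integral {0..1} (\<lambda>t. h t * exp (\<gamma> t * of_real (ln x)))"
      unfolding f_def by (simp add: integral_unique)
  qed
qed

text \<open>\<open>abel_identity\<close> turns the test sums into integrals of the summatory
  function. Subtracting \<open>R\<close> leaves the error term, which contributes at most
  \<open>b\<close> times the integral of the modulus of the test function; the residue part is
  bounded termwise with weights at most \<open>N\<close>.\<close>

lemma test_upper_bound:
  fixes f g :: "nat \<Rightarrow> complex" and R :: "real \<Rightarrow> complex" and U N Q :: nat
  assumes "U \<ge> 1" "N \<ge> 1" "Q \<ge> 1"
    and f: "\<And>n. n \<ge> 1 \<Longrightarrow> f n = fcoef g n"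
    and R: "\<And>n. n \<ge> 1 \<Longrightarrow> (\<lambda>u. R (u\<^sup>2) * wave_deriv U n u) integrable_on {real U..2 * real U} \<and>
       norm (integral {real U..2 * real U} (\<lambda>u. R (u\<^sup>2) * wave_deriv U n u)) \<le> C * sqrt (real n) * (2 * real U) powr (5 / 4)"
    and C: "C \<ge> 0"
    and \<Delta>: "\<And>u. u \<in> {real U..2 * real U} \<Longrightarrow> norm ((\<Sum>n\<in>{n. 1 \<le> n \<and> real n \<le> u\<^sup>2}. f n) - R (u\<^sup>2)) \<le> b"
  defines "B \<equiv> {m\<in>{1..N}. coprime m Q}" and "D \<equiv> ndiv2_sum Q N"
  shows "norm (\<Sum>m\<in>B. \<Sum>j\<in>{j. j dvd Q}. of_real (real (ndiv m) * mu j) * wave_sum g U (j\<^sup>2 * m)) \<le>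
     b * (2 * real Q * (real U * sqrt D + 2 * real Q * real N ^ 6)) +
     real Q * (real N)\<^sup>2 * (C * (real Q * real N) * (2 * real U) powr (5 / 4))"
proof -
  define J where "J = {j. j dvd Q}"
  have J: "finite J" "card J \<le> Q" "\<And>j. j \<in> J \<Longrightarrow> 1 \<le> j \<and> j \<le> Q"
  proof -
    show "finite J" using assms unfolding J_def by (intro finite_divisors) auto
    show "card J \<le> Q" using ndiv_le[of Q] assms by (simp add: J_def ndiv_def)
    show "1 \<le> j \<and> j \<le> Q" if "j \<in> J" for j
      using that assms by (auto simp: J_def Suc_le_eq dest: dvd_imp_le intro: Nat.gr0I)
  qed
  define S where "S = (\<lambda>y. \<Sum>n\<in>{n. 1 \<le> n \<and> real n \<le> y}. f n)"
  define c where "c = (\<lambda>m j. complex_of_real (real (ndiv m) * mu j))"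
  have n1: "j\<^sup>2 * m \<ge> 1" if "m \<in> B" "j \<in> J" for m j using that J(3)[of j] by (auto simp: B_def Suc_le_eq)
  have hS: "((\<lambda>u. S (u\<^sup>2) * wave_deriv U n u) has_integral - wave_sum g U n) {real U..2 * real U}" if "n \<ge> 1" for n
  proof -
    have "((\<lambda>u. S (u\<^sup>2) * wave_deriv U n u) has_integral - (\<Sum>m\<in>{1..4 * U\<^sup>2}. f m * wave U n (sqrt (real m)))) {real U..2 * real U}"
      unfolding S_def by (rule abel_identity) (use assms that in auto)
    also have "(\<Sum>m\<in>{1..4 * U\<^sup>2}. f m * wave U n (sqrt (real m))) = wave_sum g U n"
      unfolding sum_fcoef_wave[OF \<open>U \<ge> 1\<close>, symmetric] by (intro sum.cong refl) (simp add: f)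
    finally show ?thesis .
  qed
  define I where "I = (\<lambda>n. integral {real U..2 * real U} (\<lambda>u. R (u\<^sup>2) * wave_deriv U n u))"
  have hR: "((\<lambda>u. R (u\<^sup>2) * wave_deriv U n u) has_integral I n) {real U..2 * real U}" if "n \<ge> 1" for n
    unfolding I_def using R[OF that] by (intro integrable_integral) auto
  define \<Psi> where "\<Psi> = (\<lambda>u. \<Sum>m\<in>B. \<Sum>j\<in>J. c m j * wave_deriv U (j\<^sup>2 * m) u)"
  define T where "T = (\<Sum>m\<in>B. \<Sum>j\<in>J. c m j * (- wave_sum g U (j\<^sup>2 * m) - I (j\<^sup>2 * m)))"
  have hi0: "((\<lambda>u. \<Sum>m\<in>B. \<Sum>j\<in>J. c m j * (S (u\<^sup>2) * wave_deriv U (j\<^sup>2 * m) u - R (u\<^sup>2) * wave_deriv U (j\<^sup>2 * m) u)) has_integral T) {real U..2 * real U}"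
    unfolding T_def by (intro has_integral_sum has_integral_mult_right has_integral_diff hS hR n1) (auto simp: B_def J)
  have eq: "(\<Sum>m\<in>B. \<Sum>j\<in>J. c m j * (S (u\<^sup>2) * wave_deriv U (j\<^sup>2 * m) u - R (u\<^sup>2) * wave_deriv U (j\<^sup>2 * m) u)) = (S (u\<^sup>2) - R (u\<^sup>2)) * \<Psi> u" for u
    unfolding \<Psi>_def sum_distrib_left by (intro sum.cong refl) (simp add: algebra_simps)
  have hi: "((\<lambda>u. (S (u\<^sup>2) - R (u\<^sup>2)) * \<Psi> u) has_integral T) {real U..2 * real U}"
    using hi0 unfolding eq .
  have cont\<Psi>: "continuous_on {real U..2 * real U} \<Psi>" unfolding \<Psi>_def by (intro continuous_intros continuous_wave_deriv)
  have b0: "b \<ge> 0" using order_trans[OF norm_ge_zero \<Delta>[of "real U"]] by simp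
  have "norm (integral {real U..2 * real U} (\<lambda>u. (S (u\<^sup>2) - R (u\<^sup>2)) * \<Psi> u)) \<le> integral {real U..2 * real U} (\<lambda>u. b * norm (\<Psi> u))"
  proof (rule integral_norm_bound_integral)
    show "(\<lambda>u. (S (u\<^sup>2) - R (u\<^sup>2)) * \<Psi> u) integrable_on {real U..2 * real U}" using hi by blast
    show "(\<lambda>u. b * norm (\<Psi> u)) integrable_on {real U..2 * real U}"
      by (intro integrable_continuous_interval continuous_intros cont\<Psi>)
    show "norm ((S (u\<^sup>2) - R (u\<^sup>2)) * \<Psi> u) \<le> b * norm (\<Psi> u)" if "u \<in> {real U..2 * real U}" for u
      unfolding norm_mult S_def by (intro mult_right_mono \<Delta> that) auto
  qed
  also have "\<dots> = b * integral {real U..2 * real U} (\<lambda>u. norm (\<Psi> u))" by simp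
  also have "\<dots> \<le> b * (2 * real Q * (real U * sqrt D + 2 * real Q * real N ^ 6))"
    unfolding \<Psi>_def c_def J_def B_def D_def by (intro mult_left_mono integral_norm_test assms b0)
  finally have 1: "norm T \<le> b * (2 * real Q * (real U * sqrt D + 2 * real Q * real N ^ 6))"
    unfolding integral_unique[OF hi] .
  have cB: "real (card B) \<le> real N"
  proof -
    have "card B \<le> card {1..N}" unfolding B_def by (intro card_mono) auto
    thus ?thesis by simp
  qed
  define W where "W = C * (real Q * real N) * (2 * real U) powr (5 / 4)"
  have W0: "W \<ge> 0" using C by (simp add: W_def)
  have "norm (\<Sum>m\<in>B. \<Sum>j\<in>J. c m j * I (j\<^sup>2 * m)) \<le> (\<Sum>m\<in>B. \<Sum>j\<in>J. real N * W)"
  proof (intro sum_norm_le)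
    fix m j assume mj: "m \<in> B" "j \<in> J"
    have m: "1 \<le> m" "m \<le> N" using mj by (auto simp: B_def)
    have "norm (c m j) = real (ndiv m) * \<bar>mu j\<bar>" by (simp add: c_def norm_mult)
    also have "\<dots> \<le> real N * 1" using ndiv_le[of m] m abs_mu_le[of j] by (intro mult_mono) auto
    finally have cN: "norm (c m j) \<le> real N" by simp
    have "sqrt (real (j\<^sup>2 * m)) = real j * sqrt (real m)" by (simp add: real_sqrt_mult)
    also have "\<dots> \<le> real Q * real N"
    proof (rule mult_mono)
      have "sqrt (real m) * 1 \<le> sqrt (real m) * sqrt (real m)" using m by (intro mult_left_mono) auto
      thus "sqrt (real m) \<le> real N" using m by simp
    qed (use J(3)[OF mj(2)] in auto)
    finally have "C * sqrt (real (j\<^sup>2 * m)) * (2 * real U) powr (5 / 4) \<le> W"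
      unfolding W_def using C by (intro mult_right_mono mult_left_mono) auto
    hence "norm (I (j\<^sup>2 * m)) \<le> W" using R[OF n1[OF mj]] by (simp add: I_def)
    thus "norm (c m j * I (j\<^sup>2 * m)) \<le> real N * W" unfolding norm_mult using cN by (intro mult_mono) auto
  qed
  also have "\<dots> = real (card B) * (real (card J) * (real N * W))" by simp
  also have "\<dots> \<le> real N * (real Q * (real N * W))"
    using cB J W0 by (intro mult_mono) auto
  finally have 2: "norm (\<Sum>m\<in>B. \<Sum>j\<in>J. c m j * I (j\<^sup>2 * m)) \<le> real Q * (real N)\<^sup>2 * W"
    by (simp add: power2_eq_square mult_ac)
  have "(\<Sum>m\<in>B. \<Sum>j\<in>J. c m j * wave_sum g U (j\<^sup>2 * m)) = - T - (\<Sum>m\<in>B. \<Sum>j\<in>J. c m j * I (j\<^sup>2 * m))"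
    unfolding T_def by (simp add: sum_negf[symmetric] sum_subtractf[symmetric] algebra_simps)
  also have "norm \<dots> \<le> norm T + norm (\<Sum>m\<in>B. \<Sum>j\<in>J. c m j * I (j\<^sup>2 * m))"
    by (rule order_trans[OF norm_triangle_ineq4]) simp
  finally show ?thesis using 1 2 unfolding c_def J_def W_def by linarith
qed

text \<open>The approximation error is paid termwise: at most \<open>N * Q\<close> pairs
  \<open>(m, j)\<close>, with weights at most \<open>N\<close>. The assumption \<open>tail\<close>
  keeps half of the constant 1/20.\<close>

lemma test_lower_bound:
  fixes g :: "nat \<Rightarrow> complex" and U L E N P0 :: nat
  assumes "U \<ge> 1" "E \<ge> 1" "N \<ge> 1" "L \<ge> 1" "L \<le> 4 * U\<^sup>2" "E \<le> 4 * U\<^sup>2"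
    and LN: "real (Suc L) * real N \<le> real U" "4 * real N \<le> real U"
    and g1: "g 1 = 1"
    and C\<eta>: "C\<eta> \<ge> 0" "\<And>e X. e > 0 \<Longrightarrow> (\<Sum>K\<in>{1..X}. real (ndiv (K\<^sup>2)) / (real K)\<^sup>2 *
       (real (ndiv (e div gcd e (K\<^sup>2))) ^ 2 / real (e div gcd e (K\<^sup>2)))) \<le> C\<eta> * real e powr (- 3 / 4)"
    and tail: "C\<eta> * (\<Sum>e\<in>{Suc P0..E}. norm (g e) * real e powr (- 3 / 4)) \<le> 1 / 40"
    and QN: "(fact P0)\<^sup>2 * N \<le> U"
    and err: "\<And>n. n \<ge> 1 \<Longrightarrow> n \<le> (fact P0)\<^sup>2 * N \<Longrightarrow> norm (wave_sum g U n - resonant_part g U L E n) \<le> err"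
  defines "Q \<equiv> fact P0 :: nat"
  defines "B \<equiv> {m\<in>{1..N}. coprime m Q}"
  shows "norm (\<Sum>m\<in>B. \<Sum>j\<in>{j. j dvd Q}. of_real (real (ndiv m) * mu j) * wave_sum g U (j\<^sup>2 * m)) \<ge>
     (real U)\<^sup>2 * ndiv2_sum Q N / 40 - real Q * (real N)\<^sup>2 * err"
proof -
  define J where "J = {j. j dvd Q}"
  have Q1: "Q \<ge> 1" by (simp add: Q_def)
  have J: "finite J" "card J \<le> Q" "\<And>j. j \<in> J \<Longrightarrow> 1 \<le> j \<and> j \<le> Q"
  proof -
    show "finite J" using Q1 unfolding J_def by (intro finite_divisors) auto
    show "card J \<le> Q" using ndiv_le[of Q] Q1 by (simp add: J_def ndiv_def)
    show "1 \<le> j \<and> j \<le> Q" if "j \<in> J" for j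
      using that Q1 by (auto simp: J_def Suc_le_eq dest: dvd_imp_le intro: Nat.gr0I)
  qed
  define c where "c = (\<lambda>m j. complex_of_real (real (ndiv m) * mu j))"
  have cB: "real (card B) \<le> real N"
  proof -
    have "card B \<le> card {1..N}" unfolding B_def by (intro card_mono) auto
    thus ?thesis by simp
  qed
  have err0: "err \<ge> 0" using order_trans[OF norm_ge_zero err[of 1]] assms by (auto simp: Suc_le_eq)
  have "norm (\<Sum>m\<in>B. \<Sum>j\<in>J. c m j * (wave_sum g U (j\<^sup>2 * m) - resonant_part g U L E (j\<^sup>2 * m))) \<le> (\<Sum>m\<in>B. \<Sum>j\<in>J. real N * err)"
  proof (intro sum_norm_le)
    fix m j assume mj: "m \<in> B" "j \<in> J"
    have m: "1 \<le> m" "m \<le> N" using mj by (auto simp: B_def)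
    have "norm (c m j) = real (ndiv m) * \<bar>mu j\<bar>" by (simp add: c_def norm_mult)
    also have "\<dots> \<le> real N * 1" using ndiv_le[of m] m abs_mu_le[of j] by (intro mult_mono) auto
    finally have cN: "norm (c m j) \<le> real N" by simp
    have "j\<^sup>2 * m \<ge> 1" using m J(3)[OF mj(2)] by (simp add: Suc_le_eq)
    moreover have "j\<^sup>2 * m \<le> (fact P0)\<^sup>2 * N"
      using J(3)[OF mj(2)] m by (intro mult_mono power_mono) (auto simp: Q_def)
    ultimately have "norm (wave_sum g U (j\<^sup>2 * m) - resonant_part g U L E (j\<^sup>2 * m)) \<le> err" by (rule err)
    thus "norm (c m j * (wave_sum g U (j\<^sup>2 * m) - resonant_part g U L E (j\<^sup>2 * m))) \<le> real N * err"
      unfolding norm_mult using cN by (intro mult_mono) auto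
  qed
  also have "\<dots> = real (card B) * (real (card J) * (real N * err))" by simp
  also have "\<dots> \<le> real N * (real Q * (real N * err))"
    using cB J err0 by (intro mult_mono) auto
  finally have 1: "norm (\<Sum>m\<in>B. \<Sum>j\<in>J. c m j * (wave_sum g U (j\<^sup>2 * m) - resonant_part g U L E (j\<^sup>2 * m))) \<le> real Q * (real N)\<^sup>2 * err"
    by (simp add: power2_eq_square mult_ac)
  have 2: "norm (\<Sum>m\<in>B. \<Sum>j\<in>J. c m j * resonant_part g U L E (j\<^sup>2 * m)) \<ge>
     (real U)\<^sup>2 * ndiv2_sum Q N * (1 / 20 - C\<eta> * (\<Sum>e\<in>{Suc P0..E}. norm (g e) * real e powr (- 3 / 4)))"
    unfolding c_def J_def B_def Q_def
  proof (rule main_lower_bound)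
    fix e X :: nat assume "e > 0"
    thus "(\<Sum>K\<in>{1..X}. real (ndiv (K\<^sup>2)) / (real K)\<^sup>2 *
       (real (ndiv (e div gcd e (K\<^sup>2))) ^ 2 / real (e div gcd e (K\<^sup>2)))) \<le> C\<eta> * real e powr (- 3 / 4)"
      by (rule C\<eta>(2))
  qed (rule refl | fact)+
  have D0: "ndiv2_sum Q N \<ge> 0" unfolding ndiv2_sum_def by (intro sum_nonneg) auto
  have "(real U)\<^sup>2 * ndiv2_sum Q N * (1 / 40) \<le> (real U)\<^sup>2 * ndiv2_sum Q N * (1 / 20 - C\<eta> * (\<Sum>e\<in>{Suc P0..E}. norm (g e) * real e powr (- 3 / 4)))"
    using tail D0 by (intro mult_left_mono) auto
  with 2 have 3: "norm (\<Sum>m\<in>B. \<Sum>j\<in>J. c m j * resonant_part g U L E (j\<^sup>2 * m)) \<ge> (real U)\<^sup>2 * ndiv2_sum Q N / 40" by simp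
  have "(\<Sum>m\<in>B. \<Sum>j\<in>J. c m j * resonant_part g U L E (j\<^sup>2 * m)) =
     (\<Sum>m\<in>B. \<Sum>j\<in>J. c m j * wave_sum g U (j\<^sup>2 * m)) - (\<Sum>m\<in>B. \<Sum>j\<in>J. c m j * (wave_sum g U (j\<^sup>2 * m) - resonant_part g U L E (j\<^sup>2 * m)))"
    by (simp add: sum_subtractf[symmetric] algebra_simps)
  hence "norm (\<Sum>m\<in>B. \<Sum>j\<in>J. c m j * resonant_part g U L E (j\<^sup>2 * m)) \<le>
     norm (\<Sum>m\<in>B. \<Sum>j\<in>J. c m j * wave_sum g U (j\<^sup>2 * m)) + norm (\<Sum>m\<in>B. \<Sum>j\<in>J. c m j * (wave_sum g U (j\<^sup>2 * m) - resonant_part g U L E (j\<^sup>2 * m)))"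
    by (simp add: norm_triangle_ineq4)
  thus ?thesis using 1 3 unfolding c_def J_def by linarith
qed

text \<open>
  The parameters are successive powers of one large \<open>y\<close>: the cut-offs \<open>y^40\<close> for \<open>e\<close> and \<open>y^60\<close> for
  \<open>l\<close> dominate the powers of \<open>N = y^4\<close> lost in the estimates, and \<open>U = y^700\<close> dominates all of them.
\<close>

lemma wave_sum_error_bound:
  fixes g :: "nat \<Rightarrow> complex" and y n :: nat
  assumes y: "y \<ge> 2" and n: "n \<ge> 1" "n \<le> y ^ 6"
    and G1: "\<And>m. (\<Sum>e\<in>{1..m}. norm (g e) * real e powr (- 3 / 4)) \<le> G1"
    and Cd: "Cd \<ge> 1" "\<And>t. t > 0 \<Longrightarrow> real (ndiv t) \<le> Cd * real t powr (1 / 2800)"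
  defines "\<L> \<equiv> 1 + ln (4 * real y ^ 1400)"
  shows "norm (wave_sum g (y ^ 700) n - resonant_part g (y ^ 700) (y ^ 60) (y ^ 40) n)
    \<le> G1 * ((4401 + 960 * Cd) * (real y ^ 1390 * \<L>\<^sup>2))"
proof -
  define Y where "Y = real y"
  define U where "U = y ^ 700"
  define X where "X = 4 * U\<^sup>2"
  have Y: "Y \<ge> 2" using y by (simp add: Y_def)
  have Ur: "real U = Y ^ 700" by (simp add: U_def Y_def)
  have Xr: "real X = 4 * Y ^ 1400" by (simp add: X_def Ur flip: power_mult)
  have pw: "Y ^ a \<le> Y ^ b" if "a \<le> b" for a b using that Y by (intro power_increasing) auto
  have pw1: "Y ^ a \<ge> 1" for a using Y by (intro one_le_power) auto
  have pp: "(Y ^ a) powr c = Y powr (real a * c)" for a c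
    using Y by (subst powr_realpow[symmetric]) (simp_all add: powr_powr)
  have "1 * 1 \<le> 4 * Y ^ 1400" using pw1[of 1400] by (intro mult_mono) auto
  hence lnX: "ln (4 * Y ^ 1400) \<ge> 0" by simp
  have L1: "\<L> \<ge> 1" using lnX by (simp add: \<L>_def Y_def)
  have L2: "\<L> \<le> \<L>\<^sup>2" using L1 by (simp add: power2_eq_square)
  \<comment> \<open>\<open>X\<close> is \<open>4 * Y ^ 1400\<close>, so the exponent 1/2800 turns it
    into a constant times \<open>sqrt Y\<close>; rounded up to \<open>2 * Y\<close>, the divisor
    function costs just one power of \<open>Y\<close>.\<close>
  define M0 where "M0 = 2 * Cd * Y"
  have M0: "real (ndiv t) \<le> M0" if t: "t \<in> {1..X}" for t
  proof -
    have "real t \<le> 4 * Y ^ 1400" using t unfolding Xr[symmetric] by simp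
    hence "real t powr (1 / 2800) \<le> (4 * Y ^ 1400) powr (1 / 2800)" by (intro powr_mono2) auto
    also have "\<dots> = 4 powr (1 / 2800) * (Y ^ 1400) powr (1 / 2800)" using Y by (intro powr_mult)
    also have "(Y ^ 1400) powr (1 / 2800) = Y powr (1 / 2)"
      unfolding pp by simp
    also have "4 powr (1 / 2800) * Y powr (1 / 2) \<le> 4 powr (1 / 2) * Y powr 1"
      using Y by (intro mult_mono powr_mono) auto
    also have "\<dots> = 2 * Y" using Y by (simp add: powr_half_sqrt)
    finally have "Cd * real t powr (1 / 2800) \<le> Cd * (2 * Y)" using Cd by (intro mult_left_mono) auto
    thus ?thesis using Cd(2)[of t] t by (simp add: M0_def)
  qed
  have G0: "G1 \<ge> 0" using G1[of 0] by simp
  have nY: "real n \<le> Y ^ 6" using n unfolding Y_def by (metis of_nat_le_iff of_nat_power)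
  have "real n * 1 \<le> real n * real n" using n by (intro mult_left_mono) auto
  hence "sqrt (real n) \<le> sqrt (real n * real n)" by (intro real_sqrt_le_mono) simp
  hence sn: "sqrt (real n) \<le> Y ^ 6" using nY by simp
  have l2U: "1 + ln (2 * real U) \<le> \<L>"
  proof -
    have "2 * Y ^ 700 \<le> 4 * Y ^ 1400" using pw[of 700 1400] pw1[of 1400] by linarith
    hence "ln (2 * Y ^ 700) \<le> ln (4 * Y ^ 1400)" using Y by (subst ln_le_cancel_iff) auto
    thus ?thesis by (simp add: \<L>_def Ur Y_def)
  qed
  have s20: "sqrt (Y ^ 40) = Y ^ 20"
    using Y by (intro real_sqrt_unique) (auto simp flip: power_mult)
  have s350: "sqrt (Y ^ 700) = Y ^ 350"
    using Y by (intro real_sqrt_unique) (auto simp flip: power_mult)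
  \<comment> \<open>The tail over \<open>e\<close> gains
    \<open>E powr (- 1 / 4) = Y powr (- 10)\<close> on \<open>U^2 = Y ^ 1400\<close> and so fixes
    1390 as the exponent of the total. Later the weights cost \<open>N^2 = Y ^ 8\<close>, which
    still leaves a gain of \<open>Y^2\<close>.\<close>
  have t1: "real (y ^ 40) powr (- 1 / 4) * ((real U)\<^sup>2 * (1 + ln (real X))\<^sup>2) = Y ^ 1390 * \<L>\<^sup>2"
  proof -
    have "real (y ^ 40) powr (- 1 / 4) = Y powr (- 10)"
      unfolding of_nat_power Y_def[symmetric] pp by simp
    moreover have "(real U)\<^sup>2 = Y powr 1400" using Y by (simp add: Ur powr_realpow flip: power_mult)
    moreover have "Y powr (- 10) * Y powr 1400 = Y powr 1390" by (subst powr_add[symmetric]) simp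
    ultimately have "real (y ^ 40) powr (- 1 / 4) * (real U)\<^sup>2 = Y ^ 1390" using Y by (simp add: powr_realpow)
    thus ?thesis by (simp only: mult.assoc[symmetric]) (simp add: \<L>_def Xr Y_def)
  qed
  \<comment> \<open>Small \<open>l\<close>: the factor \<open>E * L^2\<close> costs
    \<open>Y ^ 160\<close>, the squared factor \<open>L * sqrt E + 2\<close> another
    \<open>Y ^ 160\<close>, and \<open>U * sqrt U\<close> is only \<open>Y ^ 1050\<close>.\<close>
  have t2: "real (y ^ 40) * (real (y ^ 60) * real (y ^ 60) * (80 * real U * sqrt (real n) * (1 + ln (2 * real U)) +
      1080 * (real (y ^ 60) * sqrt (real (y ^ 40)) + 2)\<^sup>2 * (real U * sqrt (real U)))) \<le> 4400 * (Y ^ 1390 * \<L>\<^sup>2)"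
  proof -
    have "0 \<le> ln (2 * Y ^ 700)" using pw1[of 700] by (intro ln_ge_zero) linarith
    hence l0: "0 \<le> 1 + ln (2 * Y ^ 700)" by linarith
    hence "80 * real U * sqrt (real n) * (1 + ln (2 * real U)) \<le> 80 * Y ^ 700 * Y ^ 6 * \<L>\<^sup>2"
      using sn l2U L2 Y unfolding Ur by (intro mult_mono mult_left_mono) auto
    also have "\<dots> = 80 * (Y ^ 706 * \<L>\<^sup>2)" by (simp flip: power_add)
    also have "\<dots> \<le> 80 * (Y ^ 1210 * \<L>\<^sup>2)"
      using pw[of 706 1210] by (intro mult_left_mono mult_right_mono) auto
    finally have a: "80 * real U * sqrt (real n) * (1 + ln (2 * real U)) \<le> 80 * (Y ^ 1210 * \<L>\<^sup>2)" .
    have "real (y ^ 60) * sqrt (real (y ^ 40)) = Y ^ 80"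
      using s20 by (simp add: Y_def flip: power_add)
    moreover have "2 \<le> Y ^ 80" using pw[of 1 80] Y by simp
    ultimately have "(real (y ^ 60) * sqrt (real (y ^ 40)) + 2)\<^sup>2 \<le> (2 * Y ^ 80)\<^sup>2"
      by (intro power_mono) auto
    also have "\<dots> = 4 * Y ^ 160" by (simp add: power_mult_distrib flip: power_mult)
    finally have "1080 * (real (y ^ 60) * sqrt (real (y ^ 40)) + 2)\<^sup>2 * (real U * sqrt (real U)) \<le> 1080 * (4 * Y ^ 160) * (Y ^ 700 * Y ^ 350)"
      unfolding Ur s350 using Y by (intro mult_right_mono mult_left_mono) auto
    also have "\<dots> = 4320 * (Y ^ 1210 * 1)" by (simp flip: power_add)
    also have "\<dots> \<le> 4320 * (Y ^ 1210 * \<L>\<^sup>2)" using L1 L2 Y by (intro mult_left_mono) auto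
    finally have b: "1080 * (real (y ^ 60) * sqrt (real (y ^ 40)) + 2)\<^sup>2 * (real U * sqrt (real U)) \<le> 4320 * (Y ^ 1210 * \<L>\<^sup>2)" .
    have "real (y ^ 40) * (real (y ^ 60) * real (y ^ 60) * (80 * real U * sqrt (real n) * (1 + ln (2 * real U)) +
      1080 * (real (y ^ 60) * sqrt (real (y ^ 40)) + 2)\<^sup>2 * (real U * sqrt (real U)))) \<le>
      Y ^ 40 * (Y ^ 60 * Y ^ 60 * (80 * (Y ^ 1210 * \<L>\<^sup>2) + 4320 * (Y ^ 1210 * \<L>\<^sup>2)))"
      unfolding of_nat_power Y_def[symmetric] using a b Y
      by (intro mult_left_mono add_mono) (simp_all add: Y_def)
    also have "\<dots> = 4400 * ((Y ^ 40 * (Y ^ 60 * (Y ^ 60 * Y ^ 1210))) * \<L>\<^sup>2)" by simp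
    also have "Y ^ 40 * (Y ^ 60 * (Y ^ 60 * Y ^ 1210)) = Y ^ 1370" by (simp flip: power_add)
    also have "4400 * (Y ^ 1370 * \<L>\<^sup>2) \<le> 4400 * (Y ^ 1390 * \<L>\<^sup>2)"
      using pw[of 1370 1390] by (intro mult_left_mono mult_right_mono) auto
    finally show ?thesis .
  qed
  \<comment> \<open>Non-resonant products: the gain \<open>1 / L = Y powr (- 60)\<close> pays for
    \<open>E = Y ^ 40\<close>, \<open>n \<le> Y ^ 6\<close> and the single power in
    \<open>M0\<close>, which leaves \<open>Y ^ 1387\<close>.\<close>
  have t3: "real (y ^ 40) * (M0 * (60 * real n * real U * ((2 * real U / real (y ^ 60) + 2) * (2 * (1 + ln (real X))))))
     \<le> 960 * Cd * (Y ^ 1390 * \<L>\<^sup>2)"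
  proof -
    have "real U / real (y ^ 60) = Y ^ 640"
      using Y by (simp add: Ur Y_def power_diff[symmetric])
    hence "2 * real U / real (y ^ 60) + 2 \<le> 4 * Y ^ 640" using pw1[of 640] by simp
    moreover have "2 * (1 + ln (real X)) \<le> 2 * \<L>\<^sup>2" using L2 by (simp add: Xr \<L>_def Y_def)
    moreover have "0 \<le> 2 * (1 + ln (real X))" using lnX by (simp add: Xr)
    ultimately have "(2 * real U / real (y ^ 60) + 2) * (2 * (1 + ln (real X))) \<le> 4 * Y ^ 640 * (2 * \<L>\<^sup>2)"
      using Y by (intro mult_mono) auto
    moreover have "60 * real n * real U \<le> 60 * Y ^ 6 * Y ^ 700"
      unfolding Ur using nY Y by (intro mult_right_mono mult_left_mono) auto
    moreover have "0 \<le> (2 * real U / real (y ^ 60) + 2) * (2 * (1 + ln (real X)))"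
      using lnX by (intro mult_nonneg_nonneg add_nonneg_nonneg) (auto simp: Xr)
    ultimately have "60 * real n * real U * ((2 * real U / real (y ^ 60) + 2) * (2 * (1 + ln (real X))))
      \<le> 60 * Y ^ 6 * Y ^ 700 * (4 * Y ^ 640 * (2 * \<L>\<^sup>2))"
      by - (rule mult_mono, assumption, assumption, use Y in simp, assumption)
    hence "real (y ^ 40) * (M0 * (60 * real n * real U * ((2 * real U / real (y ^ 60) + 2) * (2 * (1 + ln (real X))))))
      \<le> Y ^ 40 * (2 * Cd * Y * (60 * Y ^ 6 * Y ^ 700 * (4 * Y ^ 640 * (2 * \<L>\<^sup>2))))"
      unfolding M0_def of_nat_power Y_def[symmetric] using Y Cd by (intro mult_left_mono) auto
    also have "\<dots> = 960 * Cd * ((Y ^ 40 * (Y ^ 1 * (Y ^ 6 * (Y ^ 700 * Y ^ 640)))) * \<L>\<^sup>2)" by simp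
    also have "Y ^ 40 * (Y ^ 1 * (Y ^ 6 * (Y ^ 700 * Y ^ 640))) = Y ^ 1387" by (simp only: power_add[symmetric]) simp
    also have "960 * Cd * (Y ^ 1387 * \<L>\<^sup>2) \<le> 960 * Cd * (Y ^ 1390 * \<L>\<^sup>2)"
      using pw[of 1387 1390] Cd by (intro mult_left_mono mult_right_mono) auto
    finally show ?thesis .
  qed
  have pn: "y ^ a \<le> y ^ b" if "a \<le> b" for a b using that y by (intro power_increasing) auto
  have U2: "U\<^sup>2 = y ^ 1400" by (simp add: U_def flip: power_mult)
  have "norm (wave_sum g U n - resonant_part g U (y ^ 60) (y ^ 40) n) \<le> G1 * (
      real (y ^ 40) powr (- 1 / 4) * ((real U)\<^sup>2 * (1 + ln (real X))\<^sup>2)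
      + real (y ^ 40) * (real (y ^ 60) * real (y ^ 60) * (80 * real U * sqrt (real n) * (1 + ln (2 * real U)) + 1080 * (real (y ^ 60) * sqrt (real (y ^ 40)) + 2)\<^sup>2 * (real U * sqrt (real U))))
      + real (y ^ 40) * (M0 * (60 * real n * real U * ((2 * real U / real (y ^ 60) + 2) * (2 * (1 + ln (real X)))))))"
  proof (rule wave_sum_approx)
    show "n \<le> U" using n pn[of 6 700] by (simp add: U_def)
    show "y ^ 60 \<le> X" "y ^ 40 \<le> X" using pn[of 60 1400] pn[of 40 1400] by (simp_all add: X_def U2)
    show "M0 \<ge> 0" using Cd Y by (simp add: M0_def)
    show "U \<ge> 1" "y ^ 60 \<ge> 1" "y ^ 40 \<ge> 1" using y by (simp_all add: U_def Suc_le_eq)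
  qed (use n M0 G1 in \<open>auto simp: X_def\<close>)
  also have "\<dots> \<le> G1 * (Y ^ 1390 * \<L>\<^sup>2 + 4400 * (Y ^ 1390 * \<L>\<^sup>2) + 960 * Cd * (Y ^ 1390 * \<L>\<^sup>2))"
    using t1 t2 t3 G0 by (intro mult_left_mono add_mono) auto
  also have "\<dots> = G1 * ((4401 + 960 * Cd) * (Y ^ 1390 * \<L>\<^sup>2))" by (simp add: algebra_simps)
  finally show ?thesis by (simp add: U_def Y_def)
qed

text \<open>The proof is by contradiction, with the choices in strict order: \<open>P0\<close>,
  hence \<open>Q\<close>, comes from the sizes of the coefficients \<open>g\<close>; then
  \<open>\<epsilon>\<close> is fixed in terms of \<open>Q\<close>; the little-o assumption yields
  \<open>x0\<close> for this \<open>\<epsilon>\<close>; only then is \<open>y\<close> taken large.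
  The powers of \<open>Q\<close> lost in the sieve are therefore constants.\<close>

theorem theorem1:
  fixes M :: int and H F :: "complex \<Rightarrow> complex" and f :: "nat \<Rightarrow> complex"
  assumes H: "has_abs_conv_euler_product H (1 / 3)"
    and F: "F = (\<lambda>s. zeta s ^ 2 * zeta (2 * s - 1) * zeta (2 * s) powi M * H s)"
    and f: "\<And>s. Re s > 1 \<Longrightarrow> (\<lambda>n. f (Suc n) / of_nat (Suc n) powr s) sums F s"
  shows "(\<lambda>x::real. (\<Sum>n\<in>{n. 1 \<le> n \<and> real n \<le> x}. f n)
             - residue (\<lambda>s. F s * (of_real x powr s / s)) 1)
         \<notin> o[at_top](\<lambda>x. of_real (sqrt x * ln x ^ 2 / ln (ln x) ^ nat \<bar>M + 1\<bar>))"
proof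
  define R where "R = (\<lambda>x::real. residue (\<lambda>s. F s * (of_real x powr s / s)) 1)"
  define S where "S = (\<lambda>x::real. \<Sum>n\<in>{n. 1 \<le> n \<and> real n \<le> x}. f n)"
  define k where "k = nat \<bar>M + 1\<bar>"
  assume "(\<lambda>x::real. (\<Sum>n\<in>{n. 1 \<le> n \<and> real n \<le> x}. f n)
             - residue (\<lambda>s. F s * (of_real x powr s / s)) 1)
         \<in> o[at_top](\<lambda>x. of_real (sqrt x * ln x ^ 2 / ln (ln x) ^ nat \<bar>M + 1\<bar>))"
  hence so: "(\<lambda>x. S x - R x) \<in> o[at_top](\<lambda>x. of_real (sqrt x * ln x ^ 2 / ln (ln x) ^ k))"
    by (simp only: S_def R_def k_def)
  obtain h Kh where h: "dirichlet_bound h (3 / 4) Kh" "h 1 = 1" "\<And>s. Re s \<ge> 3 / 4 \<Longrightarrow> dirichlet h s = H s"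
    using euler_product_dirichlet[OF H] by blast
  obtain c Kc where c: "dirichlet_bound c (3 / 4) Kc" "c 1 = 1" "\<And>s. Re s \<ge> 3 / 4 \<Longrightarrow> dirichlet c s = zeta (2 * s) powi M"
    using zeta_square_powi[of M] by blast
  define g where "g = dirichlet_conv c h"
  define G1 where "G1 = Kc * Kh"
  have g: "dirichlet_bound g (3 / 4) G1" unfolding g_def G1_def by (rule dirichlet_bound_dirichlet_conv[OF c(1) h(1)])
  have g1: "g 1 = 1" unfolding g_def dirichlet_conv_1 using c h by simp
  have FG: "F s = zeta s ^ 2 * zeta (2 * s - 1) * dirichlet g s" if "Re s \<ge> 3 / 4" for s
    unfolding F g_def dirichlet_dirichlet_conv[OF c(1) h(1) that] using c(3)[OF that] h(3)[OF that] by simp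
  have ff: "f n = fcoef g n" if "n \<ge> 1" for n
    by (rule coefficients_eq_fcoef[OF g refl _ f that]) (rule FG, simp)
  have G1: "(\<Sum>e\<in>{1..m}. norm (g e) * real e powr (- 3 / 4)) \<le> G1" for m
    using nboundD[OF g, of m] by simp
  obtain h0 \<gamma> :: "real \<Rightarrow> complex" where R0: "continuous_on {0..1} h0" "continuous_on {0..1} \<gamma>"
    "\<And>t. t \<in> {0..1} \<Longrightarrow> norm (\<gamma> t - 1) \<le> 1 / 8"
    "\<And>x. x > 0 \<Longrightarrow> residue (\<lambda>s. F s * (of_real x powr s / s)) 1 = integral {0..1} (\<lambda>t. h0 t * exp (\<gamma> t * of_real (ln x)))"
    by (rule residue_representation[OF holomorphic_dirichlet[OF g] FG]) (simp, blast)
  obtain C where C: "C \<ge> 0" "\<And>U n. U \<ge> 1 \<Longrightarrow> n \<ge> 1 \<Longrightarrow>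
     (\<lambda>u. R (u\<^sup>2) * wave_deriv U n u) integrable_on {real U..2 * real U} \<and>
     norm (integral {real U..2 * real U} (\<lambda>u. R (u\<^sup>2) * wave_deriv U n u)) \<le> C * sqrt (real n) * (2 * real U) powr (5 / 4)"
    using residue_wave_deriv_integral[OF R0(1,2), of R] R0(3,4) unfolding R_def by blast
  obtain C\<eta> where C\<eta>: "C\<eta> \<ge> 0" "\<And>e X. e > 0 \<Longrightarrow> (\<Sum>K\<in>{1..X}. real (ndiv (K\<^sup>2)) / (real K)\<^sup>2 *
       (real (ndiv (e div gcd e (K\<^sup>2))) ^ 2 / real (e div gcd e (K\<^sup>2)))) \<le> C\<eta> * real e powr (- 3 / 4)"
    using eta_bound by blast
  obtain Cd where Cd: "Cd \<ge> 1" "\<And>t. t > 0 \<Longrightarrow> real (ndiv t) \<le> Cd * real t powr (1 / 2800)"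
    using ndiv_bound[of "1 / 2800"] by auto
  \<comment> \<open>Absolute convergence at 3/4 makes the tail so small that subtracting it from
    1/20 still leaves 1/40.\<close>
  obtain P0 where P0: "\<And>E. C\<eta> * (\<Sum>e\<in>{Suc P0..E}. norm (g e) * real e powr (- 3 / 4)) \<le> 1 / 40"
  proof -
    define a where "a = (\<lambda>n. norm (g (Suc n)) * real (Suc n) powr (- 3 / 4))"
    have "summable a"
    proof (rule summableI_nonneg_bounded[of _ G1])
      show "(\<Sum>n<X. a n) \<le> G1" for X
        using G1[of X] by (simp add: a_def sum.atLeast1_atMost_eq)
    qed (simp add: a_def)
    moreover have "1 / (40 * (C\<eta> + 1)) > 0" using C\<eta> by simp
    ultimately obtain P0 where P0: "\<And>n. norm (\<Sum>i. a (i + P0)) < 1 / (40 * (C\<eta> + 1))"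
      using suminf_exist_split[of "1 / (40 * (C\<eta> + 1))" a] by blast
    have "C\<eta> * (\<Sum>e\<in>{Suc P0..E}. norm (g e) * real e powr (- 3 / 4)) \<le> 1 / 40" for E
    proof -
      have "(\<Sum>e\<in>{Suc P0..E}. norm (g e) * real e powr (- 3 / 4)) = (\<Sum>i\<in>{..<E - P0}. a (i + P0))"
        by (rule sum.reindex_bij_witness[of _ "\<lambda>i. Suc (i + P0)" "\<lambda>e. e - Suc P0"]) (auto simp: a_def)
      also have "\<dots> \<le> (\<Sum>i. a (i + P0))"
        using summable_ignore_initial_segment[OF \<open>summable a\<close>, of P0] by (intro sum_le_suminf) (auto simp: a_def)
      also have "\<dots> \<le> 1 / (40 * (C\<eta> + 1))" using P0 by (auto dest: less_imp_le)
      finally have "C\<eta> * (\<Sum>e\<in>{Suc P0..E}. norm (g e) * real e powr (- 3 / 4)) \<le> C\<eta> * (1 / (40 * (C\<eta> + 1)))"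
        using C\<eta> by (intro mult_left_mono) auto
      also have "\<dots> \<le> 1 / 40" using C\<eta> by (simp add: field_simps)
      finally show ?thesis .
    qed
    thus ?thesis by (rule that)
  qed
  define Q where "Q = (fact P0 :: nat)"
  define q where "q = real Q"
  have Q1: "Q \<ge> 1" by (simp add: Q_def)
  hence q1: "q \<ge> 1" by (simp add: q_def)
  \<comment> \<open>18000000 is \<open>1500^2 * 8\<close>: \<open>\<L>\<close> is at most
    \<open>1500 * ln Y\<close>, and the square of \<open>ln Y\<close> at most
    \<open>8 * q^2 * sqrt D\<close>, so \<open>\<L>^2 \<le> A * sqrt D\<close>. With the
    \<open>\<epsilon>\<close> below, the error term contributes
    \<open>8 * \<epsilon> * q * A = 1/80\<close> of \<open>U^2 * D\<close>, half of the 1/40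
    available from below.\<close>
  define A where "A = 18000000 * q\<^sup>2"
  have A1: "A > 0" using q1 by (simp add: A_def)
  define \<epsilon> where "\<epsilon> = 1 / (640 * q * A)"
  have \<epsilon>0: "\<epsilon> > 0" using q1 A1 by (simp add: \<epsilon>_def)
  have "eventually (\<lambda>x. norm (S x - R x) \<le> \<epsilon> * norm (complex_of_real (sqrt x * ln x ^ 2 / ln (ln x) ^ k))) at_top"
    by (rule landau_o.smallD[OF so \<epsilon>0])
  moreover have "eventually (\<lambda>x::real. ln (ln x) \<ge> 1) at_top" by real_asymp
  moreover have "eventually (\<lambda>x::real. x \<ge> 1) at_top" by (rule eventually_ge_at_top)
  ultimately have "eventually (\<lambda>x. norm (S x - R x) \<le> \<epsilon> * (sqrt x * ln x ^ 2)) at_top"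
  proof eventually_elim
    case (elim x)
    \<comment> \<open>Eventually the denominator is at least 1, so the comparison function is at
      most \<open>sqrt x * (ln x)^2\<close>, and the contradiction is derived from that weaker
      bound.\<close>
    have "ln (ln x) ^ k \<ge> 1" using elim by (intro one_le_power)
    hence "sqrt x * ln x ^ 2 / ln (ln x) ^ k \<le> sqrt x * ln x ^ 2 / 1"
      using elim by (intro divide_left_mono mult_pos_pos) auto
    moreover have "sqrt x * ln x ^ 2 / ln (ln x) ^ k \<ge> 0" using elim \<open>ln (ln x) ^ k \<ge> 1\<close> by simp
    ultimately have "norm (complex_of_real (sqrt x * ln x ^ 2 / ln (ln x) ^ k)) \<le> sqrt x * ln x ^ 2"
      unfolding norm_of_real by simp
    hence "\<epsilon> * norm (complex_of_real (sqrt x * ln x ^ 2 / ln (ln x) ^ k)) \<le> \<epsilon> * (sqrt x * ln x ^ 2)"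
      using \<epsilon>0 by (intro mult_left_mono) auto
    thus ?case using elim(1) by linarith
  qed
  then obtain x0 where x0: "\<And>x. x \<ge> x0 \<Longrightarrow> norm (S x - R x) \<le> \<epsilon> * (sqrt x * ln x ^ 2)"
    by (auto simp: eventually_at_top_linorder)
  define K where "K = q * (G1 * (4401 + 960 * Cd))"
  \<comment> \<open>After division by \<open>Y ^ 1398\<close> the residue and the approximation
    error are bounded by \<open>4 * C\<close> and a multiple of a squared logarithm, against
    \<open>Y^2\<close> in the main term.\<close>
  have "eventually (\<lambda>y::real. 4 * C + K * (1500 * ln y)\<^sup>2 < y\<^sup>2 / 80) at_top" by real_asymp
  hence "eventually (\<lambda>y::nat. 4 * C + K * (1500 * ln (real y))\<^sup>2 < (real y)\<^sup>2 / 80) sequentially"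
    by (rule eventually_compose_filterlim[OF _ filterlim_real_sequentially])
  \<comment> \<open>\<open>y \<ge> q^2\<close> provides the condition \<open>Y \<ge> Q^2\<close> of
    \<open>coprime_sum_lower\<close>, and \<open>y \<ge> 3\<close> gives
    \<open>ln y \<ge> 1\<close>.\<close>
  moreover have "eventually (\<lambda>y::nat. real y \<ge> max 3 (max x0 (q\<^sup>2))) sequentially"
    using filterlim_real_sequentially unfolding filterlim_at_top by blast
  ultimately have "eventually (\<lambda>y::nat. 4 * C + K * (1500 * ln (real y))\<^sup>2 < (real y)\<^sup>2 / 80 \<and> real y \<ge> max 3 (max x0 (q\<^sup>2))) sequentially"
    by (rule eventually_conj)
  then obtain y :: nat where y: "4 * C + K * (1500 * ln (real y))\<^sup>2 < (real y)\<^sup>2 / 80"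
    "real y \<ge> 3" "real y \<ge> x0" "real y \<ge> q\<^sup>2"
    by (auto simp: eventually_sequentially)
  define Y where "Y = real y"
  have Y3: "Y \<ge> 3" using y by (simp add: Y_def)
  have y2: "y \<ge> 2" using y by linarith
  have "q * 1 \<le> q * q" using q1 by (intro mult_left_mono) auto
  hence qY: "q \<le> Y" using y by (simp add: Y_def power2_eq_square)
  hence Qy: "Q \<le> y" by (simp add: q_def Y_def)
  have QQy: "y \<ge> Q\<^sup>2" using y(4) by (simp add: q_def flip: of_nat_power)
  define U where "U = y ^ 700"
  define N where "N = y ^ 4"
  have Ur: "real U = Y ^ 700" by (simp add: U_def Y_def)
  have pn: "y ^ a \<le> y ^ b" if "a \<le> b" for a b using that y2 by (intro power_increasing) auto
  have pw: "Y ^ a \<le> Y ^ b" if "a \<le> b" for a b using that Y3 by (intro power_increasing) auto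
  have pw1: "Y ^ a \<ge> 1" for a using Y3 by (intro one_le_power) auto
  have U1: "U \<ge> 1" using y2 by (simp add: U_def Suc_le_eq)
  have N1: "N \<ge> 1" using y2 by (simp add: N_def Suc_le_eq)
  have U2: "U\<^sup>2 = y ^ 1400" by (simp add: U_def flip: power_mult)
  define D where "D = ndiv2_sum Q N"
  define \<L> where "\<L> = 1 + ln (4 * real y ^ 1400)"
  have lny: "ln Y \<ge> 1"
  proof -
    have "exp 1 \<le> Y" using exp_le Y3 by linarith
    thus ?thesis using Y3 ln_ge_iff[of Y 1] by simp
  qed
  have Dge: "ln Y ^ 2 \<le> 8 * q\<^sup>2 * sqrt D" and D1: "D \<ge> 1"
  proof -
    define s where "s = coprime_sum Q y"
    define t where "t = ln Y / (2 * q)"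
    have t0: "t \<ge> 0" using lny q1 by (simp add: t_def)
    have "s \<ge> t"
      unfolding s_def t_def q_def Y_def by (rule coprime_sum_lower) (use Q1 QQy y2 in auto)
    hence "t ^ 4 \<le> s ^ 4" using t0 by (intro power_mono)
    moreover have "D \<ge> s ^ 4 / 2" unfolding D_def N_def s_def by (rule ndiv2_sum_lower)
    ultimately have Dt: "D \<ge> t ^ 4 / 2" by linarith
    have "(t\<^sup>2 / 2)\<^sup>2 = t ^ 4 / 4" by (simp add: power_divide flip: power_mult)
    moreover have "t ^ 4 \<ge> 0" using t0 by simp
    ultimately have "(t\<^sup>2 / 2)\<^sup>2 \<le> D" using Dt by linarith
    hence "t\<^sup>2 / 2 \<le> sqrt D" by (rule real_le_rsqrt)
    hence "8 * q\<^sup>2 * (t\<^sup>2 / 2) \<le> 8 * q\<^sup>2 * sqrt D" by (intro mult_left_mono) auto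
    moreover have "8 * q\<^sup>2 * (t\<^sup>2 / 2) = ln Y ^ 2" using q1 by (simp add: t_def power_divide power_mult_distrib)
    ultimately show "ln Y ^ 2 \<le> 8 * q\<^sup>2 * sqrt D" by linarith
    have "(\<Sum>m\<in>{1::nat}. real (ndiv m) ^ 2 / real m) \<le> D"
      unfolding D_def ndiv2_sum_def using N1 by (intro sum_mono2) auto
    thus "D \<ge> 1" by (simp add: ndiv_def)
  qed
  have Lb: "\<L> \<ge> 1" "\<L> \<le> 1500 * ln Y"
  proof -
    have e: "ln (4 * Y ^ 1400) = ln 4 + 1400 * ln Y" using Y3 by (simp add: ln_mult ln_realpow)
    have "ln 4 \<le> (4 - 1 :: real)" by (rule ln_le_minus_one) auto
    moreover have "ln (4::real) \<ge> 0" by simp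
    ultimately show "\<L> \<ge> 1" "\<L> \<le> 1500 * ln Y" unfolding \<L>_def Y_def[symmetric] e using lny by linarith+
  qed
  have LA: "\<L>\<^sup>2 \<le> A * sqrt D"
  proof -
    have "\<L>\<^sup>2 \<le> (1500 * ln Y)\<^sup>2" using Lb by (intro power_mono) auto
    also have "\<dots> = 2250000 * ln Y ^ 2" by (simp add: power_mult_distrib)
    also have "\<dots> \<le> 2250000 * (8 * q\<^sup>2 * sqrt D)" using Dge by (intro mult_left_mono) auto
    finally show ?thesis by (simp add: A_def)
  qed
  define T where "T = norm (\<Sum>m\<in>{m\<in>{1..N}. coprime m Q}. \<Sum>j\<in>{j. j dvd Q}. of_real (real (ndiv m) * mu j) * wave_sum g U (j\<^sup>2 * m))"
  \<comment> \<open>The argument \<open>x = u^2\<close> runs up to \<open>4 * U^2\<close>, so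
    \<open>sqrt x \<le> 2 * U\<close> and \<open>ln x \<le> \<L>\<close>.\<close>
  define b where "b = \<epsilon> * (2 * real U * \<L>\<^sup>2)"
  have upper: "T \<le> b * (2 * real Q * (real U * sqrt D + 2 * real Q * real N ^ 6)) +
     real Q * (real N)\<^sup>2 * (C * (real Q * real N) * (2 * real U) powr (5 / 4))"
    unfolding T_def D_def
  proof (rule test_upper_bound[of U N Q f g R])
    fix u assume u: "u \<in> {real U..2 * real U}"
    have uU: "1 \<le> real U" using U1 by simp
    have u1: "u \<ge> 1" using u uU by (auto intro: order_trans)
    have "x0 \<le> Y ^ 1" using y by (simp add: Y_def)
    also have "\<dots> \<le> real U" unfolding Ur by (rule pw) simp
    also have "\<dots> \<le> u * 1" using u by simp
    also have "\<dots> \<le> u * u" using u1 by (intro mult_left_mono) auto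
    finally have "x0 \<le> u\<^sup>2" by (simp add: power2_eq_square)
    from x0[OF this] have "norm (S (u\<^sup>2) - R (u\<^sup>2)) \<le> \<epsilon> * (sqrt (u\<^sup>2) * ln (u\<^sup>2) ^ 2)" .
    also have "\<dots> \<le> b" unfolding b_def
    proof (intro mult_left_mono mult_mono power_mono)
      show "sqrt (u\<^sup>2) \<le> 2 * real U" using u u1 by simp
      have "u\<^sup>2 \<le> (2 * real U)\<^sup>2" using u u1 by (intro power_mono) auto
      also have "\<dots> = 4 * Y ^ 1400" by (simp add: Ur power_mult_distrib flip: power_mult)
      finally have "ln (u\<^sup>2) \<le> ln (4 * Y ^ 1400)" using u1 by (intro ln_mono) auto
      thus "ln (u\<^sup>2) \<le> \<L>" by (simp add: \<L>_def Y_def)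
      show "0 \<le> ln (u\<^sup>2)" using u1 by (simp add: ln_realpow)
    qed (use \<epsilon>0 in auto)
    finally show "norm ((\<Sum>n\<in>{n. 1 \<le> n \<and> real n \<le> u\<^sup>2}. f n) - R (u\<^sup>2)) \<le> b" by (simp only: S_def)
  qed (use U1 N1 Q1 ff C in auto)
  define err where "err = G1 * ((4401 + 960 * Cd) * (Y ^ 1390 * \<L>\<^sup>2))"
  have lower: "T \<ge> (real U)\<^sup>2 * D / 40 - real Q * (real N)\<^sup>2 * err"
    unfolding T_def D_def Q_def
  proof (rule test_lower_bound[where L = "y ^ 60" and E = "y ^ 40" and C\<eta> = C\<eta>])
    show "y ^ 60 \<ge> 1" "y ^ 40 \<ge> 1" using y2 by (simp_all add: Suc_le_eq)
    show "y ^ 60 \<le> 4 * U\<^sup>2" "y ^ 40 \<le> 4 * U\<^sup>2" unfolding U2 using pn[of 60 1400] pn[of 40 1400] by simp_all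
    have "(y ^ 60 + 1) * N \<le> (2 * y ^ 60) * y ^ 4" unfolding N_def using y2 by (intro mult_right_mono) (auto simp: Suc_le_eq)
    also have "\<dots> = 2 * y ^ 64" by (simp flip: power_add)
    also have "\<dots> \<le> y * y ^ 64" by (rule mult_right_mono[OF y2]) simp
    also have "\<dots> = y ^ 65" by (simp flip: power_Suc)
    also have "\<dots> \<le> U" unfolding U_def by (rule pn) simp
    finally have "Suc (y ^ 60) * N \<le> U" by simp
    thus "real (Suc (y ^ 60)) * real N \<le> real U" by (metis of_nat_le_iff of_nat_mult)
    have "4 * N \<le> (y * y) * y ^ 4" unfolding N_def using y2 mult_mono[of 2 y 2 y] by (intro mult_right_mono) auto
    also have "\<dots> = y ^ 6" by (simp add: eval_nat_numeral)
    also have "\<dots> \<le> U" unfolding U_def by (rule pn) simp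
    finally show "4 * real N \<le> real U" by linarith
    have QN: "(fact P0)\<^sup>2 * N \<le> y ^ 6"
    proof -
      have "Q\<^sup>2 * N \<le> y\<^sup>2 * y ^ 4" unfolding N_def using Qy by (intro mult_right_mono power_mono) auto
      thus ?thesis by (simp add: Q_def flip: power_add)
    qed
    thus "(fact P0)\<^sup>2 * N \<le> U" unfolding U_def using pn[of 6 700] by simp
    fix n :: nat assume n: "n \<ge> 1" "n \<le> (fact P0)\<^sup>2 * N"
    show "norm (wave_sum g U n - resonant_part g U (y ^ 60) (y ^ 40) n) \<le> err"
      unfolding err_def U_def Y_def \<L>_def
      by (rule wave_sum_error_bound[OF y2 _ _ G1 Cd]) (use n QN in auto)
  qed (use U1 N1 g1 C\<eta> P0 in auto)
  have u1: "b * (2 * real Q * (real U * sqrt D + 2 * real Q * real N ^ 6)) \<le> (real U)\<^sup>2 * D / 80"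
  proof -
    have "2 * real Q * real N ^ 6 \<le> real U * sqrt D"
    proof -
      have "real N ^ 6 = Y ^ 24" by (simp add: N_def Y_def flip: power_mult)
      hence "2 * real Q * real N ^ 6 \<le> Y * Y * Y ^ 24"
        using qY Y3 q1 unfolding q_def[symmetric] by (intro mult_mono) auto
      also have "\<dots> = Y ^ 26" by (simp add: eval_nat_numeral)
      also have "\<dots> \<le> Y ^ 700 * 1" using pw[of 26 700] by simp
      also have "\<dots> \<le> real U * sqrt D" unfolding Ur using D1 Y3 by (intro mult_left_mono) auto
      finally show ?thesis .
    qed
    hence "2 * q * (real U * sqrt D + 2 * real Q * real N ^ 6) \<le> 2 * q * (2 * (real U * sqrt D))"
      using q1 by (intro mult_left_mono) auto
    hence "b * (2 * q * (real U * sqrt D + 2 * real Q * real N ^ 6)) \<le> b * (2 * q * (2 * (real U * sqrt D)))"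
      using \<epsilon>0 by - (rule mult_left_mono, assumption, simp add: b_def)
    also have "\<dots> = 8 * \<epsilon> * q * (real U)\<^sup>2 * sqrt D * \<L>\<^sup>2" by (simp add: b_def power2_eq_square)
    also have "\<dots> \<le> 8 * \<epsilon> * q * (real U)\<^sup>2 * sqrt D * (A * sqrt D)"
      using LA \<epsilon>0 q1 D1 by (intro mult_left_mono) auto
    also have "\<dots> = 8 * (\<epsilon> * q * A) * (real U)\<^sup>2 * (sqrt D * sqrt D)" by simp
    also have "\<epsilon> * q * A = 1 / 640" using q1 A1 by (simp add: \<epsilon>_def)
    also have "sqrt D * sqrt D = D" using D1 by simp
    finally show ?thesis by (simp add: q_def)
  qed
  have u2: "real Q * (real N)\<^sup>2 * (C * (real Q * real N) * (2 * real U) powr (5 / 4)) \<le> Y ^ 1398 * (4 * C)"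
  proof -
    have "(2 * real U) powr (5 / 4) = 2 powr (5 / 4) * (Y ^ 700) powr (5 / 4)" unfolding Ur using Y3 by (intro powr_mult)
    also have "(Y ^ 700) powr (5 / 4) = Y ^ 875"
    proof -
      have "(Y ^ 700) powr (5 / 4) = (Y powr 700) powr (5 / 4)" using Y3 by (simp add: powr_realpow)
      also have "\<dots> = Y powr 875" by (simp add: powr_powr)
      finally show ?thesis using Y3 by (simp add: powr_realpow)
    qed
    also have "2 powr (5 / 4) * Y ^ 875 \<le> 2 powr 2 * Y ^ 875"
      using Y3 by (intro mult_right_mono powr_mono) auto
    finally have p: "(2 * real U) powr (5 / 4) \<le> 4 * Y ^ 875" by simp
    have Nr: "real N = Y ^ 4" by (simp add: N_def Y_def)
    have "real Q * (real N)\<^sup>2 * (C * (real Q * real N) * (2 * real U) powr (5 / 4)) \<le>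
       Y * (Y ^ 4)\<^sup>2 * (C * (Y * Y ^ 4) * (4 * Y ^ 875))"
      unfolding Nr using p qY C Y3 q1 unfolding q_def[symmetric] by (intro mult_mono) auto
    also have "\<dots> = (Y ^ 1 * ((Y ^ 4)\<^sup>2 * (Y ^ 1 * (Y ^ 4 * Y ^ 875)))) * (4 * C)" by simp
    also have "Y ^ 1 * ((Y ^ 4)\<^sup>2 * (Y ^ 1 * (Y ^ 4 * Y ^ 875))) = Y ^ 889"
      by (simp only: power_mult[symmetric] power_add[symmetric]) simp
    also have "Y ^ 889 * (4 * C) \<le> Y ^ 1398 * (4 * C)" using pw[of 889 1398] C by (intro mult_right_mono) auto
    finally show ?thesis .
  qed
  have G0: "G1 \<ge> 0" using dirichlet_bound_nonneg[OF g] .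
  have K0: "K \<ge> 0" unfolding K_def using q1 G0 Cd by (intro mult_nonneg_nonneg) auto
  have u3: "real Q * (real N)\<^sup>2 * err \<le> Y ^ 1398 * (K * (1500 * ln Y)\<^sup>2)"
  proof -
    have "real Q * (real N)\<^sup>2 * err = ((Y ^ 4)\<^sup>2 * Y ^ 1390) * (K * \<L>\<^sup>2)"
      by (simp add: err_def K_def q_def N_def Y_def)
    also have "(Y ^ 4)\<^sup>2 * Y ^ 1390 = Y ^ 1398" by (simp flip: power_mult power_add)
    also have "Y ^ 1398 * (K * \<L>\<^sup>2) \<le> Y ^ 1398 * (K * (1500 * ln Y)\<^sup>2)"
      using Y3 K0 Lb by (intro mult_left_mono power_mono) auto
    finally show ?thesis .
  qed
  \<comment> \<open>Half of the lower bound remains once the error term is absorbed. By the choice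
    of \<open>y\<close> the right-hand side is below \<open>U^2 / 80\<close>, which is impossible
    since \<open>D \<ge> 1\<close>.\<close>
  have "(real U)\<^sup>2 * D / 80 \<le> Y ^ 1398 * (4 * C + K * (1500 * ln Y)\<^sup>2)"
    using upper lower u1 u2 u3 by (simp add: distrib_left)
  also have "\<dots> < Y ^ 1398 * (Y\<^sup>2 / 80)"
    using y(1) Y3 by (intro mult_strict_left_mono) (auto simp: Y_def)
  also have "\<dots> = (real U)\<^sup>2 * 1 / 80" by (simp add: Ur flip: power_mult power_add)
  also have "\<dots> \<le> (real U)\<^sup>2 * D / 80" using D1 by (intro divide_right_mono mult_left_mono) auto
  finally show False by simp
qed

end
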